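(* Suppose the reference extremal $(\bar x,\bar p,\bar u)$ described in the context satisfies: (A0) it is normal (so that $p^0=-1$); (A1) $H_{12}(\bar z_1)>0$, where $H_{12}=\{H_1,H_2\}$; (A2) $\delta(t)\neq 0$ for all $t\in(0,\bar t_1)\cup(\bar t_1,t_f]$, and $\delta(\bar t_1+)\,\delta(\bar t_1-)>0$. Then the reference trajectory $\bar x$ is a $C^0$-local minimizer among all trajectories with the same endpoints. That is, there is a neighbourhood of $\bar x$ in the $C^0([0,t_f])$-topology such that, for every admissible pair $(x,u)$ with $x$ in this neighbourhood and $x(0)=\bar x(0)$, $x(t_f)=\bar x(t_f)$, $$\int_0^{t_f} f^0(x(t),u(t))\,dt\ \ge\ \int_0^{t_f} f^0(\bar x(t),\bar u(t))\,dt .$$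
   Context: Problem. $X$ is an open subset of $\mathbf{R}^n$, $U$ is a nonempty subset of $\mathbf{R}^m$, $f$ is a vector field on $X$ parameterized by $u\in U$, and $f^0:X\times U\to\mathbf{R}$ is a cost function, all smooth. The final time $t_f>0$ and the endpoints $x_0,x_f\in X$ are fixed. An admissible pair is $(x,u):[0,t_f]\to X\times U$ with $x$ absolutely continuous, $u$ measurable and bounded, $\dot x(t)=f(x(t),u(t))$ for a.e. $t\in[0,t_f]$, $x(0)=x_0$, $x(t_f)=x_f$. One minimizes $\int_0^{t_f}f^0(x(t),u(t))\,dt$. Extremals. $H(x,p,u):=p^0f^0(x,u)+p\,f(x,u)$ on $T^*X\times U$. An extremal is a triple $(\bar x,\bar p,\bar u)$, with $(\bar x,\bar u)$ admissible and $\bar p$ absolutely continuous, together with a constant $p^0\le 0$, $(p^0,\bar p)\ne(0,0)$, such that for a.e. $t$: $\dot{\bar x}=\partial H/\partial p$, $\dot{\bar p}=-\partial H/\partial x$ at $(\bar x(t),\bar p(t),\bar u(t))$, and $H(\bar x(t),\bar p(t),\bar u(t))=\max_U H(\bar x(t),\bar p(t),\cdot)$. It is normal if $p^0\neq0$, in which case $p^0$ is set to $-1$. Write $z=(x,p)$, $\bar z=(\bar x,\bar p)$, $\bar z_0=\bar z(0)$. Competing Hamiltonians. $H_1,H_2:T^*X\to\mathbf{R}$ are smooth functions; $\Sigma:=\{H_1=H_2\}$, $\Omega_1:=\{H_1>H_2\}$, $\Omega_2:=\{H_2>H_1\}$. It is assumed that (with $p^0=-1$) $\max_U H(z,\cdot)=H_i(z)$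 for $z\in\Omega_i$, $i=1,2$. The reference extremal has exactly one contact with $\Sigma$, at $\bar z_1:=\bar z(\bar t_1)$ with $\bar t_1\in(0,t_f)$. Conventions. $\vec H_i=(\partial H_i/\partial p,-\partial H_i/\partial x)$ is the Hamiltonian vector field; the Poisson bracket is $\{F,G\}=\frac{\partial F}{\partial p}\frac{\partial G}{\partial x}-\frac{\partial F}{\partial x}\frac{\partial G}{\partial p}$ (the derivative of $G$ along $\vec F$). The flows $z_i(t,z_0)=(x_i(t,z_0),p_i(t,z_0))=e^{t\vec H_i}(z_0)$, $i=1,2$, are assumed complete. Under (A1), there is a smooth function $t_1$ defined on a neighbourhood of $\bar z_0$ with $t_1(\bar z_0)=\bar t_1$ and $z_1(t_1(z_0),z_0)\in\Sigma$. For $z_0=(x_0,p_0)$ near $\bar z_0$ define $z(t,z_0)=(x(t,z_0),p(t,z_0))$ by $z(t,z_0):=z_1(t,z_0)$ if $t\le t_1(z_0)$ and $z(t,z_0):=z_2(t-t_1(z_0),z_1(t_1(z_0),z_0))$ if $t\ge t_1(z_0)$. Finally $$\delta(t):=\det\frac{\partial x}{\partial p_0}(t,\bar z_0),\qquad t\neq\bar t_1,$$ and $\delta(\bar t_1\pm)$ denote its one-sided limits at $\bar t_1$. *)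

theory Defs
  imports "HOL-Analysis.Analysis"
begin

section \<open>Smooth functions and absolutely continuous curves\<close>

text \<open>\<^term>\<open>k\<close>-times continuous differentiability on an open set, by way of directional derivatives;
  intended for maps between Euclidean spaces.\<close>

primrec Ck_on_open ::
  "nat \<Rightarrow> 'a::real_normed_vector set \<Rightarrow> ('a \<Rightarrow> 'b::real_normed_vector) \<Rightarrow> bool" where
  "Ck_on_open 0 W f \<longleftrightarrow> continuous_on W f"
| "Ck_on_open (Suc k) W f \<longleftrightarrow>
     (\<forall>y\<in>W. f differentiable (at y)) \<and>
     (\<forall>v. Ck_on_open k W (\<lambda>y. frechet_derivative f (at y) v))"

text \<open>Smoothness on a set that need not be open (such as the product of an open set and an arbitrary
  set of controls) means that, near each point of the set, the function is the restriction of a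
  \<open>C\<^sup>\<infinity>\<close> function defined on an open set.\<close>

definition smooth_on :: "'a::real_normed_vector set \<Rightarrow> ('a \<Rightarrow> 'b::real_normed_vector) \<Rightarrow> bool" where
  "smooth_on S f \<longleftrightarrow>
     (\<forall>y\<in>S. \<exists>W g. open W \<and> y \<in> W \<and> (\<forall>k. Ck_on_open k W g) \<and> (\<forall>w\<in>W \<inter> S. f w = g w))"

lemma Ck_on_open_cong:
  assumes "open W" and "\<And>w. w \<in> W \<Longrightarrow> f w = g w" and "Ck_on_open k W f"
  shows "Ck_on_open k W g"
  using assms
proof (induction k arbitrary: f g)
  case 0
  then show ?case by (auto cong: continuous_on_cong)
next
  case (Suc k)
  have der: "(g has_derivative frechet_derivative f (at y)) (at y)" if "y \<in> W" for y
  proof -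
    have "(f has_derivative frechet_derivative f (at y)) (at y)"
      using Suc.prems(3) that by (simp add: frechet_derivative_works)
    then show ?thesis
      using has_derivative_transform_within_open[OF _ Suc.prems(1) that] Suc.prems(2) by blast
  qed
  have "frechet_derivative f (at y) = frechet_derivative g (at y)" if "y \<in> W" for y
    using der[OF that] frechet_derivative_at by blast
  then have "Ck_on_open k W (\<lambda>y. frechet_derivative g (at y) v)" for v
    using Suc.IH[OF Suc.prems(1), of "\<lambda>y. frechet_derivative f (at y) v"] Suc.prems(3) by simp
  with der show ?case by (auto simp: differentiable_def)
qed

lemma Ck_on_open_subset: "Ck_on_open k W f \<Longrightarrow> V \<subseteq> W \<Longrightarrow> Ck_on_open k V f"
  by (induction k arbitrary: f) (auto intro: continuous_on_subset)

lemma Ck_on_open_local: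
  assumes "\<And>y. y \<in> S \<Longrightarrow> \<exists>W. open W \<and> y \<in> W \<and> Ck_on_open k W f"
  shows "Ck_on_open k S f"
  using assms
proof (induction k arbitrary: f)
  case 0
  have "isCont f y" if "y \<in> S" for y
    using 0[OF that] by (auto simp: continuous_on_eq_continuous_at)
  then show ?case by (simp add: continuous_at_imp_continuous_on)
next
  case (Suc k)
  have "Ck_on_open k S (\<lambda>y. frechet_derivative f (at y) v)" for v
  proof (rule Suc.IH)
    fix y assume "y \<in> S"
    from Suc.prems[OF this] obtain W where "open W" "y \<in> W" "Ck_on_open (Suc k) W f"
      by blast
    then show "\<exists>W. open W \<and> y \<in> W \<and> Ck_on_open k W (\<lambda>y. frechet_derivative f (at y) v)"
      by (intro exI[of _ W]) simp
  qed
  moreover have "f differentiable (at y)" if "y \<in> S" for y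
    using Suc.prems[OF that] by auto
  ultimately show ?case by simp
qed

text \<open>On open sets, smoothness is the usual notion.\<close>

lemma smooth_on_open_iff:
  assumes "open S"
  shows "smooth_on S f \<longleftrightarrow> (\<forall>k. Ck_on_open k S f)"
proof
  assume smooth: "smooth_on S f"
  show "\<forall>k. Ck_on_open k S f"
  proof (intro allI Ck_on_open_local)
    fix k y assume "y \<in> S"
    with smooth obtain W g where W: "open W" "y \<in> W" "Ck_on_open k W g" "\<forall>w\<in>W \<inter> S. f w = g w"
      unfolding smooth_on_def by blast
    have "Ck_on_open k (W \<inter> S) f"
      by (rule Ck_on_open_cong[of _ g]) (use W assms in \<open>auto intro: Ck_on_open_subset\<close>)
    then show "\<exists>W. open W \<and> y \<in> W \<and> Ck_on_open k W f"
      using W assms \<open>y \<in> S\<close> by blast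
  qed
next
  assume "\<forall>k. Ck_on_open k S f"
  with assms show "smooth_on S f"
    unfolding smooth_on_def by blast
qed

definition absolutely_continuous_on_interval ::
  "real \<Rightarrow> real \<Rightarrow> (real \<Rightarrow> 'a::real_normed_vector) \<Rightarrow> bool" where
  "absolutely_continuous_on_interval a b g \<longleftrightarrow>
     (\<forall>\<epsilon>>0. \<exists>\<delta>>0. \<forall>D :: (real \<times> real) set.
        finite D \<longrightarrow>
        (\<forall>(r, s)\<in>D. a \<le> r \<and> r \<le> s \<and> s \<le> b) \<longrightarrow>
        pairwise (\<lambda>I J. disjnt {fst I<..<snd I} {fst J<..<snd J}) D \<longrightarrow>
        (\<Sum>(r, s)\<in>D. s - r) < \<delta> \<longrightarrow>
        (\<Sum>(r, s)\<in>D. norm (g s - g r)) < \<epsilon>)"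

section \<open>Hamiltonians on the cotangent bundle\<close>

text \<open>The cotangent bundle of an open set \<open>X\<close> is the set of pairs \<open>z = (x, p)\<close> with \<open>x \<in> X\<close>;
  covectors are identified with vectors through the standard inner product.\<close>

definition cotangent :: "(real ^ 'n) set \<Rightarrow> ((real ^ 'n) \<times> (real ^ 'n)) set" where
  "cotangent X = X \<times> UNIV"

definition gradient :: "(real ^ 'n \<Rightarrow> real) \<Rightarrow> real ^ 'n \<Rightarrow> real ^ 'n" where
  "gradient g y = (\<chi> i. frechet_derivative g (at y) (axis i 1))"

definition grad_x :: "((real ^ 'n) \<times> (real ^ 'n) \<Rightarrow> real) \<Rightarrow> (real ^ 'n) \<times> (real ^ 'n) \<Rightarrow> real ^ 'n" where
  "grad_x F z = gradient (\<lambda>x. F (x, snd z)) (fst z)"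

definition grad_p :: "((real ^ 'n) \<times> (real ^ 'n) \<Rightarrow> real) \<Rightarrow> (real ^ 'n) \<times> (real ^ 'n) \<Rightarrow> real ^ 'n" where
  "grad_p F z = gradient (\<lambda>p. F (fst z, p)) (snd z)"

definition ham_vec ::
  "((real ^ 'n) \<times> (real ^ 'n) \<Rightarrow> real) \<Rightarrow> (real ^ 'n) \<times> (real ^ 'n) \<Rightarrow> (real ^ 'n) \<times> (real ^ 'n)" where
  "ham_vec F z = (grad_p F z, - grad_x F z)"

definition poisson_bracket ::
  "((real ^ 'n) \<times> (real ^ 'n) \<Rightarrow> real) \<Rightarrow> ((real ^ 'n) \<times> (real ^ 'n) \<Rightarrow> real) \<Rightarrow>
     (real ^ 'n) \<times> (real ^ 'n) \<Rightarrow> real" where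
  "poisson_bracket F G z = grad_p F z \<bullet> grad_x G z - grad_x F z \<bullet> grad_p G z"

text \<open>On \<^term>\<open>cotangent X\<close>, with \<open>X\<close> open and \<open>F\<close> smooth, a map satisfying this condition is
  unique: it is the flow of the Hamiltonian vector field
  of \<open>F\<close>, which in particular is complete.\<close>

definition complete_ham_flow ::
  "(real ^ 'n) set \<Rightarrow> ((real ^ 'n) \<times> (real ^ 'n) \<Rightarrow> real) \<Rightarrow>
     (real \<Rightarrow> (real ^ 'n) \<times> (real ^ 'n) \<Rightarrow> (real ^ 'n) \<times> (real ^ 'n)) \<Rightarrow> bool" where
  "complete_ham_flow X F \<zeta> \<longleftrightarrow>
     (\<forall>z0\<in>cotangent X. \<zeta> 0 z0 = z0 \<and>
        (\<forall>t. \<zeta> t z0 \<in> cotangent X \<and>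
             ((\<lambda>s. \<zeta> s z0) has_vector_derivative ham_vec F (\<zeta> t z0)) (at t)))"

section \<open>The optimal control problem\<close>

definition admissible ::
  "(real ^ 'n) set \<Rightarrow> (real ^ 'm) set \<Rightarrow> (real ^ 'n \<Rightarrow> real ^ 'm \<Rightarrow> real ^ 'n) \<Rightarrow>
     real \<Rightarrow> real ^ 'n \<Rightarrow> real ^ 'n \<Rightarrow> (real \<Rightarrow> real ^ 'n) \<Rightarrow> (real \<Rightarrow> real ^ 'm) \<Rightarrow> bool" where
  "admissible X U f tf x0 xf x u \<longleftrightarrow>
     (\<forall>t\<in>{0..tf}. x t \<in> X \<and> u t \<in> U) \<and>
     absolutely_continuous_on_interval 0 tf x \<and>
     u \<in> borel_measurable (lebesgue_on {0..tf}) \<and> bounded (u ` {0..tf}) \<and>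
     (AE t in lebesgue_on {0..tf}. (x has_vector_derivative f (x t) (u t)) (at t within {0..tf})) \<and>
     x 0 = x0 \<and> x tf = xf"

text \<open>The integral of the running cost is extended-real valued: for an arbitrary set of controls a
  bounded control need not stay away from the boundary of this set, so that
  \<open>t \<mapsto> f\<^sup>0(x(t), u(t))\<close> need not be integrable. If it is integrable, this is its Lebesgue integral;
  if only the integral of the negative part is finite, the cost is \<open>\<infinity>\<close>. Note that
  \<^term>\<open>ennreal\<close> maps negative numbers to \<open>0\<close>, and that \<open>\<infinity> - \<infinity> = \<infinity>\<close> in \<^typ>\<open>ereal\<close>.\<close>

definition cost ::
  "(real ^ 'n \<Rightarrow> real ^ 'm \<Rightarrow> real) \<Rightarrow> real \<Rightarrow>
     (real \<Rightarrow> real ^ 'n) \<Rightarrow> (real \<Rightarrow> real ^ 'm) \<Rightarrow> ereal" where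
  "cost f0 tf x u =
     enn2ereal (\<integral>\<^sup>+ t. ennreal (f0 (x t) (u t)) \<partial>lebesgue_on {0..tf}) -
     enn2ereal (\<integral>\<^sup>+ t. ennreal (- f0 (x t) (u t)) \<partial>lebesgue_on {0..tf})"

lemma cost_eq_integral:
  assumes "integrable (lebesgue_on {0..tf}) (\<lambda>t. f0 (x t) (u t))"
  shows "cost f0 tf x u = ereal (\<integral> t. f0 (x t) (u t) \<partial>lebesgue_on {0..tf})"
  by (rule integrableE[OF assms]) (simp add: cost_def enn2ereal_ennreal)

definition control_hamiltonian ::
  "(real ^ 'n \<Rightarrow> real ^ 'm \<Rightarrow> real ^ 'n) \<Rightarrow> (real ^ 'n \<Rightarrow> real ^ 'm \<Rightarrow> real) \<Rightarrow> real \<Rightarrow>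
     (real ^ 'n) \<times> (real ^ 'n) \<Rightarrow> real ^ 'm \<Rightarrow> real" where
  "control_hamiltonian f f0 p0 z u = p0 * f0 (fst z) u + snd z \<bullet> f (fst z) u"

definition is_maximum_over :: "'a set \<Rightarrow> ('a \<Rightarrow> real) \<Rightarrow> real \<Rightarrow> bool" where
  "is_maximum_over U g M \<longleftrightarrow> M \<in> g ` U \<and> (\<forall>u\<in>U. g u \<le> M)"

definition extremal ::
  "(real ^ 'n) set \<Rightarrow> (real ^ 'm) set \<Rightarrow> (real ^ 'n \<Rightarrow> real ^ 'm \<Rightarrow> real ^ 'n) \<Rightarrow>
     (real ^ 'n \<Rightarrow> real ^ 'm \<Rightarrow> real) \<Rightarrow> real \<Rightarrow> real ^ 'n \<Rightarrow> real ^ 'n \<Rightarrow> real \<Rightarrow>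
     (real \<Rightarrow> real ^ 'n) \<Rightarrow> (real \<Rightarrow> real ^ 'n) \<Rightarrow> (real \<Rightarrow> real ^ 'm) \<Rightarrow> bool" where
  "extremal X U f f0 tf x0 xf p0 x p u \<longleftrightarrow>
     admissible X U f tf x0 xf x u \<and>
     absolutely_continuous_on_interval 0 tf p \<and>
     p0 \<le> 0 \<and> (p0 \<noteq> 0 \<or> (\<exists>t\<in>{0..tf}. p t \<noteq> 0)) \<and>
     (AE t in lebesgue_on {0..tf}.
        (x has_vector_derivative
           grad_p (\<lambda>z. control_hamiltonian f f0 p0 z (u t)) (x t, p t)) (at t within {0..tf}) \<and>
        (p has_vector_derivative
           - grad_x (\<lambda>z. control_hamiltonian f f0 p0 z (u t)) (x t, p t)) (at t within {0..tf}) \<and>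
        is_maximum_over U (control_hamiltonian f f0 p0 (x t, p t))
          (control_hamiltonian f f0 p0 (x t, p t) (u t)))"

section \<open>Competing Hamiltonians and broken extremals\<close>

definition switching_set ::
  "(real ^ 'n) set \<Rightarrow> ((real ^ 'n) \<times> (real ^ 'n) \<Rightarrow> real) \<Rightarrow> ((real ^ 'n) \<times> (real ^ 'n) \<Rightarrow> real) \<Rightarrow>
     ((real ^ 'n) \<times> (real ^ 'n)) set" where
  "switching_set X H1 H2 = {z \<in> cotangent X. H1 z = H2 z}"

definition dominance_set ::
  "(real ^ 'n) set \<Rightarrow> ((real ^ 'n) \<times> (real ^ 'n) \<Rightarrow> real) \<Rightarrow> ((real ^ 'n) \<times> (real ^ 'n) \<Rightarrow> real) \<Rightarrow>
     ((real ^ 'n) \<times> (real ^ 'n)) set" where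
  "dominance_set X F G = {z \<in> cotangent X. F z > G z}"

text \<open>\<open>t1\<close> is a smooth switching time on a neighbourhood of \<open>zb0\<close>. By the implicit function theorem
  it exists, and its germ at \<open>zb0\<close> is unique, as soon as the bracket of the two Hamiltonians does not
  vanish at the contact point.\<close>

definition switching_time ::
  "(real ^ 'n) set \<Rightarrow> ((real ^ 'n) \<times> (real ^ 'n) \<Rightarrow> real) \<Rightarrow> ((real ^ 'n) \<times> (real ^ 'n) \<Rightarrow> real) \<Rightarrow>
     (real \<Rightarrow> (real ^ 'n) \<times> (real ^ 'n) \<Rightarrow> (real ^ 'n) \<times> (real ^ 'n)) \<Rightarrow>
     (real ^ 'n) \<times> (real ^ 'n) \<Rightarrow> real \<Rightarrow> ((real ^ 'n) \<times> (real ^ 'n) \<Rightarrow> real) \<Rightarrow> bool" where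
  "switching_time X H1 H2 \<zeta>1 zb0 tb1 t1 \<longleftrightarrow>
     (\<exists>N. open N \<and> zb0 \<in> N \<and> N \<subseteq> cotangent X \<and> smooth_on N t1 \<and> t1 zb0 = tb1 \<and>
          (\<forall>z0\<in>N. \<zeta>1 (t1 z0) z0 \<in> switching_set X H1 H2))"

definition broken_flow ::
  "(real \<Rightarrow> 'z \<Rightarrow> 'z) \<Rightarrow> (real \<Rightarrow> 'z \<Rightarrow> 'z) \<Rightarrow> ('z \<Rightarrow> real) \<Rightarrow> real \<Rightarrow> 'z \<Rightarrow> 'z" where
  "broken_flow \<zeta>1 \<zeta>2 t1 t z0 =
     (if t \<le> t1 z0 then \<zeta>1 t z0 else \<zeta>2 (t - t1 z0) (\<zeta>1 (t1 z0) z0))"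

definition fold_det ::
  "(real \<Rightarrow> (real ^ 'n) \<times> (real ^ 'n) \<Rightarrow> (real ^ 'n) \<times> (real ^ 'n)) \<Rightarrow>
     (real \<Rightarrow> (real ^ 'n) \<times> (real ^ 'n) \<Rightarrow> (real ^ 'n) \<times> (real ^ 'n)) \<Rightarrow>
     ((real ^ 'n) \<times> (real ^ 'n) \<Rightarrow> real) \<Rightarrow> (real ^ 'n) \<times> (real ^ 'n) \<Rightarrow> real \<Rightarrow> real" where
  "fold_det \<zeta>1 \<zeta>2 t1 zb0 t =
     det (jacobian (\<lambda>p0. fst (broken_flow \<zeta>1 \<zeta>2 t1 t (fst zb0, p0))) (at (snd zb0)))"

end

theory Submission
  imports Defs
begin

text \<open>
  The extremal is embedded in a field of broken extremals, and optimality follows by verification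
  in the manner of Weierstrass and Hilbert.

  \<^bold>\<open>The field.\<close>  The bracket condition fixes the order of the two Hamiltonians: along either flow the
  difference \<open>H\<^sub>1 - H\<^sub>2\<close> decreases through the contact, so the reference extremal follows the first flow
  before and the second flow after it (\<open>dominance\<close>, \<open>reference_arcs\<close>), and nearby broken extremals do
  the same and hence satisfy the maximum condition all along (\<open>broken_dominated\<close>, \<open>broken_maximality\<close>).
  The extremals that start on the fibre over \<open>x\<^sub>0\<close> all pass through one point at time \<open>0\<close> and therefore
  do not give a field.  They are replaced by those that start at \<open>(x\<^sub>0 + \<epsilon> (q - p\<^sub>0), q)\<close>, where \<open>p\<^sub>0\<close> is the initial
  covector of the reference extremal, for a small
  \<open>\<epsilon> > 0\<close>; these points form the graph of a gradient, so that the field still has a value function.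

  \<^bold>\<open>Its regularity.\<close>  The broken flow is only Lipschitz at the contact time, but it has a strict derivative
  on either side of the contact, and where two trajectories are on different sides the difference quotients
  are close to an intermediate map \<open>A + \<mu> l a\<close> with \<open>0 \<le> \<mu> \<le> 1\<close>, where \<open>A\<close> is the derivative before the
  contact and \<open>A + l a\<close>, a rank-one modification of it, the derivative after it
  (\<open>broken_strict_derivative\<close>).  The determinant is affine along this segment, so the condition
  \<open>\<delta>(t\<^sub>1+) \<delta>(t\<^sub>1-) > 0\<close> says precisely that no map on it is singular
  (\<open>rank_one_segment_injective\<close>).  On the rest of the interval the non-vanishing of \<open>\<delta>\<close> survives a small
  tilt by compactness, except near the time \<open>0\<close>, where \<open>\<delta>\<close> itself vanishes; there the convexity of
  \<open>H\<^sub>1\<close> in the covector, which comes from its being a maximum of affine functions, gives regularity for every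
  positive tilt (\<open>hessian_pp_nonneg\<close>, \<open>no_early_conjugate_point\<close>).  Together (\<open>tilted_field_regular\<close>)
  the field parameter \<open>q\<close> can be read off from the position with a Lipschitz estimate that is uniform in time,
  and by invariance of domain the field covers a tube around the reference trajectory (\<open>field_covers\<close>).

  \<^bold>\<open>Verification.\<close>  The action along the broken extremals, corrected by the generating function of the tilted initial
  set, has the differential \<open>p dx - H dt\<close> (\<open>action_differential\<close>, \<open>broken_action_differential\<close>).
  Along an admissible trajectory in the tube the value function is therefore absolutely continuous with
  derivative \<open>p f - H\<close>, which by the maximum condition is at most \<open>f\<^sup>0\<close>, with equality on the reference
  trajectory.  Integration gives the inequality between the costs (\<open>value_along_trajectory\<close>,
  \<open>field_minimizer\<close>).
\<close>

section \<open>Absolutely continuous functions\<close>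

lemma absolutely_continuous_on_intervalE:
  fixes g :: "real \<Rightarrow> 'a::real_normed_vector"
  assumes "absolutely_continuous_on_interval a b g" "e > 0"
  obtains d where "d > 0" "\<And>D. finite D \<Longrightarrow> (\<forall>(r, s)\<in>D. a \<le> r \<and> r \<le> s \<and> s \<le> b) \<Longrightarrow>
        pairwise (\<lambda>I J. disjnt {fst I<..<snd I} {fst J<..<snd J}) D \<Longrightarrow>
        (\<Sum>(r, s)\<in>D. s - r) < d \<Longrightarrow> (\<Sum>(r, s)\<in>D. norm (g s - g r)) < e"
proof -
  note ac = assms(1)[unfolded absolutely_continuous_on_interval_def, rule_format, OF assms(2)]
  show ?thesis by (use ac in \<open>elim exE conjE\<close>) (rule that, auto)
qed

text \<open>A tagged division is a family of intervals rather than a set, in which several tags may share a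
  degenerate interval.\<close>

lemma absolutely_continuous_on_interval_indexed:
  fixes g :: "real \<Rightarrow> 'a::real_normed_vector"
  assumes "absolutely_continuous_on_interval a b g" "e > 0"
  obtains d where "d > 0" and "\<And>(I :: 'i set) l r. finite I \<Longrightarrow>
      (\<forall>i\<in>I. a \<le> l i \<and> l i \<le> r i \<and> r i \<le> b) \<Longrightarrow>
      pairwise (\<lambda>i j. disjnt {l i<..<r i} {l j<..<r j}) I \<Longrightarrow> (\<Sum>i\<in>I. r i - l i) < d \<Longrightarrow>
      (\<Sum>i\<in>I. norm (g (r i) - g (l i))) < e"
proof -
  obtain d where "d > 0" and d: "\<And>D. finite D \<Longrightarrow> (\<forall>(r, s)\<in>D. a \<le> r \<and> r \<le> s \<and> s \<le> b) \<Longrightarrow>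
        pairwise (\<lambda>I J. disjnt {fst I<..<snd I} {fst J<..<snd J}) D \<Longrightarrow>
        (\<Sum>(r, s)\<in>D. s - r) < d \<Longrightarrow> (\<Sum>(r, s)\<in>D. norm (g s - g r)) < e"
    by (rule absolutely_continuous_on_intervalE[OF assms]) (rule that)
  show ?thesis
  proof (rule that[OF \<open>d > 0\<close>])
    fix I :: "'i set" and l r
    assume I: "finite I" "\<forall>i\<in>I. a \<le> l i \<and> l i \<le> r i \<and> r i \<le> b"
      "pairwise (\<lambda>i j. disjnt {l i<..<r i} {l j<..<r j}) I" "(\<Sum>i\<in>I. r i - l i) < d"
    let ?h = "\<lambda>i. (l i, r i)"
    (* Two indices with the same interval force it to be degenerate, so that passing to the
       set of intervals loses no contribution. *)
    have same: "r j = l j" if "i \<in> I" "j \<in> I" "i \<noteq> j" "?h i = ?h j" for i j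
    proof -
      have "disjnt {l i<..<r i} {l j<..<r j}"
        using I(3) that unfolding pairwise_def by blast
      then have "{l j<..<r j} = {}" using that(4) by (simp add: disjnt_def)
      then show ?thesis using I(2) that(2) by (simp add: order.antisym)
    qed
    have reindex: "(\<Sum>(r, s)\<in>?h ` I. k s r) = (\<Sum>i\<in>I. k (r i) (l i))"
      if "\<And>s. k s s = 0" for k :: "real \<Rightarrow> real \<Rightarrow> real"
    proof (subst sum.reindex_nontrivial[OF I(1)])
      fix x y assume "x \<in> I" "y \<in> I" "x \<noteq> y" "?h x = ?h y"
      then show "(case ?h x of (r, s) \<Rightarrow> k s r) = 0" using same[of y x] that by simp
    qed simp
    have len: "(\<Sum>(r, s)\<in>?h ` I. s - r) = (\<Sum>i\<in>I. r i - l i)"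
      using reindex[of "\<lambda>s r. s - r"] by simp
    have osc: "(\<Sum>(r, s)\<in>?h ` I. norm (g s - g r)) = (\<Sum>i\<in>I. norm (g (r i) - g (l i)))"
      using reindex[of "\<lambda>s r. norm (g s - g r)"] by simp
    have "(\<Sum>(r, s)\<in>?h ` I. norm (g s - g r)) < e"
      by (rule d) (use I len in \<open>auto simp: pairwise_def\<close>)
    then show "(\<Sum>i\<in>I. norm (g (r i) - g (l i))) < e" by (simp add: osc)
  qed
qed

text \<open>In the Henstock--Kurzweil sums the integrand may be set to \<open>0\<close> on the null set \<open>N\<close>.  The intervals whose tag is
  outside \<open>N\<close> are handled by differentiability; those with a tag in \<open>N\<close> are kept, by the gauge, in an open
  set \<open>G\<close> of small measure, where absolute continuity makes the sum of the increments small.\<close>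

lemma fundamental_theorem_absolutely_continuous:
  fixes g :: "real \<Rightarrow> 'a::real_normed_vector"
  assumes "a \<le> b" and ac: "absolutely_continuous_on_interval a b g" and "negligible N"
    and der: "\<And>t. t \<in> {a..b} - N \<Longrightarrow> (g has_vector_derivative g' t) (at t within {a..b})"
  shows "(g' has_integral g b - g a) {a..b}"
proof -
  define f where "f t = (if t \<in> N then 0 else g' t)" for t
  have "(f has_integral g b - g a) {a..b}"
    unfolding has_integral_real
  proof (intro allI impI)
    fix e :: real assume "e > 0"
    define e1 where "e1 = e / (4 * (b - a + 1))"
    have e1: "e1 > 0" "e1 * (b - a) < e / 2" "e1 * (b - a) \<ge> 0"
    proof -
      show "e1 > 0" using \<open>e > 0\<close> \<open>a \<le> b\<close> by (simp add: e1_def)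
      show "e1 * (b - a) \<ge> 0" using \<open>e1 > 0\<close> \<open>a \<le> b\<close> by simp
      have "e1 * (b - a) < e1 * (2 * (b - a + 1))"
        using \<open>e1 > 0\<close> \<open>a \<le> b\<close> by (intro mult_strict_left_mono) auto
      also have "\<dots> = e / 2" using \<open>a \<le> b\<close> by (simp add: e1_def field_simps)
      finally show "e1 * (b - a) < e / 2" .
    qed
    obtain d where "d > 0" and d: "\<And>(I :: (real \<times> real set) set) l r. finite I \<Longrightarrow>
        (\<forall>i\<in>I. a \<le> l i \<and> l i \<le> r i \<and> r i \<le> b) \<Longrightarrow>
        pairwise (\<lambda>i j. disjnt {l i<..<r i} {l j<..<r j}) I \<Longrightarrow> (\<Sum>i\<in>I. r i - l i) < d \<Longrightarrow>
        (\<Sum>i\<in>I. norm (g (r i) - g (l i))) < e / 2"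
      by (rule absolutely_continuous_on_interval_indexed[OF ac half_gt_zero[OF \<open>e > 0\<close>]]) (rule that)
    obtain G where G: "open G" "N \<subseteq> G" "(G - N) \<in> lmeasurable" "emeasure lebesgue (G - N) < ennreal d"
      using sets_lebesgue_outer_open[of N d] \<open>negligible N\<close> \<open>d > 0\<close> negligible_imp_sets by blast
    have Gm: "G \<in> lmeasurable" "measure lebesgue G < d"
    proof -
      have N0: "N \<in> lmeasurable" "measure lebesgue N = 0"
        using \<open>negligible N\<close> by (auto simp: negligible_imp_measurable negligible_imp_measure0)
      have eq: "G = (G - N) \<union> N" using G(2) by auto
      show "G \<in> lmeasurable" by (subst eq) (intro fmeasurable.Un G N0)
      have "measure lebesgue G \<le> measure lebesgue (G - N) + measure lebesgue N"
        by (subst eq) (rule measure_Un_le, use G(3) N0 in auto)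
      moreover have "measure lebesgue (G - N) < d"
        using G(3,4) \<open>d > 0\<close> by (simp add: emeasure_eq_measure2 ennreal_less_iff)
      ultimately show "measure lebesgue G < d" using N0 by simp
    qed
    have "\<exists>c>0. (t \<in> {a..b} - N \<longrightarrow> (\<forall>y\<in>{a..b}. norm (y - t) < c \<longrightarrow>
         norm (g y - g t - (y - t) *\<^sub>R g' t) \<le> e1 * norm (y - t))) \<and> (t \<in> N \<longrightarrow> ball t c \<subseteq> G)" for t
    proof (cases "t \<in> N")
      case True
      then obtain c where "c > 0" "ball t c \<subseteq> G" using G openE[of G t] by blast
      with True show ?thesis by blast
    next
      case False
      show ?thesis
      proof (cases "t \<in> {a..b}")
        case True
        with der[of t] False have "(g has_vector_derivative g' t) (at t within {a..b})" by auto
        then show ?thesis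
          using e1(1) False unfolding has_vector_derivative_def has_derivative_within_alt by blast
      next
        case ntab: False
        with False show ?thesis by (intro exI[of _ 1]) auto
      qed
    qed
    then obtain c where c: "\<And>t. c t > 0"
      "\<And>t y. t \<in> {a..b} - N \<Longrightarrow> y \<in> {a..b} \<Longrightarrow> norm (y - t) < c t \<Longrightarrow>
         norm (g y - g t - (y - t) *\<^sub>R g' t) \<le> e1 * norm (y - t)"
      "\<And>t. t \<in> N \<Longrightarrow> ball t (c t) \<subseteq> G"
      by metis
    show "\<exists>\<gamma>. gauge \<gamma> \<and> (\<forall>\<D>. \<D> tagged_division_of {a..b} \<and> \<gamma> fine \<D> \<longrightarrow>
              norm ((\<Sum>(x, k)\<in>\<D>. measure lborel k *\<^sub>R f x) - (g b - g a)) < e)"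
    proof (intro exI conjI allI impI)
      show "gauge (\<lambda>t. ball t (c t))" using c(1) by (simp add: gauge_ball_dependent)
    next
      fix p assume p: "p tagged_division_of {a..b} \<and> (\<lambda>t. ball t (c t)) fine p"
      then have ptag: "p tagged_division_of {a..b}" and fine: "(\<lambda>t. ball t (c t)) fine p" by auto
      have "finite p" using ptag by blast
      have K: "\<exists>u v. K = {u..v} \<and> u \<le> v \<and> u \<le> x \<and> x \<le> v \<and> a \<le> u \<and> v \<le> b \<and> {u..v} \<subseteq> ball x (c x)"
        if xK: "(x, K) \<in> p" for x K
      proof -
        have "x \<in> K" "K \<subseteq> {a..b}"
          using tagged_division_ofD(2,3)[OF ptag that] by auto
        moreover obtain u v where "K = cbox u v" using tagged_division_ofD(4)[OF ptag xK] by auto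
        moreover have "K \<subseteq> ball x (c x)" using fine that by (auto simp: fine_def)
        ultimately show ?thesis
          by (intro exI[of _ u] exI[of _ v]) auto
      qed
      define pN where "pN = {(x, K) \<in> p. x \<in> N}"
      have "finite pN" using \<open>finite p\<close> unfolding pN_def by (rule rev_finite_subset) auto
      have disj: "disjnt {Inf (snd i)<..<Sup (snd i)} {Inf (snd j)<..<Sup (snd j)}"
        if ijp: "i \<in> p" "j \<in> p" "i \<noteq> j" for i j
      proof -
        obtain x K y L where ij: "i = (x, K)" "j = (y, L)" by (metis surj_pair)
        have "interior K \<inter> interior L = {}"
          using tagged_division_ofD(5)[OF ptag, of x K y L] that unfolding ij by blast
        moreover obtain u v where "K = {u..v}" "u \<le> v" using K[of x K] ijp ij by blast
        moreover obtain u' v' where "L = {u'..v'}" "u' \<le> v'" using K[of y L] ijp ij by blast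
        ultimately show ?thesis by (simp add: ij disjnt_def)
      qed
      have lensum: "(\<Sum>i\<in>pN. Sup (snd i) - Inf (snd i)) < d"
      proof -
        let ?J = "\<lambda>i::real \<times> real set. {Inf (snd i)<..<Sup (snd i)}"
        have le: "Inf (snd i) \<le> Sup (snd i)" if "i \<in> pN" for i
          using K that unfolding pN_def by fastforce
        have "(\<Sum>i\<in>pN. Sup (snd i) - Inf (snd i)) = (\<Sum>i\<in>pN. measure lebesgue (?J i))"
          using le by (intro sum.cong) auto
        also have "\<dots> = measure lebesgue (\<Union>i\<in>pN. ?J i)"
        proof (rule measure_negligible_finite_Union_image[symmetric, OF \<open>finite pN\<close>])
          show "pairwise (\<lambda>i j. negligible (?J i \<inter> ?J j)) pN"
            using disj unfolding pairwise_def disjnt_def pN_def by fastforce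
        qed simp
        also have "\<dots> \<le> measure lebesgue G"
        proof (rule measure_mono_fmeasurable)
          show "(\<Union>i\<in>pN. ?J i) \<subseteq> G"
          proof clarify
            fix x K y assume "(x, K) \<in> pN" "y \<in> {Inf (snd (x, K))<..<Sup (snd (x, K))}"
            moreover from this obtain u v where "K = {u..v}" "u \<le> v" "{u..v} \<subseteq> ball x (c x)"
              using K[of x K] unfolding pN_def by blast
            moreover have "ball x (c x) \<subseteq> G"
              using c(3)[of x] \<open>(x, K) \<in> pN\<close> unfolding pN_def by blast
            ultimately have "y \<in> {u..v}" "{u..v} \<subseteq> G" by auto
            then show "y \<in> G" by blast
          qed
        qed (use Gm in \<open>auto intro!: sets.finite_UN \<open>finite pN\<close>\<close>)
        finally show ?thesis using Gm by linarith
      qed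
      have bad: "(\<Sum>i\<in>pN. norm (g (Sup (snd i)) - g (Inf (snd i)))) < e / 2"
      proof (rule d[OF \<open>finite pN\<close> _ _ lensum])
        show "\<forall>i\<in>pN. a \<le> Inf (snd i) \<and> Inf (snd i) \<le> Sup (snd i) \<and> Sup (snd i) \<le> b"
        proof
          fix i assume "i \<in> pN"
          then obtain x K where "i = (x, K)" "(x, K) \<in> p" by (auto simp: pN_def)
          then show "a \<le> Inf (snd i) \<and> Inf (snd i) \<le> Sup (snd i) \<and> Sup (snd i) \<le> b"
            using K[of x K] by auto
        qed
        show "pairwise (\<lambda>i j. disjnt {Inf (snd i)<..<Sup (snd i)} {Inf (snd j)<..<Sup (snd j)}) pN"
          by (rule pairwiseI) (rule disj, auto simp: pN_def)
      qed
      let ?err = "\<lambda>i::real \<times> real set. measure lborel (snd i) *\<^sub>R f (fst i) - (g (Sup (snd i)) - g (Inf (snd i)))"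
      have good: "norm (?err i) \<le> e1 * (Sup (snd i) - Inf (snd i))" if "i \<in> p - pN" for i
      proof -
        obtain x L where "i = (x, L)" by (cases i)
        with that have i: "i = (x, L)" "(x, L) \<in> p" "x \<notin> N" by (auto simp: pN_def)
        obtain u v where uv: "L = {u..v}" "u \<le> v" "u \<le> x" "x \<le> v" "a \<le> u" "v \<le> b" "{u..v} \<subseteq> ball x (c x)"
          using K[OF i(2)] by blast
        have "u \<in> {u..v}" "v \<in> {u..v}" using uv by auto
        then have "u \<in> ball x (c x)" "v \<in> ball x (c x)" using uv(7) by blast+
        then have cu: "norm (u - x) < c x" "norm (v - x) < c x" by (auto simp: dist_real_def)
        have "norm (g v - g x - (v - x) *\<^sub>R g' x) \<le> e1 * norm (v - x)"
             "norm (g u - g x - (u - x) *\<^sub>R g' x) \<le> e1 * norm (u - x)"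
          using c(2)[of x u] c(2)[of x v] uv cu i(3) by auto
        moreover have "?err i = (g u - g x - (u - x) *\<^sub>R g' x) - (g v - g x - (v - x) *\<^sub>R g' x)"
          using uv i by (simp add: f_def algebra_simps)
        ultimately have "norm (?err i) \<le> e1 * norm (u - x) + e1 * norm (v - x)"
          by (smt (verit) norm_triangle_ineq4)
        also have "\<dots> = e1 * (v - u)" using uv by (simp add: algebra_simps)
        finally show ?thesis using uv i by simp
      qed
      have nonneg: "Sup (snd i) - Inf (snd i) \<ge> 0" if "i \<in> p" for i
      proof -
        obtain x L where i: "i = (x, L)" by (cases i)
        with K[of x L] that show ?thesis by auto
      qed
      have "norm ((\<Sum>(x, k)\<in>p. measure lborel k *\<^sub>R f x) - (g b - g a)) = norm (\<Sum>i\<in>p. ?err i)"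
        using additive_tagged_division_1[OF \<open>a \<le> b\<close> ptag, of g, symmetric]
        by (simp add: sum_subtractf case_prod_unfold)
      also have "(\<Sum>i\<in>p. ?err i) = (\<Sum>i\<in>p - pN. ?err i) + (\<Sum>i\<in>pN. ?err i)"
        by (rule sum.subset_diff) (use \<open>finite p\<close> in \<open>auto simp: pN_def\<close>)
      also have "norm ((\<Sum>i\<in>p - pN. ?err i) + (\<Sum>i\<in>pN. ?err i)) \<le>
          (\<Sum>i\<in>p - pN. norm (?err i)) + (\<Sum>i\<in>pN. norm (?err i))"
        by (intro norm_triangle_le add_mono norm_sum)
      also have "(\<Sum>i\<in>pN. norm (?err i)) = (\<Sum>i\<in>pN. norm (g (Sup (snd i)) - g (Inf (snd i))))"
        by (intro sum.cong) (auto simp: pN_def f_def norm_minus_commute)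
      also have "(\<Sum>i\<in>p - pN. norm (?err i)) \<le> (\<Sum>i\<in>p - pN. e1 * (Sup (snd i) - Inf (snd i)))"
        using good by (rule sum_mono)
      also have "\<dots> \<le> (\<Sum>i\<in>p. e1 * (Sup (snd i) - Inf (snd i)))"
        using nonneg e1(1) by (intro sum_mono2 \<open>finite p\<close>) (auto simp: mult_nonneg_nonneg)
      also have "\<dots> = e1 * (b - a)"
        using additive_tagged_division_1[OF \<open>a \<le> b\<close> ptag, of "\<lambda>t. t"]
        by (simp add: sum_distrib_left[symmetric] case_prod_unfold)
      finally show "norm ((\<Sum>(x, k)\<in>p. measure lborel k *\<^sub>R f x) - (g b - g a)) < e"
        using bad e1 by linarith
    qed
  qed
  moreover have "f t = g' t" if "t \<in> {a..b} - N" for t using that by (simp add: f_def)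
  ultimately show ?thesis
    using has_integral_spike[OF \<open>negligible N\<close>] by metis
qed

lemma absolutely_continuous_on_interval_subset:
  assumes "absolutely_continuous_on_interval a b g" "a \<le> c" "d \<le> b"
  shows "absolutely_continuous_on_interval c d g"
  unfolding absolutely_continuous_on_interval_def
proof (intro allI impI)
  fix e :: real assume "e > 0"
  obtain \<delta> where "\<delta> > 0" and \<delta>: "\<And>D. finite D \<Longrightarrow> (\<forall>(r, s)\<in>D. a \<le> r \<and> r \<le> s \<and> s \<le> b) \<Longrightarrow>
        pairwise (\<lambda>I J. disjnt {fst I<..<snd I} {fst J<..<snd J}) D \<Longrightarrow>
        (\<Sum>(r, s)\<in>D. s - r) < \<delta> \<Longrightarrow> (\<Sum>(r, s)\<in>D. norm (g s - g r)) < e"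
    by (rule absolutely_continuous_on_intervalE[OF assms(1) \<open>e > 0\<close>]) (rule that)
  show "\<exists>\<delta>>0. \<forall>D. finite D \<longrightarrow> (\<forall>(r, s)\<in>D. c \<le> r \<and> r \<le> s \<and> s \<le> d) \<longrightarrow>
        pairwise (\<lambda>I J. disjnt {fst I<..<snd I} {fst J<..<snd J}) D \<longrightarrow>
        (\<Sum>(r, s)\<in>D. s - r) < \<delta> \<longrightarrow> (\<Sum>(r, s)\<in>D. norm (g s - g r)) < e"
  proof (intro exI[of _ \<delta>] conjI allI impI \<open>\<delta> > 0\<close>)
    fix D :: "(real \<times> real) set"
    assume D: "finite D" "\<forall>(r, s)\<in>D. c \<le> r \<and> r \<le> s \<and> s \<le> d"
      "pairwise (\<lambda>I J. disjnt {fst I<..<snd I} {fst J<..<snd J}) D" "(\<Sum>(r, s)\<in>D. s - r) < \<delta>"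
    have "\<forall>(r, s)\<in>D. a \<le> r \<and> r \<le> s \<and> s \<le> b" using D(2) assms(2,3) by fastforce
    with D \<delta> show "(\<Sum>(r, s)\<in>D. norm (g s - g r)) < e" by blast
  qed
qed

lemma absolutely_continuous_on_interval_dominated:
  fixes g :: "real \<Rightarrow> 'a::real_normed_vector" and k :: "real \<Rightarrow> 'b::real_normed_vector"
  assumes ac: "absolutely_continuous_on_interval a b g" and "L > 0"
    and le: "\<And>r s. a \<le> r \<Longrightarrow> r \<le> s \<Longrightarrow> s \<le> b \<Longrightarrow> norm (k s - k r) \<le> L * ((s - r) + norm (g s - g r))"
  shows "absolutely_continuous_on_interval a b k"
  unfolding absolutely_continuous_on_interval_def
proof (intro allI impI)
  fix e :: real assume "e > 0"
  then have "e / (2 * L) > 0" using \<open>L > 0\<close> by simp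
  obtain \<delta> where "\<delta> > 0" and \<delta>: "\<And>D. finite D \<Longrightarrow> (\<forall>(r, s)\<in>D. a \<le> r \<and> r \<le> s \<and> s \<le> b) \<Longrightarrow>
        pairwise (\<lambda>I J. disjnt {fst I<..<snd I} {fst J<..<snd J}) D \<Longrightarrow>
        (\<Sum>(r, s)\<in>D. s - r) < \<delta> \<Longrightarrow> (\<Sum>(r, s)\<in>D. norm (g s - g r)) < e / (2 * L)"
    by (rule absolutely_continuous_on_intervalE[OF ac \<open>e / (2 * L) > 0\<close>]) (rule that)
  show "\<exists>\<delta>>0. \<forall>D. finite D \<longrightarrow> (\<forall>(r, s)\<in>D. a \<le> r \<and> r \<le> s \<and> s \<le> b) \<longrightarrow>
        pairwise (\<lambda>I J. disjnt {fst I<..<snd I} {fst J<..<snd J}) D \<longrightarrow>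
        (\<Sum>(r, s)\<in>D. s - r) < \<delta> \<longrightarrow> (\<Sum>(r, s)\<in>D. norm (k s - k r)) < e"
  proof (intro exI[of _ "min \<delta> (e / (2 * L))"] conjI allI impI)
    show "min \<delta> (e / (2 * L)) > 0" using \<open>\<delta> > 0\<close> \<open>e / (2 * L) > 0\<close> by simp
    fix D :: "(real \<times> real) set"
    assume D: "finite D" "\<forall>(r, s)\<in>D. a \<le> r \<and> r \<le> s \<and> s \<le> b"
      "pairwise (\<lambda>I J. disjnt {fst I<..<snd I} {fst J<..<snd J}) D"
      "(\<Sum>(r, s)\<in>D. s - r) < min \<delta> (e / (2 * L))"
    have g: "(\<Sum>(r, s)\<in>D. norm (g s - g r)) < e / (2 * L)" using D \<delta> by auto
    have "(\<Sum>(r, s)\<in>D. norm (k s - k r)) \<le> (\<Sum>(r, s)\<in>D. L * ((s - r) + norm (g s - g r)))"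
      using D(2) le by (intro sum_mono) auto
    also have "\<dots> = L * ((\<Sum>(r, s)\<in>D. s - r) + (\<Sum>(r, s)\<in>D. norm (g s - g r)))"
      by (simp add: case_prod_unfold sum_distrib_left sum.distrib distrib_left)
    also have "\<dots> < L * (e / (2 * L) + e / (2 * L))"
      using g D(4) \<open>L > 0\<close> by (intro mult_strict_left_mono add_strict_mono) auto
    also have "\<dots> = e" using \<open>L > 0\<close> by simp
    finally show "(\<Sum>(r, s)\<in>D. norm (k s - k r)) < e" .
  qed
qed

lemma absolutely_continuous_on_interval_imp_continuous:
  assumes "absolutely_continuous_on_interval a b g"
  shows "continuous_on {a..b} g"
  unfolding continuous_on_iff
proof (intro ballI allI impI)
  fix t e :: real assume t: "t \<in> {a..b}" and "e > 0"
  obtain \<delta> where "\<delta> > 0" and \<delta>: "\<And>D. finite D \<Longrightarrow> (\<forall>(r, s)\<in>D. a \<le> r \<and> r \<le> s \<and> s \<le> b) \<Longrightarrow>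
        pairwise (\<lambda>I J. disjnt {fst I<..<snd I} {fst J<..<snd J}) D \<Longrightarrow>
        (\<Sum>(r, s)\<in>D. s - r) < \<delta> \<Longrightarrow> (\<Sum>(r, s)\<in>D. norm (g s - g r)) < e"
    by (rule absolutely_continuous_on_intervalE[OF assms \<open>e > 0\<close>]) (rule that)
  show "\<exists>d>0. \<forall>s\<in>{a..b}. dist s t < d \<longrightarrow> dist (g s) (g t) < e"
  proof (intro exI[of _ \<delta>] conjI ballI impI \<open>\<delta> > 0\<close>)
    fix s assume s: "s \<in> {a..b}" "dist s t < \<delta>"
    show "dist (g s) (g t) < e"
    proof (cases "s \<le> t")
      case True
      then show ?thesis
        using \<delta>[of "{(s, t)}"] s t by (auto simp: dist_norm norm_minus_commute)
    next
      case False
      then show ?thesis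
        using \<delta>[of "{(t, s)}"] s t by (auto simp: dist_norm)
    qed
  qed
qed

text \<open>The indefinite integral of \<open>g'\<close> is \<open>g\<close>, so that absolute integrability amounts to the bounded variation
  of \<open>g\<close>.\<close>

lemma absolutely_integrable_derivative:
  fixes g :: "real \<Rightarrow> real"
  assumes "a \<le> b" and ac: "absolutely_continuous_on_interval a b g" and "negligible N"
    and der: "\<And>t. t \<in> {a..b} - N \<Longrightarrow> (g has_vector_derivative g' t) (at t within {a..b})"
  shows "g' absolutely_integrable_on {a..b}"
proof -
  obtain d where "d > 0" and d: "\<And>(I :: real set set) l r. finite I \<Longrightarrow>
        (\<forall>i\<in>I. a \<le> l i \<and> l i \<le> r i \<and> r i \<le> b) \<Longrightarrow>
        pairwise (\<lambda>i j. disjnt {l i<..<r i} {l j<..<r j}) I \<Longrightarrow> (\<Sum>i\<in>I. r i - l i) < d \<Longrightarrow>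
        (\<Sum>i\<in>I. norm (g (r i) - g (l i))) < 1"
    by (rule absolutely_continuous_on_interval_indexed[OF ac zero_less_one]) (rule that)
  have int: "(g' has_integral g v - g u) {u..v}" if "a \<le> u" "u \<le> v" "v \<le> b" for u v
  proof (rule fundamental_theorem_absolutely_continuous[OF \<open>u \<le> v\<close> _ \<open>negligible N\<close>])
    show "absolutely_continuous_on_interval u v g"
      using ac that by (auto intro: absolutely_continuous_on_interval_subset)
    fix t assume "t \<in> {u..v} - N"
    with that show "(g has_vector_derivative g' t) (at t within {u..v})"
      by (intro has_vector_derivative_within_subset[OF der]) auto
  qed
  (* On intervals shorter than the modulus of absolute continuity the variation is at most 1. *)
  have short: "g' absolutely_integrable_on {u..v}" if uv: "a \<le> u" "u \<le> v" "v \<le> b" "v - u < d" for u v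
    unfolding box_real(2)[symmetric]
  proof (rule bounded_variation_absolutely_integrable_interval)
    show "g' integrable_on cbox u v" using int[OF uv(1-3)] by auto
    fix D assume D: "D division_of cbox u v"
    have K: "\<exists>l r. K = {l..r} \<and> l \<le> r \<and> u \<le> l \<and> r \<le> v" if KD: "K \<in> D" for K
    proof -
      obtain l r where "K = cbox l r" using division_ofD(4)[OF D KD] by auto
      moreover have "K \<subseteq> cbox u v" "K \<noteq> {}" using division_ofD(2,3)[OF D that] by auto
      ultimately show ?thesis by auto
    qed
    have disj: "pairwise (\<lambda>i j. disjnt {Inf i<..<Sup i} {Inf j<..<Sup j}) D"
      unfolding pairwise_def
    proof (intro ballI impI)
      fix i j assume ij: "i \<in> D" "j \<in> D" "i \<noteq> j"
      then have "interior i \<inter> interior j = {}" using division_ofD(5)[OF D] by blast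
      moreover obtain l r where "i = {l..r}" "l \<le> r" using K ij by blast
      moreover obtain l' r' where "j = {l'..r'}" "l' \<le> r'" using K ij by blast
      ultimately show "disjnt {Inf i<..<Sup i} {Inf j<..<Sup j}" by (simp add: disjnt_def)
    qed
    have "(\<Sum>K\<in>D. Sup K - Inf K) = (\<Sum>K\<in>D. measure lborel K)"
      using K by (intro sum.cong refl) fastforce
    also have "\<dots> = v - u" using additive_content_division[OF D] uv by simp
    finally have len: "(\<Sum>K\<in>D. Sup K - Inf K) < d" using uv by simp
    have "(\<Sum>K\<in>D. norm (integral K g')) = (\<Sum>K\<in>D. norm (g (Sup K) - g (Inf K)))"
    proof (intro sum.cong refl)
      fix K assume "K \<in> D"
      then obtain l r where lr: "K = {l..r}" "l \<le> r" "u \<le> l" "r \<le> v" using K by blast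
      then show "norm (integral K g') = norm (g (Sup K) - g (Inf K))"
        using int[of l r] uv by (simp add: integral_unique)
    qed
    also have "\<dots> < 1"
    proof (rule d[OF _ _ disj len])
      show "finite D" using D by blast
      show "\<forall>K\<in>D. a \<le> Inf K \<and> Inf K \<le> Sup K \<and> Sup K \<le> b" using K uv by fastforce
    qed
    finally show "(\<Sum>K\<in>D. norm (integral K g')) \<le> 1" by simp
  qed
  have "g' absolutely_integrable_on {a..min b (a + real n * (d / 2))}" for n
  proof (induction n)
    case 0
    then show ?case using short[of a a] assms(1) \<open>d > 0\<close> by simp
  next
    case (Suc n)
    let ?u = "min b (a + real n * (d / 2))" and ?v = "min b (a + real (Suc n) * (d / 2))"
    have uv: "a \<le> ?u" "?u \<le> ?v" "?v \<le> b" "?v - ?u < d"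
    proof -
      have "real (Suc n) * (d / 2) = real n * (d / 2) + d / 2" by (simp add: algebra_simps)
      moreover have "0 \<le> real n * (d / 2)" using \<open>d > 0\<close> by simp
      ultimately show "a \<le> ?u" "?u \<le> ?v" "?v \<le> b" "?v - ?u < d"
        using assms(1) \<open>d > 0\<close> by linarith+
    qed
    have "g' absolutely_integrable_on ({a..?u} \<union> {?u..?v})"
      using Suc short[OF uv] by (intro set_integrable_Un) auto
    moreover have "{a..?u} \<union> {?u..?v} = {a..?v}" by (rule ivl_disj_un_two_touch(4)) (use uv in auto)
    ultimately show ?case by simp
  qed
  moreover obtain n :: nat where "(b - a) / (d / 2) < real n" using reals_Archimedean2 by blast
  moreover from this have "min b (a + real n * (d / 2)) = b"
    using \<open>d > 0\<close> by (auto simp: field_simps min_def)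
  ultimately show ?thesis by metis
qed

section \<open>Comparison of costs\<close>

text \<open>A minorant of the running cost that is integrable excludes the value \<open>\<infinity> - \<infinity>\<close> in the cost.\<close>

lemma cost_ge_integral:
  assumes int: "k absolutely_integrable_on {0..tf}"
    and le: "AE t in lebesgue_on {0..tf}. k t \<le> f0 (x t) (u t)"
  shows "cost f0 tf x u \<ge> ereal (integral {0..tf} k)"
proof -
  let ?M = "lebesgue_on {0..tf}"
  have k: "integrable ?M k"
    using int by (simp add: absolutely_integrable_on_def integrable_restrict_space set_integrable_def)
  have "ereal (integral {0..tf} k) = ereal (\<integral>t. k t \<partial>?M)"
    using int by (simp add: lebesgue_integral_eq_integral[OF k] )
  also have "\<dots> = enn2ereal (\<integral>\<^sup>+ t. ennreal (k t) \<partial>?M) - enn2ereal (\<integral>\<^sup>+ t. ennreal (- k t) \<partial>?M)"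
    by (rule integrableE[OF k]) (simp add: enn2ereal_ennreal)
  also have "\<dots> \<le> cost f0 tf x u"
    unfolding cost_def
  proof (rule ereal_minus_mono)
    show "enn2ereal (\<integral>\<^sup>+ t. ennreal (k t) \<partial>?M) \<le> enn2ereal (\<integral>\<^sup>+ t. ennreal (f0 (x t) (u t)) \<partial>?M)"
      unfolding less_eq_ennreal.rep_eq[symmetric]
      by (rule nn_integral_mono_AE) (use le in eventually_elim, simp add: ennreal_leI)
    show "enn2ereal (\<integral>\<^sup>+ t. ennreal (- f0 (x t) (u t)) \<partial>?M) \<le> enn2ereal (\<integral>\<^sup>+ t. ennreal (- k t) \<partial>?M)"
      unfolding less_eq_ennreal.rep_eq[symmetric]
      by (rule nn_integral_mono_AE) (use le in eventually_elim, simp add: ennreal_leI)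
  qed
  finally show ?thesis .
qed

lemma cost_eq_integral_AE:
  assumes int: "k absolutely_integrable_on {0..tf}"
    and eq: "AE t in lebesgue_on {0..tf}. k t = f0 (x t) (u t)"
  shows "cost f0 tf x u = ereal (integral {0..tf} k)"
proof -
  let ?M = "lebesgue_on {0..tf}"
  have k: "integrable ?M k"
    using int by (simp add: absolutely_integrable_on_def integrable_restrict_space set_integrable_def)
  have "ereal (integral {0..tf} k) = ereal (\<integral>t. k t \<partial>?M)"
    by (simp add: lebesgue_integral_eq_integral[OF k])
  also have "\<dots> = enn2ereal (\<integral>\<^sup>+ t. ennreal (k t) \<partial>?M) - enn2ereal (\<integral>\<^sup>+ t. ennreal (- k t) \<partial>?M)"
    by (rule integrableE[OF k]) (simp add: enn2ereal_ennreal)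
  also have "(\<integral>\<^sup>+ t. ennreal (k t) \<partial>?M) = (\<integral>\<^sup>+ t. ennreal (f0 (x t) (u t)) \<partial>?M)"
    by (rule nn_integral_cong_AE) (use eq in eventually_elim, simp)
  also have "(\<integral>\<^sup>+ t. ennreal (- k t) \<partial>?M) = (\<integral>\<^sup>+ t. ennreal (- f0 (x t) (u t)) \<partial>?M)"
    by (rule nn_integral_cong_AE) (use eq in eventually_elim, simp)
  finally show ?thesis by (simp add: cost_def)
qed

lemma AE_lebesgue_on_negligible:
  assumes "AE t in lebesgue_on {a..b::real}. P t"
  obtains N where "negligible N" "\<And>t. t \<in> {a..b} - N \<Longrightarrow> P t"
proof -
  have "AE t in lebesgue. t \<in> {a..b} \<longrightarrow> P t"
    using assms by (subst (asm) AE_restrict_space_iff) auto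
  then obtain N where "{t. \<not> (t \<in> {a..b} \<longrightarrow> P t)} \<subseteq> N" "N \<in> null_sets lebesgue"
    unfolding eventually_ae_filter by auto
  then show ?thesis
    using that[of N] by (auto simp: negligible_iff_null_sets)
qed

section \<open>Continuously differentiable maps\<close>

lemma Ck_on_open_Suc_0_blinfun:
  fixes F :: "'a::euclidean_space \<Rightarrow> 'b::real_normed_vector"
  assumes "Ck_on_open (Suc 0) W F"
  defines "D \<equiv> \<lambda>z. Blinfun (frechet_derivative F (at z))"
  shows "\<And>z. z \<in> W \<Longrightarrow> blinfun_apply (D z) = frechet_derivative F (at z)"
    and "\<And>z. z \<in> W \<Longrightarrow> (F has_derivative blinfun_apply (D z)) (at z)"
    and "continuous_on W D"
proof -
  show D: "blinfun_apply (D z) = frechet_derivative F (at z)" if "z \<in> W" for z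
    using assms(1) that unfolding D_def
    by (intro bounded_linear_Blinfun_apply) (auto simp: frechet_derivative_works has_derivative_bounded_linear)
  show "(F has_derivative blinfun_apply (D z)) (at z)" if "z \<in> W" for z
    unfolding D[OF that] using assms(1) that by (simp add: frechet_derivative_works)
  show "continuous_on W D"
  proof (rule continuous_on_blinfun_componentwise)
    fix i :: 'a
    have "continuous_on W (\<lambda>z. frechet_derivative F (at z) i)" using assms(1) by simp
    then show "continuous_on W (\<lambda>z. D z i)" by (simp add: D cong: continuous_on_cong)
  qed
qed

text \<open>A \<open>C\<^sup>1\<close> map is strictly differentiable, uniformly along a compact set: the two points
  that are compared need not include the base point.\<close>

lemma uniform_strict_derivative:
  fixes F :: "'a::euclidean_space \<Rightarrow> 'b::real_normed_vector" and D :: "'a \<Rightarrow> 'a \<Rightarrow>\<^sub>L 'b"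
  assumes "open W" "\<And>z. z \<in> W \<Longrightarrow> (F has_derivative blinfun_apply (D z)) (at z)"
    "continuous_on W D" "compact K" "K \<subseteq> W" "e > 0"
  obtains r where "r > 0" "\<And>k. k \<in> K \<Longrightarrow> ball k r \<subseteq> W"
    "\<And>k z z'. k \<in> K \<Longrightarrow> z \<in> ball k r \<Longrightarrow> z' \<in> ball k r \<Longrightarrow>
       norm (F z - F z' - D k (z - z')) \<le> e * norm (z - z')"
proof -
  obtain r0 where r0: "r0 > 0" "(\<Union>k\<in>K. cball k r0) \<subseteq> W"
    using compact_subset_open_imp_cball_epsilon_subset[OF assms(4,1,5)] by blast
  define C where "C = (\<Union>k\<in>K. cball k r0)"
  have "C = (\<Union>k\<in>K. \<Union>v\<in>cball 0 r0. {k + v})"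
    by (force simp: C_def dist_norm norm_minus_commute intro: exI[of _ "_ - _"])
  then have "C = {k + v | k v. k \<in> K \<and> v \<in> cball 0 r0}" by blast
  then have "compact C" by (simp only: compact_sums[OF assms(4) compact_cball])
  then have "uniformly_continuous_on C D"
    using assms(3) r0(2) unfolding C_def
    by (intro compact_uniformly_continuous) (auto intro: continuous_on_subset)
  then obtain d where d: "d > 0" "\<And>z z'. z \<in> C \<Longrightarrow> z' \<in> C \<Longrightarrow> dist z' z < d \<Longrightarrow> dist (D z') (D z) < e"
    unfolding uniformly_continuous_on_def using \<open>e > 0\<close> by metis
  define r where "r = min d r0"
  have sub: "ball k r \<subseteq> C" if "k \<in> K" for k using that unfolding C_def r_def by auto
  show ?thesis
  proof (rule that[of r])
    show "r > 0" using d r0 by (simp add: r_def)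
    show "ball k r \<subseteq> W" if "k \<in> K" for k using sub[OF that] r0(2) C_def by blast
    fix k z z' assume k: "k \<in> K" "z \<in> ball k r" "z' \<in> ball k r"
    have "norm ((F z - D k z) - (F z' - D k z')) \<le> e * norm (z - z')"
    proof (rule differentiable_bound[where S = "ball k r" and f' = "\<lambda>x h. D x h - D k h"])
      show "convex (ball k r)" by simp
      fix x assume x: "x \<in> ball k r"
      have "x \<in> W" using sub[OF k(1)] x r0(2) C_def by blast
      show "((\<lambda>z. F z - D k z) has_derivative (\<lambda>h. D x h - D k h)) (at x within ball k r)"
        by (intro derivative_intros has_derivative_at_withinI[OF assms(2)[OF \<open>x \<in> W\<close>]]
            bounded_linear_imp_has_derivative blinfun.bounded_linear_right)
      have "k \<in> C" "x \<in> C" using sub[OF k(1)] x \<open>r > 0\<close> by auto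
      then have "norm (D x - D k) < e"
        using d(2)[of k x] x unfolding r_def dist_norm[symmetric] by (auto simp: dist_commute)
      then show "onorm (\<lambda>h. D x h - D k h) \<le> e"
        by (simp add: norm_blinfun.rep_eq minus_blinfun.rep_eq)
    qed (use k in auto)
    then show "norm (F z - F z' - D k (z - z')) \<le> e * norm (z - z')"
      by (simp add: blinfun.diff_right algebra_simps)
  qed
qed

section \<open>Differential inequalities and linear equations\<close>

text \<open>Gronwall's inequality in a form that only needs the derivative of the squared norm.  Adding
  \<open>c\<^sup>2\<close> to it turns the inhomogeneous inequality into a homogeneous one.\<close>

lemma gronwall_inner:
  fixes w :: "real \<Rightarrow> 'a::real_inner"
  assumes "a \<le> b" and cont: "continuous_on {a..b} w"
    and der: "\<And>t. t \<in> {a<..<b} \<Longrightarrow> (w has_vector_derivative w' t) (at t)"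
    and le: "\<And>t. t \<in> {a<..<b} \<Longrightarrow> norm (w' t) \<le> L * norm (w t) + c"
    and "L \<ge> 0" "c \<ge> 0"
  shows "norm (w b) \<le> (norm (w a) + c) * exp ((2 * L + 1) * (b - a))"
proof (cases "a = b")
  case True
  then show ?thesis using \<open>c \<ge> 0\<close> by simp
next
  case False
  with \<open>a \<le> b\<close> have "a < b" by simp
  define K where "K = 2 * L + 1"
  have "K \<ge> 1" using \<open>L \<ge> 0\<close> by (simp add: K_def)
  define h where "h t = (w t \<bullet> w t + c\<^sup>2) * exp (- (K * (t - a)))" for t
  have "h b \<le> h a"
  proof (rule DERIV_nonpos_imp_decreasing_open[OF \<open>a \<le> b\<close>])
    fix t assume t: "a < t" "t < b"
    have "((\<lambda>t. w t \<bullet> w t) has_vector_derivative 2 * (w t \<bullet> w' t)) (at t)"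
      using bounded_bilinear.has_vector_derivative[OF bounded_bilinear_inner der der, of t] t
      by (simp add: inner_commute)
    then have 1: "((\<lambda>t. w t \<bullet> w t) has_real_derivative 2 * (w t \<bullet> w' t)) (at t)"
      by (simp add: has_real_derivative_iff_has_vector_derivative)
    have 2: "(h has_real_derivative (2 * (w t \<bullet> w' t) - K * (w t \<bullet> w t + c\<^sup>2)) * exp (- (K * (t - a)))) (at t)"
      unfolding h_def by (rule derivative_eq_intros 1 refl)+ (simp add: algebra_simps)
    have "2 * (w t \<bullet> w' t) \<le> 2 * (norm (w t) * (L * norm (w t) + c))"
      using norm_cauchy_schwarz[of "w t" "w' t"] mult_left_mono[OF le[of t] norm_ge_zero[of "w t"]] t by auto
    also have "\<dots> \<le> K * (norm (w t))\<^sup>2 + c\<^sup>2"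
      using sum_squares_bound[of "norm (w t)" c] by (simp add: K_def algebra_simps power2_eq_square)
    also have "\<dots> \<le> K * (w t \<bullet> w t + c\<^sup>2)"
      using \<open>K \<ge> 1\<close> mult_right_mono[of 1 K "c\<^sup>2"] by (simp add: power2_norm_eq_inner algebra_simps)
    finally have "(2 * (w t \<bullet> w' t) - K * (w t \<bullet> w t + c\<^sup>2)) * exp (- (K * (t - a))) \<le> 0"
      by (intro mult_nonpos_nonneg) auto
    with 2 show "\<exists>y. (h has_real_derivative y) (at t) \<and> y \<le> 0" by blast
  next
    show "continuous_on {a..b} h" unfolding h_def by (intro continuous_intros cont)
  qed
  then have "(w b \<bullet> w b + c\<^sup>2) * exp (- (K * (b - a))) \<le> w a \<bullet> w a + c\<^sup>2"
    by (simp add: h_def)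
  then have "w b \<bullet> w b + c\<^sup>2 \<le> (w a \<bullet> w a + c\<^sup>2) * exp (K * (b - a))"
    by (simp add: exp_minus divide_inverse[symmetric] pos_divide_le_eq)
  then have "(norm (w b))\<^sup>2 \<le> ((norm (w a))\<^sup>2 + c\<^sup>2) * exp (K * (b - a))"
    using zero_le_power2[of c] unfolding power2_norm_eq_inner by linarith
  also have "\<dots> \<le> (norm (w a) + c)\<^sup>2 * exp (K * (b - a)) ^ 2"
  proof (rule mult_mono)
    show "(norm (w a))\<^sup>2 + c\<^sup>2 \<le> (norm (w a) + c)\<^sup>2"
      using \<open>c \<ge> 0\<close> by (simp add: power2_sum)
    have "1 \<le> exp (K * (b - a))" using \<open>K \<ge> 1\<close> \<open>a \<le> b\<close> by simp
    then show "exp (K * (b - a)) \<le> (exp (K * (b - a)))\<^sup>2"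
      by (simp add: power2_eq_square)
  qed auto
  also have "\<dots> = ((norm (w a) + c) * exp (K * (b - a)))\<^sup>2" by (simp add: power_mult_distrib)
  finally show ?thesis
    unfolding K_def by (rule power2_le_imp_le) (use \<open>c \<ge> 0\<close> in simp)
qed

text \<open>The terms of the Picard series; the factorial bound makes the series and the series of its
  derivatives converge uniformly.\<close>

primrec picard_term :: "('c \<Rightarrow> 'b \<Rightarrow> 'b) \<Rightarrow> (real \<Rightarrow> 'c) \<Rightarrow> 'b \<Rightarrow> nat \<Rightarrow> real \<Rightarrow> 'b::banach" where
  "picard_term pr A w0 0 = (\<lambda>t. w0)"
| "picard_term pr A w0 (Suc n) = (\<lambda>t. integral {0..t} (\<lambda>s. pr (A s) (picard_term pr A w0 n s)))"

text \<open>The coefficient acts through a bounded bilinear product, which is the composition of operators when the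
  resolvent of a linear equation is constructed.\<close>

lemma linear_ode_solution:
  fixes pr :: "'c::real_normed_vector \<Rightarrow> 'b::banach \<Rightarrow> 'b"
  assumes bil: "bounded_bilinear pr" and "T \<ge> 0" and contA: "continuous_on {0..T} A"
  obtains w where "w 0 = w0"
    "\<And>t. t \<in> {0..T} \<Longrightarrow> (w has_vector_derivative pr (A t) (w t)) (at t within {0..T})"
proof -
  interpret bounded_bilinear pr by fact
  define u where "u = picard_term pr A w0"
  obtain B where B: "B > 0" "\<And>a b. norm (pr a b) \<le> norm a * norm b * B"
    using pos_bounded by blast
  have "bounded (A ` {0..T})" using contA compact_continuous_image compact_imp_bounded by blast
  then obtain M0 where M0: "M0 > 0" "\<And>t. t \<in> {0..T} \<Longrightarrow> norm (A t) \<le> M0"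
    unfolding bounded_pos by auto
  define M where "M = M0 * B"
  have M: "norm (pr (A t) b) \<le> M * norm b" if "t \<in> {0..T}" for t b
  proof -
    have "norm (pr (A t) b) \<le> norm (A t) * (norm b * B)" using B(2)[of "A t" b] by simp
    also have "\<dots> \<le> M0 * (norm b * B)" using M0(2)[OF that] B(1) by (intro mult_right_mono) auto
    finally show ?thesis by (simp add: M_def mult_ac)
  qed
  have "M > 0" using M0 B by (simp add: M_def)
  have contu: "continuous_on {0..T} (u n)" for n
  proof (induction n)
    case (Suc n)
    have "continuous_on {0..T} (\<lambda>s. pr (A s) (u n s))" by (intro continuous_on contA Suc)
    then show ?case
      using indefinite_integral_continuous_1[OF integrable_continuous_interval] by (simp add: u_def)
  qed (simp add: u_def)
  have contp: "continuous_on {0..T} (\<lambda>s. pr (A s) (u n s))" for n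
    by (intro continuous_on contA contu)
  have der: "(u (Suc n) has_vector_derivative pr (A t) (u n t)) (at t within {0..T})" if "t \<in> {0..T}" for n t
    using integral_has_vector_derivative[OF contp that] by (simp add: u_def)
  have bound: "norm (u n t) \<le> norm w0 * (M * t) ^ n / fact n" if "t \<in> {0..T}" for n t
    using that
  proof (induction n arbitrary: t)
    case (Suc n)
    have "norm (u (Suc n) t) \<le> integral {0..t} (\<lambda>s. M * (norm w0 * (M * s) ^ n / fact n))"
      unfolding u_def picard_term.simps
    proof (rule integral_norm_bound_integral)
      show "(\<lambda>s. pr (A s) (picard_term pr A w0 n s)) integrable_on {0..t}"
        using contp[of n] Suc.prems unfolding u_def
        by (intro integrable_continuous_interval) (auto intro: continuous_on_subset)
      show "(\<lambda>s. M * (norm w0 * (M * s) ^ n / fact n)) integrable_on {0..t}"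
        by (intro integrable_continuous_interval continuous_intros) auto
      fix s assume "s \<in> {0..t}"
      then have s: "s \<in> {0..T}" using Suc.prems by auto
      have "norm (pr (A s) (u n s)) \<le> M * norm (u n s)" by (rule M[OF s])
      also have "\<dots> \<le> M * (norm w0 * (M * s) ^ n / fact n)"
        using Suc.IH[OF s] \<open>M > 0\<close> by (intro mult_left_mono) auto
      finally show "norm (pr (A s) (picard_term pr A w0 n s)) \<le> M * (norm w0 * (M * s) ^ n / fact n)"
        by (simp add: u_def)
    qed
    also have "\<dots> = norm w0 * (M * t) ^ Suc n / fact (Suc n)"
    proof (rule integral_unique)
      have "((\<lambda>s. norm w0 * (M * s) ^ Suc n / fact (Suc n)) has_vector_derivative
               M * (norm w0 * (M * s) ^ n / fact n)) (at s within {0..t})" for s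
      proof -
        define c where "c = norm w0 / fact (Suc n)"
        have "((\<lambda>s. c * (M * s) ^ Suc n) has_vector_derivative c * (real (Suc n) * (M * (M * s) ^ n))) (at s within {0..t})"
          unfolding has_real_derivative_iff_has_vector_derivative[symmetric]
          by (rule derivative_eq_intros refl)+ simp
        moreover have "c * real (Suc n) = norm w0 / fact n"
          by (simp add: c_def del: of_nat_Suc)
        then have "c * (real (Suc n) * (M * (M * s) ^ n)) = norm w0 / fact n * (M * (M * s) ^ n)"
          by (simp only: mult.assoc[symmetric])
        then have "c * (real (Suc n) * (M * (M * s) ^ n)) = M * (norm w0 * (M * s) ^ n / fact n)"
          by (simp only:) simp
        moreover have "(\<lambda>s. norm w0 * (M * s) ^ Suc n / fact (Suc n)) = (\<lambda>s. c * (M * s) ^ Suc n)"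
          by (simp add: c_def)
        ultimately show ?thesis by (simp only:)
      qed
      moreover have "0 \<le> t" using Suc.prems by simp
      ultimately have "((\<lambda>s. M * (norm w0 * (M * s) ^ n / fact n)) has_integral
          norm w0 * (M * t) ^ Suc n / fact (Suc n) - norm w0 * (M * 0) ^ Suc n / fact (Suc n)) {0..t}"
        by (intro fundamental_theorem_of_calculus)
      then show "((\<lambda>s. M * (norm w0 * (M * s) ^ n / fact n)) has_integral norm w0 * (M * t) ^ Suc n / fact (Suc n)) {0..t}"
        by (simp only: mult_zero_right power_Suc mult_zero_left div_0 diff_0_right)
    qed
    finally show ?case .
  qed (simp add: u_def)
  have bound': "norm (u n t) \<le> norm w0 * ((M * T) ^ n / fact n)" if "t \<in> {0..T}" for n t
  proof -
    have "(M * t) ^ n \<le> (M * T) ^ n" using that \<open>M > 0\<close> by (intro power_mono) auto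
    then have "norm w0 * ((M * t) ^ n / fact n) \<le> norm w0 * ((M * T) ^ n / fact n)"
      by (intro mult_left_mono divide_right_mono) auto
    then show ?thesis using bound[OF that, of n] by simp
  qed
  have "summable (\<lambda>n. (M * T) ^ n / fact n)"
    using summable_exp_generic[of "M * T"] by (simp add: divide_inverse_commute)
  then have summ: "summable (\<lambda>n. norm w0 * ((M * T) ^ n / fact n))" by (rule summable_mult)
  define w where "w t = (\<Sum>n. u n t)" for t
  have unif: "uniform_limit {0..T} (\<lambda>n t. \<Sum>i<n. u i t) w sequentially"
    unfolding w_def by (rule Weierstrass_m_test[OF bound' summ])
  have sums: "(\<lambda>n. u n t) sums w t" if "t \<in> {0..T}" for t
    unfolding w_def using bound'[OF that] summ by (intro summable_sums summable_comparison_test'[OF summ])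
  have sums0: "(\<lambda>n. u n 0) sums w0"
  proof -
    have "u n 0 = (if n = 0 then w0 else 0)" for n by (cases n) (auto simp: u_def)
    then have "(\<lambda>n. u n 0) = (\<lambda>n. if n = 0 then w0 else 0)" by (rule ext)
    then show ?thesis using sums_single[of 0 "\<lambda>_. w0"] by simp
  qed
  define u' where "u' n t = (case n of 0 \<Rightarrow> 0 | Suc m \<Rightarrow> pr (A t) (u m t))" for n t
  have "\<exists>g. \<forall>t\<in>{0..T}. (\<lambda>n. u n t) sums g t \<and>
      (g has_derivative (\<lambda>h. h *\<^sub>R pr (A t) (w t))) (at t within {0..T})"
  proof (rule has_derivative_series[where f' = "\<lambda>n t h. h *\<^sub>R u' n t"])
    show "convex {0..T}" by simp
    fix n t assume t: "t \<in> {0..T}"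
    show "(u n has_derivative (\<lambda>h. h *\<^sub>R u' n t)) (at t within {0..T})"
    proof (cases n)
      case 0
      then show ?thesis by (simp add: u_def u'_def)
    next
      case (Suc m)
      then show ?thesis using der[OF t, of m] by (simp add: u'_def has_vector_derivative_def)
    qed
  next
    fix e :: real assume "e > 0"
    then have "e / M > 0" using \<open>M > 0\<close> by simp
    then have "\<forall>\<^sub>F n in sequentially. \<forall>t\<in>{0..T}. dist (\<Sum>i<n. u i t) (w t) < e / M"
      using unif unfolding uniform_limit_iff by blast
    then have "\<forall>\<^sub>F n in sequentially. \<forall>t\<in>{0..T}. \<forall>h. norm ((\<Sum>i<Suc n. h *\<^sub>R u' i t) - h *\<^sub>R pr (A t) (w t)) \<le> e * norm h"
    proof eventually_elim
      case (elim n)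
      show ?case
      proof (intro ballI allI)
        fix t h assume t: "t \<in> {0..T}"
        have "(\<Sum>i<Suc n. h *\<^sub>R u' i t) - h *\<^sub>R pr (A t) (w t) = h *\<^sub>R pr (A t) ((\<Sum>i<n. u i t) - w t)"
          by (subst sum.lessThan_Suc_shift)
             (simp add: u'_def diff_right sum_right scaleR_diff_right scaleR_sum_right)
        then have "norm ((\<Sum>i<Suc n. h *\<^sub>R u' i t) - h *\<^sub>R pr (A t) (w t)) \<le> \<bar>h\<bar> * (M * norm ((\<Sum>i<n. u i t) - w t))"
          using M[OF t] by (simp add: mult_left_mono)
        also have "\<dots> \<le> \<bar>h\<bar> * (M * (e / M))"
          using elim t \<open>M > 0\<close> by (intro mult_left_mono) (auto simp: dist_norm less_imp_le)
        finally show "norm ((\<Sum>i<Suc n. h *\<^sub>R u' i t) - h *\<^sub>R pr (A t) (w t)) \<le> e * norm h"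
          using \<open>M > 0\<close> by (simp add: mult.commute)
      qed
    qed
    then show "\<forall>\<^sub>F n in sequentially. \<forall>t\<in>{0..T}. \<forall>h. norm ((\<Sum>i<n. h *\<^sub>R u' i t) - h *\<^sub>R pr (A t) (w t)) \<le> e * norm h"
      by (subst (asm) eventually_sequentially_Suc)
  next
    show "0 \<in> {0..T}" using \<open>T \<ge> 0\<close> by simp
    show "(\<lambda>n. u n 0) sums w0" by (rule sums0)
  qed
  then obtain g where g: "\<And>t. t \<in> {0..T} \<Longrightarrow> (\<lambda>n. u n t) sums g t"
    "\<And>t. t \<in> {0..T} \<Longrightarrow> (g has_vector_derivative pr (A t) (w t)) (at t within {0..T})"
    unfolding has_vector_derivative_def by blast
  have gw: "g t = w t" if "t \<in> {0..T}" for t using sums_unique2[OF g(1)[OF that] sums[OF that]] .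
  have "g 0 = w0" using sums_unique2[OF g(1) sums0] \<open>T \<ge> 0\<close> by simp
  then show ?thesis
  proof (rule that)
    fix t assume t: "t \<in> {0..T}"
    show "(g has_vector_derivative pr (A t) (g t)) (at t within {0..T})"
      unfolding gw[OF t] by (rule g(2)[OF t])
  qed
qed

section \<open>Flows of continuously differentiable vector fields\<close>

locale complete_C1_flow =
  fixes W :: "'a::euclidean_space set" and F :: "'a \<Rightarrow> 'a" and D :: "'a \<Rightarrow> 'a \<Rightarrow>\<^sub>L 'a"
    and \<zeta> :: "real \<Rightarrow> 'a \<Rightarrow> 'a"
  assumes open_W: "open W"
    and F_deriv: "\<And>z. z \<in> W \<Longrightarrow> (F has_derivative blinfun_apply (D z)) (at z)"
    and D_cont: "continuous_on W D"
    and flow_0: "\<And>z. z \<in> W \<Longrightarrow> \<zeta> 0 z = z"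
    and flow_in: "\<And>t z. z \<in> W \<Longrightarrow> \<zeta> t z \<in> W"
    and flow_deriv: "\<And>t z. z \<in> W \<Longrightarrow> ((\<lambda>s. \<zeta> s z) has_vector_derivative F (\<zeta> t z)) (at t)"
begin

lemma F_cont: "continuous_on W F"
  using F_deriv by (meson continuous_at_imp_continuous_on has_derivative_continuous)

lemma flow_cont: "z \<in> W \<Longrightarrow> continuous_on S (\<lambda>t. \<zeta> t z)"
  by (intro continuous_at_imp_continuous_on ballI has_vector_derivative_continuous[OF flow_deriv])

lemma lipschitz_tube:
  fixes T :: real and y :: "real \<Rightarrow> 'a"
  assumes "continuous_on {0..T} y" "\<And>t. t \<in> {0..T} \<Longrightarrow> y t \<in> W"
  obtains R L B where "R > 0" "L \<ge> 0" "B \<ge> 0" "\<And>t. t \<in> {0..T} \<Longrightarrow> ball (y t) R \<subseteq> W"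
    "\<And>t a. t \<in> {0..T} \<Longrightarrow> a \<in> ball (y t) R \<Longrightarrow> norm (F a) \<le> B"
    "\<And>t a b. t \<in> {0..T} \<Longrightarrow> a \<in> ball (y t) R \<Longrightarrow> b \<in> ball (y t) R \<Longrightarrow> norm (F a - F b) \<le> L * norm (a - b)"
proof -
  have K: "compact (y ` {0..T})" "y ` {0..T} \<subseteq> W"
    using assms by (auto intro!: compact_continuous_image)
  have "continuous_on {0..T} (\<lambda>t. D (y t))" "continuous_on {0..T} (\<lambda>t. F (y t))"
    using assms by (auto intro!: continuous_on_compose2[OF D_cont] continuous_on_compose2[OF F_cont])
  then have "bounded ((\<lambda>t. D (y t)) ` {0..T})" "bounded ((\<lambda>t. F (y t)) ` {0..T})"
    by (auto intro!: compact_imp_bounded compact_continuous_image)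
  then obtain M B where M: "M > 0" "\<And>t. t \<in> {0..T} \<Longrightarrow> norm (D (y t)) \<le> M"
    and B: "B > 0" "\<And>t. t \<in> {0..T} \<Longrightarrow> norm (F (y t)) \<le> B"
    unfolding bounded_pos by auto
  obtain R where R: "R > 0" "\<And>k. k \<in> y ` {0..T} \<Longrightarrow> ball k R \<subseteq> W"
    "\<And>k z z'. k \<in> y ` {0..T} \<Longrightarrow> z \<in> ball k R \<Longrightarrow> z' \<in> ball k R \<Longrightarrow>
       norm (F z - F z' - D k (z - z')) \<le> 1 * norm (z - z')"
    using uniform_strict_derivative[OF open_W F_deriv D_cont K, of 1] by auto
  have lip: "norm (F a - F b) \<le> (1 + M) * norm (a - b)"
    if t: "t \<in> {0..T}" "a \<in> ball (y t) R" "b \<in> ball (y t) R" for t a b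
  proof -
    have "norm (F a - F b) \<le> norm (F a - F b - D (y t) (a - b)) + norm (D (y t) (a - b))"
      using norm_triangle_ineq[of "F a - F b - D (y t) (a - b)" "D (y t) (a - b)"] by simp
    also have "\<dots> \<le> 1 * norm (a - b) + M * norm (a - b)"
      using R(3)[of "y t" a b] t order_trans[OF norm_blinfun mult_right_mono[OF M(2)[OF t(1)] norm_ge_zero]]
      by (intro add_mono) auto
    finally show "norm (F a - F b) \<le> (1 + M) * norm (a - b)" by (simp add: algebra_simps)
  qed
  show ?thesis
  proof (rule that[OF _ _ _ _ _ lip])
    fix t a assume t: "t \<in> {0..T}" "a \<in> ball (y t) R"
    have "norm (F a) \<le> norm (F (y t)) + norm (F a - F (y t))"
      using norm_triangle_ineq[of "F (y t)" "F a - F (y t)"] by simp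
    also have "\<dots> \<le> B + (1 + M) * norm (a - y t)"
      using B(2)[OF t(1)] lip[OF t, of "y t"] R(1) by (intro add_mono) auto
    also have "\<dots> \<le> B + (1 + M) * R"
      using t(2) M(1) by (auto simp: dist_norm norm_minus_commute)
    finally show "norm (F a) \<le> B + (1 + M) * R" .
  qed (use R M B in auto)
qed

text \<open>A solution that starts close to \<open>y\<close> cannot leave the tube: at the first exit time Gronwall's
  inequality would still hold.\<close>

lemma solution_stays_in_tube:
  assumes tube: "\<And>t a b. t \<in> {0..T} \<Longrightarrow> a \<in> ball (y t) R \<Longrightarrow> b \<in> ball (y t) R \<Longrightarrow> norm (F a - F b) \<le> L * norm (a - b)"
    and "L \<ge> 0" "R > 0"
    and y: "continuous_on {0..T} y" "\<And>t. t \<in> {0<..<T} \<Longrightarrow> (y has_vector_derivative F (y t)) (at t)"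
    and v: "continuous_on {0..T} v" "\<And>t. t \<in> {0<..<T} \<Longrightarrow> (v has_vector_derivative F (v t)) (at t)"
    and close: "norm (v 0 - y 0) * exp ((2 * L + 1) * T) < R" and t: "t \<in> {0..T}"
  shows "norm (v t - y t) \<le> norm (v 0 - y 0) * exp ((2 * L + 1) * T)"
proof -
  have gr: "norm (v s - y s) \<le> norm (v 0 - y 0) * exp ((2 * L + 1) * T)"
    if s: "s \<in> {0..T}" and inside: "\<And>r. r \<in> {0<..<s} \<Longrightarrow> norm (v r - y r) < R" for s
  proof -
    have "norm (v s - y s) \<le> (norm (v 0 - y 0) + 0) * exp ((2 * L + 1) * (s - 0))"
    proof (rule gronwall_inner[where w = "\<lambda>t. v t - y t" and w' = "\<lambda>t. F (v t) - F (y t)"])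
      show "continuous_on {0..s} (\<lambda>t. v t - y t)"
        using v(1) y(1) s by (intro continuous_intros) (auto intro: continuous_on_subset)
      fix r assume r: "r \<in> {0<..<s}"
      then show "((\<lambda>t. v t - y t) has_vector_derivative F (v r) - F (y r)) (at r)"
        using s by (intro has_vector_derivative_diff v(2) y(2)) auto
      show "norm (F (v r) - F (y r)) \<le> L * norm (v r - y r) + 0"
        using tube[of r "v r" "y r"] inside[OF r] r s \<open>R > 0\<close> by (auto simp: dist_norm norm_minus_commute)
    qed (use s \<open>L \<ge> 0\<close> in auto)
    also have "\<dots> \<le> norm (v 0 - y 0) * exp ((2 * L + 1) * T)"
      using s \<open>L \<ge> 0\<close> by (auto intro!: mult_left_mono)
    finally show ?thesis .
  qed
  have "norm (v s - y s) < R" if s: "s \<in> {0..T}" for s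
  proof (rule ccontr)
    assume out: "\<not> norm (v s - y s) < R"
    define C where "C = {0..T} \<inter> (\<lambda>s. norm (v s - y s)) -` {R..}"
    have "s \<in> C" using s out by (simp add: C_def)
    have "closed C" unfolding C_def
      by (intro continuous_closed_preimage continuous_intros v(1) y(1))
    have Inf: "Inf C \<in> C"
      using \<open>s \<in> C\<close> \<open>closed C\<close> by (intro closed_contains_Inf) (auto simp: C_def bdd_below_def)
    have "norm (v (Inf C) - y (Inf C)) \<le> norm (v 0 - y 0) * exp ((2 * L + 1) * T)"
    proof (rule gr)
      show "Inf C \<in> {0..T}" using Inf by (simp add: C_def)
      fix r assume r: "r \<in> {0<..<Inf C}"
      have "bdd_below C" by (rule bdd_belowI[of _ 0]) (simp add: C_def)
      then have "r \<notin> C" using cInf_lower[of r C] r by auto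
      then show "norm (v r - y r) < R" using r Inf by (auto simp: C_def)
    qed
    with Inf close show False by (simp add: C_def)
  qed
  with gr[OF t] t show ?thesis by auto
qed

lemma solution_unique:
  assumes "T \<ge> 0" "z \<in> W" "v 0 = z" and v: "continuous_on {0..T} v"
    "\<And>t. t \<in> {0<..<T} \<Longrightarrow> (v has_vector_derivative F (v t)) (at t)"
    and t: "t \<in> {0..T}"
  shows "v t = \<zeta> t z"
proof -
  obtain R L B where RL: "R > 0" "L \<ge> 0" "B \<ge> 0" "\<And>t. t \<in> {0..T} \<Longrightarrow> ball (\<zeta> t z) R \<subseteq> W"
    "\<And>t a. t \<in> {0..T} \<Longrightarrow> a \<in> ball (\<zeta> t z) R \<Longrightarrow> norm (F a) \<le> B"
    "\<And>t a b. t \<in> {0..T} \<Longrightarrow> a \<in> ball (\<zeta> t z) R \<Longrightarrow> b \<in> ball (\<zeta> t z) R \<Longrightarrow> norm (F a - F b) \<le> L * norm (a - b)"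
    by (rule lipschitz_tube[OF flow_cont[OF \<open>z \<in> W\<close>] flow_in[OF \<open>z \<in> W\<close>]]) (rule that)
  have "norm (v t - \<zeta> t z) \<le> norm (v 0 - \<zeta> 0 z) * exp ((2 * L + 1) * T)"
    using assms by (intro solution_stays_in_tube[OF RL(6,2,1) flow_cont flow_deriv v _ t])
                   (auto simp: flow_0 RL)
  then show ?thesis using assms by (simp add: flow_0)
qed

text \<open>Two nearby trajectories stay in a common tube, on which the field is Lipschitz, and Gronwall's inequality
  compares them there.\<close>

lemma flow_lipschitz:
  assumes "T \<ge> 0" "z0 \<in> W"
  obtains r C where "r > 0" "C > 0" "ball z0 r \<subseteq> W"
    "\<And>z z' s s'. z \<in> ball z0 r \<Longrightarrow> z' \<in> ball z0 r \<Longrightarrow> s \<in> {0..T} \<Longrightarrow> s' \<in> {0..T} \<Longrightarrow>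
       norm (\<zeta> s z - \<zeta> s' z') \<le> C * (norm (z - z') + \<bar>s - s'\<bar>)"
proof -
  let ?y = "\<lambda>t. \<zeta> t z0"
  obtain R L B where RL: "R > 0" "L \<ge> 0" "B \<ge> 0" "\<And>t. t \<in> {0..T} \<Longrightarrow> ball (?y t) R \<subseteq> W"
    "\<And>t a. t \<in> {0..T} \<Longrightarrow> a \<in> ball (?y t) R \<Longrightarrow> norm (F a) \<le> B"
    "\<And>t a b. t \<in> {0..T} \<Longrightarrow> a \<in> ball (?y t) R \<Longrightarrow> b \<in> ball (?y t) R \<Longrightarrow> norm (F a - F b) \<le> L * norm (a - b)"
    by (rule lipschitz_tube[OF flow_cont[OF \<open>z0 \<in> W\<close>] flow_in[OF \<open>z0 \<in> W\<close>]]) (rule that)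
  define E where "E = exp ((2 * L + 1) * T)"
  have "E \<ge> 1" unfolding E_def using RL(2) assms by simp
  define r where "r = R / E"
  have r: "r > 0" "r \<le> R" using \<open>E \<ge> 1\<close> RL(1) by (auto simp: r_def field_simps)
  have sub: "ball z0 r \<subseteq> W" using RL(4)[of 0] r assms by (auto simp: flow_0)
  have inside: "\<zeta> t z \<in> ball (?y t) R" if "z \<in> ball z0 r" "t \<in> {0..T}" for t z
  proof -
    have zW: "z \<in> W" using that sub by blast
    have lt: "norm (z - z0) * E < R"
      using that(1) \<open>E \<ge> 1\<close> by (simp add: r_def dist_norm norm_minus_commute pos_less_divide_eq)
    have "norm (\<zeta> t z - ?y t) \<le> norm (\<zeta> 0 z - ?y 0) * exp ((2 * L + 1) * T)"
      using zW assms lt that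
      by (intro solution_stays_in_tube[OF RL(6,2,1)] flow_cont flow_deriv) (auto simp: flow_0 E_def)
    with lt show ?thesis using zW assms by (simp add: flow_0 E_def dist_norm norm_minus_commute)
  qed
  have space: "norm (\<zeta> t z - \<zeta> t z') \<le> E * norm (z - z')"
    if z: "z \<in> ball z0 r" "z' \<in> ball z0 r" and t: "t \<in> {0..T}" for t z z'
  proof -
    have zW: "z \<in> W" "z' \<in> W" using z sub by auto
    have "norm (\<zeta> t z - \<zeta> t z') \<le> (norm (\<zeta> 0 z - \<zeta> 0 z') + 0) * exp ((2 * L + 1) * (t - 0))"
    proof (rule gronwall_inner[where w' = "\<lambda>t. F (\<zeta> t z) - F (\<zeta> t z')"])
      show "continuous_on {0..t} (\<lambda>t. \<zeta> t z - \<zeta> t z')"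
        by (intro continuous_intros flow_cont zW)
      fix s assume s: "s \<in> {0<..<t}"
      show "((\<lambda>t. \<zeta> t z - \<zeta> t z') has_vector_derivative F (\<zeta> s z) - F (\<zeta> s z')) (at s)"
        by (intro has_vector_derivative_diff flow_deriv zW)
      show "norm (F (\<zeta> s z) - F (\<zeta> s z')) \<le> L * norm (\<zeta> s z - \<zeta> s z') + 0"
        using RL(6)[of s] inside[OF z(1), of s] inside[OF z(2), of s] s t by auto
    qed (use t RL in auto)
    also have "\<dots> \<le> norm (z - z') * E"
      unfolding E_def using t RL(2) zW by (auto simp: flow_0 intro!: mult_left_mono)
    finally show ?thesis by (simp add: mult.commute)
  qed
  have time: "norm (\<zeta> s z - \<zeta> s' z) \<le> B * \<bar>s - s'\<bar>"
    if z: "z \<in> ball z0 r" and s: "s \<in> {0..T}" "s' \<in> {0..T}" for z s s'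
  proof -
    have zW: "z \<in> W" using z sub by auto
    have "norm (\<zeta> s z - \<zeta> s' z) \<le> B * norm (s - s')"
    proof (rule differentiable_bound[where S = "{0..T}" and f' = "\<lambda>t h. h *\<^sub>R F (\<zeta> t z)"])
      fix t assume t: "t \<in> {0..T}"
      show "((\<lambda>t. \<zeta> t z) has_derivative (\<lambda>h. h *\<^sub>R F (\<zeta> t z))) (at t within {0..T})"
        using flow_deriv[OF zW] by (auto simp: has_vector_derivative_def intro: has_derivative_at_withinI)
      show "onorm (\<lambda>h. h *\<^sub>R F (\<zeta> t z)) \<le> B"
        using RL(5)[OF t inside[OF z t]] by (simp add: onorm_scaleR_left[OF bounded_linear_ident] onorm_id)
    qed (use s in auto)
    then show ?thesis by simp
  qed
  show ?thesis
  proof (rule that[of r "E + B"])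
    show "r > 0" "ball z0 r \<subseteq> W" by fact+
    show "E + B > 0" using \<open>E \<ge> 1\<close> RL(3) by linarith
    fix z z' s s' assume a: "z \<in> ball z0 r" "z' \<in> ball z0 r" "s \<in> {0..T}" "s' \<in> {0..T}"
    have "norm (\<zeta> s z - \<zeta> s' z') \<le> norm (\<zeta> s z - \<zeta> s z') + norm (\<zeta> s z' - \<zeta> s' z')"
      using norm_triangle_ineq[of "\<zeta> s z - \<zeta> s z'" "\<zeta> s z' - \<zeta> s' z'"] by simp
    also have "\<dots> \<le> E * norm (z - z') + B * \<bar>s - s'\<bar>"
      using space[OF a(1,2,3)] time[OF a(2,3,4)] by (rule add_mono)
    also have "\<dots> \<le> (E + B) * norm (z - z') + (E + B) * \<bar>s - s'\<bar>"
    proof (rule add_mono; rule mult_right_mono)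
      show "E \<le> E + B" "B \<le> E + B" using \<open>E \<ge> 1\<close> RL(3) by linarith+
    qed auto
    finally show "norm (\<zeta> s z - \<zeta> s' z') \<le> (E + B) * (norm (z - z') + \<bar>s - s'\<bar>)"
      by (simp add: algebra_simps)
  qed
qed

text \<open>The flow is strictly differentiable in time and initial point along a reference solution, and
  its derivative in the initial point solves the linearized equation.\<close>

lemma flow_strict_derivative:
  assumes "T \<ge> 0" "z0 \<in> W"
  obtains \<Phi> :: "real \<Rightarrow> 'a \<Rightarrow>\<^sub>L 'a" where "\<Phi> 0 = id_blinfun"
    "\<And>t. t \<in> {0..T} \<Longrightarrow> (\<Phi> has_vector_derivative D (\<zeta> t z0) o\<^sub>L \<Phi> t) (at t within {0..T})"
    "\<And>e. e > 0 \<Longrightarrow> \<exists>r>0. \<forall>z z' s s' \<sigma>. z \<in> ball z0 r \<longrightarrow> z' \<in> ball z0 r \<longrightarrow> s \<in> {0..T} \<longrightarrow> s' \<in> {0..T} \<longrightarrow>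
       \<sigma> \<in> {0..T} \<longrightarrow> \<bar>s - \<sigma>\<bar> < r \<longrightarrow> \<bar>s' - \<sigma>\<bar> < r \<longrightarrow>
       norm (\<zeta> s z - \<zeta> s' z' - \<Phi> \<sigma> (z - z') - (s - s') *\<^sub>R F (\<zeta> \<sigma> z0)) \<le> e * (norm (z - z') + \<bar>s - s'\<bar>)"
proof -
  let ?y = "\<lambda>t. \<zeta> t z0"
  have yW: "?y t \<in> W" for t using flow_in assms by blast
  have ycont: "continuous_on S ?y" for S using flow_cont assms by blast
  have Dycont: "continuous_on {0..T} (\<lambda>t. D (?y t))"
    using yW by (intro continuous_on_compose2[OF D_cont ycont]) auto
  obtain \<Phi> :: "real \<Rightarrow> 'a \<Rightarrow>\<^sub>L 'a" where \<Phi>: "\<Phi> 0 = id_blinfun"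
    "\<And>t. t \<in> {0..T} \<Longrightarrow> (\<Phi> has_vector_derivative D (?y t) o\<^sub>L \<Phi> t) (at t within {0..T})"
    using linear_ode_solution[OF bounded_bilinear_blinfun_compose \<open>T \<ge> 0\<close> Dycont] by metis
  have \<Phi>cont: "continuous_on {0..T} \<Phi>"
    using \<Phi>(2) has_vector_derivative_continuous continuous_on_eq_continuous_within by blast
  obtain r0 C where rC: "r0 > 0" "C > 0" "ball z0 r0 \<subseteq> W"
    "\<And>z z' s s'. z \<in> ball z0 r0 \<Longrightarrow> z' \<in> ball z0 r0 \<Longrightarrow> s \<in> {0..T} \<Longrightarrow> s' \<in> {0..T} \<Longrightarrow>
       norm (\<zeta> s z - \<zeta> s' z') \<le> C * (norm (z - z') + \<bar>s - s'\<bar>)"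
    by (rule flow_lipschitz[OF assms]) (rule that)
  have "bounded ((\<lambda>t. D (?y t)) ` {0..T})"
    using Dycont compact_continuous_image compact_imp_bounded by blast
  then obtain M where M: "M > 0" "\<And>t. t \<in> {0..T} \<Longrightarrow> norm (D (?y t)) \<le> M"
    unfolding bounded_pos by auto
  define E where "E = exp ((2 * M + 1) * T)"
  have "E > 0" by (simp add: E_def)
  have K: "compact (?y ` {0..T})" "?y ` {0..T} \<subseteq> W"
    using yW by (auto intro!: compact_continuous_image ycont)
  (* The error w of the linear approximation satisfies a linear differential inequality with a small
     inhomogeneity, since F is strictly differentiable uniformly along the reference solution. *)
  have space: "\<exists>r>0. r \<le> r0 \<and> (\<forall>z z' t. z \<in> ball z0 r \<longrightarrow> z' \<in> ball z0 r \<longrightarrow> t \<in> {0..T} \<longrightarrow>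
     norm (\<zeta> t z - \<zeta> t z' - \<Phi> t (z - z')) \<le> e * norm (z - z'))" if "e > 0" for e
  proof -
    define e1 where "e1 = e / (C * E)"
    have e1: "e1 > 0" "e1 * C * E = e" using \<open>e > 0\<close> rC \<open>E > 0\<close> by (auto simp: e1_def)
    obtain r1 where r1: "r1 > 0"
      "\<And>k z z'. k \<in> ?y ` {0..T} \<Longrightarrow> z \<in> ball k r1 \<Longrightarrow> z' \<in> ball k r1 \<Longrightarrow>
         norm (F z - F z' - D k (z - z')) \<le> e1 * norm (z - z')"
      using uniform_strict_derivative[OF open_W F_deriv D_cont K e1(1)] by metis
    define r where "r = min r0 (r1 / C)"
    have "r > 0" using rC r1 by (simp add: r_def)
    moreover have "norm (\<zeta> t z - \<zeta> t z' - \<Phi> t (z - z')) \<le> e * norm (z - z')"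
      if z: "z \<in> ball z0 r" "z' \<in> ball z0 r" and t: "t \<in> {0..T}" for z z' t
    proof -
      have z0: "z \<in> ball z0 r0" "z' \<in> ball z0 r0" using z by (auto simp: r_def)
      have zW: "z \<in> W" "z' \<in> W" using z0 rC by auto
      have near: "\<zeta> s x \<in> ball (?y s) r1" if "x \<in> ball z0 r" "s \<in> {0..T}" for s x
      proof -
        have "norm (\<zeta> s x - ?y s) \<le> C * (norm (x - z0) + \<bar>s - s\<bar>)"
          using that rC(1) by (intro rC(4)) (auto simp: r_def)
        also have "\<dots> < C * (r1 / C)"
          using that rC(2) by (intro mult_strict_left_mono) (auto simp: r_def dist_norm norm_minus_commute)
        finally show ?thesis using rC(2) by (simp add: dist_norm norm_minus_commute)
      qed
      let ?w = "\<lambda>s. \<zeta> s z - \<zeta> s z' - \<Phi> s (z - z')"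
      let ?w' = "\<lambda>s. F (\<zeta> s z) - F (\<zeta> s z') - D (?y s) (\<Phi> s (z - z'))"
      have "norm (?w t) \<le> (norm (?w 0) + e1 * C * norm (z - z')) * exp ((2 * M + 1) * (t - 0))"
      proof (rule gronwall_inner[where w' = ?w'])
        show "continuous_on {0..t} ?w"
          using t by (intro continuous_intros flow_cont zW blinfun.continuous_on
              continuous_on_subset[OF \<Phi>cont]) auto
        fix s assume s: "s \<in> {0<..<t}"
        then have sT: "s \<in> {0<..<T}" "s \<in> {0..T}" using t by auto
        have "at s within {0..T} = at s" using sT by (intro at_within_interior) auto
        then have "(\<Phi> has_vector_derivative D (?y s) o\<^sub>L \<Phi> s) (at s)" using \<Phi>(2)[OF sT(2)] by simp
        then have "((\<lambda>s. \<Phi> s (z - z')) has_vector_derivative (D (?y s) o\<^sub>L \<Phi> s) (z - z')) (at s)"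
          by (rule bounded_linear.has_vector_derivative[OF blinfun.bounded_linear_left])
        then show "(?w has_vector_derivative ?w' s) (at s)"
          by (intro has_vector_derivative_diff flow_deriv zW) simp
        let ?a = "F (\<zeta> s z) - F (\<zeta> s z') - D (?y s) (\<zeta> s z - \<zeta> s z')"
        have "?w' s = ?a + D (?y s) (?w s)" by (simp add: blinfun.diff_right)
        then have "norm (?w' s) \<le> norm ?a + norm (D (?y s) (?w s))"
          by (metis norm_triangle_ineq)
        also have "norm ?a \<le> e1 * norm (\<zeta> s z - \<zeta> s z')"
          using near z sT by (intro r1(2)) auto
        also have "\<dots> \<le> e1 * (C * (norm (z - z') + \<bar>s - s\<bar>))"
          using e1(1) by (intro mult_left_mono rC(4) z0 sT) auto
        also have "norm (D (?y s) (?w s)) \<le> M * norm (?w s)"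
          using norm_blinfun[of "D (?y s)" "?w s"] M(2)[OF sT(2)] by (meson mult_right_mono norm_ge_zero order_trans)
        finally show "norm (?w' s) \<le> M * norm (?w s) + e1 * C * norm (z - z')" by (simp add: algebra_simps)
      qed (use t M e1 rC in auto)
      also have "\<dots> = e1 * C * norm (z - z') * exp ((2 * M + 1) * t)"
        using zW by (simp add: flow_0 \<Phi>(1))
      also have "\<dots> \<le> e1 * C * norm (z - z') * E"
        unfolding E_def using t M e1 rC by (intro mult_left_mono) auto
      also have "\<dots> = e * norm (z - z')" using e1(2) by (simp add: mult_ac)
      finally show ?thesis .
    qed
    ultimately show ?thesis by (intro exI[of _ r]) (auto simp: r_def)
  qed
  have main: "\<exists>r>0. \<forall>z z' s s' \<sigma>. z \<in> ball z0 r \<longrightarrow> z' \<in> ball z0 r \<longrightarrow> s \<in> {0..T} \<longrightarrow> s' \<in> {0..T} \<longrightarrow>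
       \<sigma> \<in> {0..T} \<longrightarrow> \<bar>s - \<sigma>\<bar> < r \<longrightarrow> \<bar>s' - \<sigma>\<bar> < r \<longrightarrow>
       norm (\<zeta> s z - \<zeta> s' z' - \<Phi> \<sigma> (z - z') - (s - s') *\<^sub>R F (?y \<sigma>)) \<le> e * (norm (z - z') + \<bar>s - s'\<bar>)"
    if "e > 0" for e
  proof -
    obtain r1 where r1: "r1 > 0" "r1 \<le> r0" "\<And>z z' t. z \<in> ball z0 r1 \<Longrightarrow> z' \<in> ball z0 r1 \<Longrightarrow> t \<in> {0..T} \<Longrightarrow>
        norm (\<zeta> t z - \<zeta> t z' - \<Phi> t (z - z')) \<le> e / 2 * norm (z - z')"
      using space[of "e / 2"] \<open>e > 0\<close> by auto
    have "uniformly_continuous_on {0..T} \<Phi>" by (intro compact_uniformly_continuous \<Phi>cont) auto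
    then obtain r2 where r2: "r2 > 0" "\<And>s \<sigma>. s \<in> {0..T} \<Longrightarrow> \<sigma> \<in> {0..T} \<Longrightarrow> \<bar>s - \<sigma>\<bar> < r2 \<Longrightarrow> norm (\<Phi> s - \<Phi> \<sigma>) < e / 2"
      unfolding uniformly_continuous_on_def dist_norm real_norm_def using \<open>e > 0\<close> by (meson half_gt_zero)
    obtain R L B where RL: "R > 0" "L \<ge> 0" "B \<ge> 0" "\<And>t. t \<in> {0..T} \<Longrightarrow> ball (?y t) R \<subseteq> W"
      "\<And>t a. t \<in> {0..T} \<Longrightarrow> a \<in> ball (?y t) R \<Longrightarrow> norm (F a) \<le> B"
      "\<And>t a b. t \<in> {0..T} \<Longrightarrow> a \<in> ball (?y t) R \<Longrightarrow> b \<in> ball (?y t) R \<Longrightarrow> norm (F a - F b) \<le> L * norm (a - b)"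
      by (rule lipschitz_tube[OF ycont yW]) (rule that)
    define r where "r = min (min r1 r2) (min (R / (2 * C)) (e / (2 * (L + 1) * C)))"
    have r: "r > 0" "r \<le> r1" "r \<le> r2" "C * (2 * r) \<le> R" "L * (C * (2 * r)) \<le> e"
    proof -
      show "r > 0" using r1 r2 rC RL \<open>e > 0\<close> by (simp add: r_def)
      show "r \<le> r1" "r \<le> r2" by (auto simp: r_def)
      have "r \<le> R / (2 * C)" by (auto simp: r_def)
      then show "C * (2 * r) \<le> R" using rC(2) by (simp add: pos_le_divide_eq mult_ac)
      have "r \<le> e / (2 * (L + 1) * C)" by (auto simp: r_def)
      then have "r * (2 * (L + 1) * C) \<le> e" using rC(2) RL(2) by (subst (asm) pos_le_divide_eq) auto
      moreover have "L * (C * (2 * r)) \<le> (L + 1) * (C * (2 * r))"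
        using rC(2) \<open>r > 0\<close> by (intro mult_right_mono) auto
      ultimately show "L * (C * (2 * r)) \<le> e" by (simp add: mult_ac)
    qed
    have "norm (\<zeta> s z - \<zeta> s' z' - \<Phi> \<sigma> (z - z') - (s - s') *\<^sub>R F (?y \<sigma>)) \<le> e * (norm (z - z') + \<bar>s - s'\<bar>)"
      if z: "z \<in> ball z0 r" "z' \<in> ball z0 r" and s: "s \<in> {0..T}" "s' \<in> {0..T}" "\<sigma> \<in> {0..T}"
        "\<bar>s - \<sigma>\<bar> < r" "\<bar>s' - \<sigma>\<bar> < r" for z z' s s' \<sigma>
    proof -
      have zr: "z \<in> ball z0 r1" "z' \<in> ball z0 r1" "z' \<in> ball z0 r0" using z r r1 by auto
      have z'W: "z' \<in> W" using zr rC by auto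
      have 1: "norm (\<zeta> s z - \<zeta> s z' - \<Phi> s (z - z')) \<le> e / 2 * norm (z - z')"
        by (rule r1(3)[OF zr(1,2) s(1)])
      have 2: "norm ((\<Phi> s - \<Phi> \<sigma>) (z - z')) \<le> e / 2 * norm (z - z')"
      proof -
        have "norm (\<Phi> s - \<Phi> \<sigma>) \<le> e / 2" using r2(2)[of s \<sigma>] s r by simp
        then show ?thesis
          using norm_blinfun[of "\<Phi> s - \<Phi> \<sigma>" "z - z'"] by (meson mult_right_mono norm_ge_zero order_trans)
      qed
      have "norm ((\<zeta> s z' - s *\<^sub>R F (?y \<sigma>)) - (\<zeta> s' z' - s' *\<^sub>R F (?y \<sigma>))) \<le> e * norm (s - s')"
      proof (rule differentiable_bound[where S = "{max 0 (\<sigma> - r)..min T (\<sigma> + r)}" and f' = "\<lambda>t h. h *\<^sub>R (F (\<zeta> t z') - F (?y \<sigma>))"])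
        fix t assume "t \<in> {max 0 (\<sigma> - r)..min T (\<sigma> + r)}"
        then have t: "t \<in> {0..T}" "\<bar>t - \<sigma>\<bar> \<le> r" by auto
        have "((\<lambda>t. \<zeta> t z') has_derivative (\<lambda>h. h *\<^sub>R F (\<zeta> t z'))) (at t within {max 0 (\<sigma> - r)..min T (\<sigma> + r)})"
          using has_vector_derivative_at_within[OF flow_deriv[OF z'W]] by (simp add: has_vector_derivative_def)
        then show "((\<lambda>t. \<zeta> t z' - t *\<^sub>R F (?y \<sigma>)) has_derivative (\<lambda>h. h *\<^sub>R (F (\<zeta> t z') - F (?y \<sigma>)))) (at t within {max 0 (\<sigma> - r)..min T (\<sigma> + r)})"
          unfolding scaleR_diff_right
          by (intro has_derivative_diff bounded_linear_imp_has_derivative bounded_linear_scaleR_left)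
        have "norm (\<zeta> t z' - ?y \<sigma>) \<le> C * (norm (z' - z0) + \<bar>t - \<sigma>\<bar>)"
          using rC(1) by (intro rC(4) zr t s) auto
        also have "\<dots> < C * (2 * r)"
          using z(2) t(2) rC(2) by (intro mult_strict_left_mono) (auto simp: dist_norm norm_minus_commute)
        finally have d: "norm (\<zeta> t z' - ?y \<sigma>) < C * (2 * r)" .
        have "norm (F (\<zeta> t z') - F (?y \<sigma>)) \<le> L * norm (\<zeta> t z' - ?y \<sigma>)"
          using d r(4) RL(1) by (intro RL(6)[OF s(3)]) (auto simp: dist_norm norm_minus_commute)
        also have "\<dots> \<le> L * (C * (2 * r))" using d RL(2) by (intro mult_left_mono) auto
        also have "\<dots> \<le> e" by (rule r)
        finally show "onorm (\<lambda>h. h *\<^sub>R (F (\<zeta> t z') - F (?y \<sigma>))) \<le> e"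
          by (simp add: onorm_scaleR_left[OF bounded_linear_ident] onorm_id)
      qed (use s in auto)
      then have 3: "norm (\<zeta> s z' - \<zeta> s' z' - (s - s') *\<^sub>R F (?y \<sigma>)) \<le> e * \<bar>s - s'\<bar>"
        by (simp add: algebra_simps)
      have "\<zeta> s z - \<zeta> s' z' - \<Phi> \<sigma> (z - z') - (s - s') *\<^sub>R F (?y \<sigma>) =
        (\<zeta> s z - \<zeta> s z' - \<Phi> s (z - z')) + (\<Phi> s - \<Phi> \<sigma>) (z - z') + (\<zeta> s z' - \<zeta> s' z' - (s - s') *\<^sub>R F (?y \<sigma>))"
        by (simp add: blinfun.diff_left)
      also have "norm \<dots> \<le> e / 2 * norm (z - z') + e / 2 * norm (z - z') + e * \<bar>s - s'\<bar>"
        using 1 2 3 by (intro norm_triangle_le add_mono) auto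
      finally show ?thesis by (simp add: algebra_simps)
    qed
    then show ?thesis using r(1) by blast
  qed
  show ?thesis by (rule that[OF \<Phi> main])
qed

end

section \<open>Derivatives of smooth Hamiltonians\<close>

lemma onorm_scaleR_left_le: "norm c \<le> B \<Longrightarrow> onorm (\<lambda>h::real. h *\<^sub>R c) \<le> B"
  by (rule onorm_le) (simp add: mult.commute[of B] mult_left_mono)

lemma open_cotangent: "open X \<Longrightarrow> open (cotangent X)"
  by (simp add: cotangent_def open_Times)

lemma gradient_inner:
  assumes "g differentiable (at y)"
  shows "gradient g y \<bullet> v = frechet_derivative g (at y) v"
proof -
  interpret linear "frechet_derivative g (at y)"
    using assms by (simp add: frechet_derivative_works has_derivative_linear)
  have "frechet_derivative g (at y) v = frechet_derivative g (at y) (\<Sum>i\<in>UNIV. v $ i *\<^sub>R axis i 1)"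
    using basis_expansion[of v] by (simp add: scalar_mult_eq_scaleR)
  also have "\<dots> = (\<Sum>i\<in>UNIV. v $ i * frechet_derivative g (at y) (axis i 1))"
    by (simp add: sum scaleR)
  finally show ?thesis by (simp add: gradient_def inner_vec_def mult.commute)
qed

lemma frechet_derivative_grad:
  assumes "H differentiable (at z)"
  shows "frechet_derivative H (at z) w = grad_x H z \<bullet> fst w + grad_p H z \<bullet> snd w"
proof -
  let ?D = "frechet_derivative H (at z)"
  have D: "(H has_derivative ?D) (at z)" using assms by (simp add: frechet_derivative_works)
  have lin: "linear ?D" using D by (rule has_derivative_linear)
  have "((\<lambda>x. H (x, snd z)) has_derivative (\<lambda>v. ?D (v, 0))) (at (fst z))"
    by (rule has_derivative_compose[of "\<lambda>x. (x, snd z)" _ _ _ H ?D, simplified])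
       (use D in \<open>auto intro!: derivative_eq_intros\<close>)
  then have x: "grad_x H z \<bullet> v = ?D (v, 0)" for v
    unfolding grad_x_def by (subst gradient_inner) (auto simp: differentiable_def frechet_derivative_at[symmetric])
  have "((\<lambda>p. H (fst z, p)) has_derivative (\<lambda>v. ?D (0, v))) (at (snd z))"
    by (rule has_derivative_compose[of "\<lambda>p. (fst z, p)" _ _ _ H ?D, simplified])
       (use D in \<open>auto intro!: derivative_eq_intros\<close>)
  then have p: "grad_p H z \<bullet> v = ?D (0, v)" for v
    unfolding grad_p_def by (subst gradient_inner) (auto simp: differentiable_def frechet_derivative_at[symmetric])
  have "?D w = ?D (fst w, 0) + ?D (0, snd w)"
    using linear_add[OF lin, of "(fst w, 0)" "(0, snd w)"] by simp
  then show ?thesis by (simp add: x p)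
qed

text \<open>The symplectic rotation through which the Hamiltonian vector field is read off from the
  differential of the Hamiltonian.\<close>

definition rot :: "'a \<times> 'a \<Rightarrow> 'a \<times> 'a::real_vector" where
  "rot w = (- snd w, fst w)"

lemma ham_vec_inner:
  assumes "H differentiable (at z)"
  shows "ham_vec H z \<bullet> w = frechet_derivative H (at z) (rot w)"
  using frechet_derivative_grad[OF assms, of "rot w"]
  by (simp add: ham_vec_def inner_prod_def rot_def)

lemma norm_rot [simp]: "norm (rot w) = norm w"
  by (simp add: rot_def norm_prod_def add.commute)

definition hessian :: "('a::real_normed_vector \<Rightarrow> real) \<Rightarrow> 'a \<Rightarrow> 'a \<Rightarrow> 'a \<Rightarrow> real" where
  "hessian H z w v = frechet_derivative (\<lambda>y. frechet_derivative H (at y) w) (at z) v"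

lemma Ck_on_open_hessian:
  fixes H :: "'a::euclidean_space \<Rightarrow> real"
  assumes "Ck_on_open 2 W H"
  shows "z \<in> W \<Longrightarrow> ((\<lambda>y. frechet_derivative H (at y) w) has_derivative hessian H z w) (at z)"
    and "continuous_on W (\<lambda>y. hessian H y w v)"
proof -
  have C: "Ck_on_open (Suc 0) W (\<lambda>y. frechet_derivative H (at y) w)"
    using assms(1) by (simp add: numeral_2_eq_2)
  then show "((\<lambda>y. frechet_derivative H (at y) w) has_derivative hessian H z w) (at z)" if "z \<in> W"
    using that unfolding hessian_def by (simp add: frechet_derivative_works[symmetric])
  show "continuous_on W (\<lambda>y. hessian H y w v)"
    using C unfolding hessian_def by simp
qed

text \<open>The left-hand side does not depend on the order of the two directions, which makes the Hessian
  symmetric in the limit.\<close>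

lemma second_difference:
  fixes H :: "'a::euclidean_space \<Rightarrow> real"
  assumes C: "Ck_on_open 2 W H" and W: "\<And>s t. s \<in> {0..h} \<Longrightarrow> t \<in> {0..h} \<Longrightarrow> z + s *\<^sub>R v + t *\<^sub>R w \<in> W" and "h > 0"
  obtains s t where "s \<in> {0..h}" "t \<in> {0..h}"
    "H (z + h *\<^sub>R v + h *\<^sub>R w) - H (z + h *\<^sub>R v) - H (z + h *\<^sub>R w) + H z = h * h * hessian H (z + s *\<^sub>R v + t *\<^sub>R w) v w"
proof -
  have der: "(H has_derivative frechet_derivative H (at y)) (at y)" if "y \<in> W" for y
    using C that by (simp add: numeral_2_eq_2 frechet_derivative_works[symmetric])
  define g where "g s = H (z + s *\<^sub>R v + h *\<^sub>R w) - H (z + s *\<^sub>R v)" for s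
  have g: "(g has_real_derivative
      frechet_derivative H (at (z + s *\<^sub>R v + h *\<^sub>R w)) v - frechet_derivative H (at (z + s *\<^sub>R v)) v) (at s)"
    if s: "s \<in> {0..h}" for s
  proof -
    have "((\<lambda>s. H (z + s *\<^sub>R v + t *\<^sub>R w)) has_derivative (\<lambda>r. r * frechet_derivative H (at (z + s *\<^sub>R v + t *\<^sub>R w)) v)) (at s)"
      if t: "t \<in> {0..h}" for t
    proof -
      let ?D = "frechet_derivative H (at (z + s *\<^sub>R v + t *\<^sub>R w))"
      have D: "(H has_derivative ?D) (at (z + s *\<^sub>R v + t *\<^sub>R w))" by (rule der[OF W[OF s t]])
      have "((\<lambda>s. z + s *\<^sub>R v + t *\<^sub>R w) has_derivative (\<lambda>r. r *\<^sub>R v)) (at s)"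
        by (auto intro!: derivative_eq_intros)
      from has_derivative_compose[OF this D] show ?thesis
        by (simp add: linear_scale[OF has_derivative_linear[OF D]])
    qed
    from has_derivative_diff[OF this[of h] this[of 0]] \<open>h > 0\<close>
    have "(g has_derivative (\<lambda>r. r * frechet_derivative H (at (z + s *\<^sub>R v + h *\<^sub>R w)) v
        - r * frechet_derivative H (at (z + s *\<^sub>R v)) v)) (at s)"
      by (simp add: g_def[abs_def])
    then show ?thesis
      unfolding has_field_derivative_def by (rule has_derivative_eq_rhs) (simp add: fun_eq_iff algebra_simps)
  qed
  obtain s where s: "0 < s" "s < h" "g h - g 0 = (h - 0) *
      (frechet_derivative H (at (z + s *\<^sub>R v + h *\<^sub>R w)) v - frechet_derivative H (at (z + s *\<^sub>R v)) v)"
    using MVT2[of 0 h g "\<lambda>s. frechet_derivative H (at (z + s *\<^sub>R v + h *\<^sub>R w)) v - frechet_derivative H (at (z + s *\<^sub>R v)) v"]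
      g \<open>h > 0\<close> by auto
  have sh: "s \<in> {0..h}" using s by simp
  define k where "k t = frechet_derivative H (at (z + s *\<^sub>R v + t *\<^sub>R w)) v" for t
  have k: "(k has_real_derivative hessian H (z + s *\<^sub>R v + t *\<^sub>R w) v w) (at t)" if t: "t \<in> {0..h}" for t
  proof -
    have D: "((\<lambda>y. frechet_derivative H (at y) v) has_derivative hessian H (z + s *\<^sub>R v + t *\<^sub>R w) v) (at (z + s *\<^sub>R v + t *\<^sub>R w))"
      by (rule Ck_on_open_hessian(1)[OF C W[OF sh t]])
    have "((\<lambda>t. z + s *\<^sub>R v + t *\<^sub>R w) has_derivative (\<lambda>r. r *\<^sub>R w)) (at t)"
      by (auto intro!: derivative_eq_intros)
    from has_derivative_compose[OF this D] show ?thesis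
      by (simp add: k_def[abs_def] has_field_derivative_def linear_scale[OF has_derivative_linear[OF D]] mult.commute[of _ "hessian _ _ _ _"])
  qed
  obtain t where t: "0 < t" "t < h" "k h - k 0 = (h - 0) * hessian H (z + s *\<^sub>R v + t *\<^sub>R w) v w"
    using MVT2[of 0 h k "\<lambda>t. hessian H (z + s *\<^sub>R v + t *\<^sub>R w) v w"] k \<open>h > 0\<close> by auto
  show ?thesis
    by (rule that[of s t]) (use s t in \<open>auto simp: g_def k_def algebra_simps\<close>)
qed

lemma hessian_symmetric:
  fixes H :: "'a::euclidean_space \<Rightarrow> real"
  assumes C: "Ck_on_open 2 W H" and "open W" "z \<in> W"
  shows "hessian H z v w = hessian H z w v"
proof -
  have cont: "isCont (\<lambda>y. hessian H y a b) z" for a b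
    using Ck_on_open_hessian(2)[OF C] assms(2,3) by (simp add: continuous_on_eq_continuous_at)
  have le: "\<bar>hessian H z v w - hessian H z w v\<bar> \<le> 0 + e" if "e > 0" for e
  proof -
    obtain d1 where d1: "d1 > 0" "\<And>y. dist y z < d1 \<Longrightarrow> dist (hessian H y v w) (hessian H z v w) < e / 2"
      using cont[of v w, unfolded continuous_at_eps_delta, rule_format, of "e / 2"] \<open>e > 0\<close> by auto
    obtain d2 where d2: "d2 > 0" "\<And>y. dist y z < d2 \<Longrightarrow> dist (hessian H y w v) (hessian H z w v) < e / 2"
      using cont[of w v, unfolded continuous_at_eps_delta, rule_format, of "e / 2"] \<open>e > 0\<close> by auto
    obtain d3 where d3: "d3 > 0" "ball z d3 \<subseteq> W" using openE[OF assms(2,3)] by blast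
    define d where "d = min d1 (min d2 d3)"
    define m where "m = norm v + norm w + 1"
    define h where "h = d / (2 * m)"
    have pos: "m > 0" unfolding m_def by (simp add: add_nonneg_pos)
    have h: "h > 0" unfolding h_def using d1 d2 d3 pos by (simp add: d_def)
    have near: "dist (z + s *\<^sub>R a + t *\<^sub>R b) z < d" if "s \<in> {0..h}" "t \<in> {0..h}" "{a, b} = {v, w}" for s t a b
    proof -
      have "norm (s *\<^sub>R a + t *\<^sub>R b) \<le> h * norm a + h * norm b"
        using that by (intro norm_triangle_le add_mono) (auto intro!: mult_right_mono)
      also have "\<dots> \<le> h * m"
        using that(3) h by (auto simp: m_def doubleton_eq_iff algebra_simps)
      also have "\<dots> = d / 2" using pos by (simp add: h_def)
      also have "d / 2 < d" using h pos by (simp add: h_def zero_less_divide_iff)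
      finally show ?thesis by (simp add: dist_norm)
    qed
    have inW: "z + s *\<^sub>R a + t *\<^sub>R b \<in> W" if "s \<in> {0..h}" "t \<in> {0..h}" "{a, b} = {v, w}" for s t a b
      using near[OF that] d3(2) by (auto simp: d_def dist_commute)
    obtain s t where st: "s \<in> {0..h}" "t \<in> {0..h}"
      "H (z + h *\<^sub>R v + h *\<^sub>R w) - H (z + h *\<^sub>R v) - H (z + h *\<^sub>R w) + H z = h * h * hessian H (z + s *\<^sub>R v + t *\<^sub>R w) v w"
      using second_difference[OF C inW h, of v w] by blast
    obtain s' t' where st': "s' \<in> {0..h}" "t' \<in> {0..h}"
      "H (z + h *\<^sub>R w + h *\<^sub>R v) - H (z + h *\<^sub>R w) - H (z + h *\<^sub>R v) + H z = h * h * hessian H (z + s' *\<^sub>R w + t' *\<^sub>R v) w v"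
      using second_difference[OF C inW h, of w v] by blast
    have swap: "z + h *\<^sub>R w + h *\<^sub>R v = z + h *\<^sub>R v + h *\<^sub>R w" by simp
    have "h * h * hessian H (z + s *\<^sub>R v + t *\<^sub>R w) v w = h * h * hessian H (z + s' *\<^sub>R w + t' *\<^sub>R v) w v"
      using st(3) st'(3)[unfolded swap] by linarith
    then have "hessian H (z + s *\<^sub>R v + t *\<^sub>R w) v w = hessian H (z + s' *\<^sub>R w + t' *\<^sub>R v) w v"
      using h by simp
    moreover have "dist (hessian H (z + s *\<^sub>R v + t *\<^sub>R w) v w) (hessian H z v w) < e / 2"
      using near[OF st(1,2)] by (intro d1(2)) (auto simp: d_def)
    moreover have "dist (hessian H (z + s' *\<^sub>R w + t' *\<^sub>R v) w v) (hessian H z w v) < e / 2"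
      using near[OF st'(1,2), of w v] by (intro d2(2)) (auto simp: d_def)
    ultimately show ?thesis unfolding dist_real_def by linarith
  qed
  have "\<bar>hessian H z v w - hessian H z w v\<bar> \<le> 0" by (rule field_le_epsilon) (rule le)
  then show ?thesis by simp
qed

section \<open>Hamiltonian flows\<close>

definition ham_vec_deriv :: "((real ^ 'n) \<times> (real ^ 'n) \<Rightarrow> real) \<Rightarrow> (real ^ 'n) \<times> (real ^ 'n) \<Rightarrow>
    ((real ^ 'n) \<times> (real ^ 'n)) \<Rightarrow>\<^sub>L ((real ^ 'n) \<times> (real ^ 'n))" where
  "ham_vec_deriv H z = Blinfun (frechet_derivative (ham_vec H) (at z))"

definition lagrangian :: "((real ^ 'n) \<times> (real ^ 'n) \<Rightarrow> real) \<Rightarrow> (real ^ 'n) \<times> (real ^ 'n) \<Rightarrow> real" where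
  "lagrangian H z = snd z \<bullet> grad_p H z - H z"

locale ham_flow =
  fixes X :: "(real ^ 'n) set" and H :: "(real ^ 'n) \<times> (real ^ 'n) \<Rightarrow> real"
    and \<zeta> :: "real \<Rightarrow> (real ^ 'n) \<times> (real ^ 'n) \<Rightarrow> (real ^ 'n) \<times> (real ^ 'n)"
  assumes open_X: "open X" and smooth_H: "smooth_on (cotangent X) H"
    and flow_H: "complete_ham_flow X H \<zeta>"
begin

abbreviation "W \<equiv> cotangent X"

lemma Ck_H: "Ck_on_open k W H"
  using smooth_H smooth_on_open_iff[OF open_cotangent[OF open_X]] by blast

lemma H_differentiable: "z \<in> W \<Longrightarrow> H differentiable (at z)"
  using Ck_H[of 1] by simp

lemma H_deriv: "z \<in> W \<Longrightarrow> (H has_derivative (\<lambda>w. grad_x H z \<bullet> fst w + grad_p H z \<bullet> snd w)) (at z)"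
  by (rule has_derivative_eq_rhs[of _ "frechet_derivative H (at z)"])
     (use H_differentiable[of z] in \<open>auto simp: frechet_derivative_works[symmetric] frechet_derivative_grad fun_eq_iff\<close>)

lemma ham_vec_Ck: "Ck_on_open (Suc 0) W (ham_vec H)"
proof -
  let ?f = "\<lambda>b z. frechet_derivative H (at z) (rot b) *\<^sub>R b"
  have "Ck_on_open (Suc 0) W (\<lambda>z. \<Sum>b\<in>Basis. ?f b z)"
  proof -
    have d: "((\<lambda>z. \<Sum>b\<in>Basis. ?f b z) has_derivative (\<lambda>v. \<Sum>b\<in>Basis. hessian H z (rot b) v *\<^sub>R b)) (at z)" if "z \<in> W" for z
      by (intro has_derivative_sum has_derivative_scaleR_left Ck_on_open_hessian(1)[OF Ck_H that])
    have "continuous_on W (\<lambda>z. \<Sum>b\<in>Basis. hessian H z (rot b) v *\<^sub>R b)" for v :: "(real ^ 'n) \<times> (real ^ 'n)"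
      by (auto intro!: continuous_intros Ck_on_open_hessian(2)[OF Ck_H])
    then have "continuous_on W (\<lambda>z. frechet_derivative (\<lambda>z. \<Sum>b\<in>Basis. ?f b z) (at z) v)" for v
      by (rule continuous_on_eq) (simp add: frechet_derivative_at[OF d, symmetric])
    with d show ?thesis unfolding Ck_on_open.simps differentiable_def by blast
  qed
  then show ?thesis
  proof (rule Ck_on_open_cong[OF open_cotangent[OF open_X], rotated])
    fix z assume "z \<in> W"
    then show "(\<Sum>b\<in>Basis. ?f b z) = ham_vec H z"
      using euclidean_representation[of "ham_vec H z"] by (simp add: ham_vec_inner[OF H_differentiable])
  qed
qed

sublocale complete_C1_flow W "ham_vec H" "ham_vec_deriv H" \<zeta>
  using Ck_on_open_Suc_0_blinfun(2,3)[OF ham_vec_Ck] flow_H open_cotangent[OF open_X]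
  by unfold_locales (auto simp: complete_ham_flow_def ham_vec_deriv_def[abs_def])

lemma ham_vec_deriv_inner:
  assumes "z \<in> W"
  shows "ham_vec_deriv H z v \<bullet> w = hessian H z (rot w) v"
proof -
  have "((\<lambda>y. ham_vec H y \<bullet> w) has_derivative (\<lambda>v. ham_vec_deriv H z v \<bullet> w)) (at z)"
    by (intro derivative_intros F_deriv assms)
  moreover have "((\<lambda>y. ham_vec H y \<bullet> w) has_derivative hessian H z (rot w)) (at z)"
    by (rule has_derivative_transform_within_open[OF Ck_on_open_hessian(1)[OF Ck_H assms] open_W assms])
       (simp add: ham_vec_inner[OF H_differentiable])
  ultimately show ?thesis using has_derivative_unique by metis
qed

lemma H_cont: "continuous_on W H"
  using Ck_H[of 0] by simp

lemma deriv_along_flow: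
  assumes "z \<in> W" and G: "(G has_derivative (\<lambda>w. grad_x G (\<zeta> t z) \<bullet> fst w + grad_p G (\<zeta> t z) \<bullet> snd w)) (at (\<zeta> t z))"
  shows "((\<lambda>t. G (\<zeta> t z)) has_real_derivative poisson_bracket H G (\<zeta> t z)) (at t)"
proof -
  have "((\<lambda>t. \<zeta> t z) has_derivative (\<lambda>h. h *\<^sub>R ham_vec H (\<zeta> t z))) (at t)"
    using flow_deriv[OF assms(1)] by (simp add: has_vector_derivative_def)
  from has_derivative_compose[OF this G] show ?thesis
    unfolding has_field_derivative_def
    by (rule has_derivative_eq_rhs)
       (simp add: fun_eq_iff ham_vec_def poisson_bracket_def inner_commute algebra_simps)
qed

lemma H_conserved:
  assumes "z \<in> W"
  shows "H (\<zeta> t z) = H z"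
proof -
  have "((\<lambda>t. H (\<zeta> t z)) has_real_derivative 0) (at t)" for t
    using deriv_along_flow[OF assms H_deriv[OF flow_in[OF assms]]]
    by (simp add: poisson_bracket_def inner_commute)
  then have "H (\<zeta> t z) = H (\<zeta> 0 z)" using DERIV_isconst_all by blast
  then show ?thesis using assms by (simp add: flow_0)
qed

lemma lipschitz_derivative_H:
  assumes tube: "\<And>a b. a \<in> ball y R \<Longrightarrow> b \<in> ball y R \<Longrightarrow> norm (ham_vec H a - ham_vec H b) \<le> L * norm (a - b)"
    and sub: "ball y R \<subseteq> W" and "L \<ge> 0" and a: "a \<in> ball y R" and b: "b \<in> ball y R"
  shows "\<bar>H a - H b - frechet_derivative H (at b) (a - b)\<bar> \<le> L * (norm (a - b))\<^sup>2"
proof -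
  have seg: "closed_segment b a \<subseteq> ball y R"
    using convex_contains_segment[of "ball y R"] a b by simp
  have "norm (H a - H b - frechet_derivative H (at b) (a - b)) \<le> norm (a - b) * (L * norm (a - b))"
  proof (rule differentiable_bound_linearization[where S = "closed_segment b a"])
    show "b + t *\<^sub>R (a - b) \<in> closed_segment b a" if "t \<in> {0..1}" for t
      using that by (auto simp: closed_segment_def algebra_simps intro!: exI[of _ t])
    fix x assume x: "x \<in> closed_segment b a"
    then have xW: "x \<in> ball y R" "x \<in> W" "b \<in> W" using seg sub b by auto
    show "(H has_derivative frechet_derivative H (at x)) (at x within closed_segment b a)"
      using H_differentiable[OF xW(2)] by (auto simp: frechet_derivative_works intro: has_derivative_at_withinI)
    show "onorm (frechet_derivative H (at x) - frechet_derivative H (at b)) \<le> L * norm (a - b)"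
    proof (rule onorm_le)
      fix v :: "(real ^ 'n) \<times> (real ^ 'n)"
      have "v = rot (- rot v)" by (simp add: rot_def)
      then have "frechet_derivative H (at c) v = ham_vec H c \<bullet> (- rot v)" if "c \<in> W" for c
        using ham_vec_inner[OF H_differentiable[OF that], of "- rot v"] by simp
      then have "(frechet_derivative H (at x) - frechet_derivative H (at b)) v = (ham_vec H x - ham_vec H b) \<bullet> (- rot v)"
        using xW by (simp add: inner_diff_left)
      also have "norm \<dots> \<le> norm (ham_vec H x - ham_vec H b) * norm (- rot v)"
        unfolding real_norm_def by (rule Cauchy_Schwarz_ineq2)
      also have "\<dots> \<le> (L * norm (a - b)) * norm v"
      proof (rule mult_mono)
        have "norm (ham_vec H x - ham_vec H b) \<le> L * norm (x - b)" by (rule tube[OF xW(1) b])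
        also have "\<dots> \<le> L * norm (a - b)"
          using segment_bound(1)[of x b a] x \<open>L \<ge> 0\<close> by (intro mult_left_mono) auto
        finally show "norm (ham_vec H x - ham_vec H b) \<le> L * norm (a - b)" .
      qed (use \<open>L \<ge> 0\<close> in auto)
      finally show "norm ((frechet_derivative H (at x) - frechet_derivative H (at b)) v) \<le> L * norm (a - b) * norm v" .
    qed
  qed simp
  then show ?thesis by (simp add: power2_eq_square algebra_simps)
qed

definition action :: "real \<Rightarrow> (real ^ 'n) \<times> (real ^ 'n) \<Rightarrow> real" where
  "action t z = integral {0..t} (\<lambda>s. lagrangian H (\<zeta> s z))"

lemma lagrangian_cont: "continuous_on W (lagrangian H)"
proof -
  have "continuous_on W (\<lambda>z. snd z \<bullet> fst (ham_vec H z) - H z)"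
    by (intro continuous_intros F_cont H_cont)
  then show ?thesis by (simp add: lagrangian_def[abs_def] ham_vec_def)
qed

lemma action_0 [simp]: "action 0 z = 0"
  by (simp add: action_def)

lemma action_deriv:
  assumes "z \<in> W" "t \<in> {0..T}"
  shows "((\<lambda>t. action t z) has_vector_derivative lagrangian H (\<zeta> t z)) (at t within {0..T})"
proof -
  have "continuous_on {0..T} (\<lambda>s. lagrangian H (\<zeta> s z))"
    using flow_in[OF assms(1)] by (intro continuous_on_compose2[OF lagrangian_cont flow_cont[OF assms(1)]]) auto
  from integral_has_vector_derivative[OF this assms(2)] show ?thesis by (simp add: action_def)
qed

text \<open>This is the Poincare--Cartan formula \<open>dS = p dx - p\<^sub>0 dx\<^sub>0 - H dt\<close> for the action, with a quadratic remainder.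
  It is obtained for two initial points at equal times first, and then for a change of time along one trajectory.\<close>

lemma action_differential:
  assumes "T \<ge> 0" "z0 \<in> W"
  obtains r C where "r > 0" "C > 0" "ball z0 r \<subseteq> W"
    "\<And>z z' t t'. z \<in> ball z0 r \<Longrightarrow> z' \<in> ball z0 r \<Longrightarrow> t \<in> {0..T} \<Longrightarrow> t' \<in> {0..T} \<Longrightarrow>
      \<bar>action t' z' - action t z - (snd (\<zeta> t z) \<bullet> (fst (\<zeta> t' z') - fst (\<zeta> t z)) - snd z \<bullet> (fst z' - fst z))
         + H z * (t' - t)\<bar> \<le> C * (\<bar>t' - t\<bar> + norm (z' - z))\<^sup>2"
proof -
  let ?y = "\<lambda>t. \<zeta> t z0"
  obtain R L B where RL: "R > 0" "L \<ge> 0" "B \<ge> 0" "\<And>t. t \<in> {0..T} \<Longrightarrow> ball (?y t) R \<subseteq> W"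
    "\<And>t a. t \<in> {0..T} \<Longrightarrow> a \<in> ball (?y t) R \<Longrightarrow> norm (ham_vec H a) \<le> B"
    "\<And>t a b. t \<in> {0..T} \<Longrightarrow> a \<in> ball (?y t) R \<Longrightarrow> b \<in> ball (?y t) R \<Longrightarrow>
       norm (ham_vec H a - ham_vec H b) \<le> L * norm (a - b)"
    by (rule lipschitz_tube[OF flow_cont[OF \<open>z0 \<in> W\<close>] flow_in[OF \<open>z0 \<in> W\<close>]]) (rule that)
  obtain r0 K where rK: "r0 > 0" "K > 0" "ball z0 r0 \<subseteq> W"
    "\<And>z z' s s'. z \<in> ball z0 r0 \<Longrightarrow> z' \<in> ball z0 r0 \<Longrightarrow> s \<in> {0..T} \<Longrightarrow> s' \<in> {0..T} \<Longrightarrow>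
       norm (\<zeta> s z - \<zeta> s' z') \<le> K * (norm (z - z') + \<bar>s - s'\<bar>)"
    by (rule flow_lipschitz[OF assms]) (rule that)
  define r where "r = min r0 (R / K)"
  have r: "r > 0" "r \<le> r0" "ball z0 r \<subseteq> ball z0 r0" using rK RL(1) by (auto simp: r_def)
  have inW: "z \<in> W" if "z \<in> ball z0 r" for z using that rK(3) r(2) by auto
  have inside: "\<zeta> t z \<in> ball (?y t) R" if "z \<in> ball z0 r" "t \<in> {0..T}" for t z
  proof -
    have "norm (\<zeta> t z - ?y t) \<le> K * (norm (z - z0) + \<bar>t - t\<bar>)"
      using that r rK(1) by (intro rK(4)) auto
    also have "\<dots> < K * (R / K)"
      using that rK(2) by (intro mult_strict_left_mono) (auto simp: r_def dist_norm norm_minus_commute)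
    finally show ?thesis using rK(2) by (simp add: dist_norm norm_minus_commute)
  qed
  have fst_snd_le: "norm (fst a - fst b) \<le> norm (a - b)" "norm (snd a - snd b) \<le> norm (a - b)"
    for a b :: "(real ^ 'n) \<times> (real ^ 'n)"
    using norm_fst_le[of "fst a - fst b" "snd a - snd b"] norm_snd_le[of "snd a - snd b" "fst a - fst b"]
    by (simp_all add: minus_prod_def)
  (* At equal times the differential is reduced to the initial time: the rate of change of the defect is
     a second order Taylor remainder of H, by Hamilton's equations. *)
  have space: "\<bar>action t z' - action t z - (snd (\<zeta> t z) \<bullet> (fst (\<zeta> t z') - fst (\<zeta> t z)) - snd z \<bullet> (fst z' - fst z))\<bar>
      \<le> 2 * L * K\<^sup>2 * (norm (z' - z))\<^sup>2 * T"
    if z: "z \<in> ball z0 r" "z' \<in> ball z0 r" and t: "t \<in> {0..T}" for z z' t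
  proof -
    let ?x = "\<lambda>t. fst (\<zeta> t z)" and ?p = "\<lambda>t. snd (\<zeta> t z)" and ?x' = "\<lambda>t. fst (\<zeta> t z')" and ?p' = "\<lambda>t. snd (\<zeta> t z')"
    define E where "E t = action t z' - action t z - ?p t \<bullet> (?x' t - ?x t)" for t
    define E' where "E' t = lagrangian H (\<zeta> t z') - lagrangian H (\<zeta> t z)
      - (?p t \<bullet> (grad_p H (\<zeta> t z') - grad_p H (\<zeta> t z)) + (- grad_x H (\<zeta> t z)) \<bullet> (?x' t - ?x t))" for t
    have "norm (E t - E 0) \<le> 2 * L * K\<^sup>2 * (norm (z' - z))\<^sup>2 * norm (t - 0)"
    proof (rule differentiable_bound[where S = "{0..T}" and f' = "\<lambda>t h. h *\<^sub>R E' t"])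
      fix s assume s: "s \<in> {0..T}"
      have dz: "((\<lambda>s. \<zeta> s w) has_vector_derivative ham_vec H (\<zeta> s w)) (at s within {0..T})" if "w \<in> W" for w
        by (rule has_vector_derivative_at_within[OF flow_deriv[OF that]])
      have dx: "((\<lambda>s. fst (\<zeta> s w)) has_vector_derivative grad_p H (\<zeta> s w)) (at s within {0..T})"
        and dp: "((\<lambda>s. snd (\<zeta> s w)) has_vector_derivative - grad_x H (\<zeta> s w)) (at s within {0..T})" if "w \<in> W" for w
        using bounded_linear.has_vector_derivative[OF bounded_linear_fst dz[OF that]]
          bounded_linear.has_vector_derivative[OF bounded_linear_snd dz[OF that]] by (simp_all add: ham_vec_def)
      have "(E has_vector_derivative E' s) (at s within {0..T})"
        unfolding E_def[abs_def] E'_def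
        by (intro has_vector_derivative_diff action_deriv inW z s dx
            bounded_bilinear.has_vector_derivative[OF bounded_bilinear_inner] dp)
      then show "(E has_derivative (\<lambda>h. h *\<^sub>R E' s)) (at s within {0..T})"
        by (simp add: has_vector_derivative_def)
      let ?a = "\<zeta> s z'" and ?b = "\<zeta> s z"
      have ab: "?a \<in> ball (?y s) R" "?b \<in> ball (?y s) R" using inside z s by auto
      have "norm (?a - ?b) \<le> K * (norm (z' - z) + \<bar>s - s\<bar>)"
        using z r s by (intro rK(4)) auto
      then have dist: "norm (?a - ?b) \<le> K * norm (z' - z)" by simp
      have "E' s = - (H ?a - H ?b - frechet_derivative H (at ?b) (?a - ?b))
          + (snd ?a - snd ?b) \<bullet> (fst (ham_vec H ?a) - fst (ham_vec H ?b))
          + ((snd ?a - snd ?b) \<bullet> grad_p H ?b - grad_p H ?b \<bullet> (snd ?a - snd ?b))"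
        using frechet_derivative_grad[OF H_differentiable[OF flow_in[OF inW[OF z(1)]]], of s "?a - ?b"]
        by (simp add: E'_def lagrangian_def ham_vec_def algebra_simps)
      then have "\<bar>E' s\<bar> \<le> \<bar>H ?a - H ?b - frechet_derivative H (at ?b) (?a - ?b)\<bar>
          + \<bar>(snd ?a - snd ?b) \<bullet> (fst (ham_vec H ?a) - fst (ham_vec H ?b))\<bar>"
        by (simp add: inner_commute)
      also have "\<bar>H ?a - H ?b - frechet_derivative H (at ?b) (?a - ?b)\<bar> \<le> L * (norm (?a - ?b))\<^sup>2"
        by (rule lipschitz_derivative_H[OF RL(6)[OF s] RL(4)[OF s] RL(2) ab])
      also have "\<bar>(snd ?a - snd ?b) \<bullet> (fst (ham_vec H ?a) - fst (ham_vec H ?b))\<bar>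
          \<le> norm (snd ?a - snd ?b) * norm (fst (ham_vec H ?a) - fst (ham_vec H ?b))"
        by (rule Cauchy_Schwarz_ineq2)
      also have "\<dots> \<le> norm (?a - ?b) * (L * norm (?a - ?b))"
        using RL(6)[OF s ab] RL(2) by (intro mult_mono fst_snd_le order_trans[OF fst_snd_le(1)]) auto
      also have "L * (norm (?a - ?b))\<^sup>2 + norm (?a - ?b) * (L * norm (?a - ?b)) = 2 * L * (norm (?a - ?b))\<^sup>2"
        by (simp add: power2_eq_square)
      also have "\<dots> \<le> 2 * L * (K * norm (z' - z))\<^sup>2"
        using dist RL(2) by (intro mult_left_mono power_mono) auto
      finally have "\<bar>E' s\<bar> \<le> 2 * L * K\<^sup>2 * (norm (z' - z))\<^sup>2" by (simp add: power_mult_distrib)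
      then show "onorm (\<lambda>h. h *\<^sub>R E' s) \<le> 2 * L * K\<^sup>2 * (norm (z' - z))\<^sup>2"
        by (intro onorm_scaleR_left_le) simp
    qed (use t assms in auto)
    also have "\<dots> \<le> 2 * L * K\<^sup>2 * (norm (z' - z))\<^sup>2 * T"
      using t RL(2) by (intro mult_left_mono) auto
    finally show ?thesis using inW z by (simp add: E_def flow_0)
  qed
  have H_lip: "\<bar>H a - H b\<bar> \<le> B * norm (a - b)" if ab: "a \<in> ball z0 r" "b \<in> ball z0 r" for a b
  proof -
    have a: "a \<in> ball z0 R" and b: "b \<in> ball z0 R"
      using inside[OF ab(1), of 0] inside[OF ab(2), of 0] inW[OF ab(1)] inW[OF ab(2)] assms by (auto simp: flow_0)
    have "norm (H a - H b) \<le> B * norm (a - b)"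
    proof (rule differentiable_bound[where S = "ball z0 R" and f' = "\<lambda>x. frechet_derivative H (at x)"])
      fix x assume x: "x \<in> ball z0 R"
      have x0: "x \<in> ball (?y 0) R" using x assms by (simp add: flow_0)
      then have xW: "x \<in> W" using RL(4)[of 0] assms by auto
      show "(H has_derivative frechet_derivative H (at x)) (at x within ball z0 R)"
        using H_differentiable[OF xW] by (auto simp: frechet_derivative_works intro: has_derivative_at_withinI)
      show "onorm (frechet_derivative H (at x)) \<le> B"
      proof (rule onorm_le)
        fix v :: "(real ^ 'n) \<times> (real ^ 'n)"
        have "v = rot (- rot v)" by (simp add: rot_def)
        then have "frechet_derivative H (at x) v = ham_vec H x \<bullet> (- rot v)"
          using ham_vec_inner[OF H_differentiable[OF xW], of "- rot v"] by simp
        also have "norm \<dots> \<le> norm (ham_vec H x) * norm (- rot v)"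
          unfolding real_norm_def by (rule Cauchy_Schwarz_ineq2)
        also have "\<dots> \<le> B * norm v"
          using RL(5)[OF _ x0] assms by (auto intro!: mult_right_mono)
        finally show "norm (frechet_derivative H (at x) v) \<le> B * norm v" .
      qed
    qed (use a b in auto)
    then show ?thesis by simp
  qed
  have time: "\<bar>action t' z' - action t z' - snd (\<zeta> t z) \<bullet> (fst (\<zeta> t' z') - fst (\<zeta> t z')) + H z * (t' - t)\<bar>
      \<le> (K * (norm (z' - z) + \<bar>t' - t\<bar>) * B + B * norm (z' - z)) * \<bar>t' - t\<bar>"
    if z: "z \<in> ball z0 r" "z' \<in> ball z0 r" and t: "t \<in> {0..T}" "t' \<in> {0..T}" for z z' t t'
  proof -
    let ?S = "{min t t'..max t t'}" and ?p = "snd (\<zeta> t z)"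
    define G where "G s = action s z' - ?p \<bullet> fst (\<zeta> s z') + s *\<^sub>R H z" for s
    define G' where "G' s = lagrangian H (\<zeta> s z') - ?p \<bullet> grad_p H (\<zeta> s z') + H z" for s
    have "norm (G t' - G t) \<le> (K * (norm (z' - z) + \<bar>t' - t\<bar>) * B + B * norm (z' - z)) * norm (t' - t)"
    proof (rule differentiable_bound[where S = ?S and f' = "\<lambda>t h. h *\<^sub>R G' t"])
      fix s assume "s \<in> ?S"
      then have s: "s \<in> {0..T}" "\<bar>s - t\<bar> \<le> \<bar>t' - t\<bar>" and sub: "?S \<subseteq> {0..T}" using t by auto
      have dz: "((\<lambda>s. \<zeta> s z') has_vector_derivative ham_vec H (\<zeta> s z')) (at s within {0..T})"
        by (rule has_vector_derivative_at_within[OF flow_deriv[OF inW[OF z(2)]]])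
      have dx: "((\<lambda>s. fst (\<zeta> s z')) has_vector_derivative grad_p H (\<zeta> s z')) (at s within {0..T})"
        using bounded_linear.has_vector_derivative[OF bounded_linear_fst dz] by (simp add: ham_vec_def)
      have "(G has_vector_derivative G' s) (at s within {0..T})"
        unfolding G_def[abs_def] G'_def has_vector_derivative_def scaleR_add_right scaleR_diff_right
        by (intro has_derivative_add has_derivative_diff bounded_linear_imp_has_derivative[OF bounded_linear_scaleR_left]
            action_deriv[unfolded has_vector_derivative_def] inW z s
            bounded_linear.has_vector_derivative[OF bounded_linear_inner_right dx, unfolded has_vector_derivative_def])
      then show "(G has_derivative (\<lambda>h. h *\<^sub>R G' s)) (at s within ?S)"
        unfolding has_vector_derivative_def using sub by (rule has_derivative_subset)
      have "G' s = (snd (\<zeta> s z') - ?p) \<bullet> fst (ham_vec H (\<zeta> s z')) - (H z' - H z)"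
        using H_conserved[OF inW[OF z(2)], of s] by (simp add: G'_def lagrangian_def ham_vec_def inner_diff_left)
      then have "\<bar>G' s\<bar> \<le> \<bar>(snd (\<zeta> s z') - ?p) \<bullet> fst (ham_vec H (\<zeta> s z'))\<bar> + \<bar>H z' - H z\<bar>"
        by simp
      also have "\<bar>(snd (\<zeta> s z') - ?p) \<bullet> fst (ham_vec H (\<zeta> s z'))\<bar> \<le> norm (snd (\<zeta> s z') - ?p) * norm (fst (ham_vec H (\<zeta> s z')))"
        by (rule Cauchy_Schwarz_ineq2)
      also have "\<dots> \<le> (K * (norm (z' - z) + \<bar>t' - t\<bar>)) * B"
      proof (rule mult_mono)
        have "norm (snd (\<zeta> s z') - ?p) \<le> norm (\<zeta> s z' - \<zeta> t z)" by (rule fst_snd_le)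
        also have "\<dots> \<le> K * (norm (z' - z) + \<bar>s - t\<bar>)" using z r s t by (intro rK(4)) auto
        also have "\<dots> \<le> K * (norm (z' - z) + \<bar>t' - t\<bar>)" using s rK(2) by (intro mult_left_mono) auto
        finally show "norm (snd (\<zeta> s z') - ?p) \<le> K * (norm (z' - z) + \<bar>t' - t\<bar>)" .
        show "norm (fst (ham_vec H (\<zeta> s z'))) \<le> B"
          using fst_snd_le(1)[of "ham_vec H (\<zeta> s z')" 0] RL(5)[OF s(1) inside[OF z(2) s(1)]] by simp
      qed (use rK in auto)
      also have "\<bar>H z' - H z\<bar> \<le> B * norm (z' - z)" by (rule H_lip[OF z(2,1)])
      finally show "onorm (\<lambda>h. h *\<^sub>R G' s) \<le> K * (norm (z' - z) + \<bar>t' - t\<bar>) * B + B * norm (z' - z)"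
        by (intro onorm_scaleR_left_le) simp
    qed auto
    then show ?thesis by (simp add: G_def algebra_simps)
  qed
  show ?thesis
  proof (rule that[of r "2 * L * K\<^sup>2 * T + K * B + B + 1"])
    show "r > 0" by (rule r)
    show "2 * L * K\<^sup>2 * T + K * B + B + 1 > 0"
      using RL rK assms by (intro add_nonneg_pos add_nonneg_nonneg mult_nonneg_nonneg) auto
    show "ball z0 r \<subseteq> W" using inW by blast
    fix z z' t t' assume z: "z \<in> ball z0 r" "z' \<in> ball z0 r" and t: "t \<in> {0..T}" "t' \<in> {0..T}"
    let ?a = "norm (z' - z)" and ?b = "\<bar>t' - t\<bar>" and ?p = "snd (\<zeta> t z)"
    have sq: "?a\<^sup>2 \<le> (?b + ?a)\<^sup>2" "(?a + ?b) * ?b \<le> (?b + ?a)\<^sup>2" "?a * ?b \<le> (?b + ?a)\<^sup>2"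
    proof -
      have "a\<^sup>2 \<le> (b + a)\<^sup>2 \<and> (a + b) * b \<le> (b + a)\<^sup>2 \<and> a * b \<le> (b + a)\<^sup>2" if "a \<ge> 0" "b \<ge> 0" for a b :: real
        using that by (auto simp: power2_eq_square algebra_simps)
      from this[of ?a ?b]
      show "?a\<^sup>2 \<le> (?b + ?a)\<^sup>2" "(?a + ?b) * ?b \<le> (?b + ?a)\<^sup>2" "?a * ?b \<le> (?b + ?a)\<^sup>2" by simp_all
    qed
    have split: "action t' z' - action t z - (?p \<bullet> (fst (\<zeta> t' z') - fst (\<zeta> t z)) - snd z \<bullet> (fst z' - fst z)) + H z * (t' - t)
      = (action t z' - action t z - (?p \<bullet> (fst (\<zeta> t z') - fst (\<zeta> t z)) - snd z \<bullet> (fst z' - fst z)))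
      + (action t' z' - action t z' - ?p \<bullet> (fst (\<zeta> t' z') - fst (\<zeta> t z')) + H z * (t' - t))"
      by (simp add: inner_diff_right)
    have "\<bar>action t' z' - action t z - (?p \<bullet> (fst (\<zeta> t' z') - fst (\<zeta> t z)) - snd z \<bullet> (fst z' - fst z)) + H z * (t' - t)\<bar>
      \<le> 2 * L * K\<^sup>2 * ?a\<^sup>2 * T + (K * (?a + ?b) * B + B * ?a) * ?b"
      unfolding split by (rule order_trans[OF abs_triangle_ineq add_mono[OF space[OF z t(1)] time[OF z t]]])
    also have "\<dots> = (2 * L * K\<^sup>2 * T) * ?a\<^sup>2 + (K * B) * ((?a + ?b) * ?b) + B * (?a * ?b)"
      by (simp add: algebra_simps)
    also have "\<dots> \<le> (2 * L * K\<^sup>2 * T) * (?b + ?a)\<^sup>2 + (K * B) * (?b + ?a)\<^sup>2 + B * (?b + ?a)\<^sup>2"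
      using RL rK assms by (intro add_mono mult_left_mono sq) auto
    also have "\<dots> \<le> (2 * L * K\<^sup>2 * T + K * B + B + 1) * (?b + ?a)\<^sup>2"
      by (simp add: algebra_simps)
    finally show "\<bar>action t' z' - action t z - (?p \<bullet> (fst (\<zeta> t' z') - fst (\<zeta> t z)) - snd z \<bullet> (fst z' - fst z)) + H z * (t' - t)\<bar>
      \<le> (2 * L * K\<^sup>2 * T + K * B + B + 1) * (?b + ?a)\<^sup>2" .
  qed
qed

end

section \<open>Verification by a field of extremals\<close>

text \<open>At the time \<open>t\<close> the extremal with parameter \<open>q\<close> has the position \<open>\<xi> t q\<close>, the covector \<open>\<pi> t q\<close> and the value \<open>S t q\<close>,
  and it has the constant energy \<open>h q\<close>.  The assumption on the differential of \<open>S\<close> expresses \<open>dS = p dx - H dt\<close> in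
  the parameter space, and thus does not require the field to be differentiable.\<close>

locale extremal_field =
  fixes U :: "(real ^ 'm) set" and f :: "real ^ 'n \<Rightarrow> real ^ 'm \<Rightarrow> real ^ 'n" and f0 :: "real ^ 'n \<Rightarrow> real ^ 'm \<Rightarrow> real"
    and tf :: real and x0 xf :: "real ^ 'n"
    and \<xi> \<pi> :: "real \<Rightarrow> real ^ 'n \<Rightarrow> real ^ 'n" and S :: "real \<Rightarrow> real ^ 'n \<Rightarrow> real"
    and h :: "real ^ 'n \<Rightarrow> real" and qb :: "real ^ 'n" and r c M :: real
  assumes tf: "tf > 0" and r: "r > 0" and c: "c > 0" and M: "M > 0"
    and expanding: "\<And>t q q'. t \<in> {0..tf} \<Longrightarrow> q \<in> ball qb r \<Longrightarrow> q' \<in> ball qb r \<Longrightarrow>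
        c * norm (q - q') \<le> norm (\<xi> t q - \<xi> t q')"
    and position_cont: "\<And>t. t \<in> {0..tf} \<Longrightarrow> continuous_on (ball qb r) (\<xi> t)"
    and position_lipschitz: "\<And>t t' q. t \<in> {0..tf} \<Longrightarrow> t' \<in> {0..tf} \<Longrightarrow> q \<in> ball qb r \<Longrightarrow>
        norm (\<xi> t q - \<xi> t' q) \<le> M * \<bar>t - t'\<bar>"
    and value_lipschitz: "\<And>t t' q q'. t \<in> {0..tf} \<Longrightarrow> t' \<in> {0..tf} \<Longrightarrow> q \<in> ball qb r \<Longrightarrow> q' \<in> ball qb r \<Longrightarrow>
        \<bar>S t q - S t' q'\<bar> \<le> M * (\<bar>t - t'\<bar> + norm (q - q'))"
    and value_differential: "\<And>t q. t \<in> {0..tf} \<Longrightarrow> q \<in> ball qb r \<Longrightarrow>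
        \<exists>d>0. \<exists>C>0. \<forall>t'\<in>{0..tf}. \<forall>q'\<in>ball qb r. \<bar>t' - t\<bar> < d \<longrightarrow> norm (q' - q) < d \<longrightarrow>
          \<bar>S t' q' - S t q - \<pi> t q \<bullet> (\<xi> t' q' - \<xi> t q) + h q * (t' - t)\<bar> \<le> C * (\<bar>t' - t\<bar> + norm (q' - q))\<^sup>2"
    and hamiltonian_le: "\<And>t q u. t \<in> {0..tf} \<Longrightarrow> q \<in> ball qb r \<Longrightarrow> u \<in> U \<Longrightarrow>
        control_hamiltonian f f0 (-1) (\<xi> t q, \<pi> t q) u \<le> h q"
    and start: "\<xi> 0 qb = x0" and finish: "\<xi> tf qb = xf"
begin

text \<open>The field covers a neighbourhood of its central trajectory whose width does not depend on
  time: the image of a ball is open by invariance of domain, while the image of its boundary sphere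
  stays away.\<close>

lemma field_covers:
  assumes t: "t \<in> {0..tf}" and y: "dist (\<xi> t qb) y < c * (r / 2)"
  shows "\<exists>q\<in>ball qb r. \<xi> t q = y"
proof -
  let ?f = "\<xi> t" and ?B = "ball (\<xi> t qb) (c * (r / 2))"
  have sub: "cball qb (r / 2) \<subseteq> ball qb r" using r by auto
  have qb: "qb \<in> ball qb r" using r by simp
  have cont: "continuous_on (cball qb (r / 2)) ?f"
    using position_cont[OF t] sub by (rule continuous_on_subset)
  have inj: "inj_on ?f (cball qb (r / 2))"
  proof (rule inj_onI)
    fix q q' assume "q \<in> cball qb (r / 2)" "q' \<in> cball qb (r / 2)" "?f q = ?f q'"
    moreover from this have "q \<in> ball qb r" "q' \<in> ball qb r" using sub by blast+
    ultimately have "c * norm (q - q') \<le> 0" using expanding[OF t, of q q'] by simp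
    then show "q = q'" using c by (simp add: mult_le_0_iff)
  qed
  have op: "open (?f ` ball qb (r / 2))" using invariance_of_domain_ball[OF cont _ inj] r by simp
  have cl: "closed (?f ` cball qb (r / 2))"
    by (intro compact_imp_closed compact_continuous_image cont) simp
  have avoid: "q \<in> ball qb (r / 2)" if "q \<in> cball qb (r / 2)" "?f q \<in> ?B" for q
  proof -
    have "c * norm (qb - q) \<le> norm (?f qb - ?f q)" using that sub by (intro expanding[OF t qb]) auto
    also have "\<dots> < c * (r / 2)" using that by (simp add: dist_norm)
    finally show ?thesis using c by (simp add: dist_norm)
  qed
  have "?B \<subseteq> ?f ` ball qb (r / 2)"
  proof (rule ccontr)
    assume "\<not> ?thesis"
    then obtain b where b: "b \<in> ?B" "b \<notin> ?f ` ball qb (r / 2)" by blast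
    then have bnot: "b \<notin> ?f ` cball qb (r / 2)" using avoid by blast
    have "connected ?B" by simp
    moreover have "?B \<subseteq> ?f ` ball qb (r / 2) \<union> - ?f ` cball qb (r / 2)"
      using avoid by auto
    moreover have "?f ` ball qb (r / 2) \<inter> - ?f ` cball qb (r / 2) \<inter> ?B = {}"
      using ball_subset_cball by blast
    moreover have "?f qb \<in> ?f ` ball qb (r / 2) \<inter> ?B" using r c by auto
    ultimately show False
      using op cl b bnot connectedD[of ?B "?f ` ball qb (r / 2)" "- ?f ` cball qb (r / 2)"]
      by (metis ComplI IntI closed_Compl empty_iff open_Compl)
  qed
  moreover have "y \<in> ?B" using y by simp
  ultimately obtain q where "q \<in> ball qb (r / 2)" "?f q = y" by blast
  then show ?thesis using r by auto
qed

lemma parameter_lipschitz: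
  assumes "t \<in> {0..tf}" "s \<in> {0..tf}" "q \<in> ball qb r" "q' \<in> ball qb r"
  shows "norm (q - q') \<le> (M + 1) / c * (\<bar>t - s\<bar> + norm (\<xi> t q - \<xi> s q'))"
proof -
  have "c * norm (q - q') \<le> norm (\<xi> t q - \<xi> t q')" using assms by (intro expanding)
  also have "\<dots> \<le> norm (\<xi> t q - \<xi> s q') + norm (\<xi> s q' - \<xi> t q')"
    using norm_triangle_ineq[of "\<xi> t q - \<xi> s q'" "\<xi> s q' - \<xi> t q'"] by simp
  also have "\<dots> \<le> norm (\<xi> t q - \<xi> s q') + M * \<bar>s - t\<bar>"
    using assms by (intro add_left_mono position_lipschitz)
  also have "\<dots> \<le> (M + 1) * (\<bar>t - s\<bar> + norm (\<xi> t q - \<xi> s q'))"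
    using M by (simp add: algebra_simps abs_minus_commute)
  finally show ?thesis using c by (simp add: field_simps)
qed

text \<open>Composing the value function with the field parameter of the trajectory gives an absolutely continuous
  function: the parameter is a Lipschitz function of time and position.  Its derivative follows from
  \<open>dS = p dx - H dt\<close>, since the error, being quadratic in the increment of the parameter, is quadratic in that of time.\<close>

lemma value_along_trajectory:
  assumes adm: "admissible X U f tf x0 xf x u"
    and Q: "\<And>t. t \<in> {0..tf} \<Longrightarrow> Q t \<in> ball qb r \<and> \<xi> t (Q t) = x t"
  defines "k \<equiv> \<lambda>t. \<pi> t (Q t) \<bullet> f (x t) (u t) - h (Q t)"
  shows "k absolutely_integrable_on {0..tf}"
    and "integral {0..tf} k = S tf qb - S 0 qb"
proof -
  have acx: "absolutely_continuous_on_interval 0 tf x"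
    and AE: "AE t in lebesgue_on {0..tf}. (x has_vector_derivative f (x t) (u t)) (at t within {0..tf})"
    and ends: "x 0 = x0" "x tf = xf"
    using adm by (auto simp: admissible_def)
  obtain N where N: "negligible N"
    "\<And>t. t \<in> {0..tf} - N \<Longrightarrow> (x has_vector_derivative f (x t) (u t)) (at t within {0..tf})"
    by (rule AE_lebesgue_on_negligible[OF AE]) (rule that)
  define K where "K = (M + 1) / c"
  have K: "K > 0" using M c by (simp add: K_def)
  have Q_le: "norm (Q t - Q s) \<le> K * (\<bar>t - s\<bar> + norm (x t - x s))" if "t \<in> {0..tf}" "s \<in> {0..tf}" for s t
    using parameter_lipschitz[of t s "Q t" "Q s"] Q that by (simp add: K_def)
  define g where "g t = S t (Q t)" for t
  have g_le: "\<bar>g t - g s\<bar> \<le> M * (1 + K) * (\<bar>t - s\<bar> + norm (x t - x s))" if "t \<in> {0..tf}" "s \<in> {0..tf}" for s t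
  proof -
    have "\<bar>g t - g s\<bar> \<le> M * (\<bar>t - s\<bar> + norm (Q t - Q s))"
      unfolding g_def using Q that by (intro value_lipschitz) auto
    also have "\<dots> \<le> M * (\<bar>t - s\<bar> + K * (\<bar>t - s\<bar> + norm (x t - x s)))"
      using M Q_le[OF that] by (intro mult_left_mono add_left_mono) auto
    also have "\<dots> \<le> M * ((\<bar>t - s\<bar> + norm (x t - x s)) + K * (\<bar>t - s\<bar> + norm (x t - x s)))"
      using M by (intro mult_left_mono add_right_mono) auto
    finally show ?thesis by (simp add: algebra_simps)
  qed
  have acg: "absolutely_continuous_on_interval 0 tf g"
  proof (rule absolutely_continuous_on_interval_dominated[OF acx])
    show "M * (1 + K) > 0" using M K by simp
    fix s' s assume "0 \<le> s'" "s' \<le> s" "s \<le> tf"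
    then show "norm (g s - g s') \<le> M * (1 + K) * ((s - s') + norm (x s - x s'))"
      using g_le[of s s'] by simp
  qed
  have der: "(g has_vector_derivative k t) (at t within {0..tf})" if t: "t \<in> {0..tf} - N" for t
  proof -
    let ?p = "\<pi> t (Q t)" and ?v = "f (x t) (u t)"
    have tT: "t \<in> {0..tf}" using t by simp
    have dx: "(x has_vector_derivative ?v) (at t within {0..tf})" by (rule N(2)[OF t])
    obtain d C where d: "d > 0" "C > 0" "\<And>t' q'. t' \<in> {0..tf} \<Longrightarrow> q' \<in> ball qb r \<Longrightarrow> \<bar>t' - t\<bar> < d \<Longrightarrow> norm (q' - Q t) < d \<Longrightarrow>
          \<bar>S t' q' - S t (Q t) - ?p \<bullet> (\<xi> t' q' - \<xi> t (Q t)) + h (Q t) * (t' - t)\<bar> \<le> C * (\<bar>t' - t\<bar> + norm (q' - Q t))\<^sup>2"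
      using value_differential[OF tT conjunct1[OF Q[OF tT]]] by auto
    define R where "R s = g s - g t - ?p \<bullet> (x s - x t) + h (Q t) * (s - t)" for s
    obtain d1 where d1: "d1 > 0" "\<And>s. s \<in> {0..tf} \<Longrightarrow> \<bar>s - t\<bar> < d1 \<Longrightarrow>
        norm (x s - x t - (s - t) *\<^sub>R ?v) \<le> 1 * \<bar>s - t\<bar>"
      using dx unfolding has_vector_derivative_def has_derivative_within_alt real_norm_def
      by (metis zero_less_one)
    define J where "J = 1 + K * (2 + norm ?v)"
    have J: "J > 0" using K by (simp add: J_def add_pos_nonneg)
    have Rle: "\<bar>R s\<bar> \<le> C * J\<^sup>2 * \<bar>s - t\<bar>\<^sup>2" if s: "s \<in> {0..tf}" "\<bar>s - t\<bar> < min d (min d1 (d / J))" for s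
    proof -
      have "norm (x s - x t) \<le> norm (x s - x t - (s - t) *\<^sub>R ?v) + norm ((s - t) *\<^sub>R ?v)"
        using norm_triangle_ineq[of "x s - x t - (s - t) *\<^sub>R ?v" "(s - t) *\<^sub>R ?v"] by simp
      also have "\<dots> \<le> \<bar>s - t\<bar> * (1 + norm ?v)"
        using d1(2)[OF s(1)] s(2) by (simp add: distrib_left)
      finally have "norm (Q s - Q t) \<le> K * (\<bar>s - t\<bar> + \<bar>s - t\<bar> * (1 + norm ?v))"
        using Q_le[OF s(1) tT] K by (meson add_left_mono less_imp_le mult_left_mono order_trans)
      then have QJ: "\<bar>s - t\<bar> + norm (Q s - Q t) \<le> J * \<bar>s - t\<bar>" by (simp add: J_def algebra_simps)
      also have "\<dots> < J * (d / J)" using J s by (intro mult_strict_left_mono) auto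
      finally have "norm (Q s - Q t) < d" using J by simp
      then have "\<bar>R s\<bar> \<le> C * (\<bar>s - t\<bar> + norm (Q s - Q t))\<^sup>2"
        using d(3)[of s "Q s"] Q[OF s(1)] Q[OF tT] s by (simp add: R_def g_def)
      also have "\<dots> \<le> C * (J * \<bar>s - t\<bar>)\<^sup>2" using QJ d(2) by (intro mult_left_mono power_mono) auto
      finally show ?thesis by (simp add: power_mult_distrib)
    qed
    have R0: "R t = 0" by (simp add: R_def)
    have "(R has_derivative (\<lambda>_. 0)) (at t within {0..tf})"
      unfolding has_derivative_within_alt
    proof (intro conjI allI impI)
      fix e :: real assume "e > 0"
      define b where "b = min (min d (min d1 (d / J))) (e / (C * J\<^sup>2))"
      have "b > 0" using d d1 J \<open>e > 0\<close> by (simp add: b_def)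
      moreover have "norm (R s - R t - 0) \<le> e * norm (s - t)" if s: "s \<in> {0..tf}" "norm (s - t) < b" for s
      proof -
        have "\<bar>R s\<bar> \<le> C * J\<^sup>2 * \<bar>s - t\<bar>\<^sup>2" using s by (intro Rle) (auto simp: b_def)
        also have "\<dots> = (C * J\<^sup>2 * \<bar>s - t\<bar>) * \<bar>s - t\<bar>" by (simp add: power2_eq_square)
        also have "\<dots> \<le> e * \<bar>s - t\<bar>"
        proof (rule mult_right_mono)
          have "\<bar>s - t\<bar> \<le> e / (C * J\<^sup>2)" using s(2) by (simp add: b_def)
          then show "C * J\<^sup>2 * \<bar>s - t\<bar> \<le> e" using d(2) J by (simp add: field_simps)
        qed simp
        finally show ?thesis by (simp add: R0)
      qed
      ultimately show "\<exists>d>0. \<forall>s\<in>{0..tf}. norm (s - t) < d \<longrightarrow> norm (R s - R t - 0) \<le> e * norm (s - t)" by blast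
    qed simp
    then have "(R has_vector_derivative 0) (at t within {0..tf})" by (simp add: has_vector_derivative_def)
    then have "((\<lambda>s. R s + (g t + ?p \<bullet> (x s - x t) - h (Q t) * (s - t))) has_vector_derivative
        0 + (0 + ?p \<bullet> (?v - 0) - h (Q t) * (1 - 0))) (at t within {0..tf})"
      by (intro has_vector_derivative_add has_vector_derivative_diff has_vector_derivative_const dx
          bounded_linear.has_vector_derivative[OF bounded_linear_inner_right]
          bounded_linear.has_vector_derivative[OF bounded_linear_mult_right] has_vector_derivative_id)
    then show ?thesis by (simp add: R_def k_def)
  qed
  show "k absolutely_integrable_on {0..tf}"
    using absolutely_integrable_derivative[OF _ acg N(1) der] tf by simp
  have "Q 0 = qb" "Q tf = qb"
    using expanding[of 0 "Q 0" qb] expanding[of tf "Q tf" qb] Q[of 0] Q[of tf] tf r c start finish ends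
    by (auto simp: mult_le_0_iff)
  then show "integral {0..tf} k = S tf qb - S 0 qb"
    using fundamental_theorem_absolutely_continuous[OF _ acg N(1) der] tf
    by (auto simp: g_def intro!: integral_unique)
qed

text \<open>The cost of each trajectory in the tube is bounded below by the increment of the value function, which only
  depends on the two endpoints and is the cost of the central trajectory.\<close>

theorem field_minimizer:
  assumes adm: "admissible X U f tf x0 xf xb ub"
    and central: "\<And>t. t \<in> {0..tf} \<Longrightarrow> \<xi> t qb = xb t"
    and maximal: "AE t in lebesgue_on {0..tf}. control_hamiltonian f f0 (-1) (xb t, \<pi> t qb) (ub t) = h qb"
  shows "\<exists>\<epsilon>>0. \<forall>x u. admissible X U f tf x0 xf x u \<and> (\<forall>t\<in>{0..tf}. dist (x t) (xb t) < \<epsilon>)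
           \<longrightarrow> cost f0 tf x u \<ge> cost f0 tf xb ub"
proof (intro exI[of _ "c * (r / 2)"] conjI allI impI)
  show "c * (r / 2) > 0" using c r by simp
  have qb: "qb \<in> ball qb r" using r by simp
  have "cost f0 tf xb ub = ereal (S tf qb - S 0 qb)"
  proof -
    let ?k = "\<lambda>t. \<pi> t qb \<bullet> f (xb t) (ub t) - h qb"
    note v = value_along_trajectory[OF adm, of "\<lambda>_. qb"]
    have "cost f0 tf xb ub = ereal (integral {0..tf} ?k)"
    proof (rule cost_eq_integral_AE)
      show "?k absolutely_integrable_on {0..tf}" using v(1) central qb by simp
      show "AE t in lebesgue_on {0..tf}. ?k t = f0 (xb t) (ub t)"
        using maximal by eventually_elim (simp add: control_hamiltonian_def)
    qed
    then show ?thesis using v(2) central qb by simp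
  qed
  fix x u assume a: "admissible X U f tf x0 xf x u \<and> (\<forall>t\<in>{0..tf}. dist (x t) (xb t) < c * (r / 2))"
  then have adm': "admissible X U f tf x0 xf x u" by simp
  have "\<exists>q. q \<in> ball qb r \<and> \<xi> t q = x t" if "t \<in> {0..tf}" for t
    using field_covers[OF that, of "x t"] a that central[OF that] by (auto simp: dist_commute)
  then obtain Q where Q: "\<And>t. t \<in> {0..tf} \<Longrightarrow> Q t \<in> ball qb r \<and> \<xi> t (Q t) = x t"
    by metis
  let ?k = "\<lambda>t. \<pi> t (Q t) \<bullet> f (x t) (u t) - h (Q t)"
  note v = value_along_trajectory[OF adm' Q]
  have "ereal (integral {0..tf} ?k) \<le> cost f0 tf x u"
  proof (rule cost_ge_integral[OF v(1)])
    show "AE t in lebesgue_on {0..tf}. ?k t \<le> f0 (x t) (u t)"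
    proof (rule AE_I2)
      fix t assume "t \<in> space (lebesgue_on {0..tf})"
      then have t: "t \<in> {0..tf}" by (simp add: space_restrict_space)
      have "u t \<in> U" using adm' t by (simp add: admissible_def)
      from hamiltonian_le[OF t conjunct1[OF Q[OF t]] this] Q[OF t]
      show "?k t \<le> f0 (x t) (u t)" by (simp add: control_hamiltonian_def)
    qed
  qed
  with v(2) \<open>cost f0 tf xb ub = _\<close> show "cost f0 tf xb ub \<le> cost f0 tf x u" by simp
qed

end

section \<open>Rank-one perturbations and uniformly injective families\<close>

lemma det_rank_one_update:
  fixes a b :: "real ^ 'n"
  shows "det (\<chi> i j. (if i = j then 1 else 0) + a $ i * b $ j) = 1 + b \<bullet> a"
proof (cases "b = 0")
  case True
  then have "(\<chi> i j. (if i = j then 1 else 0) + a $ i * b $ j) = (mat 1 :: real^'n^'n)"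
    by (simp add: mat_def)
  then show ?thesis using True by simp
next
  case False
  then obtain k where k: "b $ k \<noteq> 0" by (auto simp: vec_eq_iff)
  let ?I = "mat 1 :: real^'n^'n"
  let ?C = "(\<chi> i j. (if i = j then 1 else 0) + a $ i * b $ j) :: real^'n^'n"
  (* The functional b becomes the k-th coordinate, so that the update changes a single column. *)
  define P :: "real^'n^'n" where "P = (\<chi> i. if i = k then b else axis i 1)"
  have detP: "det P = b $ k"
  proof -
    have "P = (\<chi> i. if i = k then sum (\<lambda>i. b $ i *s row i ?I) UNIV else row i ?I)"
      unfolding P_def
    proof (intro vec_eq_iff[THEN iffD2] allI)
      fix i j
      have r: "row i ?I = axis i 1" for i by (simp add: row_def mat_def vec_eq_iff axis_def)
      show "(\<chi> i. if i = k then b else axis i 1) $ i $ j =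
        (\<chi> i. if i = k then sum (\<lambda>i. b $ i *s row i ?I) UNIV else row i ?I) $ i $ j"
        by (simp add: r basis_expansion)
    qed
    then show ?thesis using cramer_lemma_transpose[of k b ?I] by simp
  qed
  have Pv: "(P *v v) $ i = (if i = k then b \<bullet> v else v $ i)" for v i
    by (simp add: P_def matrix_vector_mult_def inner_vec_def axis_def if_distrib cong: if_cong)
       (simp add: if_distribR if_distrib[of "\<lambda>c. c * _"] cong: if_cong)
  define u where "u = P *v a"
  define x where "x = axis k 1 + u"
  let ?E = "(\<chi> i j. if j = k then x $ i else if i = j then 1 else 0) :: real^'n^'n"
  have "(\<chi> i j. if j = k then (?I *v x) $ i else ?I $ i $ j) = ?E"
    by (simp add: mat_def matrix_vector_mul_lid[unfolded mat_def] vec_eq_iff)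
  then have "det ?E = 1 + b \<bullet> a"
    using cramer_lemma[of k ?I x] by (simp add: x_def u_def Pv)
  moreover have "P ** ?C = ?E ** P"
  proof -
    have C: "?C *v v = v + (b \<bullet> v) *\<^sub>R a" for v
      by (simp add: vec_eq_iff matrix_vector_mult_def inner_vec_def algebra_simps sum.distrib
          sum_distrib_left if_distrib[of "\<lambda>c. _ * c"] cong: if_cong)
    have E: "?E *v v = v + (v $ k) *\<^sub>R u" for v
    proof (intro vec_eq_iff[THEN iffD2] allI)
      fix i
      have "(?E *v v) $ i = (\<Sum>j\<in>UNIV. (if j = i then v $ j else 0) + (if j = k then v $ k * u $ i else 0))"
        by (auto simp: matrix_vector_mult_def x_def axis_def algebra_simps intro!: sum.cong)
      also have "\<dots> = (v + (v $ k) *\<^sub>R u) $ i" by (simp add: sum.distrib)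
      finally show "(?E *v v) $ i = (v + (v $ k) *\<^sub>R u) $ i" .
    qed
    have "(P ** ?C) *v v = (?E ** P) *v v" for v
      by (simp only: matrix_vector_mul_assoc[symmetric] C E)
         (simp add: matrix_vector_right_distrib matrix_vector_mult_scaleR Pv u_def)
    then show ?thesis using matrix_eq by blast
  qed
  then have "det (P ** ?C) = det (?E ** P)" by (rule arg_cong)
  then have "det P * det ?C = det ?E * det P" by (simp only: det_mul)
  ultimately show ?thesis using k detP by simp
qed

text \<open>If a matrix and a rank-one modification of it have determinants of the same sign, then so have
  all the matrices on the segment between them: the determinant is affine along the segment.\<close>

lemma rank_one_segment_injective:
  fixes A B :: "real ^ 'n \<Rightarrow> real ^ 'n" and l :: "real ^ 'n \<Rightarrow> real"
  assumes A: "linear A" and l: "linear l" and B: "\<And>v. B v = A v + l v *\<^sub>R a"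
    and sign: "det (matrix A) * det (matrix B) > 0"
    and mu: "0 \<le> \<mu>" "\<mu> \<le> 1" and w: "A w + (\<mu> * l w) *\<^sub>R a = 0"
  shows "w = 0"
proof (rule ccontr)
  assume "w \<noteq> 0"
  have "inj A" using sign det_nz_iff_inj[OF A] by auto
  then have A0: "A v = 0 \<Longrightarrow> v = 0" for v using linear_injective_0[OF A] by blast
  have "l w \<noteq> 0" "\<mu> \<noteq> 0" using A0[of w] w \<open>w \<noteq> 0\<close> by auto
  define b where "b = (\<chi> i. l (axis i 1))"
  have lb: "l v = b \<bullet> v" for v
  proof -
    have "l v = l (\<Sum>i\<in>UNIV. v $ i *\<^sub>R axis i 1)"
      using basis_expansion[of v] by (simp add: scalar_mult_eq_scaleR)
    then show ?thesis
      by (simp add: linear_sum[OF l] linear_scale[OF l] b_def inner_vec_def mult.commute)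
  qed
  define w' where "w' = (- 1 / (\<mu> * l w)) *\<^sub>R w"
  have "A w = - (\<mu> * l w) *\<^sub>R a" using w by (simp add: add_eq_0_iff)
  then have aw: "A w' = a"
    using \<open>l w \<noteq> 0\<close> \<open>\<mu> \<noteq> 0\<close> by (simp add: w'_def linear_scale[OF A] linear_neg[OF A])
  let ?C = "(\<chi> i j. (if i = j then 1 else 0) + w' $ i * b $ j) :: real^'n^'n"
  have C: "?C *v v = v + l v *\<^sub>R w'" for v
    by (simp add: lb vec_eq_iff matrix_vector_mult_def inner_vec_def algebra_simps sum.distrib
        sum_distrib_left if_distrib[of "\<lambda>c. _ * c"] cong: if_cong)
  have linB: "linear B"
    by (rule linearI)
       (simp_all add: B linear_add[OF A] linear_add[OF l] linear_scale[OF A] linear_scale[OF l] algebra_simps)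
  have "matrix B = matrix A ** ?C"
  proof -
    have "matrix B *v v = (matrix A ** ?C) *v v" for v
      unfolding matrix_vector_mul_assoc[symmetric] C
      using matrix_vector_mul(2)[OF A, THEN fun_cong] matrix_vector_mul(2)[OF linB, THEN fun_cong]
      by (simp add: B linear_add[OF A] linear_scale[OF A] aw)
    then show ?thesis using matrix_eq by blast
  qed
  then have "det (matrix B) = det (matrix A) * (1 + b \<bullet> w')"
    by (simp add: det_mul det_rank_one_update)
  also have "1 + b \<bullet> w' = 1 - 1 / \<mu>"
    using \<open>l w \<noteq> 0\<close> by (simp add: w'_def lb)
  finally have "det (matrix A) * det (matrix B) = (det (matrix A))\<^sup>2 * (1 - 1 / \<mu>)"
    by (simp add: power2_eq_square)
  also have "\<dots> \<le> 0"
    using mu \<open>\<mu> \<noteq> 0\<close> by (intro mult_nonneg_nonpos) auto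
  finally show False using sign by simp
qed

text \<open>The norm attains a positive minimum on the product of \<open>K\<close> with the unit sphere.\<close>

lemma uniformly_injective_family:
  fixes B :: "'s::metric_space \<Rightarrow> 'a::euclidean_space \<Rightarrow>\<^sub>L 'b::real_normed_vector"
  assumes K: "compact K" and cont: "continuous_on K B" and inj: "\<And>s w. s \<in> K \<Longrightarrow> B s w = 0 \<Longrightarrow> w = 0"
  obtains c where "c > 0" "\<And>s w. s \<in> K \<Longrightarrow> c * norm w \<le> norm (B s w)"
proof (cases "K = {}")
  case True
  then show ?thesis using that[of 1] by simp
next
  case False
  let ?S = "K \<times> sphere (0::'a) 1"
  have "compact ?S" by (intro compact_Times K) simp
  moreover obtain b :: 'a where "b \<in> Basis" using nonempty_Basis by blast
  then have "?S \<noteq> {}" using False by auto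
  moreover have "continuous_on ?S (\<lambda>p. norm (B (fst p) (snd p)))"
    by (intro continuous_intros continuous_on_compose2[OF cont]) auto
  ultimately obtain p where p: "p \<in> ?S" "\<And>p'. p' \<in> ?S \<Longrightarrow> norm (B (fst p) (snd p)) \<le> norm (B (fst p') (snd p'))"
    using continuous_attains_inf[of ?S "\<lambda>p. norm (B (fst p) (snd p))"] by blast
  define c where "c = norm (B (fst p) (snd p))"
  have "c > 0"
    using p(1) inj[of "fst p" "snd p"] by (auto simp: c_def)
  moreover have "c * norm w \<le> norm (B s w)" if "s \<in> K" for s w
  proof (cases "w = 0")
    case False
    have "c \<le> norm (B s ((1 / norm w) *\<^sub>R w))"
      using p(2)[of "(s, (1 / norm w) *\<^sub>R w)"] that False by (simp add: c_def)
    also have "\<dots> = norm (B s w) / norm w" by (simp add: blinfun.scaleR_right)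
    finally show ?thesis using False by (simp add: field_simps)
  qed simp
  ultimately show ?thesis using that by blast
qed

section \<open>Absence of conjugate points near the initial time\<close>

context ham_flow
begin

lemma hessian_eq_deriv:
  assumes "z \<in> W"
  shows "hessian H z w v = ham_vec_deriv H z v \<bullet> (- rot w)"
  using ham_vec_deriv_inner[OF assms, of v "- rot w"] by (simp add: rot_def)

lemma hessian_linear_right: "z \<in> W \<Longrightarrow> linear (hessian H z w)"
  using Ck_on_open_hessian(1)[OF Ck_H] by (blast intro: has_derivative_linear)

lemma hessian_sym: "z \<in> W \<Longrightarrow> hessian H z v w = hessian H z w v"
  by (rule hessian_symmetric[OF Ck_H open_W])

text \<open>A Riccati argument.  The quadratic form \<open>\<pi> \<bullet> \<xi> + c t |\<xi>|\<^sup>2\<close> is nondecreasing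
  along the linearized flow for small times, because the Hessian is nonnegative in the
  direction of the covectors; since it starts with a positive value, \<open>\<xi>\<close> cannot vanish.\<close>

lemma no_early_conjugate_point:
  fixes \<Phi> :: "real \<Rightarrow> ((real ^ 'n) \<times> (real ^ 'n)) \<Rightarrow>\<^sub>L ((real ^ 'n) \<times> (real ^ 'n))"
  assumes "T > 0" "z0 \<in> W" and \<Phi>0: "\<Phi> 0 = id_blinfun"
    and \<Phi>: "\<And>t. t \<in> {0..T} \<Longrightarrow> (\<Phi> has_vector_derivative ham_vec_deriv H (\<zeta> t z0) o\<^sub>L \<Phi> t) (at t within {0..T})"
    and psd: "\<And>t p. t \<in> {0..<T} \<Longrightarrow> hessian H (\<zeta> t z0) (0, p) (0, p) \<ge> 0"
  obtains t0 where "t0 > 0" "t0 < T"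
    "\<And>t \<epsilon> w. t \<in> {0..t0} \<Longrightarrow> \<epsilon> > 0 \<Longrightarrow> fst (\<Phi> t (\<epsilon> *\<^sub>R w, w)) = 0 \<Longrightarrow> w = 0"
proof -
  let ?y = "\<lambda>t. \<zeta> t z0" and ?D = "\<lambda>t. ham_vec_deriv H (\<zeta> t z0)"
  have yW: "?y t \<in> W" for t by (rule flow_in[OF assms(2)])
  have "continuous_on {0..T} (\<lambda>t. ?D t)"
    using yW by (intro continuous_on_compose2[OF D_cont flow_cont[OF assms(2)]]) auto
  then have "bounded ((\<lambda>t. ?D t) ` {0..T})"
    by (intro compact_imp_bounded compact_continuous_image) auto
  then obtain M where M: "M > 0" "\<And>t. t \<in> {0..T} \<Longrightarrow> norm (?D t) \<le> M"
    unfolding bounded_pos by auto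
  have DM: "norm (?D t v) \<le> M * norm v" if "t \<in> {0..T}" for t v
    using norm_blinfun[of "?D t" v] M(2)[OF that] by (meson mult_right_mono norm_ge_zero order_trans)
  define c where "c = 4 * M"
  define t0 where "t0 = min (T / 2) (1 / c)"
  have t0: "t0 > 0" "t0 < T" "c * t0 \<le> 1"
    using M(1) \<open>T > 0\<close> by (auto simp: t0_def c_def min_def field_simps)
  have "w = 0" if t: "t \<in> {0..t0}" and "\<epsilon> > 0" and zero: "fst (\<Phi> t (\<epsilon> *\<^sub>R w, w)) = 0" for t \<epsilon> w
  proof (rule ccontr)
    assume "w \<noteq> 0"
    define v where "v s = \<Phi> s (\<epsilon> *\<^sub>R w, w)" for s
    define m where "m s = snd (v s) \<bullet> fst (v s) + c * s * (fst (v s) \<bullet> fst (v s))" for s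
    have dv: "(v has_vector_derivative ?D s (v s)) (at s within {0..T})" if "s \<in> {0..T}" for s
      using bounded_linear.has_vector_derivative[OF blinfun.bounded_linear_left[of "(\<epsilon> *\<^sub>R w, w)"] \<Phi>[OF that]]
      by (simp add: v_def[abs_def])
    have vcont: "continuous_on {0..T} v"
      using dv has_vector_derivative_continuous continuous_on_eq_continuous_within by blast
    have "m 0 \<le> m t"
    proof (rule DERIV_nonneg_imp_increasing_open[where f = m and a = 0 and b = t])
      show "0 \<le> t" using t by simp
      show "continuous_on {0..t} m"
        unfolding m_def using t t0 by (intro continuous_intros continuous_on_subset[OF vcont]) auto
      fix s assume s: "0 < s" "s < t"
      then have sT: "s \<in> {0..T}" "s \<in> {0..<T}" "s \<in> {0<..<T}" using t t0 by auto
      let ?x = "fst (v s)" and ?p = "snd (v s)"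
      define a where "a = fst (?D s (?x, 0))"
      define b where "b = fst (?D s (0, ?p))"
      define q where "q = hessian H (?y s) (0, ?p) (0, ?p)"
      define qx where "qx = hessian H (?y s) (?x, 0) (?x, 0)"
      have split: "v s = (?x, 0) + (0, ?p)" by simp
      have "(v has_vector_derivative ?D s (v s)) (at s)"
        using dv[OF sT(1)] sT(3) at_within_interior[of s "{0..T}"] by simp
      then have dx: "((\<lambda>s. fst (v s)) has_vector_derivative fst (?D s (v s))) (at s)"
        and dp: "((\<lambda>s. snd (v s)) has_vector_derivative snd (?D s (v s))) (at s)"
        by (auto intro: bounded_linear.has_vector_derivative bounded_linear_fst bounded_linear_snd)
      have 1: "((\<lambda>s. snd (v s) \<bullet> fst (v s)) has_real_derivative (?p \<bullet> fst (?D s (v s)) + snd (?D s (v s)) \<bullet> ?x)) (at s)"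
        using bounded_bilinear.has_vector_derivative[OF bounded_bilinear_inner dp dx]
        by (simp add: has_real_derivative_iff_has_vector_derivative)
      have 2: "((\<lambda>s. fst (v s) \<bullet> fst (v s)) has_real_derivative (?x \<bullet> fst (?D s (v s)) + fst (?D s (v s)) \<bullet> ?x)) (at s)"
        using bounded_bilinear.has_vector_derivative[OF bounded_bilinear_inner dx dx]
        by (simp add: has_real_derivative_iff_has_vector_derivative)
      have fD: "fst (?D s (v s)) = a + b"
        by (subst split) (simp add: a_def b_def blinfun.add_right del: add_Pair)
      have cross: "?p \<bullet> fst (?D s (v s)) + snd (?D s (v s)) \<bullet> ?x = q - qx"
      proof -
        have "?p \<bullet> fst (?D s (v s)) + snd (?D s (v s)) \<bullet> ?x = ?D s (v s) \<bullet> (- rot (- ?x, ?p))"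
          by (simp add: rot_def inner_prod_def inner_commute)
        also have "\<dots> = hessian H (?y s) (- ?x, ?p) (v s)"
          by (rule hessian_eq_deriv[OF yW, symmetric])
        also have "\<dots> = hessian H (?y s) (- ?x, ?p) ((?x, 0) + (0, ?p))" by simp
        also have "\<dots> = hessian H (?y s) ((?x, 0) + (0, ?p)) ((0, ?p) - (?x, 0))"
          by (subst hessian_sym[OF yW]) simp
        also have "\<dots> = hessian H (?y s) ((?x, 0) + (0, ?p)) (0, ?p) - hessian H (?y s) ((?x, 0) + (0, ?p)) (?x, 0)"
          by (rule linear_diff[OF hessian_linear_right[OF yW]])
        also have "\<dots> = hessian H (?y s) (0, ?p) ((?x, 0) + (0, ?p)) - hessian H (?y s) (?x, 0) ((?x, 0) + (0, ?p))"
          by (simp only: hessian_sym[OF yW, of _ "(?x, 0) + (0, ?p)"])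
        also have "\<dots> = q - qx"
          using hessian_sym[OF yW, of s "(0, ?p)" "(?x, 0)"]
          by (simp add: linear_add[OF hessian_linear_right[OF yW]] q_def qx_def del: add_Pair)
        finally show ?thesis .
      qed
      have "q \<ge> 0" unfolding q_def by (rule psd[OF sT(2)])
      have "qx \<le> M * (norm ?x)\<^sup>2"
      proof -
        have "qx \<le> norm (?D s (?x, 0)) * norm (- rot (?x, 0))"
          unfolding qx_def hessian_eq_deriv[OF yW] by (rule norm_cauchy_schwarz)
        also have "\<dots> \<le> (M * norm (?x, 0 :: real ^ 'n)) * norm (?x, 0 :: real ^ 'n)"
          using DM[OF sT(1), of "(?x, 0)"] by (simp add: mult_right_mono)
        finally show ?thesis by (simp add: power2_eq_square)
      qed
      (* A nonnegative quadratic form bounded by M satisfies |Q p|^2 \<le> M (Q p, p): evaluate it at p - Q p / M. *)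
      have bq: "(norm b)\<^sup>2 \<le> M * q"
      proof -
        let ?w = "(0, ?p) - (1 / M) *\<^sub>R (0, b)"
        have hb: "hessian H (?y s) (0, b) (0, ?p) = (norm b)\<^sup>2"
          unfolding hessian_eq_deriv[OF yW] by (simp add: rot_def inner_prod_def b_def power2_norm_eq_inner)
        have hbb: "hessian H (?y s) (0, b) (0, b) \<le> M * (norm b)\<^sup>2"
        proof -
          have "hessian H (?y s) (0, b) (0, b) \<le> norm (?D s (0, b)) * norm (- rot (0, b))"
            unfolding hessian_eq_deriv[OF yW] by (rule norm_cauchy_schwarz)
          also have "\<dots> \<le> (M * norm (0 :: real ^ 'n, b)) * norm (0 :: real ^ 'n, b)"
            using DM[OF sT(1), of "(0, b)"] by (simp add: mult_right_mono)
          finally show ?thesis by (simp add: power2_eq_square)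
        qed
        have "0 \<le> hessian H (?y s) ?w ?w" using psd[OF sT(2), of "?p - (1 / M) *\<^sub>R b"] by simp
        also have "\<dots> = hessian H (?y s) ?w (0, ?p) - (1 / M) * hessian H (?y s) ?w (0, b)"
          by (simp only: linear_diff[OF hessian_linear_right[OF yW]] linear_scale[OF hessian_linear_right[OF yW]] real_scaleR_def)
        also have "\<dots> = hessian H (?y s) (0, ?p) ?w - (1 / M) * hessian H (?y s) (0, b) ?w"
          by (simp only: hessian_sym[OF yW, of _ ?w])
        also have "\<dots> = q - (1 / M) * (norm b)\<^sup>2 - (1 / M) * ((norm b)\<^sup>2 - (1 / M) * hessian H (?y s) (0, b) (0, b))"
          using hessian_sym[OF yW, of s "(0, ?p)" "(0, b)"] hb
          by (simp only: linear_diff[OF hessian_linear_right[OF yW]] linear_scale[OF hessian_linear_right[OF yW]] real_scaleR_def q_def)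
        finally have "(1 / M) * (norm b)\<^sup>2 + (1 / M) * (norm b)\<^sup>2 \<le> q + (1 / M) * ((1 / M) * hessian H (?y s) (0, b) (0, b))"
          by (simp add: algebra_simps)
        also have "\<dots> \<le> q + (1 / M) * ((1 / M) * (M * (norm b)\<^sup>2))"
          using hbb M(1) by (intro add_left_mono mult_left_mono) auto
        also have "\<dots> = q + (1 / M) * (norm b)\<^sup>2" using M(1) by simp
        finally have "(1 / M) * (norm b)\<^sup>2 \<le> q" by simp
        then show ?thesis using M(1) by (simp add: field_simps)
      qed
      have cs: "0 \<le> c * s" "c * s \<le> 1"
      proof -
        show "0 \<le> c * s" using M(1) s by (simp add: c_def)
        have "c * s \<le> c * t0" using M(1) s t by (intro mult_left_mono) (auto simp: c_def)
        then show "c * s \<le> 1" using t0(3) by simp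
      qed
      have ax: "\<bar>?x \<bullet> a\<bar> \<le> M * (norm ?x)\<^sup>2"
      proof -
        have "\<bar>?x \<bullet> a\<bar> \<le> norm ?x * norm a" by (rule Cauchy_Schwarz_ineq2)
        also have "norm a \<le> norm (?D s (?x, 0))" using norm_fst_le[of "fst (?D s (?x, 0))" "snd (?D s (?x, 0))"] by (simp add: a_def)
        also have "\<dots> \<le> M * norm ?x" using DM[OF sT(1), of "(?x, 0)"] by simp
        finally show ?thesis by (simp add: power2_eq_square mult_left_mono mult.left_commute)
      qed
      have bx: "2 * \<bar>?x \<bullet> b\<bar> \<le> M * (norm ?x)\<^sup>2 + q"
      proof -
        have "M * (2 * \<bar>?x \<bullet> b\<bar>) \<le> 2 * (M * norm ?x) * norm b"
          using Cauchy_Schwarz_ineq2[of ?x b] M(1) by (simp add: mult_left_mono)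
        also have "\<dots> \<le> (M * norm ?x)\<^sup>2 + (norm b)\<^sup>2" by (rule sum_squares_bound)
        also have "\<dots> \<le> M * (M * (norm ?x)\<^sup>2 + q)"
          using bq by (simp add: power_mult_distrib power2_eq_square algebra_simps)
        finally show ?thesis using M(1) by simp
      qed
      have "\<bar>c * s * (2 * (?x \<bullet> a) + 2 * (?x \<bullet> b))\<bar> \<le> 1 * \<bar>2 * (?x \<bullet> a) + 2 * (?x \<bullet> b)\<bar>"
        unfolding abs_mult[of "c * s"] using cs by (intro mult_right_mono) auto
      also have "\<dots> \<le> 3 * (M * (norm ?x)\<^sup>2) + q"
        using ax bx abs_triangle_ineq[of "2 * (?x \<bullet> a)" "2 * (?x \<bullet> b)"] by (simp add: abs_mult)
      finally have "0 \<le> q - qx + (c * s * (2 * (?x \<bullet> a) + 2 * (?x \<bullet> b)) + c * (norm ?x)\<^sup>2)"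
        using \<open>qx \<le> _\<close> unfolding c_def by (simp add: abs_le_iff)
      moreover have "(m has_real_derivative q - qx + (c * s * (2 * (?x \<bullet> a) + 2 * (?x \<bullet> b)) + c * (norm ?x)\<^sup>2)) (at s)"
        unfolding m_def
        by (rule derivative_eq_intros 1 2 refl)+
           (simp add: cross[symmetric] fD inner_add_right inner_add_left inner_commute power2_norm_eq_inner algebra_simps)
      ultimately show "\<exists>y. (m has_real_derivative y) (at s) \<and> 0 \<le> y" by blast
    qed
    moreover have "m 0 = \<epsilon> * (norm w)\<^sup>2"
      by (simp add: m_def v_def \<Phi>0 power2_norm_eq_inner)
    moreover have "m t = 0" using zero by (simp add: m_def v_def)
    ultimately show False using \<open>\<epsilon> > 0\<close> \<open>w \<noteq> 0\<close> by (simp add: mult_le_0_iff)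
  qed
  then show ?thesis using that t0(1,2) by blast
qed

end

section \<open>The broken flow near the reference extremal\<close>

context complete_C1_flow
begin

text \<open>\<open>\<Phi>\<close> is the resolvent of the linearized equation along the solution through \<open>z0\<close>, and it is a strict
  derivative of the flow.  The derivative is taken at a time \<open>\<sigma>\<close> near the times that are compared, because the latter will vary with
  the contact time.\<close>

definition linearization :: "real \<Rightarrow> 'a \<Rightarrow> (real \<Rightarrow> 'a \<Rightarrow>\<^sub>L 'a) \<Rightarrow> bool" where
  "linearization T z0 \<Phi> \<longleftrightarrow> \<Phi> 0 = id_blinfun \<and>
     (\<forall>t\<in>{0..T}. (\<Phi> has_vector_derivative D (\<zeta> t z0) o\<^sub>L \<Phi> t) (at t within {0..T})) \<and>
     (\<forall>e>0. \<exists>r>0. \<forall>z z' s s' \<sigma>. z \<in> ball z0 r \<longrightarrow> z' \<in> ball z0 r \<longrightarrow> s \<in> {0..T} \<longrightarrow> s' \<in> {0..T} \<longrightarrow>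
       \<sigma> \<in> {0..T} \<longrightarrow> \<bar>s - \<sigma>\<bar> < r \<longrightarrow> \<bar>s' - \<sigma>\<bar> < r \<longrightarrow>
       norm (\<zeta> s z - \<zeta> s' z' - \<Phi> \<sigma> (z - z') - (s - s') *\<^sub>R F (\<zeta> \<sigma> z0)) \<le> e * (norm (z - z') + \<bar>s - s'\<bar>))"

lemma linearization_exists:
  assumes "T \<ge> 0" "z0 \<in> W"
  obtains \<Phi> where "linearization T z0 \<Phi>"
proof (rule flow_strict_derivative[OF assms])
  fix \<Phi> assume "\<Phi> 0 = id_blinfun"
    "\<And>t. t \<in> {0..T} \<Longrightarrow> (\<Phi> has_vector_derivative D (\<zeta> t z0) o\<^sub>L \<Phi> t) (at t within {0..T})"
    "\<And>e. e > 0 \<Longrightarrow> \<exists>r>0. \<forall>z z' s s' \<sigma>. z \<in> ball z0 r \<longrightarrow> z' \<in> ball z0 r \<longrightarrow> s \<in> {0..T} \<longrightarrow> s' \<in> {0..T} \<longrightarrow>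
       \<sigma> \<in> {0..T} \<longrightarrow> \<bar>s - \<sigma>\<bar> < r \<longrightarrow> \<bar>s' - \<sigma>\<bar> < r \<longrightarrow>
       norm (\<zeta> s z - \<zeta> s' z' - \<Phi> \<sigma> (z - z') - (s - s') *\<^sub>R F (\<zeta> \<sigma> z0)) \<le> e * (norm (z - z') + \<bar>s - s'\<bar>)"
  then have "linearization T z0 \<Phi>" unfolding linearization_def by (intro conjI ballI allI impI)
  then show ?thesis by (rule that)
qed

lemma linearizationE:
  assumes "linearization T z0 \<Phi>" "e > 0"
  obtains r where "r > 0" "\<And>z z' s s' \<sigma>. z \<in> ball z0 r \<Longrightarrow> z' \<in> ball z0 r \<Longrightarrow> s \<in> {0..T} \<Longrightarrow> s' \<in> {0..T} \<Longrightarrow>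
       \<sigma> \<in> {0..T} \<Longrightarrow> \<bar>s - \<sigma>\<bar> < r \<Longrightarrow> \<bar>s' - \<sigma>\<bar> < r \<Longrightarrow>
       norm (\<zeta> s z - \<zeta> s' z' - \<Phi> \<sigma> (z - z') - (s - s') *\<^sub>R F (\<zeta> \<sigma> z0)) \<le> e * (norm (z - z') + \<bar>s - s'\<bar>)"
proof -
  have "\<forall>e>0. \<exists>r>0. \<forall>z z' s s' \<sigma>. z \<in> ball z0 r \<longrightarrow> z' \<in> ball z0 r \<longrightarrow> s \<in> {0..T} \<longrightarrow> s' \<in> {0..T} \<longrightarrow>
       \<sigma> \<in> {0..T} \<longrightarrow> \<bar>s - \<sigma>\<bar> < r \<longrightarrow> \<bar>s' - \<sigma>\<bar> < r \<longrightarrow>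
       norm (\<zeta> s z - \<zeta> s' z' - \<Phi> \<sigma> (z - z') - (s - s') *\<^sub>R F (\<zeta> \<sigma> z0)) \<le> e * (norm (z - z') + \<bar>s - s'\<bar>)"
    using assms(1) unfolding linearization_def by (elim conjE)
  note this[rule_format, OF assms(2)]
  then show ?thesis by (elim exE conjE) (rule that, assumption, blast)
qed

lemma linearization_continuous:
  assumes "linearization T z0 \<Phi>"
  shows "continuous_on {0..T} \<Phi>"
  using assms has_vector_derivative_continuous
  unfolding linearization_def continuous_on_eq_continuous_within by blast

end

text \<open>Two pieces that are Lipschitz on their own sides of the moving interface \<open>t = \<tau> z\<close> and agree on it
  glue to a Lipschitz map: two points on different sides are compared through an interface point.\<close>

lemma lipschitz_glue:
  fixes G :: "real \<Rightarrow> 'z::real_normed_vector \<Rightarrow> 'b::real_normed_vector" and \<tau> :: "'z \<Rightarrow> real"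
  assumes r1: "\<And>t t' z z'. t \<in> T \<Longrightarrow> t' \<in> T \<Longrightarrow> z \<in> A \<Longrightarrow> z' \<in> A \<Longrightarrow> t \<le> \<tau> z \<Longrightarrow> t' \<le> \<tau> z' \<Longrightarrow>
      norm (G t z - G t' z') \<le> C * (\<bar>t - t'\<bar> + norm (z - z'))"
    and r2: "\<And>t t' z z'. t \<in> T \<Longrightarrow> t' \<in> T \<Longrightarrow> z \<in> A \<Longrightarrow> z' \<in> A \<Longrightarrow> \<tau> z \<le> t \<Longrightarrow> \<tau> z' \<le> t' \<Longrightarrow>
      norm (G t z - G t' z') \<le> C * (\<bar>t - t'\<bar> + norm (z - z'))"
    and \<tau>: "\<And>z z'. z \<in> A \<Longrightarrow> z' \<in> A \<Longrightarrow> \<bar>\<tau> z - \<tau> z'\<bar> \<le> K * norm (z - z')" "\<And>z. z \<in> A \<Longrightarrow> \<tau> z \<in> T"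
    and "C \<ge> 0" "K \<ge> 0" and a: "t \<in> T" "t' \<in> T" "z \<in> A" "z' \<in> A"
  shows "norm (G t z - G t' z') \<le> C * (3 + 2 * K) * (\<bar>t - t'\<bar> + norm (z - z'))"
proof -
  let ?d = "\<bar>t - t'\<bar> + norm (z - z')"
  have same: "C * ?d \<le> C * (3 + 2 * K) * ?d"
    using mult_left_mono[OF mult_right_mono[of 1 "3 + 2 * K" ?d] \<open>C \<ge> 0\<close>] \<open>K \<ge> 0\<close>
    by (simp add: mult.assoc)
  have mixed: "norm (G t z - G t' z') \<le> C * (3 + 2 * K) * (\<bar>t - t'\<bar> + norm (z - z'))"
    if a: "t \<in> T" "t' \<in> T" "z \<in> A" "z' \<in> A" and side: "t \<le> \<tau> z" "\<tau> z' \<le> t'" for t t' z z'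
  proof -
    let ?n = "norm (z - z')"
    have 1: "\<bar>t' - \<tau> z'\<bar> \<le> \<bar>t - t'\<bar> + K * ?n"
      using \<tau>(1)[OF a(3,4)] side by linarith
    have 2: "\<bar>t - \<tau> z'\<bar> \<le> 2 * \<bar>t - t'\<bar> + K * ?n"
      using 1 abs_triangle_ineq[of "t - t'" "t' - \<tau> z'"] by simp
    have "norm (G t z - G t' z') \<le> norm (G t z - G (\<tau> z') z') + norm (G (\<tau> z') z' - G t' z')"
      using norm_triangle_ineq[of "G t z - G (\<tau> z') z'" "G (\<tau> z') z' - G t' z'"] by simp
    also have "\<dots> \<le> C * (\<bar>t - \<tau> z'\<bar> + ?n) + C * (\<bar>\<tau> z' - t'\<bar> + norm (z' - z'))"
      by (intro add_mono r1 r2 a side \<tau>(2)) auto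
    also have "\<dots> = C * (\<bar>t - \<tau> z'\<bar> + ?n + \<bar>t' - \<tau> z'\<bar>)"
      by (simp add: algebra_simps abs_minus_commute)
    also have "\<dots> \<le> C * ((3 + 2 * K) * (\<bar>t - t'\<bar> + ?n))"
    proof (rule mult_left_mono[OF _ \<open>C \<ge> 0\<close>])
      have "0 \<le> K * \<bar>t - t'\<bar>" "0 \<le> ?n" using \<open>K \<ge> 0\<close> by simp_all
      moreover have "(3 + 2 * K) * (\<bar>t - t'\<bar> + ?n) = 3 * \<bar>t - t'\<bar> + 3 * ?n + 2 * (K * \<bar>t - t'\<bar>) + 2 * (K * ?n)"
        by (simp add: distrib_left distrib_right)
      ultimately show "\<bar>t - \<tau> z'\<bar> + ?n + \<bar>t' - \<tau> z'\<bar> \<le> (3 + 2 * K) * (\<bar>t - t'\<bar> + ?n)"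
        using 1 2 by linarith
    qed
    finally show ?thesis by (simp add: mult.assoc)
  qed
  consider "t \<le> \<tau> z" "t' \<le> \<tau> z'" | "\<tau> z \<le> t" "\<tau> z' \<le> t'" | "t \<le> \<tau> z" "\<tau> z' \<le> t'" | "\<tau> z \<le> t" "t' \<le> \<tau> z'"
    by linarith
  then show ?thesis
  proof cases
    case 1
    then show ?thesis using r1[OF a] same by linarith
  next
    case 2
    then show ?thesis using r2[OF a] same by linarith
  next
    case 3
    then show ?thesis using mixed[OF a] by simp
  next
    case 4
    then show ?thesis
      using mixed[OF a(2,1,4,3)] by (simp add: norm_minus_commute abs_minus_commute)
  qed
qed

text \<open>The point \<open>zb0\<close> starts a trajectory of the first Hamiltonian that reaches the switching set for the first time at
  \<open>tb1\<close>, crosses it transversally, and continues with the second Hamiltonian up to \<open>tf\<close>.\<close>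

locale broken_extremal =
  H1: ham_flow X H1 \<zeta>1 + H2: ham_flow X H2 \<zeta>2
  for X :: "(real ^ 'n) set" and H1 H2 :: "(real ^ 'n) \<times> (real ^ 'n) \<Rightarrow> real" and \<zeta>1 \<zeta>2 +
  fixes t1 :: "(real ^ 'n) \<times> (real ^ 'n) \<Rightarrow> real" and zb0 :: "(real ^ 'n) \<times> (real ^ 'n)" and tb1 tf :: real
  assumes zb0: "zb0 \<in> cotangent X" and tb1: "0 < tb1" "tb1 < tf"
    and switching: "switching_time X H1 H2 \<zeta>1 zb0 tb1 t1"
    and dominance1: "\<And>t. t \<in> {0..<tb1} \<Longrightarrow> \<zeta>1 t zb0 \<in> dominance_set X H1 H2"
    and dominance2: "\<And>s. s \<in> {0<..tf - tb1} \<Longrightarrow> \<zeta>2 s (\<zeta>1 tb1 zb0) \<in> dominance_set X H2 H1"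
    and bracket: "poisson_bracket H1 H2 (\<zeta>1 tb1 zb0) > 0"
begin

abbreviation "W \<equiv> cotangent X"
abbreviation "zb1 \<equiv> \<zeta>1 tb1 zb0"
abbreviation "contact z \<equiv> \<zeta>1 (t1 z) z"
abbreviation "broken t z \<equiv> broken_flow \<zeta>1 \<zeta>2 t1 t z"
abbreviation "F1 \<equiv> ham_vec H1 zb1"
abbreviation "F2 \<equiv> ham_vec H2 zb1"

lemma tf: "tf > 0" using tb1 by simp

lemma zb1: "zb1 \<in> W" by (rule H1.flow_in[OF zb0])

lemma t1_zb0: "t1 zb0 = tb1"
  using switching by (auto simp: switching_time_def)

text \<open>The contact time is Lipschitz, being continuously differentiable, and so is the contact point; the radius
  keeps the contact points where the second flow is Lipschitz.\<close>

lemma contact_lipschitz: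
  obtains r K where "r > 0" "K > 0" "ball zb0 r \<subseteq> W"
    "\<And>z. z \<in> ball zb0 r \<Longrightarrow> t1 z \<in> {0<..<tf} \<and> contact z \<in> switching_set X H1 H2 \<and> contact z \<in> W"
    "\<And>z z'. z \<in> ball zb0 r \<Longrightarrow> z' \<in> ball zb0 r \<Longrightarrow> \<bar>t1 z - t1 z'\<bar> \<le> K * norm (z - z')"
    "\<And>z z'. z \<in> ball zb0 r \<Longrightarrow> z' \<in> ball zb0 r \<Longrightarrow> norm (contact z - contact z') \<le> K * norm (z - z')"
    "\<And>z z' s s'. z \<in> ball zb0 r \<Longrightarrow> z' \<in> ball zb0 r \<Longrightarrow> s \<in> {0..tf} \<Longrightarrow> s' \<in> {0..tf} \<Longrightarrow>
       norm (\<zeta>1 s z - \<zeta>1 s' z') \<le> K * (\<bar>s - s'\<bar> + norm (z - z'))"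
    "\<And>z z' s s'. z \<in> ball zb0 r \<Longrightarrow> z' \<in> ball zb0 r \<Longrightarrow> s \<in> {0..tf} \<Longrightarrow> s' \<in> {0..tf} \<Longrightarrow>
       norm (\<zeta>2 s (contact z) - \<zeta>2 s' (contact z')) \<le> K * (\<bar>s - s'\<bar> + norm (z - z'))"
proof -
  obtain N where N: "open N" "zb0 \<in> N" "N \<subseteq> W" "smooth_on N t1" "\<And>z. z \<in> N \<Longrightarrow> contact z \<in> switching_set X H1 H2"
    using switching by (auto simp: switching_time_def)
  have "Ck_on_open (Suc 0) N t1" using N(4) smooth_on_open_iff[OF N(1)] by blast
  note t1' = Ck_on_open_Suc_0_blinfun[OF this]
  define dt1 where "dt1 = Blinfun (frechet_derivative t1 (at zb0))"
  obtain r1 where r1: "r1 > 0" "\<And>k. k \<in> {zb0} \<Longrightarrow> ball k r1 \<subseteq> N"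
    "\<And>k z z'. k \<in> {zb0} \<Longrightarrow> z \<in> ball k r1 \<Longrightarrow> z' \<in> ball k r1 \<Longrightarrow>
       norm (t1 z - t1 z' - Blinfun (frechet_derivative t1 (at k)) (z - z')) \<le> 1 * norm (z - z')"
    by (rule uniform_strict_derivative[OF N(1) t1'(2,3), of "{zb0}" 1]) (use N(2) that in auto)
  define Kt where "Kt = 1 + norm dt1"
  have Kt: "Kt > 0" by (simp add: Kt_def add_pos_nonneg)
  have t1_lip: "\<bar>t1 z - t1 z'\<bar> \<le> Kt * norm (z - z')" if "z \<in> ball zb0 r1" "z' \<in> ball zb0 r1" for z z'
  proof -
    have "\<bar>t1 z - t1 z'\<bar> \<le> \<bar>t1 z - t1 z' - dt1 (z - z')\<bar> + \<bar>dt1 (z - z')\<bar>" by linarith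
    also have "\<dots> \<le> 1 * norm (z - z') + norm dt1 * norm (z - z')"
      using r1(3)[OF _ that] norm_blinfun[of dt1 "z - z'"] by (intro add_mono) (auto simp: dt1_def)
    finally show ?thesis by (simp add: Kt_def algebra_simps)
  qed
  obtain ra Ca where a: "ra > 0" "Ca > 0" "ball zb0 ra \<subseteq> W"
    "\<And>z z' s s'. z \<in> ball zb0 ra \<Longrightarrow> z' \<in> ball zb0 ra \<Longrightarrow> s \<in> {0..tf} \<Longrightarrow> s' \<in> {0..tf} \<Longrightarrow>
       norm (\<zeta>1 s z - \<zeta>1 s' z') \<le> Ca * (norm (z - z') + \<bar>s - s'\<bar>)"
    by (rule H1.flow_lipschitz[OF less_imp_le[OF tf] zb0]) (rule that)
  obtain rb Cb where b: "rb > 0" "Cb > 0" "ball zb1 rb \<subseteq> W"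
    "\<And>z z' s s'. z \<in> ball zb1 rb \<Longrightarrow> z' \<in> ball zb1 rb \<Longrightarrow> s \<in> {0..tf} \<Longrightarrow> s' \<in> {0..tf} \<Longrightarrow>
       norm (\<zeta>2 s z - \<zeta>2 s' z') \<le> Cb * (norm (z - z') + \<bar>s - s'\<bar>)"
    by (rule H2.flow_lipschitz[OF less_imp_le[OF tf] zb1]) (rule that)
  define Ky where "Ky = Ca * (1 + Kt)"
  have Ky: "Ky > 0" using a(2) Kt by (simp add: Ky_def)
  define g where "g = min tb1 (tf - tb1)"
  have g: "g > 0" using tb1 by (simp add: g_def)
  define r where "r = min (min r1 ra) (min (g / Kt) (rb / Ky))"
  have r: "r > 0" "r \<le> r1" "r \<le> ra" "r \<le> g / Kt" "r \<le> rb / Ky"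
    using r1(1) a(1) b(1) g Kt Ky by (auto simp: r_def)
  have sub: "ball zb0 r \<subseteq> ball zb0 r1" "ball zb0 r \<subseteq> ball zb0 ra" "zb0 \<in> ball zb0 r" using r by auto
  have time: "t1 z \<in> {0<..<tf}" if "z \<in> ball zb0 r" for z
  proof -
    have "\<bar>t1 z - tb1\<bar> \<le> Kt * norm (z - zb0)"
      using t1_lip[of z zb0] that sub r by (auto simp: t1_zb0)
    also have "\<dots> < Kt * (g / Kt)"
      using that r(4) Kt by (intro mult_strict_left_mono) (auto simp: dist_norm norm_minus_commute)
    finally show ?thesis using Kt tb1 by (auto simp: g_def)
  qed
  have y_lip: "norm (contact z - contact z') \<le> Ky * norm (z - z')" if z: "z \<in> ball zb0 r" "z' \<in> ball zb0 r" for z z'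
  proof -
    have "norm (contact z - contact z') \<le> Ca * (norm (z - z') + \<bar>t1 z - t1 z'\<bar>)"
      using z sub time[OF z(1)] time[OF z(2)] by (intro a(4)) auto
    also have "\<dots> \<le> Ca * (norm (z - z') + Kt * norm (z - z'))"
      using z sub a(2) by (intro mult_left_mono add_left_mono t1_lip) auto
    finally show ?thesis by (simp add: Ky_def algebra_simps)
  qed
  have y_in: "contact z \<in> ball zb1 rb" if "z \<in> ball zb0 r" for z
  proof -
    have "norm (contact z - zb1) \<le> Ky * norm (z - zb0)" using y_lip[OF that sub(3)] by (simp add: t1_zb0)
    also have "\<dots> < Ky * (rb / Ky)"
      using that r(5) Ky by (intro mult_strict_left_mono) (auto simp: dist_norm norm_minus_commute)
    finally show ?thesis using Ky by (simp add: dist_norm norm_minus_commute)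
  qed
  define K where "K = Kt + Ky + Ca + Cb * (1 + Ky)"
  have K: "K > 0" "Kt \<le> K" "Ky \<le> K" "Ca \<le> K" "Cb * (1 + Ky) \<le> K"
    using Kt Ky a(2) b(2) by (auto simp: K_def intro!: add_pos_nonneg)
  show ?thesis
  proof (rule that[of r K])
    show "ball zb0 r \<subseteq> W" using sub(2) a(3) by auto
    fix z assume z: "z \<in> ball zb0 r"
    then have "z \<in> N" "z \<in> W" using sub(1,2) r1(2) a(3) by auto
    then show "t1 z \<in> {0<..<tf} \<and> contact z \<in> switching_set X H1 H2 \<and> contact z \<in> W"
      using N(5) time[OF z] H1.flow_in by blast
  next
    fix z z' assume z: "z \<in> ball zb0 r" "z' \<in> ball zb0 r"
    have "Kt * norm (z - z') \<le> K * norm (z - z')" "Ky * norm (z - z') \<le> K * norm (z - z')"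
      using K by (auto intro: mult_right_mono)
    moreover have "\<bar>t1 z - t1 z'\<bar> \<le> Kt * norm (z - z')" using z sub by (intro t1_lip) auto
    ultimately show "\<bar>t1 z - t1 z'\<bar> \<le> K * norm (z - z')" "norm (contact z - contact z') \<le> K * norm (z - z')"
      using y_lip[OF z] by linarith+
    fix s s' assume s: "s \<in> {0..tf}" "s' \<in> {0..tf}"
    have "norm (\<zeta>1 s z - \<zeta>1 s' z') \<le> Ca * (norm (z - z') + \<bar>s - s'\<bar>)"
      using z sub s by (intro a(4)) auto
    also have "\<dots> \<le> K * (norm (z - z') + \<bar>s - s'\<bar>)" using K by (intro mult_right_mono) auto
    finally show "norm (\<zeta>1 s z - \<zeta>1 s' z') \<le> K * (\<bar>s - s'\<bar> + norm (z - z'))" by (simp add: add.commute)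
    have "norm (\<zeta>2 s (contact z) - \<zeta>2 s' (contact z')) \<le> Cb * (norm (contact z - contact z') + \<bar>s - s'\<bar>)"
      by (intro b(4) y_in z s)
    also have "\<dots> \<le> Cb * (Ky * norm (z - z') + \<bar>s - s'\<bar>)"
      using y_lip[OF z] b(2) by (intro mult_left_mono add_right_mono) auto
    also have "\<dots> \<le> Cb * ((1 + Ky) * (\<bar>s - s'\<bar> + norm (z - z')))"
      using b(2) Ky by (intro mult_left_mono) (auto simp: algebra_simps)
    also have "\<dots> = (Cb * (1 + Ky)) * (\<bar>s - s'\<bar> + norm (z - z'))" by simp
    also have "\<dots> \<le> K * (\<bar>s - s'\<bar> + norm (z - z'))" using K by (intro mult_right_mono) auto
    finally show "norm (\<zeta>2 s (contact z) - \<zeta>2 s' (contact z')) \<le> K * (\<bar>s - s'\<bar> + norm (z - z'))" .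
  qed (use r K in auto)
qed

lemma broken_before: "t \<le> t1 z \<Longrightarrow> broken t z = \<zeta>1 t z"
  by (simp add: broken_flow_def)

lemma broken_after: "t1 z \<le> t \<Longrightarrow> contact z \<in> W \<Longrightarrow> broken t z = \<zeta>2 (t - t1 z) (contact z)"
  by (cases "t = t1 z") (auto simp: broken_flow_def H2.flow_0)

end

context broken_extremal
begin

text \<open>A continuously differentiable function is strictly differentiable at each point.\<close>

lemma contact_time_strict_derivative:
  obtains dt1 :: "((real ^ 'n) \<times> (real ^ 'n)) \<Rightarrow>\<^sub>L real" where
    "\<And>e. e > 0 \<Longrightarrow> \<exists>r>0. \<forall>z\<in>ball zb0 r. \<forall>z'\<in>ball zb0 r. \<bar>t1 z - t1 z' - dt1 (z - z')\<bar> \<le> e * norm (z - z')"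
proof -
  obtain N where N: "open N" "zb0 \<in> N" "smooth_on N t1"
    using switching by (auto simp: switching_time_def)
  have "Ck_on_open (Suc 0) N t1" using N(3) smooth_on_open_iff[OF N(1)] by blast
  note t1' = Ck_on_open_Suc_0_blinfun[OF this]
  show ?thesis
  proof (rule that)
    fix e :: real assume e: "e > 0"
    obtain r where r: "r > 0" "\<And>k. k \<in> {zb0} \<Longrightarrow> ball k r \<subseteq> N"
      "\<And>k z z'. k \<in> {zb0} \<Longrightarrow> z \<in> ball k r \<Longrightarrow> z' \<in> ball k r \<Longrightarrow>
         norm (t1 z - t1 z' - Blinfun (frechet_derivative t1 (at k)) (z - z')) \<le> e * norm (z - z')"
      by (rule uniform_strict_derivative[OF N(1) t1'(2,3), of "{zb0}" e]) (use N(2) e that in auto)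
    show "\<exists>r>0. \<forall>z\<in>ball zb0 r. \<forall>z'\<in>ball zb0 r.
        \<bar>t1 z - t1 z' - Blinfun (frechet_derivative t1 (at zb0)) (z - z')\<bar> \<le> e * norm (z - z')"
      using r(1) r(3)[of zb0] by (intro exI[of _ r]) auto
  qed
qed

end

locale linearized_broken_extremal = broken_extremal X H1 H2 \<zeta>1 \<zeta>2 t1 zb0 tb1 tf
  for X :: "(real ^ 'n) set" and H1 H2 \<zeta>1 \<zeta>2 t1 zb0 tb1 tf +
  fixes \<Phi>1 \<Phi>2 :: "real \<Rightarrow> ((real ^ 'n) \<times> (real ^ 'n)) \<Rightarrow>\<^sub>L ((real ^ 'n) \<times> (real ^ 'n))"
    and dt1 :: "((real ^ 'n) \<times> (real ^ 'n)) \<Rightarrow>\<^sub>L real"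
  assumes \<Phi>1: "H1.linearization tf zb0 \<Phi>1" and \<Phi>2: "H2.linearization tf zb1 \<Phi>2"
    and dt1: "\<And>e. e > 0 \<Longrightarrow> \<exists>r>0. \<forall>z\<in>ball zb0 r. \<forall>z'\<in>ball zb0 r. \<bar>t1 z - t1 z' - dt1 (z - z')\<bar> \<le> e * norm (z - z')"
begin

text \<open>The derivative of the broken flow at elapsed time \<open>\<sigma>\<close> after the contact: the variation of the
  contact point is transported by the second flow, and the delay of the contact is subtracted.\<close>

definition \<Psi> :: "real \<Rightarrow> ((real ^ 'n) \<times> (real ^ 'n)) \<Rightarrow>\<^sub>L ((real ^ 'n) \<times> (real ^ 'n))" where
  "\<Psi> \<sigma> = (\<Phi>2 \<sigma> o\<^sub>L (\<Phi>1 tb1 + (blinfun_scaleR_left F1 o\<^sub>L dt1)))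
     - (blinfun_scaleR_left (ham_vec H2 (\<zeta>2 \<sigma> zb1)) o\<^sub>L dt1)"

lemma \<Psi>_apply: "\<Psi> \<sigma> v = \<Phi>2 \<sigma> (\<Phi>1 tb1 v + dt1 v *\<^sub>R F1) - dt1 v *\<^sub>R ham_vec H2 (\<zeta>2 \<sigma> zb1)"
  by (simp add: \<Psi>_def blinfun.diff_left blinfun.add_left)

lemma \<Psi>_0: "\<Psi> 0 v = \<Phi>1 tb1 v + dt1 v *\<^sub>R (F1 - F2)"
  using \<Phi>2 zb1 by (simp add: \<Psi>_apply H2.linearization_def H2.flow_0 algebra_simps)

lemma \<Phi>1_cont: "continuous_on {0..tf} \<Phi>1"
  by (rule H1.linearization_continuous[OF \<Phi>1])

lemma \<Psi>_cont: "continuous_on {0..tf} \<Psi>"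
proof -
  have "continuous_on {0..tf} (\<lambda>\<sigma>. ham_vec H2 (\<zeta>2 \<sigma> zb1))"
    using H2.flow_in[OF zb1] by (intro continuous_on_compose2[OF H2.F_cont H2.flow_cont[OF zb1]]) auto
  then show ?thesis
    unfolding \<Psi>_def by (intro continuous_intros H2.linearization_continuous[OF \<Phi>2]
        bounded_linear.continuous_on[OF bounded_linear_blinfun_scaleR_left])
qed

text \<open>Strict differentiability of the broken flow: two nearby trajectories are compared on the same
  side of the contact, or while only one of them has passed it.  In the latter case the time since the
  earlier contact is a fraction \<open>\<mu>\<close> of the delay between the two contacts, and the two trajectories have separated with the
  difference of the two velocities during this time.\<close>

lemma broken_strict_derivative:
  assumes "e > 0"
  obtains r where "r > 0"
    "\<And>z z' t. z \<in> ball zb0 r \<Longrightarrow> z' \<in> ball zb0 r \<Longrightarrow> t \<in> {0..tf} \<Longrightarrow> t \<le> t1 z \<Longrightarrow> t \<le> t1 z' \<Longrightarrow>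
       norm (broken t z - broken t z' - \<Phi>1 (min t tb1) (z - z')) \<le> e * norm (z - z')"
    "\<And>z z' t. z \<in> ball zb0 r \<Longrightarrow> z' \<in> ball zb0 r \<Longrightarrow> t \<in> {0..tf} \<Longrightarrow> t1 z \<le> t \<Longrightarrow> t1 z' \<le> t \<Longrightarrow>
       norm (broken t z - broken t z' - \<Psi> (max (t - tb1) 0) (z - z')) \<le> e * norm (z - z')"
    "\<And>z z' t. z \<in> ball zb0 r \<Longrightarrow> z' \<in> ball zb0 r \<Longrightarrow> t \<in> {0..tf} \<Longrightarrow> t1 z' \<le> t \<Longrightarrow> t \<le> t1 z \<Longrightarrow>
       \<exists>\<mu>\<in>{0..1}. norm (broken t z - broken t z' - (\<Phi>1 tb1 (z - z') + (\<mu> * dt1 (z - z')) *\<^sub>R (F1 - F2))) \<le> e * norm (z - z')"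
proof -
  obtain r0 K where rK: "r0 > 0" "K > 0" "ball zb0 r0 \<subseteq> W"
    "\<And>z. z \<in> ball zb0 r0 \<Longrightarrow> t1 z \<in> {0<..<tf} \<and> contact z \<in> switching_set X H1 H2 \<and> contact z \<in> W"
    "\<And>z z'. z \<in> ball zb0 r0 \<Longrightarrow> z' \<in> ball zb0 r0 \<Longrightarrow> \<bar>t1 z - t1 z'\<bar> \<le> K * norm (z - z')"
    "\<And>z z'. z \<in> ball zb0 r0 \<Longrightarrow> z' \<in> ball zb0 r0 \<Longrightarrow> norm (contact z - contact z') \<le> K * norm (z - z')"
    "\<And>z z' s s'. z \<in> ball zb0 r0 \<Longrightarrow> z' \<in> ball zb0 r0 \<Longrightarrow> s \<in> {0..tf} \<Longrightarrow> s' \<in> {0..tf} \<Longrightarrow>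
       norm (\<zeta>1 s z - \<zeta>1 s' z') \<le> K * (\<bar>s - s'\<bar> + norm (z - z'))"
    "\<And>z z' s s'. z \<in> ball zb0 r0 \<Longrightarrow> z' \<in> ball zb0 r0 \<Longrightarrow> s \<in> {0..tf} \<Longrightarrow> s' \<in> {0..tf} \<Longrightarrow>
       norm (\<zeta>2 s (contact z) - \<zeta>2 s' (contact z')) \<le> K * (\<bar>s - s'\<bar> + norm (z - z'))"
    by (rule contact_lipschitz) (rule that)
  have "bounded (\<Phi>2 ` {0..tf})" "bounded ((\<lambda>\<sigma>. ham_vec H2 (\<zeta>2 \<sigma> zb1)) ` {0..tf})"
    using H2.flow_in[OF zb1]
    by (auto intro!: compact_imp_bounded compact_continuous_image H2.linearization_continuous[OF \<Phi>2]
        continuous_on_compose2[OF H2.F_cont H2.flow_cont[OF zb1]])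
  then obtain P G where P: "P > 0" "\<And>\<sigma>. \<sigma> \<in> {0..tf} \<Longrightarrow> norm (\<Phi>2 \<sigma>) \<le> P"
    and G: "G > 0" "\<And>\<sigma>. \<sigma> \<in> {0..tf} \<Longrightarrow> norm (ham_vec H2 (\<zeta>2 \<sigma> zb1)) \<le> G"
    unfolding bounded_pos by auto
  define A where "A = 2 * K + P * (1 + K + norm F1) + G + (1 + 2 * K + norm (F1 - F2))"
  have A: "A > 0" "2 * K + P * (1 + K + norm F1) + G \<le> A" "1 + 2 * K + norm (F1 - F2) \<le> A" "1 \<le> A"
    using rK(2) P(1) G(1) by (auto simp: A_def add_pos_nonneg intro!: add_nonneg_nonneg mult_nonneg_nonneg)
  define e1 where "e1 = e / A"
  have e1: "e1 > 0" "e1 * A = e" using \<open>e > 0\<close> A(1) by (auto simp: e1_def)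
  obtain ra where ra: "ra > 0" "\<And>z z' s s' \<sigma>. z \<in> ball zb0 ra \<Longrightarrow> z' \<in> ball zb0 ra \<Longrightarrow> s \<in> {0..tf} \<Longrightarrow> s' \<in> {0..tf} \<Longrightarrow>
       \<sigma> \<in> {0..tf} \<Longrightarrow> \<bar>s - \<sigma>\<bar> < ra \<Longrightarrow> \<bar>s' - \<sigma>\<bar> < ra \<Longrightarrow>
       norm (\<zeta>1 s z - \<zeta>1 s' z' - \<Phi>1 \<sigma> (z - z') - (s - s') *\<^sub>R ham_vec H1 (\<zeta>1 \<sigma> zb0)) \<le> e1 * (norm (z - z') + \<bar>s - s'\<bar>)"
    by (rule H1.linearizationE[OF \<Phi>1 e1(1)]) (rule that)
  obtain rb where rb: "rb > 0" "\<And>z z' s s' \<sigma>. z \<in> ball zb1 rb \<Longrightarrow> z' \<in> ball zb1 rb \<Longrightarrow> s \<in> {0..tf} \<Longrightarrow> s' \<in> {0..tf} \<Longrightarrow>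
       \<sigma> \<in> {0..tf} \<Longrightarrow> \<bar>s - \<sigma>\<bar> < rb \<Longrightarrow> \<bar>s' - \<sigma>\<bar> < rb \<Longrightarrow>
       norm (\<zeta>2 s z - \<zeta>2 s' z' - \<Phi>2 \<sigma> (z - z') - (s - s') *\<^sub>R ham_vec H2 (\<zeta>2 \<sigma> zb1)) \<le> e1 * (norm (z - z') + \<bar>s - s'\<bar>)"
    by (rule H2.linearizationE[OF \<Phi>2 e1(1)]) (rule that)
  obtain rc where rc: "rc > 0" "\<And>z z'. z \<in> ball zb0 rc \<Longrightarrow> z' \<in> ball zb0 rc \<Longrightarrow>
      \<bar>t1 z - t1 z' - dt1 (z - z')\<bar> \<le> e1 * norm (z - z')"
    using dt1[OF e1(1)] by blast
  define r where "r = min (min r0 (min ra rc)) (min (ra / K) (rb / (2 * K)))"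
  have r: "r > 0" "r \<le> r0" "r \<le> ra" "r \<le> rc" "r \<le> ra / K" "r \<le> rb / (2 * K)"
    using rK ra rb rc by (auto simp: r_def)
  have sub: "ball zb0 r \<subseteq> ball zb0 r0" "ball zb0 r \<subseteq> ball zb0 ra" "ball zb0 r \<subseteq> ball zb0 rc" "zb0 \<in> ball zb0 r"
    using r by auto
  have Kr: "K * norm (z - zb0) < ra" "K * norm (z - zb0) < rb / 2" if "z \<in> ball zb0 r" for z
  proof -
    have "K * norm (z - zb0) < K * r" using that rK(2) by (simp add: dist_norm norm_minus_commute)
    moreover have "K * r \<le> ra" "K * r \<le> rb / 2" using r(5,6) rK(2) by (auto simp: field_simps)
    ultimately show "K * norm (z - zb0) < ra" "K * norm (z - zb0) < rb / 2" by linarith+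
  qed
  have tau: "\<bar>t1 z - tb1\<bar> < ra" "\<bar>t1 z - tb1\<bar> < rb / 2" "t1 z \<in> {0..tf}" if z: "z \<in> ball zb0 r" for z
  proof -
    have z0: "z \<in> ball zb0 r0" "zb0 \<in> ball zb0 r0" using z sub by blast+
    show "\<bar>t1 z - tb1\<bar> < ra" "\<bar>t1 z - tb1\<bar> < rb / 2"
      using rK(5)[OF z0] Kr[OF z] by (simp_all add: t1_zb0)
    show "t1 z \<in> {0..tf}" using rK(4)[OF z0(1)] by auto
  qed
  have cont: "contact z \<in> ball zb1 rb" "contact z \<in> W" if z: "z \<in> ball zb0 r" for z
  proof -
    have z0: "z \<in> ball zb0 r0" "zb0 \<in> ball zb0 r0" using z sub by blast+
    show "contact z \<in> ball zb1 rb"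
      using rK(6)[OF z0] Kr(2)[OF z] rb(1) by (simp add: t1_zb0 dist_norm norm_minus_commute)
    show "contact z \<in> W" using rK(4)[OF z0(1)] by simp
  qed
  have tbT: "tb1 \<in> {0..tf}" using tb1 by simp
  show ?thesis
  proof (rule that[OF r(1)])
    fix z z' t assume z: "z \<in> ball zb0 r" "z' \<in> ball zb0 r" and t: "t \<in> {0..tf}"
    let ?v = "z - z'"
    have z0: "z \<in> ball zb0 r0" "z' \<in> ball zb0 r0" "z \<in> ball zb0 ra" "z' \<in> ball zb0 ra" "z \<in> ball zb0 rc" "z' \<in> ball zb0 rc"
      using z sub by blast+
    have dtau: "\<bar>t1 z - t1 z'\<bar> \<le> K * norm ?v" by (rule rK(5)[OF z0(1,2)])
    have dtau': "\<bar>t1 z - t1 z' - dt1 ?v\<bar> \<le> e1 * norm ?v" by (rule rc(2)[OF z0(5,6)])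
    {
      assume le: "t \<le> t1 z" "t \<le> t1 z'"
      have "norm (\<zeta>1 t z - \<zeta>1 t z' - \<Phi>1 (min t tb1) ?v - (t - t) *\<^sub>R ham_vec H1 (\<zeta>1 (min t tb1) zb0)) \<le> e1 * (norm ?v + \<bar>t - t\<bar>)"
        using t tbT le tau[OF z(1)] ra(1) by (intro ra(2) z0) auto
      then have "norm (broken t z - broken t z' - \<Phi>1 (min t tb1) ?v) \<le> e1 * norm ?v"
        using le by (simp add: broken_before)
      also have "\<dots> \<le> e1 * A * norm ?v"
        using e1(1) A(4) by (intro mult_right_mono) auto
      finally show "norm (broken t z - broken t z' - \<Phi>1 (min t tb1) ?v) \<le> e * norm ?v"
        using e1(2) by simp
    }
    {
      assume le: "t1 z \<le> t" "t1 z' \<le> t"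
      define \<sigma> where "\<sigma> = max (t - tb1) 0"
      have \<sigma>: "\<sigma> \<in> {0..tf}" using t tb1 by (auto simp: \<sigma>_def)
      let ?y = "contact z" and ?y' = "contact z'" and ?\<Delta> = "t1 z - t1 z'"
      define a where "a = \<zeta>2 (t - t1 z) ?y - \<zeta>2 (t - t1 z') ?y' - \<Phi>2 \<sigma> (?y - ?y')
          - ((t - t1 z) - (t - t1 z')) *\<^sub>R ham_vec H2 (\<zeta>2 \<sigma> zb1)"
      define b where "b = ?y - ?y' - \<Phi>1 tb1 ?v - ?\<Delta> *\<^sub>R F1"
      have na: "norm a \<le> e1 * (2 * K) * norm ?v"
      proof -
        have "norm a \<le> e1 * (norm (?y - ?y') + \<bar>(t - t1 z) - (t - t1 z')\<bar>)"
          unfolding a_def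
        proof (intro rb(2) cont z \<sigma>)
          show "t - t1 z \<in> {0..tf}" "t - t1 z' \<in> {0..tf}"
            using t le tau(3)[OF z(1)] tau(3)[OF z(2)] by auto
          show "\<bar>t - t1 z - \<sigma>\<bar> < rb" "\<bar>t - t1 z' - \<sigma>\<bar> < rb"
            using le tau(2)[OF z(1)] tau(2)[OF z(2)] rb(1) unfolding \<sigma>_def max_def abs_if
            by (simp_all split: if_splits)
        qed
        also have "\<dots> \<le> e1 * (K * norm ?v + K * norm ?v)"
          using rK(6)[OF z0(1,2)] dtau e1(1) by (intro mult_left_mono add_mono) auto
        finally show ?thesis by (simp add: algebra_simps)
      qed
      have nb: "norm b \<le> e1 * (1 + K) * norm ?v"
      proof -
        have "norm b \<le> e1 * (norm ?v + \<bar>?\<Delta>\<bar>)"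
          unfolding b_def by (intro ra(2) z0 tau z tbT)
        also have "\<dots> \<le> e1 * (norm ?v + K * norm ?v)"
          using dtau e1(1) by (intro mult_left_mono add_mono) auto
        finally show ?thesis by (simp add: algebra_simps)
      qed
      have eq: "broken t z - broken t z' - \<Psi> \<sigma> ?v =
          a + \<Phi>2 \<sigma> (b + (?\<Delta> - dt1 ?v) *\<^sub>R F1) - (?\<Delta> - dt1 ?v) *\<^sub>R ham_vec H2 (\<zeta>2 \<sigma> zb1)"
        using le cont z
        by (simp add: broken_after a_def b_def \<Psi>_apply blinfun.add_right blinfun.diff_right blinfun.scaleR_right algebra_simps)
      have "norm (broken t z - broken t z' - \<Psi> \<sigma> ?v) \<le>
          norm a + norm (\<Phi>2 \<sigma> (b + (?\<Delta> - dt1 ?v) *\<^sub>R F1)) + norm ((?\<Delta> - dt1 ?v) *\<^sub>R ham_vec H2 (\<zeta>2 \<sigma> zb1))"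
        unfolding eq by (intro order_trans[OF norm_triangle_ineq4] add_right_mono norm_triangle_ineq)
      also have "norm ((?\<Delta> - dt1 ?v) *\<^sub>R ham_vec H2 (\<zeta>2 \<sigma> zb1)) \<le> (e1 * norm ?v) * G"
        using dtau' G(2)[OF \<sigma>] e1(1) by (simp add: mult_mono)
      also have "norm (\<Phi>2 \<sigma> (b + (?\<Delta> - dt1 ?v) *\<^sub>R F1)) \<le> norm (\<Phi>2 \<sigma>) * norm (b + (?\<Delta> - dt1 ?v) *\<^sub>R F1)"
        by (rule norm_blinfun)
      also have "\<dots> \<le> P * (e1 * (1 + K) * norm ?v + (e1 * norm ?v) * norm F1)"
      proof (rule mult_mono[OF P(2)[OF \<sigma>]])
        have "norm (b + (?\<Delta> - dt1 ?v) *\<^sub>R F1) \<le> norm b + \<bar>?\<Delta> - dt1 ?v\<bar> * norm F1"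
          using norm_triangle_ineq[of b "(?\<Delta> - dt1 ?v) *\<^sub>R F1"] by simp
        also have "\<dots> \<le> e1 * (1 + K) * norm ?v + (e1 * norm ?v) * norm F1"
          using nb dtau' by (intro add_mono mult_right_mono) auto
        finally show "norm (b + (?\<Delta> - dt1 ?v) *\<^sub>R F1) \<le> e1 * (1 + K) * norm ?v + (e1 * norm ?v) * norm F1" .
      qed (use P in auto)
      also note na
      also have "e1 * (2 * K) * norm ?v + P * (e1 * (1 + K) * norm ?v + (e1 * norm ?v) * norm F1) + (e1 * norm ?v) * G
          = e1 * (2 * K + P * (1 + K + norm F1) + G) * norm ?v"
        by (simp add: algebra_simps)
      also have "\<dots> \<le> e1 * A * norm ?v"
        using e1(1) A(2) by (intro mult_right_mono mult_left_mono) auto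
      finally show "norm (broken t z - broken t z' - \<Psi> (max (t - tb1) 0) ?v) \<le> e * norm ?v"
        using e1(2) by (simp add: \<sigma>_def)
    }
    {
      assume le: "t1 z' \<le> t" "t \<le> t1 z"
      let ?y' = "contact z'" and ?\<Delta> = "t1 z - t1 z'"
      define \<mu> where "\<mu> = (if ?\<Delta> = 0 then 0 else (t - t1 z') / ?\<Delta>)"
      have \<mu>: "\<mu> \<in> {0..1}" "t - t1 z' = \<mu> * ?\<Delta>" using le by (auto simp: \<mu>_def field_simps)
      have tt: "\<bar>t - t1 z'\<bar> \<le> K * norm ?v" using le dtau by linarith
      define a where "a = \<zeta>1 t z - \<zeta>1 (t1 z') z' - \<Phi>1 tb1 ?v - (t - t1 z') *\<^sub>R F1"
      define b where "b = \<zeta>2 (t - t1 z') ?y' - \<zeta>2 0 ?y' - \<Phi>2 0 (?y' - ?y') - (t - t1 z' - 0) *\<^sub>R ham_vec H2 (\<zeta>2 0 zb1)"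
      have na: "norm a \<le> e1 * (1 + K) * norm ?v"
      proof -
        have "norm a \<le> e1 * (norm ?v + \<bar>t - t1 z'\<bar>)"
          unfolding a_def using le tau[OF z(1)] tau[OF z(2)] by (intro ra(2) z0 t tau(3) z tbT) auto
        also have "\<dots> \<le> e1 * (norm ?v + K * norm ?v)"
          using tt e1(1) by (intro mult_left_mono add_mono) auto
        finally show ?thesis by (simp add: algebra_simps)
      qed
      have nb: "norm b \<le> e1 * K * norm ?v"
      proof -
        have "norm b \<le> e1 * (norm (?y' - ?y') + \<bar>t - t1 z' - 0\<bar>)"
          unfolding b_def
        proof (intro rb(2) cont z)
          show "t - t1 z' \<in> {0..tf}" using le t tau(3)[OF z(2)] by auto
          have "\<bar>t1 z - tb1\<bar> < rb / 2" "\<bar>t1 z' - tb1\<bar> < rb / 2" using tau(2) z by blast+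
          then show "\<bar>t - t1 z' - 0\<bar> < rb" unfolding abs_less_iff using le by linarith
        qed (use tf rb(1) in auto)
        also have "\<dots> \<le> e1 * (K * norm ?v)" using tt e1(1) by (intro mult_left_mono) auto
        finally show ?thesis by (simp add: algebra_simps)
      qed
      have eq: "broken t z - broken t z' - (\<Phi>1 tb1 ?v + (\<mu> * dt1 ?v) *\<^sub>R (F1 - F2))
          = a - b + (\<mu> * (?\<Delta> - dt1 ?v)) *\<^sub>R (F1 - F2)"
      proof -
        have "(\<mu> * (?\<Delta> - dt1 ?v)) *\<^sub>R (F1 - F2) = (t - t1 z') *\<^sub>R (F1 - F2) - (\<mu> * dt1 ?v) *\<^sub>R (F1 - F2)"
          unfolding \<mu>(2) by (simp only: right_diff_distrib[of \<mu> ?\<Delta>] scaleR_diff_left)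
        then show ?thesis
          using le cont z zb1 by (simp add: broken_before broken_after a_def b_def H2.flow_0 algebra_simps)
      qed
      have "norm (broken t z - broken t z' - (\<Phi>1 tb1 ?v + (\<mu> * dt1 ?v) *\<^sub>R (F1 - F2)))
          \<le> (norm a + norm b) + norm ((\<mu> * (?\<Delta> - dt1 ?v)) *\<^sub>R (F1 - F2))"
        unfolding eq by (intro order_trans[OF norm_triangle_ineq] add_right_mono norm_triangle_ineq4)
      also have "norm ((\<mu> * (?\<Delta> - dt1 ?v)) *\<^sub>R (F1 - F2)) \<le> (1 * (e1 * norm ?v)) * norm (F1 - F2)"
        unfolding norm_scaleR abs_mult using \<mu>(1) dtau' by (intro mult_right_mono mult_mono) auto
      also note na
      also note nb
      also have "e1 * (1 + K) * norm ?v + e1 * K * norm ?v + (1 * (e1 * norm ?v)) * norm (F1 - F2)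
          = e1 * (1 + 2 * K + norm (F1 - F2)) * norm ?v"
        by (simp add: algebra_simps)
      also have "\<dots> \<le> e1 * A * norm ?v"
        using e1(1) A(3) by (intro mult_right_mono mult_left_mono) auto
      finally show "\<exists>\<mu>\<in>{0..1}. norm (broken t z - broken t z' - (\<Phi>1 tb1 ?v + (\<mu> * dt1 ?v) *\<^sub>R (F1 - F2))) \<le> e * norm ?v"
        using e1(2) \<mu>(1) by auto
    }
  qed
qed

end

section \<open>Regularity of the tilted field\<close>

context linearized_broken_extremal
begin

text \<open>The initial variations tangent to the tilted fibre \<open>\<delta>x = \<epsilon> \<delta>p\<close>, parameterized by \<open>\<delta>p\<close>.\<close>

definition \<iota> :: "real \<Rightarrow> (real ^ 'n) \<Rightarrow>\<^sub>L ((real ^ 'n) \<times> (real ^ 'n))" where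
  "\<iota> \<epsilon> = \<epsilon> *\<^sub>R Blinfun (\<lambda>w. (w, 0)) + Blinfun (\<lambda>w. (0, w))"

definition B1 :: "real \<Rightarrow> real \<Rightarrow> (real ^ 'n) \<Rightarrow>\<^sub>L (real ^ 'n)" where
  "B1 \<epsilon> t = fst_blinfun o\<^sub>L (\<Phi>1 t o\<^sub>L \<iota> \<epsilon>)"

definition B2 :: "real \<Rightarrow> real \<Rightarrow> (real ^ 'n) \<Rightarrow>\<^sub>L (real ^ 'n)" where
  "B2 \<epsilon> \<sigma> = fst_blinfun o\<^sub>L (\<Psi> \<sigma> o\<^sub>L \<iota> \<epsilon>)"

lemma \<iota>_apply: "\<iota> \<epsilon> w = (\<epsilon> *\<^sub>R w, w)"
proof -
  have "bounded_linear (\<lambda>w::real^'n. (w, 0::real^'n))" "bounded_linear (\<lambda>w::real^'n. (0::real^'n, w))"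
    by (auto intro!: bounded_linear_Pair bounded_linear_ident bounded_linear_zero)
  then show ?thesis
    by (simp add: \<iota>_def blinfun.add_left blinfun.scaleR_left bounded_linear_Blinfun_apply)
qed

lemma B1_apply: "B1 \<epsilon> t w = fst (\<Phi>1 t (\<epsilon> *\<^sub>R w, w))"
  by (simp add: B1_def \<iota>_apply)

lemma B2_apply: "B2 \<epsilon> \<sigma> w = fst (\<Psi> \<sigma> (\<epsilon> *\<^sub>R w, w))"
  by (simp add: B2_def \<iota>_apply)

lemma B_cont:
  "continuous_on ({0..1} \<times> {0..tf}) (\<lambda>p. B1 (fst p) (snd p))"
  "continuous_on ({0..1} \<times> {0..tf}) (\<lambda>p. B2 (fst p) (snd p))"
  unfolding B1_def B2_def \<iota>_def
  by (intro continuous_intros continuous_on_compose2[OF \<Phi>1_cont] continuous_on_compose2[OF \<Psi>_cont]; auto)+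

lemma det_blinfun_cont: "continuous_on S (\<lambda>B::(real^'n) \<Rightarrow>\<^sub>L (real^'n). det (matrix B))"
  unfolding det_def matrix_def by (intro continuous_intros)

lemma det_blinfun_nonzero_iff: "det (matrix (blinfun_apply B)) \<noteq> 0 \<longleftrightarrow> (\<forall>w. B w = 0 \<longrightarrow> w = 0)"
  for B :: "(real^'n) \<Rightarrow>\<^sub>L (real^'n)"
proof -
  have lin: "linear B" by (rule bounded_linear.linear[OF blinfun.bounded_linear_right])
  show ?thesis using det_nz_iff_inj[OF lin] linear_injective_0[OF lin] by blast
qed

text \<open>Varying only the initial covector means tilt \<open>0\<close>; away from the contact time all nearby trajectories are
  on the same side of the contact, so that the strict derivative is a derivative.\<close>

lemma fold_det_eq:
  assumes t: "t \<in> {0..tf}"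
  shows "t < tb1 \<Longrightarrow> fold_det \<zeta>1 \<zeta>2 t1 zb0 t = det (matrix (B1 0 t))"
    and "t > tb1 \<Longrightarrow> fold_det \<zeta>1 \<zeta>2 t1 zb0 t = det (matrix (B2 0 (t - tb1)))"
proof -
  obtain r0 K where rK: "r0 > 0" "K > 0" "ball zb0 r0 \<subseteq> W"
    "\<And>z z'. z \<in> ball zb0 r0 \<Longrightarrow> z' \<in> ball zb0 r0 \<Longrightarrow> \<bar>t1 z - t1 z'\<bar> \<le> K * norm (z - z')"
    using contact_lipschitz by metis
  have t1_near: "\<exists>d>0. \<forall>z\<in>ball zb0 d. \<bar>t1 z - tb1\<bar> < g" if "g > 0" for g
  proof (intro exI[of _ "min r0 (g / K)"] conjI ballI)
    show "min r0 (g / K) > 0" using rK that by simp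
    fix z assume z: "z \<in> ball zb0 (min r0 (g / K))"
    then have "\<bar>t1 z - tb1\<bar> \<le> K * norm (z - zb0)" using rK(4)[of z zb0] rK(1) by (simp add: t1_zb0)
    also have "\<dots> < K * (g / K)"
      using z rK(2) by (intro mult_strict_left_mono) (auto simp: dist_norm norm_minus_commute)
    finally show "\<bar>t1 z - tb1\<bar> < g" using rK(2) by simp
  qed
  let ?f = "\<lambda>p. fst (broken t (fst zb0, p))"
  have der: "det (jacobian ?f (at (snd zb0))) = det (matrix B)"
    if B: "\<And>e. e > 0 \<Longrightarrow> \<exists>r>0. \<forall>z\<in>ball zb0 r. norm (broken t z - broken t zb0 - A (z - zb0)) \<le> e * norm (z - zb0)"
      and BA: "\<And>w. B w = fst (A (0, w))" for A :: "((real ^ 'n) \<times> (real ^ 'n)) \<Rightarrow>\<^sub>L ((real ^ 'n) \<times> (real ^ 'n))"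
        and B :: "(real ^ 'n) \<Rightarrow>\<^sub>L (real ^ 'n)"
  proof -
    have "(?f has_derivative B) (at (snd zb0))"
      unfolding has_derivative_at_alt
    proof (intro conjI allI impI blinfun.bounded_linear_right)
      fix e :: real assume "e > 0"
      then obtain r where r: "r > 0" "\<And>z. z \<in> ball zb0 r \<Longrightarrow> norm (broken t z - broken t zb0 - A (z - zb0)) \<le> e * norm (z - zb0)"
        using B by blast
      show "\<exists>d>0. \<forall>p. norm (p - snd zb0) < d \<longrightarrow> norm (?f p - ?f (snd zb0) - B (p - snd zb0)) \<le> e * norm (p - snd zb0)"
      proof (intro exI[of _ r] conjI allI impI r(1))
        fix p assume p: "norm (p - snd zb0) < r"
        let ?z = "(fst zb0, p)"
        have diff: "?z - zb0 = (0, p - snd zb0)" by (simp add: prod_eq_iff)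
        then have "?z \<in> ball zb0 r" using p by (simp add: dist_norm norm_minus_commute[of zb0])
        from r(2)[OF this] have le: "norm (broken t ?z - broken t zb0 - A (0, p - snd zb0)) \<le> e * norm (p - snd zb0)"
          by (simp add: diff)
        have eq: "?f p - ?f (snd zb0) - B (p - snd zb0) = fst (broken t ?z - broken t zb0 - A (0, p - snd zb0))"
          by (simp add: BA)
        have "norm (fst v) \<le> norm v" for v :: "(real ^ 'n) \<times> (real ^ 'n)"
          using norm_fst_le[of "fst v" "snd v"] by simp
        then show "norm (?f p - ?f (snd zb0) - B (p - snd zb0)) \<le> e * norm (p - snd zb0)"
          unfolding eq using le by (rule order_trans)
      qed
    qed
    then have "frechet_derivative ?f (at (snd zb0)) = B" using frechet_derivative_at by metis
    then show ?thesis by (simp add: jacobian_def)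
  qed
  show "fold_det \<zeta>1 \<zeta>2 t1 zb0 t = det (matrix (B1 0 t))" if lt: "t < tb1"
    unfolding fold_det_def
  proof (rule der[of "\<Phi>1 t"])
    fix e :: real assume e: "e > 0"
    obtain r where r: "r > 0"
      "\<And>z z' t. z \<in> ball zb0 r \<Longrightarrow> z' \<in> ball zb0 r \<Longrightarrow> t \<in> {0..tf} \<Longrightarrow> t \<le> t1 z \<Longrightarrow> t \<le> t1 z' \<Longrightarrow>
       norm (broken t z - broken t z' - \<Phi>1 (min t tb1) (z - z')) \<le> e * norm (z - z')"
      by (rule broken_strict_derivative[OF e]) (rule that)
    obtain d where d: "d > 0" "\<forall>z\<in>ball zb0 d. \<bar>t1 z - tb1\<bar> < tb1 - t" using t1_near[of "tb1 - t"] lt by auto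
    show "\<exists>r>0. \<forall>z\<in>ball zb0 r. norm (broken t z - broken t zb0 - \<Phi>1 t (z - zb0)) \<le> e * norm (z - zb0)"
    proof (intro exI[of _ "min r d"] conjI ballI)
      show "min r d > 0" using r d by simp
      fix z assume z: "z \<in> ball zb0 (min r d)"
      then have "\<bar>t1 z - tb1\<bar> < tb1 - t" using d by auto
      then show "norm (broken t z - broken t zb0 - \<Phi>1 t (z - zb0)) \<le> e * norm (z - zb0)"
        using r(2)[of z zb0 t] z t lt r(1) by (auto simp: t1_zb0)
    qed
  qed (simp add: B1_apply)
  show "fold_det \<zeta>1 \<zeta>2 t1 zb0 t = det (matrix (B2 0 (t - tb1)))" if gt: "t > tb1"
    unfolding fold_det_def
  proof (rule der[of "\<Psi> (t - tb1)"])
    fix e :: real assume e: "e > 0"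
    obtain r where r: "r > 0"
      "\<And>z z' t. z \<in> ball zb0 r \<Longrightarrow> z' \<in> ball zb0 r \<Longrightarrow> t \<in> {0..tf} \<Longrightarrow> t1 z \<le> t \<Longrightarrow> t1 z' \<le> t \<Longrightarrow>
       norm (broken t z - broken t z' - \<Psi> (max (t - tb1) 0) (z - z')) \<le> e * norm (z - z')"
      by (rule broken_strict_derivative[OF e]) (rule that)
    obtain d where d: "d > 0" "\<forall>z\<in>ball zb0 d. \<bar>t1 z - tb1\<bar> < t - tb1" using t1_near[of "t - tb1"] gt by auto
    show "\<exists>r>0. \<forall>z\<in>ball zb0 r. norm (broken t z - broken t zb0 - \<Psi> (t - tb1) (z - zb0)) \<le> e * norm (z - zb0)"
    proof (intro exI[of _ "min r d"] conjI ballI)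
      show "min r d > 0" using r d by simp
      fix z assume z: "z \<in> ball zb0 (min r d)"
      then have "\<bar>t1 z - tb1\<bar> < t - tb1" using d by auto
      then show "norm (broken t z - broken t zb0 - \<Psi> (t - tb1) (z - zb0)) \<le> e * norm (z - zb0)"
        using r(2)[of z zb0 t] z t gt r(1) by (auto simp: t1_zb0)
    qed
  qed (simp add: B2_apply)
qed

text \<open>The one-sided limits of \<open>\<delta>\<close> are the determinants of two maps that differ by a rank-one map, namely
  the jump of the velocity multiplied by the derivative of the contact time.\<close>

lemma fold_det_limits:
  shows "Lim (at_left tb1) (fold_det \<zeta>1 \<zeta>2 t1 zb0) = det (matrix (B1 0 tb1))"
    and "Lim (at_right tb1) (fold_det \<zeta>1 \<zeta>2 t1 zb0) = det (matrix (B2 0 0))"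
proof -
  have c1: "continuous_on {0..tf} (\<lambda>t. det (matrix (B1 0 t)))"
    by (intro continuous_on_compose2[OF det_blinfun_cont[of UNIV] continuous_on_compose2[OF B_cont(1), of _ "\<lambda>t. (0, t)", simplified]] continuous_intros) auto
  have c2: "continuous_on {0..tf} (\<lambda>t. det (matrix (B2 0 t)))"
    by (intro continuous_on_compose2[OF det_blinfun_cont[of UNIV] continuous_on_compose2[OF B_cont(2), of _ "\<lambda>t. (0, t)", simplified]] continuous_intros) auto
  have "isCont (\<lambda>t. det (matrix (B1 0 t))) tb1"
    using continuous_on_interior[OF c1] tb1 by simp
  then have "((\<lambda>t. det (matrix (B1 0 t))) \<longlongrightarrow> det (matrix (B1 0 tb1))) (at_left tb1)"
    unfolding isCont_def by (rule filterlim_mono) (auto simp: at_le)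
  moreover have "\<forall>\<^sub>F t in at_left tb1. det (matrix (B1 0 t)) = fold_det \<zeta>1 \<zeta>2 t1 zb0 t"
    using eventually_at_left_real[OF tb1(1)] by eventually_elim (use tb1 fold_det_eq(1) in auto)
  ultimately have "(fold_det \<zeta>1 \<zeta>2 t1 zb0 \<longlongrightarrow> det (matrix (B1 0 tb1))) (at_left tb1)"
    by (rule Lim_transform_eventually)
  then show "Lim (at_left tb1) (fold_det \<zeta>1 \<zeta>2 t1 zb0) = det (matrix (B1 0 tb1))"
    by (intro tendsto_Lim) auto
  have "((\<lambda>t. det (matrix (B2 0 (t - tb1)))) \<longlongrightarrow> det (matrix (B2 0 0))) (at tb1 within {tb1..tf})"
  proof -
    have c: "continuous_on {tb1..tf} (\<lambda>t. det (matrix (B2 0 (t - tb1))))"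
      using tb1 by (intro continuous_on_compose2[OF c2] continuous_intros) auto
    have "tb1 \<in> {tb1..tf}" using tb1 by simp
    from c[unfolded continuous_on_def, rule_format, OF this] show ?thesis by simp
  qed
  then have "((\<lambda>t. det (matrix (B2 0 (t - tb1)))) \<longlongrightarrow> det (matrix (B2 0 0))) (at_right tb1)"
    using tb1 by (simp add: at_within_Icc_at_right)
  moreover have "\<forall>\<^sub>F t in at_right tb1. det (matrix (B2 0 (t - tb1))) = fold_det \<zeta>1 \<zeta>2 t1 zb0 t"
    using eventually_at_right_real[OF tb1(2)] by eventually_elim (use tb1 fold_det_eq(2) in auto)
  ultimately have "(fold_det \<zeta>1 \<zeta>2 t1 zb0 \<longlongrightarrow> det (matrix (B2 0 0))) (at_right tb1)"
    by (rule Lim_transform_eventually)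
  then show "Lim (at_right tb1) (fold_det \<zeta>1 \<zeta>2 t1 zb0) = det (matrix (B2 0 0))"
    by (intro tendsto_Lim) auto
qed

text \<open>The vertical fibre over the initial point is tilted to the Lagrangian subspace \<open>\<delta>x = \<epsilon> \<delta>p\<close>.  Away from
  the initial time this is a small perturbation; near the initial time the tilt is what
  makes the field regular.\<close>

lemma tilted_field_regular:
  assumes A2: "\<And>t. t \<in> {0<..<tb1} \<union> {tb1<..tf} \<Longrightarrow> fold_det \<zeta>1 \<zeta>2 t1 zb0 t \<noteq> 0"
    and no_fold: "Lim (at_right tb1) (fold_det \<zeta>1 \<zeta>2 t1 zb0) * Lim (at_left tb1) (fold_det \<zeta>1 \<zeta>2 t1 zb0) > 0"
    and psd: "\<And>z p. z \<in> dominance_set X H1 H2 \<Longrightarrow> hessian H1 z (0, p) (0, p) \<ge> 0"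
  obtains \<epsilon> c where "\<epsilon> > 0" "c > 0"
    "\<And>t w. t \<in> {0..tb1} \<Longrightarrow> c * norm w \<le> norm (B1 \<epsilon> t w)"
    "\<And>\<sigma> w. \<sigma> \<in> {0..tf - tb1} \<Longrightarrow> c * norm w \<le> norm (B2 \<epsilon> \<sigma> w)"
    "\<And>\<mu> w. \<mu> \<in> {0..1} \<Longrightarrow> c * norm w \<le> norm (B1 \<epsilon> tb1 w + (\<mu> * dt1 (\<iota> \<epsilon> w)) *\<^sub>R fst (F1 - F2))"
proof -
  have sub: "{0..tb1} \<subseteq> {0..tf}" "{0..tf - tb1} \<subseteq> {0..tf}" using tb1 by auto
  obtain t0 where t0: "t0 > 0" "t0 < tb1"
    "\<And>t \<epsilon> w. t \<in> {0..t0} \<Longrightarrow> \<epsilon> > 0 \<Longrightarrow> fst (\<Phi>1 t (\<epsilon> *\<^sub>R w, w)) = 0 \<Longrightarrow> w = 0"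
  proof (rule H1.no_early_conjugate_point[OF tb1(1) zb0, of \<Phi>1])
    show "\<Phi>1 0 = id_blinfun" using \<Phi>1 by (simp add: H1.linearization_def)
    show "(\<Phi>1 has_vector_derivative ham_vec_deriv H1 (\<zeta>1 t zb0) o\<^sub>L \<Phi>1 t) (at t within {0..tb1})" if "t \<in> {0..tb1}" for t
      using \<Phi>1 that sub(1) unfolding H1.linearization_def
      by (meson has_vector_derivative_within_subset subsetD)
    show "hessian H1 (\<zeta>1 t zb0) (0, p) (0, p) \<ge> 0" if "t \<in> {0..<tb1}" for t p
      by (rule psd[OF dominance1[OF that]])
  qed (rule that)
  have no_fold': "det (matrix (B1 0 tb1)) * det (matrix (B2 0 0)) > 0"
    using no_fold by (simp add: fold_det_limits mult.commute)
  have n1: "w = 0" if "t \<in> {t0..tb1}" "B1 0 t w = 0" for t w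
  proof (cases "t = tb1")
    case True
    then show ?thesis using no_fold' det_blinfun_nonzero_iff[of "B1 0 t"] that by auto
  next
    case False
    then have "det (matrix (B1 0 t)) \<noteq> 0"
      using A2[of t] fold_det_eq(1)[of t] that t0 tb1 by auto
    then show ?thesis using det_blinfun_nonzero_iff that by blast
  qed
  have n2: "w = 0" if "\<sigma> \<in> {0..tf - tb1}" "B2 0 \<sigma> w = 0" for \<sigma> w
  proof (cases "\<sigma> = 0")
    case True
    then show ?thesis using no_fold' det_blinfun_nonzero_iff[of "B2 0 \<sigma>"] that by auto
  next
    case False
    then have "det (matrix (B2 0 \<sigma>)) \<noteq> 0"
      using A2[of "tb1 + \<sigma>"] fold_det_eq(2)[of "tb1 + \<sigma>"] that tb1 by auto
    then show ?thesis using det_blinfun_nonzero_iff that by blast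
  qed
  have cont1: "continuous_on S (\<lambda>t. B1 \<epsilon> t)" if "S \<subseteq> {0..tf}" "\<epsilon> \<in> {0..1}" for S \<epsilon>
    using that by (intro continuous_on_compose2[OF B_cont(1), of _ "\<lambda>t. (\<epsilon>, t)", simplified] continuous_intros) auto
  have cont2: "continuous_on S (\<lambda>t. B2 \<epsilon> t)" if "S \<subseteq> {0..tf}" "\<epsilon> \<in> {0..1}" for S \<epsilon>
    using that by (intro continuous_on_compose2[OF B_cont(2), of _ "\<lambda>t. (\<epsilon>, t)", simplified] continuous_intros) auto
  obtain c1 where c1: "c1 > 0" "\<And>t w. t \<in> {t0..tb1} \<Longrightarrow> c1 * norm w \<le> norm (B1 0 t w)"
    by (rule uniformly_injective_family[of "{t0..tb1}" "B1 0"]) (use n1 t0 tb1 cont1 in \<open>auto intro: that\<close>)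
  obtain c2 where c2: "c2 > 0" "\<And>\<sigma> w. \<sigma> \<in> {0..tf - tb1} \<Longrightarrow> c2 * norm w \<le> norm (B2 0 \<sigma> w)"
    by (rule uniformly_injective_family[of "{0..tf - tb1}" "B2 0"]) (use n2 tb1 cont2 in \<open>auto intro: that\<close>)
  have unif: "\<exists>d>0. \<forall>\<epsilon>\<in>{0..1}. \<forall>t\<in>{0..tf}. \<epsilon> < d \<longrightarrow> norm (B \<epsilon> t - B 0 t) < e"
    if "continuous_on ({0..1} \<times> {0..tf}) (\<lambda>p. B (fst p) (snd p))" "e > 0"
    for B :: "real \<Rightarrow> real \<Rightarrow> (real ^ 'n) \<Rightarrow>\<^sub>L (real ^ 'n)" and e
  proof -
    have "uniformly_continuous_on ({0..1} \<times> {0..tf}) (\<lambda>p. B (fst p) (snd p))"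
      using that(1) by (intro compact_uniformly_continuous compact_Times) auto
    then obtain d where d: "d > 0" "\<And>p p'. p \<in> {0..1} \<times> {0..tf} \<Longrightarrow> p' \<in> {0..1} \<times> {0..tf} \<Longrightarrow> dist p' p < d \<Longrightarrow>
        dist (B (fst p') (snd p')) (B (fst p) (snd p)) < e"
      unfolding uniformly_continuous_on_def using \<open>e > 0\<close> by metis
    show ?thesis
    proof (intro exI[of _ d] conjI ballI impI d(1))
      fix \<epsilon> t :: real assume "\<epsilon> \<in> {0..1}" "t \<in> {0..tf}" "\<epsilon> < d"
      then show "norm (B \<epsilon> t - B 0 t) < e"
        using d(2)[of "(0, t)" "(\<epsilon>, t)"] by (simp add: dist_norm)
    qed
  qed
  obtain d1 where d1: "d1 > 0" "\<And>\<epsilon> t. \<epsilon> \<in> {0..1} \<Longrightarrow> t \<in> {0..tf} \<Longrightarrow> \<epsilon> < d1 \<Longrightarrow> norm (B1 \<epsilon> t - B1 0 t) < c1"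
    using unif[OF B_cont(1) c1(1)] by auto
  obtain d2 where d2: "d2 > 0" "\<And>\<epsilon> t. \<epsilon> \<in> {0..1} \<Longrightarrow> t \<in> {0..tf} \<Longrightarrow> \<epsilon> < d2 \<Longrightarrow> norm (B2 \<epsilon> t - B2 0 t) < c2"
    using unif[OF B_cont(2) c2(1)] by auto
  have "continuous_on {0..1} (\<lambda>\<epsilon>. det (matrix (B1 \<epsilon> tb1)) * det (matrix (B2 \<epsilon> 0)))"
    using tb1
    by (intro continuous_on_mult continuous_on_compose2[OF det_blinfun_cont[of UNIV]]
        continuous_on_compose2[OF B_cont(1), of _ "\<lambda>\<epsilon>. (\<epsilon>, tb1)", simplified]
        continuous_on_compose2[OF B_cont(2), of _ "\<lambda>\<epsilon>. (\<epsilon>, 0)", simplified] continuous_intros) auto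
  then obtain d3 where d3: "d3 > 0" "\<And>\<epsilon>. \<epsilon> \<in> {0..1} \<Longrightarrow> dist \<epsilon> 0 < d3 \<Longrightarrow>
      dist (det (matrix (B1 \<epsilon> tb1)) * det (matrix (B2 \<epsilon> 0))) (det (matrix (B1 0 tb1)) * det (matrix (B2 0 0)))
        < det (matrix (B1 0 tb1)) * det (matrix (B2 0 0))"
    using no_fold' unfolding continuous_on_iff by (metis atLeastAtMost_iff order_refl zero_le_one)
  define \<epsilon> where "\<epsilon> = min (min d1 d2) (min d3 1) / 2"
  have \<epsilon>: "\<epsilon> > 0" "\<epsilon> \<in> {0..1}" "\<epsilon> < d1" "\<epsilon> < d2" "\<epsilon> < d3"
    using d1(1) d2(1) d3(1) by (auto simp: \<epsilon>_def min_def)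
  have i1: "w = 0" if t: "t \<in> {0..tb1}" and zero: "B1 \<epsilon> t w = 0" for t w
  proof (cases "t \<le> t0")
    case True
    then show ?thesis using t0(3)[of t \<epsilon> w] t zero \<epsilon>(1) by (simp add: B1_apply)
  next
    case False
    have "c1 * norm w \<le> norm (B1 0 t w)" using c1(2) False t by simp
    also have "B1 0 t w = - ((B1 \<epsilon> t - B1 0 t) w)" using zero by (simp add: blinfun.diff_left)
    also have "norm \<dots> \<le> norm (B1 \<epsilon> t - B1 0 t) * norm w" by (simp only: norm_minus_cancel norm_blinfun)
    finally have "(c1 - norm (B1 \<epsilon> t - B1 0 t)) * norm w \<le> 0" by (simp add: algebra_simps)
    moreover have "c1 - norm (B1 \<epsilon> t - B1 0 t) > 0" using d1(2)[OF \<epsilon>(2) _ \<epsilon>(3), of t] t tb1 by auto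
    ultimately show ?thesis by (simp add: mult_le_0_iff)
  qed
  have i2: "w = 0" if t: "\<sigma> \<in> {0..tf - tb1}" and zero: "B2 \<epsilon> \<sigma> w = 0" for \<sigma> w
  proof -
    have "c2 * norm w \<le> norm (B2 0 \<sigma> w)" using c2(2) t by simp
    also have "B2 0 \<sigma> w = - ((B2 \<epsilon> \<sigma> - B2 0 \<sigma>) w)" using zero by (simp add: blinfun.diff_left)
    also have "norm \<dots> \<le> norm (B2 \<epsilon> \<sigma> - B2 0 \<sigma>) * norm w" by (simp only: norm_minus_cancel norm_blinfun)
    finally have "(c2 - norm (B2 \<epsilon> \<sigma> - B2 0 \<sigma>)) * norm w \<le> 0" by (simp add: algebra_simps)
    moreover have "c2 - norm (B2 \<epsilon> \<sigma> - B2 0 \<sigma>) > 0" using d2(2)[OF \<epsilon>(2) _ \<epsilon>(4), of \<sigma>] t tb1 by auto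
    ultimately show ?thesis by (simp add: mult_le_0_iff)
  qed
  define l where "l = dt1 o\<^sub>L \<iota> \<epsilon>"
  define a where "a = fst (F1 - F2)"
  define B3 where "B3 \<mu> = B1 \<epsilon> tb1 + \<mu> *\<^sub>R (blinfun_scaleR_left a o\<^sub>L l)" for \<mu>
  have B3: "B3 \<mu> w = B1 \<epsilon> tb1 w + (\<mu> * l w) *\<^sub>R a" for \<mu> w
    by (simp add: B3_def blinfun.add_left blinfun.scaleR_left)
  have "det (matrix (B1 \<epsilon> tb1)) * det (matrix (B2 \<epsilon> 0)) > 0"
    using d3(2)[OF \<epsilon>(2)] \<epsilon>(1,5) by (simp add: dist_real_def abs_less_iff)
  moreover have "B2 \<epsilon> 0 w = B1 \<epsilon> tb1 w + l w *\<^sub>R a" for w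
    by (simp add: B2_apply B1_apply \<Psi>_0 l_def \<iota>_apply a_def)
  ultimately have i3: "w = 0" if "\<mu> \<in> {0..1}" "B3 \<mu> w = 0" for \<mu> w
    using that unfolding B3
    by (intro rank_one_segment_injective[of "B1 \<epsilon> tb1" l "B2 \<epsilon> 0" a \<mu> w])
       (auto intro: bounded_linear.linear blinfun.bounded_linear_right)
  obtain e1 where e1: "e1 > 0" "\<And>t w. t \<in> {0..tb1} \<Longrightarrow> e1 * norm w \<le> norm (B1 \<epsilon> t w)"
    by (rule uniformly_injective_family[of "{0..tb1}" "B1 \<epsilon>"]) (use i1 sub \<epsilon>(2) cont1 in \<open>auto intro: that\<close>)
  obtain e2 where e2: "e2 > 0" "\<And>\<sigma> w. \<sigma> \<in> {0..tf - tb1} \<Longrightarrow> e2 * norm w \<le> norm (B2 \<epsilon> \<sigma> w)"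
    by (rule uniformly_injective_family[of "{0..tf - tb1}" "B2 \<epsilon>"]) (use i2 sub \<epsilon>(2) cont2 in \<open>auto intro: that\<close>)
  have "continuous_on {0..1} B3" unfolding B3_def by (intro continuous_intros)
  then obtain e3 where e3: "e3 > 0" "\<And>\<mu> w. \<mu> \<in> {0..1} \<Longrightarrow> e3 * norm w \<le> norm (B3 \<mu> w)"
    by (rule uniformly_injective_family[of "{0..1}" B3, OF compact_Icc]) (use i3 in \<open>auto intro: that\<close>)
  have le: "min e1 (min e2 e3) * norm w \<le> e1 * norm w" "min e1 (min e2 e3) * norm w \<le> e2 * norm w"
    "min e1 (min e2 e3) * norm w \<le> e3 * norm w" for w :: "real ^ 'n"
    by (auto intro!: mult_right_mono)
  show ?thesis
  proof (rule that[of \<epsilon> "min e1 (min e2 e3)"])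
    show "min e1 (min e2 e3) * norm w \<le> norm (B1 \<epsilon> t w)" if "t \<in> {0..tb1}" for t w
      using e1(2)[OF that, of w] le(1)[of w] by linarith
    show "min e1 (min e2 e3) * norm w \<le> norm (B2 \<epsilon> \<sigma> w)" if "\<sigma> \<in> {0..tf - tb1}" for \<sigma> w
      using e2(2)[OF that, of w] le(2)[of w] by linarith
    show "min e1 (min e2 e3) * norm w \<le> norm (B1 \<epsilon> tb1 w + (\<mu> * dt1 (\<iota> \<epsilon> w)) *\<^sub>R fst (F1 - F2))" if "\<mu> \<in> {0..1}" for \<mu> w
      using e3(2)[OF that, of w] le(3)[of w] unfolding B3 l_def a_def by simp
  qed (use \<epsilon>(1) e1 e2 e3 in auto)
qed

end

section \<open>The action and the maximum condition along the broken flow\<close>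

context broken_extremal
begin

definition broken_action :: "real \<Rightarrow> (real ^ 'n) \<times> (real ^ 'n) \<Rightarrow> real" where
  "broken_action t z = (if t \<le> t1 z then H1.action t z
     else H1.action (t1 z) z + H2.action (t - t1 z) (contact z))"

lemma broken_action_before: "t \<le> t1 z \<Longrightarrow> broken_action t z = H1.action t z"
  by (simp add: broken_action_def)

lemma broken_action_after: "t1 z \<le> t \<Longrightarrow> broken_action t z = H1.action (t1 z) z + H2.action (t - t1 z) (contact z)"
  by (cases "t = t1 z") (auto simp: broken_action_def)

text \<open>On each side of the contact the differential of the action is \<open>p dx - p\<^sub>0 dx\<^sub>0 - H dt\<close> up to second
  order.  After the contact the contributions of the moving contact time cancel, because the two
  Hamiltonians agree at the contact.\<close>

lemma broken_action_differential:
  obtains r C where "r > 0" "C > 0"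
    "\<And>z z' t t'. z \<in> ball zb0 r \<Longrightarrow> z' \<in> ball zb0 r \<Longrightarrow> t \<in> {0..tf} \<Longrightarrow> t' \<in> {0..tf} \<Longrightarrow>
      (t \<le> t1 z \<and> t' \<le> t1 z') \<or> (t1 z \<le> t \<and> t1 z' \<le> t') \<Longrightarrow>
      \<bar>broken_action t' z' - broken_action t z
         - (snd (broken t z) \<bullet> (fst (broken t' z') - fst (broken t z)) - snd z \<bullet> (fst z' - fst z)) + H1 z * (t' - t)\<bar>
      \<le> C * (\<bar>t' - t\<bar> + norm (z' - z))\<^sup>2"
proof -
  obtain r0 K where rK: "r0 > 0" "K > 0" "ball zb0 r0 \<subseteq> W"
    "\<And>z. z \<in> ball zb0 r0 \<Longrightarrow> t1 z \<in> {0<..<tf} \<and> contact z \<in> switching_set X H1 H2 \<and> contact z \<in> W"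
    "\<And>z z'. z \<in> ball zb0 r0 \<Longrightarrow> z' \<in> ball zb0 r0 \<Longrightarrow> \<bar>t1 z - t1 z'\<bar> \<le> K * norm (z - z')"
    "\<And>z z'. z \<in> ball zb0 r0 \<Longrightarrow> z' \<in> ball zb0 r0 \<Longrightarrow> norm (contact z - contact z') \<le> K * norm (z - z')"
    "\<And>z z' s s'. z \<in> ball zb0 r0 \<Longrightarrow> z' \<in> ball zb0 r0 \<Longrightarrow> s \<in> {0..tf} \<Longrightarrow> s' \<in> {0..tf} \<Longrightarrow>
       norm (\<zeta>1 s z - \<zeta>1 s' z') \<le> K * (\<bar>s - s'\<bar> + norm (z - z'))"
    "\<And>z z' s s'. z \<in> ball zb0 r0 \<Longrightarrow> z' \<in> ball zb0 r0 \<Longrightarrow> s \<in> {0..tf} \<Longrightarrow> s' \<in> {0..tf} \<Longrightarrow>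
       norm (\<zeta>2 s (contact z) - \<zeta>2 s' (contact z')) \<le> K * (\<bar>s - s'\<bar> + norm (z - z'))"
    by (rule contact_lipschitz) (rule that)
  obtain ra Ca where a: "ra > 0" "Ca > 0" "ball zb0 ra \<subseteq> W"
    "\<And>z z' t t'. z \<in> ball zb0 ra \<Longrightarrow> z' \<in> ball zb0 ra \<Longrightarrow> t \<in> {0..tf} \<Longrightarrow> t' \<in> {0..tf} \<Longrightarrow>
      \<bar>H1.action t' z' - H1.action t z - (snd (\<zeta>1 t z) \<bullet> (fst (\<zeta>1 t' z') - fst (\<zeta>1 t z)) - snd z \<bullet> (fst z' - fst z))
         + H1 z * (t' - t)\<bar> \<le> Ca * (\<bar>t' - t\<bar> + norm (z' - z))\<^sup>2"
    by (rule H1.action_differential[OF less_imp_le[OF tf] zb0]) (rule that)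
  obtain rb Cb where b: "rb > 0" "Cb > 0" "ball zb1 rb \<subseteq> W"
    "\<And>z z' t t'. z \<in> ball zb1 rb \<Longrightarrow> z' \<in> ball zb1 rb \<Longrightarrow> t \<in> {0..tf} \<Longrightarrow> t' \<in> {0..tf} \<Longrightarrow>
      \<bar>H2.action t' z' - H2.action t z - (snd (\<zeta>2 t z) \<bullet> (fst (\<zeta>2 t' z') - fst (\<zeta>2 t z)) - snd z \<bullet> (fst z' - fst z))
         + H2 z * (t' - t)\<bar> \<le> Cb * (\<bar>t' - t\<bar> + norm (z' - z))\<^sup>2"
    by (rule H2.action_differential[OF less_imp_le[OF tf] zb1]) (rule that)
  define r where "r = min (min r0 ra) (rb / K)"
  have r: "r > 0" "r \<le> r0" "r \<le> ra" "r \<le> rb / K" using rK a b by (auto simp: r_def)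
  have sub: "ball zb0 r \<subseteq> ball zb0 r0" "ball zb0 r \<subseteq> ball zb0 ra" "zb0 \<in> ball zb0 r" using r by auto
  have cont: "contact z \<in> ball zb1 rb" if z: "z \<in> ball zb0 r" for z
  proof -
    have z0: "z \<in> ball zb0 r0" "zb0 \<in> ball zb0 r0" using z sub by blast+
    have "norm (contact z - zb1) \<le> K * norm (z - zb0)" using rK(6)[OF z0] by (simp add: t1_zb0)
    also have "\<dots> < K * (rb / K)"
      using z r(4) rK(2) by (intro mult_strict_left_mono) (auto simp: dist_norm norm_minus_commute)
    finally show ?thesis using rK(2) by (simp add: dist_norm norm_minus_commute)
  qed
  define C where "C = Ca + Cb * (1 + 2 * K)\<^sup>2 + Ca * (1 + 2 * K)\<^sup>2"
  have C: "C > 0" "Ca \<le> C" "Cb * (1 + 2 * K)\<^sup>2 + Ca * (1 + 2 * K)\<^sup>2 \<le> C"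
    using a(2) b(2) by (auto simp: C_def intro!: add_pos_nonneg)
  show ?thesis
  proof (rule that[OF r(1) C(1)])
    fix z z' t t' assume z: "z \<in> ball zb0 r" "z' \<in> ball zb0 r" and t: "t \<in> {0..tf}" "t' \<in> {0..tf}"
      and side: "(t \<le> t1 z \<and> t' \<le> t1 z') \<or> (t1 z \<le> t \<and> t1 z' \<le> t')"
    have z0: "z \<in> ball zb0 r0" "z' \<in> ball zb0 r0" "z \<in> ball zb0 ra" "z' \<in> ball zb0 ra" using z sub by blast+
    let ?d = "\<bar>t' - t\<bar> + norm (z' - z)"
    have zW: "z \<in> W" using z0(1) rK(3) by blast
    show "\<bar>broken_action t' z' - broken_action t z
         - (snd (broken t z) \<bullet> (fst (broken t' z') - fst (broken t z)) - snd z \<bullet> (fst z' - fst z)) + H1 z * (t' - t)\<bar>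
      \<le> C * ?d\<^sup>2"
      using side
    proof (elim disjE conjE)
      assume "t \<le> t1 z" "t' \<le> t1 z'"
      then have "\<bar>broken_action t' z' - broken_action t z
         - (snd (broken t z) \<bullet> (fst (broken t' z') - fst (broken t z)) - snd z \<bullet> (fst z' - fst z)) + H1 z * (t' - t)\<bar>
        \<le> Ca * ?d\<^sup>2"
        using a(4)[OF z0(3,4) t] by (simp add: broken_action_before broken_before)
      also have "\<dots> \<le> C * ?d\<^sup>2" using C(2) by (intro mult_right_mono) auto
      finally show ?thesis .
    next
      assume le: "t1 z \<le> t" "t1 z' \<le> t'"
      let ?y = "contact z" and ?y' = "contact z'" and ?s = "t1 z" and ?s' = "t1 z'"
      have sT: "?s \<in> {0..tf}" "?s' \<in> {0..tf}" "t - ?s \<in> {0..tf}" "t' - ?s' \<in> {0..tf}"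
        using rK(4)[OF z0(1)] rK(4)[OF z0(2)] t le by auto
      have yW: "?y \<in> W" "?y' \<in> W" and sw: "?y \<in> switching_set X H1 H2"
        using rK(4)[OF z0(1)] rK(4)[OF z0(2)] by auto
      have h: "H2 ?y = H1 z"
        using sw H1.H_conserved[OF zW, of ?s] by (simp add: switching_set_def)
      have ds: "\<bar>?s' - ?s\<bar> \<le> K * norm (z' - z)" by (rule rK(5)[OF z0(2,1)])
      have dy: "norm (?y' - ?y) \<le> K * norm (z' - z)" by (rule rK(6)[OF z0(2,1)])
      have d: "(1 + 2 * K) * ?d = \<bar>t' - t\<bar> + norm (z' - z) + 2 * (K * \<bar>t' - t\<bar>) + 2 * (K * norm (z' - z))"
        by (simp add: algebra_simps)
      have d1: "\<bar>?s' - ?s\<bar> + norm (z' - z) \<le> (1 + 2 * K) * ?d"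
        and d2: "\<bar>(t' - ?s') - (t - ?s)\<bar> + norm (?y' - ?y) \<le> (1 + 2 * K) * ?d"
      proof -
        have "0 \<le> K * \<bar>t' - t\<bar>" "0 \<le> K * norm (z' - z)" "0 \<le> norm (z' - z)" using rK(2) by simp_all
        then show "\<bar>?s' - ?s\<bar> + norm (z' - z) \<le> (1 + 2 * K) * ?d"
          unfolding d using ds by linarith
        have "\<bar>(t' - ?s') - (t - ?s)\<bar> \<le> \<bar>t' - t\<bar> + \<bar>?s' - ?s\<bar>" by linarith
        then show "\<bar>(t' - ?s') - (t - ?s)\<bar> + norm (?y' - ?y) \<le> (1 + 2 * K) * ?d"
          unfolding d using ds dy \<open>0 \<le> K * \<bar>t' - t\<bar>\<close> \<open>0 \<le> norm (z' - z)\<close> by linarith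
      qed
      define A where "A = H1.action ?s' z' - H1.action ?s z - (snd ?y \<bullet> (fst ?y' - fst ?y) - snd z \<bullet> (fst z' - fst z)) + H1 z * (?s' - ?s)"
      define B where "B = H2.action (t' - ?s') ?y' - H2.action (t - ?s) ?y
          - (snd (\<zeta>2 (t - ?s) ?y) \<bullet> (fst (\<zeta>2 (t' - ?s') ?y') - fst (\<zeta>2 (t - ?s) ?y)) - snd ?y \<bullet> (fst ?y' - fst ?y))
          + H2 ?y * ((t' - ?s') - (t - ?s))"
      have "\<bar>A\<bar> \<le> Ca * (\<bar>?s' - ?s\<bar> + norm (z' - z))\<^sup>2"
        unfolding A_def by (rule a(4)[OF z0(3,4) sT(1,2)])
      also have "\<dots> \<le> Ca * ((1 + 2 * K) * ?d)\<^sup>2" using d1 a(2) by (intro mult_left_mono power_mono) auto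
      finally have A: "\<bar>A\<bar> \<le> Ca * (1 + 2 * K)\<^sup>2 * ?d\<^sup>2" by (simp only: power_mult_distrib mult.assoc)
      have "\<bar>B\<bar> \<le> Cb * (\<bar>(t' - ?s') - (t - ?s)\<bar> + norm (?y' - ?y))\<^sup>2"
        unfolding B_def by (rule b(4)[OF cont[OF z(1)] cont[OF z(2)] sT(3,4)])
      also have "\<dots> \<le> Cb * ((1 + 2 * K) * ?d)\<^sup>2" using d2 b(2) by (intro mult_left_mono power_mono) auto
      finally have B: "\<bar>B\<bar> \<le> Cb * (1 + 2 * K)\<^sup>2 * ?d\<^sup>2" by (simp only: power_mult_distrib mult.assoc)
      have "broken_action t' z' - broken_action t z
         - (snd (broken t z) \<bullet> (fst (broken t' z') - fst (broken t z)) - snd z \<bullet> (fst z' - fst z)) + H1 z * (t' - t) = B + A"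
        using le yW by (simp add: A_def B_def h broken_action_after broken_after algebra_simps)
      then have "\<bar>broken_action t' z' - broken_action t z
         - (snd (broken t z) \<bullet> (fst (broken t' z') - fst (broken t z)) - snd z \<bullet> (fst z' - fst z)) + H1 z * (t' - t)\<bar>
        \<le> (Cb * (1 + 2 * K)\<^sup>2 + Ca * (1 + 2 * K)\<^sup>2) * ?d\<^sup>2"
        using A B by (simp add: distrib_right)
      also have "\<dots> \<le> C * ?d\<^sup>2" using C(3) by (intro mult_right_mono) auto
      finally show ?thesis .
    qed
  qed
qed

text \<open>Two arcs that are Lipschitz up to the contact are glued along the contact time, for the flow and for the
  action alike.\<close>

lemma broken_lipschitz:
  obtains r M where "r > 0" "M > 0"
    "\<And>z z' t t'. z \<in> ball zb0 r \<Longrightarrow> z' \<in> ball zb0 r \<Longrightarrow> t \<in> {0..tf} \<Longrightarrow> t' \<in> {0..tf} \<Longrightarrow>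
       norm (broken t z - broken t' z') \<le> M * (\<bar>t - t'\<bar> + norm (z - z'))"
    "\<And>z z' t t'. z \<in> ball zb0 r \<Longrightarrow> z' \<in> ball zb0 r \<Longrightarrow> t \<in> {0..tf} \<Longrightarrow> t' \<in> {0..tf} \<Longrightarrow>
       \<bar>broken_action t z - broken_action t' z'\<bar> \<le> M * (\<bar>t - t'\<bar> + norm (z - z'))"
proof -
  obtain r0 K where rK: "r0 > 0" "K > 0" "ball zb0 r0 \<subseteq> W"
    "\<And>z. z \<in> ball zb0 r0 \<Longrightarrow> t1 z \<in> {0<..<tf} \<and> contact z \<in> switching_set X H1 H2 \<and> contact z \<in> W"
    "\<And>z z'. z \<in> ball zb0 r0 \<Longrightarrow> z' \<in> ball zb0 r0 \<Longrightarrow> \<bar>t1 z - t1 z'\<bar> \<le> K * norm (z - z')"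
    "\<And>z z'. z \<in> ball zb0 r0 \<Longrightarrow> z' \<in> ball zb0 r0 \<Longrightarrow> norm (contact z - contact z') \<le> K * norm (z - z')"
    "\<And>z z' s s'. z \<in> ball zb0 r0 \<Longrightarrow> z' \<in> ball zb0 r0 \<Longrightarrow> s \<in> {0..tf} \<Longrightarrow> s' \<in> {0..tf} \<Longrightarrow>
       norm (\<zeta>1 s z - \<zeta>1 s' z') \<le> K * (\<bar>s - s'\<bar> + norm (z - z'))"
    "\<And>z z' s s'. z \<in> ball zb0 r0 \<Longrightarrow> z' \<in> ball zb0 r0 \<Longrightarrow> s \<in> {0..tf} \<Longrightarrow> s' \<in> {0..tf} \<Longrightarrow>
       norm (\<zeta>2 s (contact z) - \<zeta>2 s' (contact z')) \<le> K * (\<bar>s - s'\<bar> + norm (z - z'))"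
    by (rule contact_lipschitz) (rule that)
  obtain ra Ca where a: "ra > 0" "Ca > 0"
    "\<And>z z' t t'. z \<in> ball zb0 ra \<Longrightarrow> z' \<in> ball zb0 ra \<Longrightarrow> t \<in> {0..tf} \<Longrightarrow> t' \<in> {0..tf} \<Longrightarrow>
      (t \<le> t1 z \<and> t' \<le> t1 z') \<or> (t1 z \<le> t \<and> t1 z' \<le> t') \<Longrightarrow>
      \<bar>broken_action t' z' - broken_action t z
         - (snd (broken t z) \<bullet> (fst (broken t' z') - fst (broken t z)) - snd z \<bullet> (fst z' - fst z)) + H1 z * (t' - t)\<bar>
      \<le> Ca * (\<bar>t' - t\<bar> + norm (z' - z))\<^sup>2"
    by (rule broken_action_differential) (rule that)
  have "isCont H1 zb0"
    using H1.H_cont zb0 H1.open_W by (simp add: continuous_on_eq_continuous_at)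
  then obtain rh where rh: "rh > 0" "\<And>z. dist z zb0 < rh \<Longrightarrow> dist (H1 z) (H1 zb0) < 1"
    unfolding continuous_at_eps_delta by (metis zero_less_one)
  define r where "r = min (min r0 ra) (min rh 1)"
  have r: "r > 0" "r \<le> 1" using rK a rh by (auto simp: r_def)
  have sub: "ball zb0 r \<subseteq> ball zb0 r0" "ball zb0 r \<subseteq> ball zb0 ra" "ball zb0 r \<subseteq> ball zb0 rh" "zb0 \<in> ball zb0 r"
    using r by (auto simp: r_def)
  have \<tau>: "\<bar>t1 z - t1 z'\<bar> \<le> K * norm (z - z')" "t1 z \<in> {0..tf}" "contact z \<in> W"
    if "z \<in> ball zb0 r" "z' \<in> ball zb0 r" for z z'
  proof -
    have z0: "z \<in> ball zb0 r0" "z' \<in> ball zb0 r0" using that sub by blast+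
    show "\<bar>t1 z - t1 z'\<bar> \<le> K * norm (z - z')" by (rule rK(5)[OF z0])
    show "t1 z \<in> {0..tf}" "contact z \<in> W" using rK(4)[OF z0(1)] by auto
  qed
  define L where "L = K * (1 + K) * (3 + 2 * K)"
  have L: "L > 0" using rK(2) by (simp add: L_def)
  have lip: "norm (broken t z - broken t' z') \<le> L * (\<bar>t - t'\<bar> + norm (z - z'))"
    if "z \<in> ball zb0 r" "z' \<in> ball zb0 r" "t \<in> {0..tf}" "t' \<in> {0..tf}" for z z' t t'
    unfolding L_def
  proof (rule lipschitz_glue[where \<tau> = t1 and T = "{0..tf}" and A = "ball zb0 r"])
    fix t t' z z' assume t: "t \<in> {0..tf}" "t' \<in> {0..tf}" and z: "z \<in> ball zb0 r" "z' \<in> ball zb0 r"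
    have z0: "z \<in> ball zb0 r0" "z' \<in> ball zb0 r0" using z sub by blast+
    {
      assume le: "t \<le> t1 z" "t' \<le> t1 z'"
      have "norm (broken t z - broken t' z') \<le> K * (\<bar>t - t'\<bar> + norm (z - z'))"
        using rK(7)[OF z0 t] le by (simp add: broken_before)
      also have "\<dots> \<le> K * (1 + K) * (\<bar>t - t'\<bar> + norm (z - z'))"
        using rK(2) by (intro mult_right_mono) (auto simp: algebra_simps)
      finally show "norm (broken t z - broken t' z') \<le> K * (1 + K) * (\<bar>t - t'\<bar> + norm (z - z'))" .
    }
    {
      assume le: "t1 z \<le> t" "t1 z' \<le> t'"
      have "norm (broken t z - broken t' z') \<le> K * (\<bar>(t - t1 z) - (t' - t1 z')\<bar> + norm (z - z'))"
        using rK(8)[OF z0, of "t - t1 z" "t' - t1 z'"] le t \<tau>[OF z] \<tau>[OF z(2,1)] by (simp add: broken_after)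
      also have "\<dots> \<le> K * ((1 + K) * (\<bar>t - t'\<bar> + norm (z - z')))"
      proof (rule mult_left_mono)
        have "\<bar>(t - t1 z) - (t' - t1 z')\<bar> \<le> \<bar>t - t'\<bar> + \<bar>t1 z - t1 z'\<bar>" by linarith
        moreover have "0 \<le> K * \<bar>t - t'\<bar>" using rK(2) by simp
        moreover have "(1 + K) * (\<bar>t - t'\<bar> + norm (z - z')) = \<bar>t - t'\<bar> + norm (z - z') + K * \<bar>t - t'\<bar> + K * norm (z - z')"
          by (simp add: algebra_simps)
        ultimately show "\<bar>(t - t1 z) - (t' - t1 z')\<bar> + norm (z - z') \<le> (1 + K) * (\<bar>t - t'\<bar> + norm (z - z'))"
          using \<tau>(1)[OF z] by linarith
      qed (use rK(2) in simp)
      finally show "norm (broken t z - broken t' z') \<le> K * (1 + K) * (\<bar>t - t'\<bar> + norm (z - z'))" by (simp add: mult.assoc)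
    }
  qed (use that \<tau> rK(2) in auto)
  define P where "P = norm zb0 + L * (tf + 1) + 1"
  have P: "P > 0" "norm zb0 + 1 \<le> P" "\<And>t z. z \<in> ball zb0 r \<Longrightarrow> t \<in> {0..tf} \<Longrightarrow> norm (broken t z) \<le> P"
  proof -
    have "L * (tf + 1) \<ge> 0" using L tf by simp
    then show "P > 0" "norm zb0 + 1 \<le> P" unfolding P_def using norm_ge_zero[of zb0] by linarith+
    fix t z assume a: "z \<in> ball zb0 r" "t \<in> {0..tf}"
    have b0: "broken 0 zb0 = zb0" using tb1 zb0 by (simp add: broken_flow_def t1_zb0 H1.flow_0)
    have "norm (broken t z) \<le> norm (broken 0 zb0) + norm (broken t z - broken 0 zb0)"
      using norm_triangle_ineq[of "broken 0 zb0" "broken t z - broken 0 zb0"] by simp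
    also have "\<dots> \<le> norm zb0 + L * (\<bar>t - 0\<bar> + norm (z - zb0))"
      using a tf sub(4) by (intro add_mono lip) (auto simp: b0)
    also have "\<dots> \<le> norm zb0 + L * (tf + 1)"
      using a r(2) L by (intro add_left_mono mult_left_mono add_mono) (auto simp: dist_norm norm_minus_commute)
    finally show "norm (broken t z) \<le> P" by (simp add: P_def)
  qed
  have fst_snd: "norm (fst v) \<le> norm v" "norm (snd v) \<le> norm v" for v :: "(real ^ 'n) \<times> (real ^ 'n)"
    using norm_fst_le[of "fst v" "snd v"] norm_snd_le[of "snd v" "fst v"] by simp_all
  define Q where "Q = P * L + P + (\<bar>H1 zb0\<bar> + 1) + Ca * (tf + 2)"
  have Q: "Q > 0" using P(1) L a(2) tf by (auto simp: Q_def intro!: add_pos_pos add_nonneg_pos mult_pos_pos)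
  have piece: "norm (broken_action t z - broken_action t' z') \<le> Q * (\<bar>t - t'\<bar> + norm (z - z'))"
    if z: "z \<in> ball zb0 r" "z' \<in> ball zb0 r" and t: "t \<in> {0..tf}" "t' \<in> {0..tf}"
      and side: "(t \<le> t1 z \<and> t' \<le> t1 z') \<or> (t1 z \<le> t \<and> t1 z' \<le> t')" for z z' t t'
  proof -
    let ?d = "\<bar>t' - t\<bar> + norm (z' - z)"
    have z0: "z \<in> ball zb0 ra" "z' \<in> ball zb0 ra" "z \<in> ball zb0 rh" using z sub by blast+
    have "norm (z' - z) \<le> norm (z' - zb0) + norm (zb0 - z)"
      using norm_triangle_ineq[of "z' - zb0" "zb0 - z"] by simp
    then have dT: "0 \<le> ?d" "?d \<le> tf + 2"
      using z t r(2) by (auto simp: dist_norm norm_minus_commute)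
    have 1: "\<bar>snd (broken t z) \<bullet> (fst (broken t' z') - fst (broken t z))\<bar> \<le> P * (L * ?d)"
    proof -
      have "\<bar>snd (broken t z) \<bullet> (fst (broken t' z') - fst (broken t z))\<bar>
          \<le> norm (snd (broken t z)) * norm (fst (broken t' z' - broken t z))"
        using Cauchy_Schwarz_ineq2[of "snd (broken t z)" "fst (broken t' z' - broken t z)"] by simp
      also have "\<dots> \<le> P * (L * ?d)"
        using order_trans[OF fst_snd(2) P(3)[OF z(1) t(1)]] order_trans[OF fst_snd(1) lip[OF z(2,1) t(2,1)]] P(1)
        by (intro mult_mono) auto
      finally show ?thesis .
    qed
    have 2: "\<bar>snd z \<bullet> (fst z' - fst z)\<bar> \<le> P * ?d"
    proof -
      have "\<bar>snd z \<bullet> (fst z' - fst z)\<bar> \<le> norm (snd z) * norm (fst (z' - z))"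
        using Cauchy_Schwarz_ineq2[of "snd z" "fst (z' - z)"] by simp
      also have "\<dots> \<le> P * ?d"
      proof (rule mult_mono)
        have "norm z \<le> norm zb0 + norm (z - zb0)" using norm_triangle_ineq[of zb0 "z - zb0"] by simp
        then show "norm (snd z) \<le> P"
          using fst_snd(2)[of z] P(2) z(1) r(2) by (simp add: dist_norm norm_minus_commute)
        show "norm (fst (z' - z)) \<le> ?d" using fst_snd(1)[of "z' - z"] by simp
      qed (use P in auto)
      finally show ?thesis .
    qed
    have 3: "\<bar>H1 z * (t' - t)\<bar> \<le> (\<bar>H1 zb0\<bar> + 1) * ?d"
      unfolding abs_mult using rh(2)[of z] z0(3) by (intro mult_mono) (auto simp: dist_commute dist_real_def)
    have 4: "Ca * ?d\<^sup>2 \<le> Ca * (tf + 2) * ?d"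
    proof -
      have "?d * ?d \<le> (tf + 2) * ?d" using dT by (intro mult_right_mono) auto
      then show ?thesis using a(2) by (simp add: power2_eq_square mult.assoc)
    qed
    have "\<bar>broken_action t' z' - broken_action t z\<bar> \<le> P * (L * ?d) + P * ?d + (\<bar>H1 zb0\<bar> + 1) * ?d + Ca * (tf + 2) * ?d"
      using a(3)[OF z0(1,2) t side] 1 2 3 4 by linarith
    also have "\<dots> = Q * ?d" by (simp add: Q_def algebra_simps)
    finally show ?thesis by (simp add: abs_minus_commute norm_minus_commute)
  qed
  have lipA: "norm (broken_action t z - broken_action t' z') \<le> Q * (3 + 2 * K) * (\<bar>t - t'\<bar> + norm (z - z'))"
    if "z \<in> ball zb0 r" "z' \<in> ball zb0 r" "t \<in> {0..tf}" "t' \<in> {0..tf}" for z z' t t'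
    by (rule lipschitz_glue[where \<tau> = t1 and T = "{0..tf}" and A = "ball zb0 r" and C = Q and K = K])
       (use that \<tau> Q rK(2) piece in \<open>simp_all\<close>)
  show ?thesis
  proof (rule that[of r "L + Q * (3 + 2 * K)"])
    have QK: "Q * (3 + 2 * K) > 0" using Q rK(2) by simp
    then show "L + Q * (3 + 2 * K) > 0" using L by linarith
    fix z z' t t' assume a: "z \<in> ball zb0 r" "z' \<in> ball zb0 r" "t \<in> {0..tf}" "t' \<in> {0..tf}"
    have "0 \<le> L * (\<bar>t - t'\<bar> + norm (z - z'))" "0 \<le> Q * (3 + 2 * K) * (\<bar>t - t'\<bar> + norm (z - z'))"
      using L QK by simp_all
    then show "norm (broken t z - broken t' z') \<le> (L + Q * (3 + 2 * K)) * (\<bar>t - t'\<bar> + norm (z - z'))"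
      "\<bar>broken_action t z - broken_action t' z'\<bar> \<le> (L + Q * (3 + 2 * K)) * (\<bar>t - t'\<bar> + norm (z - z'))"
      using lip[OF a] lipA[OF a] by (simp_all add: distrib_right)
  qed (rule r)
qed

text \<open>The bracket condition makes every neighbouring broken trajectory cross the switching set
  transversally and in the same direction; away from the contact, domination is an open condition
  along the compact reference arcs.\<close>

lemma broken_dominated:
  obtains r where "r > 0"
    "\<And>z t. z \<in> ball zb0 r \<Longrightarrow> t \<in> {0..tf} \<Longrightarrow> t < t1 z \<Longrightarrow> broken t z \<in> dominance_set X H1 H2"
    "\<And>z t. z \<in> ball zb0 r \<Longrightarrow> t \<in> {0..tf} \<Longrightarrow> t1 z < t \<Longrightarrow> broken t z \<in> dominance_set X H2 H1"
proof -
  obtain r0 K where rK: "r0 > 0" "K > 0" "ball zb0 r0 \<subseteq> W"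
    "\<And>z. z \<in> ball zb0 r0 \<Longrightarrow> t1 z \<in> {0<..<tf} \<and> contact z \<in> switching_set X H1 H2 \<and> contact z \<in> W"
    "\<And>z z'. z \<in> ball zb0 r0 \<Longrightarrow> z' \<in> ball zb0 r0 \<Longrightarrow> \<bar>t1 z - t1 z'\<bar> \<le> K * norm (z - z')"
    "\<And>z z'. z \<in> ball zb0 r0 \<Longrightarrow> z' \<in> ball zb0 r0 \<Longrightarrow> norm (contact z - contact z') \<le> K * norm (z - z')"
    "\<And>z z' s s'. z \<in> ball zb0 r0 \<Longrightarrow> z' \<in> ball zb0 r0 \<Longrightarrow> s \<in> {0..tf} \<Longrightarrow> s' \<in> {0..tf} \<Longrightarrow>
       norm (\<zeta>1 s z - \<zeta>1 s' z') \<le> K * (\<bar>s - s'\<bar> + norm (z - z'))"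
    "\<And>z z' s s'. z \<in> ball zb0 r0 \<Longrightarrow> z' \<in> ball zb0 r0 \<Longrightarrow> s \<in> {0..tf} \<Longrightarrow> s' \<in> {0..tf} \<Longrightarrow>
       norm (\<zeta>2 s (contact z) - \<zeta>2 s' (contact z')) \<le> K * (\<bar>s - s'\<bar> + norm (z - z'))"
    by (rule contact_lipschitz) (rule that)
  have "continuous_on W (\<lambda>z. ham_vec H1 z \<bullet> (- rot (ham_vec H2 z)))"
    unfolding rot_def by (intro continuous_intros H1.F_cont H2.F_cont)
  moreover have pb: "ham_vec H1 z \<bullet> (- rot (ham_vec H2 z)) = - poisson_bracket H1 H2 z" for z
    by (simp add: rot_def ham_vec_def poisson_bracket_def inner_prod_def algebra_simps)
  ultimately have "continuous_on W (poisson_bracket H1 H2)"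
    using continuous_on_minus[of W "\<lambda>z. - poisson_bracket H1 H2 z"] by simp
  then have "open (W \<inter> poisson_bracket H1 H2 -` {0<..})"
    by (intro continuous_open_preimage H1.open_W) auto
  then obtain R where R: "R > 0" "ball zb1 R \<subseteq> W \<inter> poisson_bracket H1 H2 -` {0<..}"
    using openE[of "W \<inter> poisson_bracket H1 H2 -` {0<..}" zb1] zb1 bracket by auto
  define \<eta> where "\<eta> = min (R / (8 * K)) (min (tb1 / 2) ((tf - tb1) / 2))"
  have \<eta>: "\<eta> > 0" "\<eta> < tb1" "\<eta> < tf - tb1" "K * (4 * \<eta>) < R"
  proof -
    show "\<eta> > 0" using R(1) rK(2) tb1 by (simp add: \<eta>_def)
    have "\<eta> \<le> tb1 / 2" "\<eta> \<le> (tf - tb1) / 2"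
      unfolding \<eta>_def by (rule min.coboundedI2, rule min.cobounded1, rule min.coboundedI2, rule min.cobounded2)
    moreover have "tb1 / 2 < tb1" "(tf - tb1) / 2 < tf - tb1" using tb1 by simp_all
    ultimately show "\<eta> < tb1" "\<eta> < tf - tb1" by (auto intro: le_less_trans)
    have "\<eta> \<le> R / (8 * K)" by (simp add: \<eta>_def)
    then have "\<eta> * (8 * K) \<le> R" using rK(2) by (subst (asm) pos_le_divide_eq) auto
    then have "2 * (K * (4 * \<eta>)) \<le> R" by (simp add: mult_ac)
    then show "K * (4 * \<eta>) < R" using R(1) by linarith
  qed
  have open_dom: "open (dominance_set X F G)" if "continuous_on W F" "continuous_on W G" for F G
  proof -
    have "open (W \<inter> (\<lambda>z. F z - G z) -` {0<..})"
      using that by (intro continuous_open_preimage H1.open_W continuous_intros) auto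
    moreover have "dominance_set X F G = W \<inter> (\<lambda>z. F z - G z) -` {0<..}" by (auto simp: dominance_set_def)
    ultimately show ?thesis by simp
  qed
  have "compact ((\<lambda>t. \<zeta>1 t zb0) ` {0..tb1 - \<eta>})" "(\<lambda>t. \<zeta>1 t zb0) ` {0..tb1 - \<eta>} \<subseteq> dominance_set X H1 H2"
    using dominance1 \<eta> by (auto intro!: compact_continuous_image H1.flow_cont zb0)
  then obtain ea where ea: "ea > 0" "(\<Union>x\<in>(\<lambda>t. \<zeta>1 t zb0) ` {0..tb1 - \<eta>}. ball x ea) \<subseteq> dominance_set X H1 H2"
    using compact_subset_open_imp_ball_epsilon_subset[OF _ open_dom[OF H1.H_cont H2.H_cont]] by blast
  have "compact ((\<lambda>t. \<zeta>2 t zb1) ` {\<eta>..tf - tb1})" "(\<lambda>t. \<zeta>2 t zb1) ` {\<eta>..tf - tb1} \<subseteq> dominance_set X H2 H1"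
    using dominance2 \<eta> by (auto intro!: compact_continuous_image H2.flow_cont zb1)
  then obtain eb where eb: "eb > 0" "(\<Union>x\<in>(\<lambda>t. \<zeta>2 t zb1) ` {\<eta>..tf - tb1}. ball x eb) \<subseteq> dominance_set X H2 H1"
    using compact_subset_open_imp_ball_epsilon_subset[OF _ open_dom[OF H2.H_cont H1.H_cont]] by blast
  define r where "r = min (min r0 \<eta>) (min (\<eta> / K) (min (ea / K) (eb / (K * (K + 1)))))"
  have r: "r > 0" "r \<le> r0" "r \<le> \<eta>" "r \<le> \<eta> / K" "r \<le> ea / K" "r \<le> eb / (K * (K + 1))"
    using rK \<eta> ea eb by (auto simp: r_def)
  have near: "norm (z - zb0) < \<eta>" "\<bar>t1 z - tb1\<bar> < \<eta>" "K * norm (z - zb0) < ea" "K * ((K + 1) * norm (z - zb0)) < eb"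
    "z \<in> ball zb0 r0" "zb0 \<in> ball zb0 r0" "z \<in> W"
    if z: "z \<in> ball zb0 r" for z
  proof -
    have n: "norm (z - zb0) < r" using z by (simp add: dist_norm norm_minus_commute)
    show z0: "z \<in> ball zb0 r0" "zb0 \<in> ball zb0 r0" using z r rK(1) by auto
    show "z \<in> W" using z0 rK(3) by blast
    show "norm (z - zb0) < \<eta>" using n r by simp
    have "K * norm (z - zb0) < \<eta>" "K * norm (z - zb0) < ea"
      using n r(4,5) rK(2) by (auto simp: pos_le_divide_eq mult.commute intro: less_le_trans[OF mult_strict_left_mono])
    then show "\<bar>t1 z - tb1\<bar> < \<eta>" "K * norm (z - zb0) < ea"
      using rK(5)[OF z0] by (simp_all add: t1_zb0)
    have "norm (z - zb0) < eb / (K * (K + 1))" using n r(6) by simp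
    then show "K * ((K + 1) * norm (z - zb0)) < eb"
      using rK(2) by (simp add: pos_less_divide_eq mult_ac)
  qed
  show ?thesis
  proof (rule that[OF r(1)])
    fix z t assume z: "z \<in> ball zb0 r" and t: "t \<in> {0..tf}"
    note n = near[OF z]
    have sw: "contact z \<in> switching_set X H1 H2" "contact z \<in> W" "t1 z \<in> {0..tf}" using rK(4)[OF n(5)] by auto
    then have eq: "H1 (contact z) = H2 (contact z)" by (simp add: switching_set_def)
    {
      assume lt: "t < t1 z"
      then have br: "broken t z = \<zeta>1 t z" by (simp add: broken_before)
      show "broken t z \<in> dominance_set X H1 H2"
      proof (cases "t \<le> tb1 - \<eta>")
        case True
        have "norm (\<zeta>1 t z - \<zeta>1 t zb0) \<le> K * (\<bar>t - t\<bar> + norm (z - zb0))" by (rule rK(7)[OF n(5,6) t t])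
        then have "\<zeta>1 t z \<in> ball (\<zeta>1 t zb0) ea" using n(3) by (simp add: dist_norm norm_minus_commute)
        then show ?thesis using ea(2) True t unfolding br by fastforce
      next
        case False
        have "H2 (\<zeta>1 t z) < H2 (\<zeta>1 (t1 z) z)"
        proof (rule DERIV_pos_imp_increasing[OF lt, where f = "\<lambda>s. H2 (\<zeta>1 s z)"])
          fix s assume s: "t \<le> s" "s \<le> t1 z"
          have sT: "s \<in> {0..tf}" using s t sw(3) by auto
          have s\<eta>: "\<bar>s - tb1\<bar> < \<eta>" using s False n(2) by linarith
          have "norm (\<zeta>1 s z - zb1) \<le> K * (\<bar>s - tb1\<bar> + norm (z - zb0))"
            using sT tb1 by (intro rK(7)[OF n(5,6)]) auto
          also have "\<dots> \<le> K * (4 * \<eta>)" using s\<eta> n(1) rK(2) by (intro mult_left_mono) auto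
          finally have "\<zeta>1 s z \<in> ball zb1 R" using \<eta>(4) by (simp add: dist_norm norm_minus_commute)
          then have "poisson_bracket H1 H2 (\<zeta>1 s z) > 0" using R(2) by auto
          moreover have "((\<lambda>s. H2 (\<zeta>1 s z)) has_real_derivative poisson_bracket H1 H2 (\<zeta>1 s z)) (at s)"
            by (rule H1.deriv_along_flow[OF n(7) H2.H_deriv[OF H1.flow_in[OF n(7)]]])
          ultimately show "\<exists>y. ((\<lambda>s. H2 (\<zeta>1 s z)) has_real_derivative y) (at s) \<and> 0 < y" by blast
        qed
        moreover have "H1 (\<zeta>1 t z) = H1 (\<zeta>1 (t1 z) z)" by (simp add: H1.H_conserved[OF n(7)])
        ultimately show ?thesis using eq H1.flow_in[OF n(7)] by (simp add: br dominance_set_def)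
      qed
    }
    {
      assume gt: "t1 z < t"
      then have br: "broken t z = \<zeta>2 (t - t1 z) (contact z)" using sw(2) by (simp add: broken_after)
      show "broken t z \<in> dominance_set X H2 H1"
      proof (cases "tb1 + \<eta> \<le> t")
        case True
        have "norm (\<zeta>2 (t - t1 z) (contact z) - \<zeta>2 (t - tb1) (contact zb0)) \<le> K * (\<bar>(t - t1 z) - (t - tb1)\<bar> + norm (z - zb0))"
          using t gt sw(3) True \<eta>(1) tb1 by (intro rK(8)[OF n(5,6)]) auto
        also have "\<dots> \<le> K * ((K + 1) * norm (z - zb0))"
          using rK(5)[OF n(5,6)] rK(2) by (intro mult_left_mono) (auto simp: t1_zb0 algebra_simps)
        finally have "\<zeta>2 (t - t1 z) (contact z) \<in> ball (\<zeta>2 (t - tb1) zb1) eb"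
          using n(4) by (simp add: t1_zb0 dist_norm norm_minus_commute)
        moreover have "t - tb1 \<in> {\<eta>..tf - tb1}" using True t by auto
        ultimately show ?thesis using eb(2) unfolding br by blast
      next
        case False
        have "H1 (\<zeta>2 (t - t1 z) (contact z)) < H1 (\<zeta>2 0 (contact z))"
        proof (rule DERIV_neg_imp_decreasing[where f = "\<lambda>s. H1 (\<zeta>2 s (contact z))"])
          show "0 < t - t1 z" using gt by simp
          fix s assume s: "0 \<le> s" "s \<le> t - t1 z"
          have sT: "s \<in> {0..tf}" using s t sw(3) by auto
          have s\<eta>: "\<bar>s\<bar> \<le> 2 * \<eta>" using s False n(2) by linarith
          have "norm (\<zeta>2 s (contact z) - \<zeta>2 0 (contact zb0)) \<le> K * (\<bar>s - 0\<bar> + norm (z - zb0))"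
            using sT tf by (intro rK(8)[OF n(5,6)]) auto
          also have "\<dots> \<le> K * (4 * \<eta>)" using s\<eta> n(1) rK(2) by (intro mult_left_mono) auto
          finally have "\<zeta>2 s (contact z) \<in> ball zb1 R"
            using \<eta>(4) zb1 by (simp add: t1_zb0 H2.flow_0 dist_norm norm_minus_commute)
          then have "poisson_bracket H1 H2 (\<zeta>2 s (contact z)) > 0" using R(2) by auto
          moreover have "poisson_bracket H2 H1 v = - poisson_bracket H1 H2 v" for v
            by (simp add: poisson_bracket_def inner_commute)
          moreover have "((\<lambda>s. H1 (\<zeta>2 s (contact z))) has_real_derivative poisson_bracket H2 H1 (\<zeta>2 s (contact z))) (at s)"
            by (rule H2.deriv_along_flow[OF sw(2) H1.H_deriv[OF H2.flow_in[OF sw(2)]]])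
          ultimately show "\<exists>y. ((\<lambda>s. H1 (\<zeta>2 s (contact z))) has_real_derivative y) (at s) \<and> y < 0"
            by (intro exI[of _ "poisson_bracket H2 H1 (\<zeta>2 s (contact z))"]) simp
        qed
        moreover have "H2 (\<zeta>2 (t - t1 z) (contact z)) = H2 (contact z)" by (simp add: H2.H_conserved[OF sw(2)])
        ultimately show ?thesis using eq H2.flow_in[OF sw(2)] sw(2) by (simp add: br dominance_set_def H2.flow_0)
      qed
    }
  qed
qed

text \<open>At the contact itself the inequality is obtained as a limit from the first arc.\<close>

lemma broken_maximality:
  obtains r where "r > 0" "\<And>z t G. z \<in> ball zb0 r \<Longrightarrow> t \<in> {0..tf} \<Longrightarrow> continuous_on W G \<Longrightarrow>
     \<forall>y\<in>dominance_set X H1 H2. G y \<le> H1 y \<Longrightarrow>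
     \<forall>y\<in>dominance_set X H2 H1. G y \<le> H2 y \<Longrightarrow> broken t z \<in> W \<and> G (broken t z) \<le> H1 z"
proof -
  obtain r0 K where rK: "r0 > 0" "K > 0" "ball zb0 r0 \<subseteq> W"
    "\<And>z. z \<in> ball zb0 r0 \<Longrightarrow> t1 z \<in> {0<..<tf} \<and> contact z \<in> switching_set X H1 H2 \<and> contact z \<in> W"
    "\<And>z z'. z \<in> ball zb0 r0 \<Longrightarrow> z' \<in> ball zb0 r0 \<Longrightarrow> \<bar>t1 z - t1 z'\<bar> \<le> K * norm (z - z')"
    "\<And>z z'. z \<in> ball zb0 r0 \<Longrightarrow> z' \<in> ball zb0 r0 \<Longrightarrow> norm (contact z - contact z') \<le> K * norm (z - z')"
    "\<And>z z' s s'. z \<in> ball zb0 r0 \<Longrightarrow> z' \<in> ball zb0 r0 \<Longrightarrow> s \<in> {0..tf} \<Longrightarrow> s' \<in> {0..tf} \<Longrightarrow>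
       norm (\<zeta>1 s z - \<zeta>1 s' z') \<le> K * (\<bar>s - s'\<bar> + norm (z - z'))"
    "\<And>z z' s s'. z \<in> ball zb0 r0 \<Longrightarrow> z' \<in> ball zb0 r0 \<Longrightarrow> s \<in> {0..tf} \<Longrightarrow> s' \<in> {0..tf} \<Longrightarrow>
       norm (\<zeta>2 s (contact z) - \<zeta>2 s' (contact z')) \<le> K * (\<bar>s - s'\<bar> + norm (z - z'))"
    by (rule contact_lipschitz) (rule that)
  obtain rd where rd: "rd > 0"
    "\<And>z t. z \<in> ball zb0 rd \<Longrightarrow> t \<in> {0..tf} \<Longrightarrow> t < t1 z \<Longrightarrow> broken t z \<in> dominance_set X H1 H2"
    "\<And>z t. z \<in> ball zb0 rd \<Longrightarrow> t \<in> {0..tf} \<Longrightarrow> t1 z < t \<Longrightarrow> broken t z \<in> dominance_set X H2 H1"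
    by (rule broken_dominated) (rule that)
  show ?thesis
  proof (rule that[of "min r0 rd"])
    show "min r0 rd > 0" using rK rd by simp
    fix z t G assume z: "z \<in> ball zb0 (min r0 rd)" and t: "t \<in> {0..tf}" and G: "continuous_on W G"
      "\<forall>y\<in>dominance_set X H1 H2. G y \<le> H1 y" "\<forall>y\<in>dominance_set X H2 H1. G y \<le> H2 y"
    have z0: "z \<in> ball zb0 r0" "z \<in> ball zb0 rd" using z by auto
    have zW: "z \<in> W" using z0 rK(3) by blast
    have c: "t1 z \<in> {0<..<tf}" "contact z \<in> switching_set X H1 H2" "contact z \<in> W" using rK(4)[OF z0(1)] by auto
    have before: "G (\<zeta>1 s z) \<le> H1 z" if "s \<in> {0..<t1 z}" for s
    proof -
      have "broken s z \<in> dominance_set X H1 H2" using that c(1) by (intro rd(2)[OF z0(2)]) auto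
      then have "G (\<zeta>1 s z) \<le> H1 (\<zeta>1 s z)" using G(2) that by (simp add: broken_before)
      then show ?thesis by (simp add: H1.H_conserved[OF zW])
    qed
    consider "t < t1 z" | "t = t1 z" | "t > t1 z" by linarith
    then have "G (broken t z) \<le> H1 z"
    proof cases
      case 1
      then show ?thesis using before[of t] t by (simp add: broken_before)
    next
      case 2
      have "((\<lambda>s. G (\<zeta>1 s z)) \<longlongrightarrow> G (contact z)) (at_left (t1 z))"
      proof -
        have "continuous_on UNIV (\<lambda>s. G (\<zeta>1 s z))"
          by (rule continuous_on_compose2[OF G(1) H1.flow_cont[OF zW]]) (use H1.flow_in[OF zW] in auto)
        then have "isCont (\<lambda>s. G (\<zeta>1 s z)) (t1 z)" by (simp add: continuous_on_eq_continuous_at)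
        then show ?thesis unfolding isCont_def by (rule filterlim_mono) (auto simp: at_le)
      qed
      moreover have "\<forall>\<^sub>F s in at_left (t1 z). G (\<zeta>1 s z) \<le> H1 z"
        using eventually_at_left_real[of 0 "t1 z"] c(1) by (auto elim!: eventually_mono intro: before)
      ultimately have "G (contact z) \<le> H1 z"
        by (rule tendsto_upperbound) auto
      then show ?thesis using 2 by (simp add: broken_before)
    next
      case 3
      then have "G (broken t z) \<le> H2 (broken t z)" using G(3) rd(3)[OF z0(2) t] by blast
      also have "\<dots> = H2 (contact z)" using 3 c(3) by (simp add: broken_after H2.H_conserved)
      also have "\<dots> = H1 z" using c(2) H1.H_conserved[OF zW, of "t1 z"] by (simp add: switching_set_def)
      finally show ?thesis .
    qed
    moreover have "broken t z \<in> W"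
      using H1.flow_in[OF zW] H2.flow_in[OF c(3)] by (simp add: broken_flow_def)
    ultimately show "broken t z \<in> W \<and> G (broken t z) \<le> H1 z" by simp
  qed
qed

end

section \<open>The field of broken extremals\<close>

context linearized_broken_extremal
begin

text \<open>The value function is the broken action plus the generating function \<open>\<epsilon> |q|\<^sup>2 / 2\<close> of the tilted initial set: the
  differential of the latter is \<open>\<epsilon> q dq = p\<^sub>0 dx\<^sub>0\<close>, which cancels the initial term in the differential of the action.\<close>

lemma field_exists:
  fixes U :: "(real ^ 'm) set" and f :: "real ^ 'n \<Rightarrow> real ^ 'm \<Rightarrow> real ^ 'n" and f0 :: "real ^ 'n \<Rightarrow> real ^ 'm \<Rightarrow> real"
  assumes A2: "\<And>t. t \<in> {0<..<tb1} \<union> {tb1<..tf} \<Longrightarrow> fold_det \<zeta>1 \<zeta>2 t1 zb0 t \<noteq> 0"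
    and no_fold: "Lim (at_right tb1) (fold_det \<zeta>1 \<zeta>2 t1 zb0) * Lim (at_left tb1) (fold_det \<zeta>1 \<zeta>2 t1 zb0) > 0"
    and psd: "\<And>z p. z \<in> dominance_set X H1 H2 \<Longrightarrow> hessian H1 z (0, p) (0, p) \<ge> 0"
    and cont: "\<And>u. u \<in> U \<Longrightarrow> continuous_on W (\<lambda>z. control_hamiltonian f f0 (-1) z u)"
    and le1: "\<And>u z. u \<in> U \<Longrightarrow> z \<in> dominance_set X H1 H2 \<Longrightarrow> control_hamiltonian f f0 (-1) z u \<le> H1 z"
    and le2: "\<And>u z. u \<in> U \<Longrightarrow> z \<in> dominance_set X H2 H1 \<Longrightarrow> control_hamiltonian f f0 (-1) z u \<le> H2 z"
  obtains \<xi> \<pi> S h r c M where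
    "extremal_field U f f0 tf (fst zb0) (fst (broken tf zb0)) \<xi> \<pi> S h (snd zb0) r c M"
    "\<And>t. \<xi> t (snd zb0) = fst (broken t zb0)" "\<And>t. \<pi> t (snd zb0) = snd (broken t zb0)" "h (snd zb0) = H1 zb0"
proof -
  obtain \<epsilon> c where \<epsilon>c: "\<epsilon> > 0" "c > 0"
    "\<And>t w. t \<in> {0..tb1} \<Longrightarrow> c * norm w \<le> norm (B1 \<epsilon> t w)"
    "\<And>\<sigma> w. \<sigma> \<in> {0..tf - tb1} \<Longrightarrow> c * norm w \<le> norm (B2 \<epsilon> \<sigma> w)"
    "\<And>\<mu> w. \<mu> \<in> {0..1} \<Longrightarrow> c * norm w \<le> norm (B1 \<epsilon> tb1 w + (\<mu> * dt1 (\<iota> \<epsilon> w)) *\<^sub>R fst (F1 - F2))"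
  proof (rule tilted_field_regular[OF _ no_fold])
    show "fold_det \<zeta>1 \<zeta>2 t1 zb0 t \<noteq> 0" if "t \<in> {0<..<tb1} \<union> {tb1<..tf}" for t by (rule A2[OF that])
    show "hessian H1 z (0, p) (0, p) \<ge> 0" if "z \<in> dominance_set X H1 H2" for z p by (rule psd[OF that])
  qed (rule that)
  define E where "E = \<epsilon> + 1"
  have E: "E > 0" using \<epsilon>c(1) by (simp add: E_def)
  define qb where "qb = snd zb0"
  define z0 where "z0 q = (fst zb0 + \<epsilon> *\<^sub>R (q - qb), q)" for q
  have z0_qb: "z0 qb = zb0" by (simp add: z0_def qb_def)
  have z0_diff: "z0 q - z0 q' = \<iota> \<epsilon> (q - q')" for q q'
    by (simp add: z0_def \<iota>_apply algebra_simps)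
  have \<iota>_le: "norm (\<iota> \<epsilon> w) \<le> E * norm w" for w
    using norm_triangle_ineq[of "(\<epsilon> *\<^sub>R w, 0)" "(0, w)"] \<epsilon>c(1) by (simp add: \<iota>_apply E_def algebra_simps)
  have z0_le: "norm (z0 q - z0 q') \<le> E * norm (q - q')" for q q'
    unfolding z0_diff by (rule \<iota>_le)
  obtain r1 K where rK: "r1 > 0" "K > 0" "ball zb0 r1 \<subseteq> W"
    "\<And>z. z \<in> ball zb0 r1 \<Longrightarrow> t1 z \<in> {0<..<tf} \<and> contact z \<in> switching_set X H1 H2 \<and> contact z \<in> W"
    "\<And>z z'. z \<in> ball zb0 r1 \<Longrightarrow> z' \<in> ball zb0 r1 \<Longrightarrow> \<bar>t1 z - t1 z'\<bar> \<le> K * norm (z - z')"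
    "\<And>z z'. z \<in> ball zb0 r1 \<Longrightarrow> z' \<in> ball zb0 r1 \<Longrightarrow> norm (contact z - contact z') \<le> K * norm (z - z')"
    "\<And>z z' s s'. z \<in> ball zb0 r1 \<Longrightarrow> z' \<in> ball zb0 r1 \<Longrightarrow> s \<in> {0..tf} \<Longrightarrow> s' \<in> {0..tf} \<Longrightarrow>
       norm (\<zeta>1 s z - \<zeta>1 s' z') \<le> K * (\<bar>s - s'\<bar> + norm (z - z'))"
    "\<And>z z' s s'. z \<in> ball zb0 r1 \<Longrightarrow> z' \<in> ball zb0 r1 \<Longrightarrow> s \<in> {0..tf} \<Longrightarrow> s' \<in> {0..tf} \<Longrightarrow>
       norm (\<zeta>2 s (contact z) - \<zeta>2 s' (contact z')) \<le> K * (\<bar>s - s'\<bar> + norm (z - z'))"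
    by (rule contact_lipschitz) (rule that)
  obtain r2 CA where r2: "r2 > 0" "CA > 0"
    "\<And>z z' t t'. z \<in> ball zb0 r2 \<Longrightarrow> z' \<in> ball zb0 r2 \<Longrightarrow> t \<in> {0..tf} \<Longrightarrow> t' \<in> {0..tf} \<Longrightarrow>
      (t \<le> t1 z \<and> t' \<le> t1 z') \<or> (t1 z \<le> t \<and> t1 z' \<le> t') \<Longrightarrow>
      \<bar>broken_action t' z' - broken_action t z
         - (snd (broken t z) \<bullet> (fst (broken t' z') - fst (broken t z)) - snd z \<bullet> (fst z' - fst z)) + H1 z * (t' - t)\<bar>
      \<le> CA * (\<bar>t' - t\<bar> + norm (z' - z))\<^sup>2"
    by (rule broken_action_differential) (rule that)
  obtain r3 L where r3: "r3 > 0" "L > 0"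
    "\<And>z z' t t'. z \<in> ball zb0 r3 \<Longrightarrow> z' \<in> ball zb0 r3 \<Longrightarrow> t \<in> {0..tf} \<Longrightarrow> t' \<in> {0..tf} \<Longrightarrow>
       norm (broken t z - broken t' z') \<le> L * (\<bar>t - t'\<bar> + norm (z - z'))"
    "\<And>z z' t t'. z \<in> ball zb0 r3 \<Longrightarrow> z' \<in> ball zb0 r3 \<Longrightarrow> t \<in> {0..tf} \<Longrightarrow> t' \<in> {0..tf} \<Longrightarrow>
       \<bar>broken_action t z - broken_action t' z'\<bar> \<le> L * (\<bar>t - t'\<bar> + norm (z - z'))"
    by (rule broken_lipschitz) (rule that)
  obtain r4 where r4: "r4 > 0" "\<And>z t G. z \<in> ball zb0 r4 \<Longrightarrow> t \<in> {0..tf} \<Longrightarrow> continuous_on W G \<Longrightarrow>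
     \<forall>y\<in>dominance_set X H1 H2. G y \<le> H1 y \<Longrightarrow>
     \<forall>y\<in>dominance_set X H2 H1. G y \<le> H2 y \<Longrightarrow> broken t z \<in> W \<and> G (broken t z) \<le> H1 z"
    by (rule broken_maximality) (rule that)
  (* The accuracy for which the strict derivative of the broken flow loses at most half of the
     expansion constant c. *)
  define e where "e = c / (2 * E)"
  have e: "e > 0" "e * E = c / 2" using \<epsilon>c(2) E by (auto simp: e_def)
  obtain r5 where r5: "r5 > 0"
    "\<And>z z' t. z \<in> ball zb0 r5 \<Longrightarrow> z' \<in> ball zb0 r5 \<Longrightarrow> t \<in> {0..tf} \<Longrightarrow> t \<le> t1 z \<Longrightarrow> t \<le> t1 z' \<Longrightarrow>
       norm (broken t z - broken t z' - \<Phi>1 (min t tb1) (z - z')) \<le> e * norm (z - z')"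
    "\<And>z z' t. z \<in> ball zb0 r5 \<Longrightarrow> z' \<in> ball zb0 r5 \<Longrightarrow> t \<in> {0..tf} \<Longrightarrow> t1 z \<le> t \<Longrightarrow> t1 z' \<le> t \<Longrightarrow>
       norm (broken t z - broken t z' - \<Psi> (max (t - tb1) 0) (z - z')) \<le> e * norm (z - z')"
    "\<And>z z' t. z \<in> ball zb0 r5 \<Longrightarrow> z' \<in> ball zb0 r5 \<Longrightarrow> t \<in> {0..tf} \<Longrightarrow> t1 z' \<le> t \<Longrightarrow> t \<le> t1 z \<Longrightarrow>
       \<exists>\<mu>\<in>{0..1}. norm (broken t z - broken t z' - (\<Phi>1 tb1 (z - z') + (\<mu> * dt1 (z - z')) *\<^sub>R (F1 - F2))) \<le> e * norm (z - z')"
    by (rule broken_strict_derivative[OF e(1)]) (rule that)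
  define rr where "rr = min r1 (min r2 (min r3 (min r4 r5)))"
  define r where "r = rr / E"
  have r: "r > 0" using rK(1) r2(1) r3(1) r4(1) r5(1) E by (simp add: r_def rr_def)
  have z0_in: "z0 q \<in> ball zb0 r1" "z0 q \<in> ball zb0 r2" "z0 q \<in> ball zb0 r3" "z0 q \<in> ball zb0 r4" "z0 q \<in> ball zb0 r5"
    if q: "q \<in> ball qb r" for q
  proof -
    have "norm (z0 q - zb0) \<le> E * norm (q - qb)" using z0_le[of q qb] by (simp add: z0_qb)
    also have "\<dots> < E * r" using q E by (simp add: dist_norm norm_minus_commute)
    finally have "dist zb0 (z0 q) < rr" using E by (simp add: r_def dist_norm norm_minus_commute)
    then show "z0 q \<in> ball zb0 r1" "z0 q \<in> ball zb0 r2" "z0 q \<in> ball zb0 r3" "z0 q \<in> ball zb0 r4" "z0 q \<in> ball zb0 r5"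
      by (auto simp: rr_def)
  qed
  define \<xi> where "\<xi> t q = fst (broken t (z0 q))" for t q
  define \<pi> where "\<pi> t q = snd (broken t (z0 q))" for t q
  define S where "S t q = \<epsilon> / 2 * (q \<bullet> q) + broken_action t (z0 q)" for t q
  define h where "h q = H1 (z0 q)" for q
  define M where "M = L * (1 + E) + \<epsilon> * (norm qb + r)"
  have fst_le: "norm (fst v) \<le> norm v" for v :: "(real ^ 'n) \<times> (real ^ 'n)"
    using norm_fst_le[of "fst v" "snd v"] by simp
  have expand: "c / 2 * norm (q - q') \<le> norm (\<xi> t q - \<xi> t q')"
    if V: "norm (broken t (z0 q) - broken t (z0 q') - V) \<le> e * norm (z0 q - z0 q')"
      and cV: "c * norm (q - q') \<le> norm (fst V)" for t q q' V
  proof -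
    let ?b = "broken t (z0 q) - broken t (z0 q')"
    have "norm (fst (?b - V)) \<le> e * (E * norm (q - q'))"
      using fst_le[of "?b - V"] V z0_le[of q q'] e(1) by (meson less_imp_le mult_left_mono order_trans)
    also have "\<dots> = c / 2 * norm (q - q')" using e(2) by (simp add: mult.assoc[symmetric])
    finally have "norm (fst V) \<le> norm (fst ?b) + c / 2 * norm (q - q')"
      using norm_triangle_ineq4[of "fst ?b" "fst (?b - V)"] by simp
    then show ?thesis using cV by (simp add: \<xi>_def)
  qed
  have expanding: "c / 2 * norm (q - q') \<le> norm (\<xi> t q - \<xi> t q')"
    if t: "t \<in> {0..tf}" and q: "q \<in> ball qb r" "q' \<in> ball qb r" for t q q'
  proof -
    have mixed: "c / 2 * norm (q - q') \<le> norm (\<xi> t q - \<xi> t q')"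
      if q: "q \<in> ball qb r" "q' \<in> ball qb r" and le: "t1 (z0 q') \<le> t" "t \<le> t1 (z0 q)" for q q'
    proof -
      obtain \<mu> where \<mu>: "\<mu> \<in> {0..1}"
        "norm (broken t (z0 q) - broken t (z0 q') - (\<Phi>1 tb1 (z0 q - z0 q') + (\<mu> * dt1 (z0 q - z0 q')) *\<^sub>R (F1 - F2))) \<le> e * norm (z0 q - z0 q')"
        using r5(4)[OF z0_in(5)[OF q(1)] z0_in(5)[OF q(2)] t le] by blast
      show ?thesis
        by (rule expand[OF \<mu>(2)])
           (use \<epsilon>c(5)[OF \<mu>(1), of "q - q'"] in \<open>simp add: z0_diff B1_apply \<iota>_apply\<close>)
    qed
    consider "t \<le> t1 (z0 q)" "t \<le> t1 (z0 q')" | "t1 (z0 q) \<le> t" "t1 (z0 q') \<le> t"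
      | "t1 (z0 q') \<le> t" "t \<le> t1 (z0 q)" | "t1 (z0 q) \<le> t" "t \<le> t1 (z0 q')" by linarith
    then show ?thesis
    proof cases
      case 1
      have "min t tb1 \<in> {0..tb1}" using t tb1 by auto
      from \<epsilon>c(3)[OF this, of "q - q'"] show ?thesis
        by (intro expand[OF r5(2)[OF z0_in(5)[OF q(1)] z0_in(5)[OF q(2)] t 1]]) (simp add: z0_diff B1_apply \<iota>_apply)
    next
      case 2
      have "max (t - tb1) 0 \<in> {0..tf - tb1}" using t tb1 by auto
      from \<epsilon>c(4)[OF this, of "q - q'"] show ?thesis
        by (intro expand[OF r5(3)[OF z0_in(5)[OF q(1)] z0_in(5)[OF q(2)] t 2]]) (simp add: z0_diff B2_apply \<iota>_apply)
    next
      case 3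
      then show ?thesis by (rule mixed[OF q])
    next
      case 4
      then show ?thesis using mixed[OF q(2,1)] by (simp add: norm_minus_commute)
    qed
  qed
  have pos_lip: "norm (\<xi> t q - \<xi> t' q') \<le> L * (\<bar>t - t'\<bar> + E * norm (q - q'))"
    if "t \<in> {0..tf}" "t' \<in> {0..tf}" "q \<in> ball qb r" "q' \<in> ball qb r" for t t' q q'
  proof -
    have "norm (\<xi> t q - \<xi> t' q') \<le> norm (broken t (z0 q) - broken t' (z0 q'))"
      using fst_le[of "broken t (z0 q) - broken t' (z0 q')"] by (simp add: \<xi>_def)
    also have "\<dots> \<le> L * (\<bar>t - t'\<bar> + norm (z0 q - z0 q'))" using that by (intro r3(3) z0_in)
    also have "\<dots> \<le> L * (\<bar>t - t'\<bar> + E * norm (q - q'))" using r3(2) z0_le by (intro mult_left_mono add_left_mono) auto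
    finally show ?thesis .
  qed
  have "extremal_field U f f0 tf (fst zb0) (fst (broken tf zb0)) \<xi> \<pi> S h qb r (c / 2) M"
  proof
    show "tf > 0" "r > 0" "c / 2 > 0" using tf r \<epsilon>c(2) by auto
    have M1: "L * (1 + E) > 0" "\<epsilon> * (norm qb + r) \<ge> 0" using r3(2) E \<epsilon>c(1) r by auto
    then show "M > 0" by (simp add: M_def)
    have LM: "L \<le> M" using M1(2) r3(2) E by (simp add: M_def algebra_simps)
    show "c / 2 * norm (q - q') \<le> norm (\<xi> t q - \<xi> t q')"
      if "t \<in> {0..tf}" "q \<in> ball qb r" "q' \<in> ball qb r" for t q q' by (rule expanding[OF that])
    show "continuous_on (ball qb r) (\<xi> t)" if t: "t \<in> {0..tf}" for t
    proof -
      have "(L * E)-lipschitz_on (ball qb r) (\<xi> t)"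
        by (rule lipschitz_onI) (use pos_lip[OF t t] r3(2) E in \<open>auto simp: dist_norm mult.assoc\<close>)
      then show ?thesis by (rule lipschitz_on_continuous_on)
    qed
    show "norm (\<xi> t q - \<xi> t' q) \<le> M * \<bar>t - t'\<bar>"
      if a: "t \<in> {0..tf}" "t' \<in> {0..tf}" "q \<in> ball qb r" for t t' q
      using pos_lip[OF a a(3)] mult_right_mono[OF LM abs_ge_zero[of "t - t'"]] by simp
    show "\<bar>S t q - S t' q'\<bar> \<le> M * (\<bar>t - t'\<bar> + norm (q - q'))"
      if a: "t \<in> {0..tf}" "t' \<in> {0..tf}" "q \<in> ball qb r" "q' \<in> ball qb r" for t t' q q'
    proof -
      let ?d = "\<bar>t - t'\<bar> + norm (q - q')"
      have "\<bar>broken_action t (z0 q) - broken_action t' (z0 q')\<bar> \<le> L * (\<bar>t - t'\<bar> + norm (z0 q - z0 q'))"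
        using a by (intro r3(4) z0_in)
      also have "\<dots> \<le> L * ((1 + E) * ?d)"
      proof (rule mult_left_mono)
        have "0 \<le> E * \<bar>t - t'\<bar>" "0 \<le> norm (q - q')" using E by simp_all
        moreover have "(1 + E) * ?d = \<bar>t - t'\<bar> + norm (q - q') + E * \<bar>t - t'\<bar> + E * norm (q - q')"
          by (simp add: algebra_simps)
        ultimately show "\<bar>t - t'\<bar> + norm (z0 q - z0 q') \<le> (1 + E) * ?d"
          using z0_le[of q q'] by linarith
      qed (use r3 in simp)
      finally have A: "\<bar>broken_action t (z0 q) - broken_action t' (z0 q')\<bar> \<le> L * (1 + E) * ?d" by (simp add: mult.assoc)
      have "q \<bullet> q - q' \<bullet> q' = (q - q') \<bullet> (q + q')" by (simp add: inner_commute algebra_simps)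
      then have "\<bar>q \<bullet> q - q' \<bullet> q'\<bar> \<le> norm (q - q') * norm (q + q')" by (simp add: Cauchy_Schwarz_ineq2)
      also have "\<dots> \<le> norm (q - q') * (2 * (norm qb + r))"
      proof (rule mult_left_mono)
        have "norm q \<le> norm qb + r" "norm q' \<le> norm qb + r"
          using norm_triangle_ineq[of qb "q - qb"] norm_triangle_ineq[of qb "q' - qb"] a(3,4)
          by (auto simp: dist_norm norm_minus_commute)
        then have "norm q + norm q' \<le> 2 * (norm qb + r)" by simp
        then show "norm (q + q') \<le> 2 * (norm qb + r)" by (rule norm_triangle_le)
      qed simp
      finally have "\<epsilon> / 2 * \<bar>q \<bullet> q - q' \<bullet> q'\<bar> \<le> \<epsilon> / 2 * (norm (q - q') * (2 * (norm qb + r)))"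
        using \<epsilon>c(1) by (intro mult_left_mono) auto
      then have B: "\<epsilon> / 2 * \<bar>q \<bullet> q - q' \<bullet> q'\<bar> \<le> \<epsilon> * (norm qb + r) * norm (q - q')"
        by (simp add: algebra_simps)
      have "S t q - S t' q' = \<epsilon> / 2 * (q \<bullet> q - q' \<bullet> q') + (broken_action t (z0 q) - broken_action t' (z0 q'))"
        by (simp add: S_def algebra_simps)
      then have "\<bar>S t q - S t' q'\<bar> \<le> \<epsilon> / 2 * \<bar>q \<bullet> q - q' \<bullet> q'\<bar> + \<bar>broken_action t (z0 q) - broken_action t' (z0 q')\<bar>"
        using \<epsilon>c(1) abs_triangle_ineq[of "\<epsilon> / 2 * (q \<bullet> q - q' \<bullet> q')" "broken_action t (z0 q) - broken_action t' (z0 q')"]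
        by (simp add: abs_mult)
      also have "\<dots> \<le> \<epsilon> * (norm qb + r) * norm (q - q') + L * (1 + E) * ?d" using A B by (rule add_mono[rotated])
      also have "\<dots> \<le> \<epsilon> * (norm qb + r) * ?d + L * (1 + E) * ?d"
        using M1(2) by (intro add_right_mono mult_left_mono) auto
      finally show ?thesis by (simp add: M_def algebra_simps)
    qed
    show "\<exists>d>0. \<exists>C>0. \<forall>t'\<in>{0..tf}. \<forall>q'\<in>ball qb r. \<bar>t' - t\<bar> < d \<longrightarrow> norm (q' - q) < d \<longrightarrow>
          \<bar>S t' q' - S t q - \<pi> t q \<bullet> (\<xi> t' q' - \<xi> t q) + h q * (t' - t)\<bar> \<le> C * (\<bar>t' - t\<bar> + norm (q' - q))\<^sup>2"
      if t: "t \<in> {0..tf}" and q: "q \<in> ball qb r" for t q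
    proof -
      let ?z = "z0 q"
      (* Near (t, q) all points lie on the same side of the contact as (t, q); if (t, q) is a contact
         itself, it belongs to both sides. *)
      define d where "d = (if t = t1 ?z then 1 else \<bar>t - t1 ?z\<bar> / (1 + K * E))"
      have KE: "K * E > 0" using rK(2) E by simp
      then have d: "d > 0" by (simp add: d_def)
      have side: "(t \<le> t1 ?z \<and> t' \<le> t1 (z0 q')) \<or> (t1 ?z \<le> t \<and> t1 (z0 q') \<le> t')"
        if q': "q' \<in> ball qb r" and near: "\<bar>t' - t\<bar> < d" "norm (q' - q) < d" for t' q'
      proof (cases "t = t1 ?z")
        case True
        then show ?thesis by linarith
      next
        case False
        have "\<bar>t1 (z0 q') - t1 ?z\<bar> \<le> K * norm (z0 q' - ?z)" by (rule rK(5)[OF z0_in(1)[OF q'] z0_in(1)[OF q]])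
        also have "\<dots> \<le> K * (E * norm (q' - q))" using rK(2) z0_le by (intro mult_left_mono) auto
        also have "\<dots> \<le> K * E * d" using near(2) KE mult_left_mono[of "norm (q' - q)" d "K * E"] by (simp add: mult.assoc)
        finally have "\<bar>t' - t\<bar> + \<bar>t1 (z0 q') - t1 ?z\<bar> < (1 + K * E) * d"
          using near(1) by (simp add: distrib_right)
        also have "\<dots> = \<bar>t - t1 ?z\<bar>" using False KE by (simp add: d_def add_pos_pos less_imp_neq[symmetric])
        finally show ?thesis by linarith
      qed
      show ?thesis
      proof (rule exI[of _ d], rule conjI[OF d], rule exI[of _ "CA * (1 + E)\<^sup>2 + \<epsilon>"], intro conjI ballI impI)
        show "CA * (1 + E)\<^sup>2 + \<epsilon> > 0" using r2(2) \<epsilon>c(1) by (simp add: add_nonneg_pos)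
        fix t' q' assume a: "t' \<in> {0..tf}" "q' \<in> ball qb r" "\<bar>t' - t\<bar> < d" "norm (q' - q) < d"
        let ?z' = "z0 q'" and ?d = "\<bar>t' - t\<bar> + norm (q' - q)"
        let ?A = "broken_action t' ?z' - broken_action t ?z
          - (snd (broken t ?z) \<bullet> (fst (broken t' ?z') - fst (broken t ?z)) - snd ?z \<bullet> (fst ?z' - fst ?z)) + H1 ?z * (t' - t)"
        have "\<bar>?A\<bar> \<le> CA * (\<bar>t' - t\<bar> + norm (?z' - ?z))\<^sup>2"
          by (rule r2(3)[OF z0_in(2)[OF q] z0_in(2)[OF a(2)] t a(1) side[OF a(2,3,4)]])
        also have "\<dots> \<le> CA * ((1 + E) * ?d)\<^sup>2"
        proof (intro mult_left_mono power_mono)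
          have "0 \<le> E * \<bar>t' - t\<bar>" "0 \<le> norm (q' - q)" using E by simp_all
          moreover have "(1 + E) * ?d = \<bar>t' - t\<bar> + norm (q' - q) + E * \<bar>t' - t\<bar> + E * norm (q' - q)"
            by (simp add: algebra_simps)
          ultimately show "\<bar>t' - t\<bar> + norm (?z' - ?z) \<le> (1 + E) * ?d"
            using z0_le[of q' q] by linarith
        qed (use r2(2) in auto)
        finally have A: "\<bar>?A\<bar> \<le> CA * (1 + E)\<^sup>2 * ?d\<^sup>2" by (simp only: power_mult_distrib mult.assoc)
        have B: "\<bar>\<epsilon> / 2 * ((q' - q) \<bullet> (q' - q))\<bar> \<le> \<epsilon> * ?d\<^sup>2"
        proof -
          have "(norm (q' - q))\<^sup>2 \<le> ?d\<^sup>2" by (intro power_mono) auto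
          then have "\<epsilon> * (norm (q' - q))\<^sup>2 \<le> \<epsilon> * ?d\<^sup>2" using \<epsilon>c(1) by (intro mult_left_mono) auto
          moreover have "0 \<le> \<epsilon> * (norm (q' - q))\<^sup>2" using \<epsilon>c(1) by simp
          ultimately show ?thesis unfolding power2_norm_eq_inner[symmetric] by (simp add: abs_mult)
        qed
        have "S t' q' - S t q - \<pi> t q \<bullet> (\<xi> t' q' - \<xi> t q) + h q * (t' - t) = ?A + \<epsilon> / 2 * ((q' - q) \<bullet> (q' - q))"
        proof -
          have "snd ?z \<bullet> (fst ?z' - fst ?z) = \<epsilon> * (q \<bullet> (q' - q))"
            by (simp add: z0_def algebra_simps)
          then show ?thesis
            by (simp add: S_def \<pi>_def \<xi>_def h_def inner_commute[of q' q] algebra_simps)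
        qed
        then have "\<bar>S t' q' - S t q - \<pi> t q \<bullet> (\<xi> t' q' - \<xi> t q) + h q * (t' - t)\<bar> \<le> CA * (1 + E)\<^sup>2 * ?d\<^sup>2 + \<epsilon> * ?d\<^sup>2"
          using abs_triangle_ineq[of ?A "\<epsilon> / 2 * ((q' - q) \<bullet> (q' - q))"] A B by linarith
        then show "\<bar>S t' q' - S t q - \<pi> t q \<bullet> (\<xi> t' q' - \<xi> t q) + h q * (t' - t)\<bar> \<le> (CA * (1 + E)\<^sup>2 + \<epsilon>) * ?d\<^sup>2"
          by (simp add: distrib_right)
      qed
    qed
    show "control_hamiltonian f f0 (-1) (\<xi> t q, \<pi> t q) u \<le> h q"
      if "t \<in> {0..tf}" "q \<in> ball qb r" "u \<in> U" for t q u
      using r4(2)[OF z0_in(4)[OF that(2)] that(1) cont[OF that(3)]] le1[OF that(3)] le2[OF that(3)]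
      by (simp add: \<xi>_def \<pi>_def h_def)
    show "\<xi> 0 qb = fst zb0"
      using tb1 zb0 by (simp add: \<xi>_def z0_qb broken_flow_def t1_zb0 H1.flow_0)
    show "\<xi> tf qb = fst (broken tf zb0)" by (simp add: \<xi>_def z0_qb)
  qed
  then show ?thesis
    by (rule that[of \<xi> \<pi> S h r "c / 2" M, folded qb_def]) (simp_all add: \<xi>_def \<pi>_def h_def z0_qb)
qed

end

section \<open>The reference extremal\<close>

lemma smooth_on_section_differentiable:
  fixes g :: "'a::euclidean_space \<Rightarrow> 'c::euclidean_space \<Rightarrow> 'b::real_normed_vector"
  assumes "open X" and smooth: "smooth_on (X \<times> U) (\<lambda>(x, u). g x u)" and "x \<in> X" "u \<in> U"
  shows "(\<lambda>x. g x u) differentiable (at x)"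
proof -
  obtain V k where V: "open V" "(x, u) \<in> V" "Ck_on_open 1 V k" "\<And>w. w \<in> V \<inter> X \<times> U \<Longrightarrow> (\<lambda>(x, u). g x u) w = k w"
    using smooth assms(3,4) unfolding smooth_on_def by (metis SigmaI)
  have "k differentiable (at (x, u))" using V(2,3) by simp
  then have "(k has_derivative frechet_derivative k (at (x, u))) (at (x, u))" by (simp add: frechet_derivative_works)
  moreover have "((\<lambda>x. (x, u)) has_derivative (\<lambda>h. (h, 0))) (at x)" by (auto intro!: derivative_eq_intros)
  ultimately have "((\<lambda>x. k (x, u)) has_derivative (\<lambda>h. frechet_derivative k (at (x, u)) (h, 0))) (at x)"
    by (rule has_derivative_compose[rotated])
  moreover have "open (X \<inter> (\<lambda>x. (x, u)) -` V)"
    by (intro open_Int assms(1) open_vimage V(1) continuous_intros)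
  ultimately have "((\<lambda>x. g x u) has_derivative (\<lambda>h. frechet_derivative k (at (x, u)) (h, 0))) (at x)"
    by (rule has_derivative_transform_within_open) (use V(2,4) assms(3,4) in auto)
  then show ?thesis unfolding differentiable_def by blast
qed

lemma gradient_eq_of_touching:
  assumes "g1 differentiable (at y)" "g2 differentiable (at y)" and "open S" "y \<in> S"
    and le: "\<And>x. x \<in> S \<Longrightarrow> g1 x \<le> g2 x" and eq: "g1 y = g2 y"
  shows "gradient g1 y = gradient g2 y"
proof -
  let ?D1 = "frechet_derivative g1 (at y)" and ?D2 = "frechet_derivative g2 (at y)"
  have "((\<lambda>x. g2 x - g1 x) has_derivative (\<lambda>v. ?D2 v - ?D1 v)) (at y)"
    using assms(1,2) by (intro has_derivative_diff) (auto simp: frechet_derivative_works)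
  then have "(\<lambda>v. ?D2 v - ?D1 v) = (\<lambda>v. 0)"
    by (rule differential_zero_maxmin[OF \<open>y \<in> S\<close> \<open>open S\<close>]) (use le eq in auto)
  then have "?D1 = ?D2" by (auto simp: fun_eq_iff dest: fun_cong)
  then show ?thesis by (simp add: gradient_def)
qed

text \<open>An absolutely continuous function with an almost everywhere continuous derivative is the integral of the
  latter, and so is differentiable at all interior times.\<close>

lemma absolutely_continuous_imp_solution:
  fixes g :: "real \<Rightarrow> 'a::banach"
  assumes "a \<le> b" "absolutely_continuous_on_interval a b g" "negligible N"
    and der: "\<And>t. t \<in> {a..b} - N \<Longrightarrow> (g has_vector_derivative G t) (at t within {a..b})"
    and cont: "continuous_on {a..b} G" and t: "t \<in> {a<..<b}"
  shows "(g has_vector_derivative G t) (at t)"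
proof -
  have int: "(G has_integral g s - g a) {a..s}" if "s \<in> {a..b}" for s
  proof (rule fundamental_theorem_absolutely_continuous[OF _ _ \<open>negligible N\<close>])
    show "a \<le> s" using that by simp
    show "absolutely_continuous_on_interval a s g"
      by (rule absolutely_continuous_on_interval_subset[OF assms(2)]) (use that in auto)
    show "(g has_vector_derivative G r) (at r within {a..s})" if "r \<in> {a..s} - N" for r
      by (rule has_vector_derivative_within_subset[OF der]) (use that \<open>s \<in> {a..b}\<close> in auto)
  qed
  have "((\<lambda>s. integral {a..s} G) has_vector_derivative G t) (at t within {a..b})"
    by (rule integral_has_vector_derivative[OF cont]) (use t in auto)
  then have "((\<lambda>s. g a + integral {a..s} G) has_vector_derivative 0 + G t) (at t within {a..b})"
    by (intro has_vector_derivative_add has_vector_derivative_const)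
  then have "(g has_vector_derivative 0 + G t) (at t within {a..b})"
  proof (rule has_vector_derivative_transform[rotated 2])
    show "t \<in> {a..b}" using t by simp
    show "g s = g a + integral {a..s} G" if "s \<in> {a..b}" for s
      using integral_unique[OF int[OF that]] by simp
  qed
  moreover have "at t within {a..b} = at t" using t by (intro at_within_interior) auto
  ultimately show ?thesis by simp
qed

lemma connected_nonzero_sign:
  fixes g :: "real \<Rightarrow> real"
  assumes "connected I" "continuous_on I g" "\<And>t. t \<in> I \<Longrightarrow> g t \<noteq> 0"
  shows "(\<forall>t\<in>I. g t > 0) \<or> (\<forall>t\<in>I. g t < 0)"
proof (rule ccontr)
  assume "\<not> ?thesis"
  then obtain s t where st: "s \<in> I" "t \<in> I" "g s \<le> 0" "0 \<le> g t" by (auto simp: not_less)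
  have "connected (g ` I)" by (rule connected_continuous_image[OF assms(2,1)])
  then have "0 \<in> g ` I" using connectedD_interval[of "g ` I" "g s" "g t" 0] st by auto
  then show False using assms(3) by auto
qed

text \<open>The reference extremal, before anything is known about which Hamiltonian dominates on which side of the contact.\<close>

locale reference_extremal =
  H1: ham_flow X H1 \<zeta>1 + H2: ham_flow X H2 \<zeta>2
  for X :: "(real ^ 'n) set" and H1 H2 :: "(real ^ 'n) \<times> (real ^ 'n) \<Rightarrow> real" and \<zeta>1 \<zeta>2 +
  fixes U :: "(real ^ 'm) set" and f :: "real ^ 'n \<Rightarrow> real ^ 'm \<Rightarrow> real ^ 'n" and f0 :: "real ^ 'n \<Rightarrow> real ^ 'm \<Rightarrow> real"
    and tf tb1 :: real and x0 xf :: "real ^ 'n" and xb pb :: "real \<Rightarrow> real ^ 'n" and ub :: "real \<Rightarrow> real ^ 'm"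
  assumes smooth_f: "smooth_on (X \<times> U) (\<lambda>(x, u). f x u)" and smooth_f0: "smooth_on (X \<times> U) (\<lambda>(x, u). f0 x u)"
    and extremal: "extremal X U f f0 tf x0 xf (-1) xb pb ub"
    and max1: "\<And>z. z \<in> dominance_set X H1 H2 \<Longrightarrow> is_maximum_over U (control_hamiltonian f f0 (-1) z) (H1 z)"
    and max2: "\<And>z. z \<in> dominance_set X H2 H1 \<Longrightarrow> is_maximum_over U (control_hamiltonian f f0 (-1) z) (H2 z)"
    and tb1: "tb1 \<in> {0<..<tf}"
    and contact: "\<And>t. t \<in> {0..tf} \<Longrightarrow> (xb t, pb t) \<in> switching_set X H1 H2 \<longleftrightarrow> t = tb1"
    and bracket: "poisson_bracket H1 H2 (xb tb1, pb tb1) > 0"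
begin

abbreviation "W \<equiv> cotangent X"
abbreviation "zb t \<equiv> (xb t, pb t)"
abbreviation "Hc u z \<equiv> control_hamiltonian f f0 (-1) z u"

lemma adm: "admissible X U f tf x0 xf xb ub"
  using extremal by (simp add: extremal_def)

lemma zb_in: "t \<in> {0..tf} \<Longrightarrow> zb t \<in> W"
  using adm by (simp add: admissible_def cotangent_def)

lemma ac: "absolutely_continuous_on_interval 0 tf xb" "absolutely_continuous_on_interval 0 tf pb"
  using extremal by (auto simp: extremal_def admissible_def)

lemma zb_cont: "continuous_on {0..tf} zb"
  by (intro continuous_on_Pair absolutely_continuous_on_interval_imp_continuous ac)

lemma Hc_differentiable:
  assumes "u \<in> U" "x \<in> X"
  shows "(\<lambda>x. Hc u (x, p)) differentiable (at x)" "(\<lambda>p. Hc u (x, p)) differentiable (at p)"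
proof -
  have "(\<lambda>x. f x u) differentiable (at x)" "(\<lambda>x. f0 x u) differentiable (at x)"
    by (rule smooth_on_section_differentiable[OF H1.open_X smooth_f assms(2,1)],
        rule smooth_on_section_differentiable[OF H1.open_X smooth_f0 assms(2,1)])
  then show "(\<lambda>x. Hc u (x, p)) differentiable (at x)"
    unfolding control_hamiltonian_def by (auto intro!: derivative_intros)
  show "(\<lambda>p. Hc u (x, p)) differentiable (at p)"
    unfolding control_hamiltonian_def by (auto intro!: derivative_intros)
qed

lemma continuous_along_base:
  fixes g :: "real ^ 'n \<Rightarrow> 'b::real_normed_vector"
  assumes "\<And>x. x \<in> X \<Longrightarrow> g differentiable (at x)"
  shows "continuous_on W (\<lambda>z. g (fst z))"
proof (rule continuous_on_compose2[where g = g and t = X and f = fst and s = W])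
  show "continuous_on X g"
    by (rule continuous_at_imp_continuous_on) (rule ballI, rule differentiable_imp_continuous_within, rule assms)
  show "continuous_on W fst" by (rule continuous_on_fst[OF continuous_on_id])
  show "fst ` W \<subseteq> X" by (auto simp: cotangent_def)
qed

lemma Hc_cont:
  assumes "u \<in> U"
  shows "continuous_on W (Hc u)"
proof -
  have "continuous_on W (\<lambda>z. f (fst z) u)"
    by (rule continuous_along_base[where g = "\<lambda>x. f x u"]) (rule smooth_on_section_differentiable[OF H1.open_X smooth_f _ assms])
  moreover have "continuous_on W (\<lambda>z. f0 (fst z) u)"
    by (rule continuous_along_base[where g = "\<lambda>x. f0 x u"]) (rule smooth_on_section_differentiable[OF H1.open_X smooth_f0 _ assms])
  ultimately show ?thesis unfolding control_hamiltonian_def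
    by (intro continuous_on_add continuous_on_mult continuous_on_const continuous_on_inner continuous_on_snd continuous_on_id)
qed

lemma open_dominance: "open (dominance_set X H1 H2)" "open (dominance_set X H2 H1)"
proof -
  have "open (W \<inter> (\<lambda>z. H1 z - H2 z) -` {0<..})" "open (W \<inter> (\<lambda>z. H2 z - H1 z) -` {0<..})"
    by (rule continuous_open_preimage[OF continuous_on_diff[OF H1.H_cont H2.H_cont] H1.open_W open_greaterThan],
        rule continuous_open_preimage[OF continuous_on_diff[OF H2.H_cont H1.H_cont] H1.open_W open_greaterThan])
  moreover have "dominance_set X H1 H2 = W \<inter> (\<lambda>z. H1 z - H2 z) -` {0<..}"
    "dominance_set X H2 H1 = W \<inter> (\<lambda>z. H2 z - H1 z) -` {0<..}" by (auto simp: dominance_set_def)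
  ultimately show "open (dominance_set X H1 H2)" "open (dominance_set X H2 H1)" by simp_all
qed

text \<open>Where one Hamiltonian dominates, it touches the control Hamiltonian of the reference control from
  above, so that the two have the same gradients.\<close>

lemma touching_gradients:
  assumes dom: "open Dom" "Dom \<subseteq> W" "\<And>z. z \<in> Dom \<Longrightarrow> is_maximum_over U (\<lambda>u. Hc u z) (H z)"
    and H: "\<And>z. z \<in> W \<Longrightarrow> H differentiable (at z)" and z: "z \<in> Dom" and u: "u \<in> U" and eq: "Hc u z = H z"
  shows "grad_x (Hc u) z = grad_x H z" "grad_p (Hc u) z = grad_p H z"
proof -
  obtain x p where zx: "z = (x, p)" by (cases z)
  have zW: "z \<in> W" using dom(2) z by (rule subsetD)
  then have xX: "x \<in> X" by (simp add: zx cotangent_def)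
  have D: "(H has_derivative frechet_derivative H (at (x, p))) (at (x, p))"
    using H[OF zW] by (simp add: frechet_derivative_works zx)
  have "((\<lambda>x. (x, p)) has_derivative (\<lambda>h. (h, 0))) (at x)" "((\<lambda>p. (x, p)) has_derivative (\<lambda>h. (0, h))) (at p)"
    by (auto intro!: derivative_eq_intros)
  note d = differentiableI[OF has_derivative_compose[OF this(1) D]] differentiableI[OF has_derivative_compose[OF this(2) D]]
  have le: "Hc u y \<le> H y" if "y \<in> Dom" for y
    using dom(3)[OF that] u unfolding is_maximum_over_def by blast
  have open_sections: "open ((\<lambda>x. (x, p)) -` Dom)" "open ((\<lambda>p. (x, p)) -` Dom)"
    by (rule open_vimage[OF dom(1) continuous_on_Pair[OF continuous_on_id continuous_on_const]],
        rule open_vimage[OF dom(1) continuous_on_Pair[OF continuous_on_const continuous_on_id]])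
  have "gradient (\<lambda>x. Hc u (x, p)) x = gradient (\<lambda>x. H (x, p)) x"
    by (rule gradient_eq_of_touching[OF Hc_differentiable(1)[OF u xX] d(1) open_sections(1)])
       (use z zx in simp, rule le, simp, use eq zx in simp)
  then show "grad_x (Hc u) z = grad_x H z" by (simp add: grad_x_def zx)
  have "gradient (\<lambda>p. Hc u (x, p)) p = gradient (\<lambda>p. H (x, p)) p"
    by (rule gradient_eq_of_touching[OF Hc_differentiable(2)[OF u xX] d(2) open_sections(2)])
       (use z zx in simp, rule le, simp, use eq zx in simp)
  then show "grad_p (Hc u) z = grad_p H z" by (simp add: grad_p_def zx)
qed

lemma maximal_value:
  obtains N where "negligible N"
    "\<And>t. t \<in> {0..tf} - N \<Longrightarrow> zb t \<in> dominance_set X H1 H2 \<Longrightarrow> Hc (ub t) (zb t) = H1 (zb t) \<and>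
       (xb has_vector_derivative grad_p H1 (zb t)) (at t within {0..tf}) \<and>
       (pb has_vector_derivative - grad_x H1 (zb t)) (at t within {0..tf})"
    "\<And>t. t \<in> {0..tf} - N \<Longrightarrow> zb t \<in> dominance_set X H2 H1 \<Longrightarrow> Hc (ub t) (zb t) = H2 (zb t) \<and>
       (xb has_vector_derivative grad_p H2 (zb t)) (at t within {0..tf}) \<and>
       (pb has_vector_derivative - grad_x H2 (zb t)) (at t within {0..tf})"
proof -
  have "AE t in lebesgue_on {0..tf}.
        (xb has_vector_derivative grad_p (Hc (ub t)) (zb t)) (at t within {0..tf}) \<and>
        (pb has_vector_derivative - grad_x (Hc (ub t)) (zb t)) (at t within {0..tf}) \<and>
        is_maximum_over U (\<lambda>u. Hc u (zb t)) (Hc (ub t) (zb t))"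
    using extremal by (simp add: extremal_def)
  then obtain N where N: "negligible N" "\<And>t. t \<in> {0..tf} - N \<Longrightarrow>
        (xb has_vector_derivative grad_p (Hc (ub t)) (zb t)) (at t within {0..tf}) \<and>
        (pb has_vector_derivative - grad_x (Hc (ub t)) (zb t)) (at t within {0..tf}) \<and>
        is_maximum_over U (\<lambda>u. Hc u (zb t)) (Hc (ub t) (zb t))"
    by (rule AE_lebesgue_on_negligible) (rule that)
  have ubU: "ub t \<in> U" if "t \<in> {0..tf}" for t using adm that by (simp add: admissible_def)
  have max_unique: "a = b" if "is_maximum_over U k a" "is_maximum_over U k b" for k :: "real ^ 'm \<Rightarrow> real" and a b
    using that by (auto simp: is_maximum_over_def intro!: order.antisym)
  show ?thesis
  proof (rule that[OF N(1)])
    fix t assume t: "t \<in> {0..tf} - N"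
    {
      assume d: "zb t \<in> dominance_set X H1 H2"
      have eq: "Hc (ub t) (zb t) = H1 (zb t)" using N(2)[OF t] max1[OF d] max_unique by blast
      have "grad_x (Hc (ub t)) (zb t) = grad_x H1 (zb t)" "grad_p (Hc (ub t)) (zb t) = grad_p H1 (zb t)"
        using touching_gradients[OF open_dominance(1) _ max1 H1.H_differentiable d _ eq] ubU t
        by (auto simp: dominance_set_def)
      then show "Hc (ub t) (zb t) = H1 (zb t) \<and>
         (xb has_vector_derivative grad_p H1 (zb t)) (at t within {0..tf}) \<and>
         (pb has_vector_derivative - grad_x H1 (zb t)) (at t within {0..tf})"
        using N(2)[OF t] eq by simp
    }
    {
      assume d: "zb t \<in> dominance_set X H2 H1"
      have eq: "Hc (ub t) (zb t) = H2 (zb t)" using N(2)[OF t] max2[OF d] max_unique by blast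
      have "grad_x (Hc (ub t)) (zb t) = grad_x H2 (zb t)" "grad_p (Hc (ub t)) (zb t) = grad_p H2 (zb t)"
        using touching_gradients[OF open_dominance(2) _ max2 H2.H_differentiable d _ eq] ubU t
        by (auto simp: dominance_set_def)
      then show "Hc (ub t) (zb t) = H2 (zb t) \<and>
         (xb has_vector_derivative grad_p H2 (zb t)) (at t within {0..tf}) \<and>
         (pb has_vector_derivative - grad_x H2 (zb t)) (at t within {0..tf})"
        using N(2)[OF t] eq by simp
    }
  qed
qed

text \<open>The control drops out: while one Hamiltonian dominates, the extremal is one of its classical solutions.\<close>

lemma arc_solution:
  assumes flow: "ham_flow X H \<zeta>" and ab: "0 \<le> a" "a \<le> b" "b \<le> tf"
    and N: "negligible N" "\<And>t. t \<in> {0..tf} - N \<Longrightarrow> t \<in> {a..b} \<Longrightarrow>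
       (xb has_vector_derivative grad_p H (zb t)) (at t within {0..tf}) \<and>
       (pb has_vector_derivative - grad_x H (zb t)) (at t within {0..tf})"
    and t: "t \<in> {a<..<b}"
  shows "(zb has_vector_derivative ham_vec H (zb t)) (at t)"
proof -
  interpret H: ham_flow X H \<zeta> by fact
  have "continuous_on {a..b} (\<lambda>t. ham_vec H (zb t))"
    using ab zb_in by (intro continuous_on_compose2[OF H.F_cont continuous_on_subset[OF zb_cont]]) auto
  from continuous_on_fst[OF this] continuous_on_snd[OF this]
  have c: "continuous_on {a..b} (\<lambda>t. grad_p H (zb t))" "continuous_on {a..b} (\<lambda>t. - grad_x H (zb t))"
    by (simp_all add: ham_vec_def)
  have sub: "{a..b} \<subseteq> {0..tf}" using ab by auto
  have within: "(xb has_vector_derivative grad_p H (zb t)) (at t within {a..b})"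
    "(pb has_vector_derivative - grad_x H (zb t)) (at t within {a..b})" if "t \<in> {a..b} - N" for t
    by (rule has_vector_derivative_within_subset[OF _ sub]; use N(2)[of t] that sub in auto)+
  have "(xb has_vector_derivative grad_p H (zb t)) (at t)"
    by (rule absolutely_continuous_imp_solution[OF ab(2) absolutely_continuous_on_interval_subset[OF ac(1) ab(1,3)] N(1) within(1) c(1) t])
  moreover have "(pb has_vector_derivative - grad_x H (zb t)) (at t)"
    by (rule absolutely_continuous_imp_solution[OF ab(2) absolutely_continuous_on_interval_subset[OF ac(2) ab(1,3)] N(1) within(2) c(2) t])
  ultimately show ?thesis unfolding ham_vec_def by (rule has_vector_derivative_Pair)
qed

lemma gap_decreasing:
  assumes "t \<in> {0..tf}" and H: "H = H1 \<or> H = H2" and der: "(zb has_vector_derivative ham_vec H (zb t)) (at t)"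
  shows "((\<lambda>t. H1 (zb t) - H2 (zb t)) has_real_derivative - poisson_bracket H1 H2 (zb t)) (at t)"
proof -
  have dz: "(zb has_derivative (\<lambda>h. h *\<^sub>R ham_vec H (zb t))) (at t)"
    using der by (simp add: has_vector_derivative_def)
  have "((\<lambda>t. H1 (zb t) - H2 (zb t)) has_derivative (\<lambda>h.
      (grad_x H1 (zb t) \<bullet> fst (h *\<^sub>R ham_vec H (zb t)) + grad_p H1 (zb t) \<bullet> snd (h *\<^sub>R ham_vec H (zb t)))
      - (grad_x H2 (zb t) \<bullet> fst (h *\<^sub>R ham_vec H (zb t)) + grad_p H2 (zb t) \<bullet> snd (h *\<^sub>R ham_vec H (zb t))))) (at t)"
    by (rule has_derivative_diff[OF has_derivative_compose[where f = zb and g = H1, OF dz H1.H_deriv[OF zb_in[OF assms(1)]]]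
          has_derivative_compose[where f = zb and g = H2, OF dz H2.H_deriv[OF zb_in[OF assms(1)]]]])
  moreover have "(grad_x H1 (zb t) \<bullet> fst (h *\<^sub>R ham_vec H (zb t)) + grad_p H1 (zb t) \<bullet> snd (h *\<^sub>R ham_vec H (zb t)))
      - (grad_x H2 (zb t) \<bullet> fst (h *\<^sub>R ham_vec H (zb t)) + grad_p H2 (zb t) \<bullet> snd (h *\<^sub>R ham_vec H (zb t)))
      = - poisson_bracket H1 H2 (zb t) * h" for h
    using H
  proof
    assume "H = H1"
    show ?thesis unfolding \<open>H = H1\<close>
      by (simp add: ham_vec_def poisson_bracket_def inner_commute algebra_simps)
  next
    assume "H = H2"
    show ?thesis unfolding \<open>H = H2\<close>
      by (simp add: ham_vec_def poisson_bracket_def inner_commute algebra_simps)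
  qed
  ultimately show ?thesis unfolding has_field_derivative_def by (simp only:)
qed

text \<open>The bracket condition makes \<open>H\<^sub>1 - H\<^sub>2\<close> decrease through the contact, whichever of the two
  Hamiltonians is followed; hence the first dominates before and the second after the contact.\<close>

lemma dominance:
  shows "\<And>t. t \<in> {0..<tb1} \<Longrightarrow> zb t \<in> dominance_set X H1 H2"
    and "\<And>t. t \<in> {tb1<..tf} \<Longrightarrow> zb t \<in> dominance_set X H2 H1"
proof -
  define gap where "gap t = H1 (zb t) - H2 (zb t)" for t
  have contH: "continuous_on {0..tf} (\<lambda>t. H1 (zb t))" "continuous_on {0..tf} (\<lambda>t. H2 (zb t))"
    using zb_in by (auto intro!: continuous_on_compose2[OF H1.H_cont zb_cont] continuous_on_compose2[OF H2.H_cont zb_cont])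
  have gcont: "continuous_on {0..tf} gap" unfolding gap_def by (intro continuous_intros contH)
  have gap0: "gap tb1 = 0" using contact[of tb1] tb1 by (simp add: gap_def switching_set_def)
  have gapn: "gap t \<noteq> 0" if "t \<in> {0..tf}" "t \<noteq> tb1" for t
    using contact[of t] zb_in[of t] that by (auto simp: gap_def switching_set_def)
  obtain N where N: "negligible N"
    "\<And>t. t \<in> {0..tf} - N \<Longrightarrow> zb t \<in> dominance_set X H1 H2 \<Longrightarrow> Hc (ub t) (zb t) = H1 (zb t) \<and>
       (xb has_vector_derivative grad_p H1 (zb t)) (at t within {0..tf}) \<and>
       (pb has_vector_derivative - grad_x H1 (zb t)) (at t within {0..tf})"
    "\<And>t. t \<in> {0..tf} - N \<Longrightarrow> zb t \<in> dominance_set X H2 H1 \<Longrightarrow> Hc (ub t) (zb t) = H2 (zb t) \<and>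
       (xb has_vector_derivative grad_p H2 (zb t)) (at t within {0..tf}) \<and>
       (pb has_vector_derivative - grad_x H2 (zb t)) (at t within {0..tf})"
    by (rule maximal_value) (rule that)
  have "continuous_on W (\<lambda>z. - (ham_vec H1 z \<bullet> (- rot (ham_vec H2 z))))"
    unfolding rot_def by (intro continuous_intros H1.F_cont H2.F_cont)
  moreover have "- (ham_vec H1 z \<bullet> (- rot (ham_vec H2 z))) = poisson_bracket H1 H2 z" for z
    by (simp add: rot_def ham_vec_def poisson_bracket_def inner_prod_def algebra_simps)
  ultimately have "continuous_on W (poisson_bracket H1 H2)" by simp
  then have "continuous_on {0..tf} (\<lambda>t. poisson_bracket H1 H2 (zb t))"
    using zb_in by (auto intro!: continuous_on_compose2[OF _ zb_cont])
  then obtain d where d: "d > 0" "\<And>t. t \<in> {0..tf} \<Longrightarrow> dist t tb1 < d \<Longrightarrow>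
      dist (poisson_bracket H1 H2 (zb t)) (poisson_bracket H1 H2 (zb tb1)) < poisson_bracket H1 H2 (zb tb1)"
    using tb1 bracket unfolding continuous_on_iff by (metis greaterThanLessThan_iff atLeastAtMost_iff less_imp_le)
  have pos: "poisson_bracket H1 H2 (zb t) > 0" if "t \<in> {0..tf}" "dist t tb1 < d" for t
    using d(2)[OF that] by (simp add: dist_real_def abs_less_iff)
  have decreasing: "gap t < gap s"
    if "s < t" "{s..t} \<subseteq> {0..tf}" "\<And>r. r \<in> {s<..<t} \<Longrightarrow> dist r tb1 < d"
      "H = H1 \<or> H = H2" "\<And>r. r \<in> {s<..<t} \<Longrightarrow> (zb has_vector_derivative ham_vec H (zb r)) (at r)" for s t H
  proof (rule DERIV_neg_imp_decreasing_open[OF that(1)])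
    show "continuous_on {s..t} gap" by (rule continuous_on_subset[OF gcont that(2)])
    fix r assume r: "s < r" "r < t"
    then have rT: "r \<in> {0..tf}" "r \<in> {s<..<t}" using that(2) by auto
    have "(gap has_real_derivative - poisson_bracket H1 H2 (zb r)) (at r)"
      unfolding gap_def[abs_def] by (rule gap_decreasing[OF rT(1) that(4) that(5)[OF rT(2)]])
    moreover have "poisson_bracket H1 H2 (zb r) > 0" by (rule pos[OF rT(1) that(3)[OF rT(2)]])
    ultimately show "\<exists>y. (gap has_real_derivative y) (at r) \<and> y < 0" by (intro exI conjI) auto
  qed
  have N': "negligible (insert tb1 N)" using N(1) by simp
  show "zb t \<in> dominance_set X H1 H2" if t: "t \<in> {0..<tb1}" for t
  proof -
    have "continuous_on {0..<tb1} gap" by (rule continuous_on_subset[OF gcont]) (use tb1 in auto)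
    then have sign: "(\<forall>t\<in>{0..<tb1}. gap t > 0) \<or> (\<forall>t\<in>{0..<tb1}. gap t < 0)"
      by (rule connected_nonzero_sign[OF connected_Ico]) (use gapn tb1 in auto)
    have "\<not> (\<forall>t\<in>{0..<tb1}. gap t < 0)"
    proof
      assume neg: "\<forall>t\<in>{0..<tb1}. gap t < 0"
      then have dom: "zb t \<in> dominance_set X H2 H1" if "t \<in> {0..<tb1}" for t
        using zb_in[of t] that tb1 by (auto simp: gap_def dominance_set_def)
      define s where "s = max 0 (tb1 - d / 2)"
      have s: "0 \<le> s" "s < tb1" "tb1 - s < d" using d(1) tb1 by (auto simp: s_def)
      have "(zb has_vector_derivative ham_vec H2 (zb r)) (at r)" if "r \<in> {0<..<tb1}" for r
        by (rule arc_solution[OF H2.ham_flow_axioms _ _ _ N' _ that]) (use tb1 N(3) dom in auto)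
      then have "gap tb1 < gap s"
        by (intro decreasing[of s tb1 H2]) (use s tb1 in \<open>auto simp: dist_real_def\<close>)
      then show False using neg s gap0 by force
    qed
    then have "gap t > 0" using sign t by blast
    then show ?thesis using zb_in[of t] t tb1 by (simp add: gap_def dominance_set_def)
  qed
  show "zb t \<in> dominance_set X H2 H1" if t: "t \<in> {tb1<..tf}" for t
  proof -
    have "continuous_on {tb1<..tf} gap" by (rule continuous_on_subset[OF gcont]) (use tb1 in auto)
    then have sign: "(\<forall>t\<in>{tb1<..tf}. gap t > 0) \<or> (\<forall>t\<in>{tb1<..tf}. gap t < 0)"
      by (rule connected_nonzero_sign[OF connected_Ioc]) (use gapn tb1 in auto)
    have "\<not> (\<forall>t\<in>{tb1<..tf}. gap t > 0)"
    proof
      assume pos: "\<forall>t\<in>{tb1<..tf}. gap t > 0"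
      then have dom: "zb t \<in> dominance_set X H1 H2" if "t \<in> {tb1<..tf}" for t
        using zb_in[of t] that tb1 by (auto simp: gap_def dominance_set_def)
      define s where "s = min tf (tb1 + d / 2)"
      have s: "s \<le> tf" "tb1 < s" "s - tb1 < d" using d(1) tb1 by (auto simp: s_def)
      have "(zb has_vector_derivative ham_vec H1 (zb r)) (at r)" if "r \<in> {tb1<..<tf}" for r
        by (rule arc_solution[OF H1.ham_flow_axioms _ _ _ N' _ that]) (use tb1 N(2) dom in auto)
      then have "gap s < gap tb1"
        by (intro decreasing[of tb1 s H1]) (use s tb1 in \<open>auto simp: dist_real_def\<close>)
      then show False using pos s gap0 by force
    qed
    then have "gap t < 0" using sign t by blast
    then show ?thesis using zb_in[of t] t tb1 by (simp add: gap_def dominance_set_def)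
  qed
qed

lemma reference_arcs:
  shows "\<And>t. t \<in> {0..tb1} \<Longrightarrow> zb t = \<zeta>1 t (zb 0)"
    and "\<And>t. t \<in> {tb1..tf} \<Longrightarrow> zb t = \<zeta>2 (t - tb1) (zb tb1)"
proof -
  obtain N where N: "negligible N"
    "\<And>t. t \<in> {0..tf} - N \<Longrightarrow> zb t \<in> dominance_set X H1 H2 \<Longrightarrow> Hc (ub t) (zb t) = H1 (zb t) \<and>
       (xb has_vector_derivative grad_p H1 (zb t)) (at t within {0..tf}) \<and>
       (pb has_vector_derivative - grad_x H1 (zb t)) (at t within {0..tf})"
    "\<And>t. t \<in> {0..tf} - N \<Longrightarrow> zb t \<in> dominance_set X H2 H1 \<Longrightarrow> Hc (ub t) (zb t) = H2 (zb t) \<and>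
       (xb has_vector_derivative grad_p H2 (zb t)) (at t within {0..tf}) \<and>
       (pb has_vector_derivative - grad_x H2 (zb t)) (at t within {0..tf})"
    by (rule maximal_value) (rule that)
  have N': "negligible (insert tb1 N)" using N(1) by simp
  have d1: "(zb has_vector_derivative ham_vec H1 (zb r)) (at r)" if "r \<in> {0<..<tb1}" for r
    by (rule arc_solution[OF H1.ham_flow_axioms _ _ _ N' _ that]) (use tb1 N(2) dominance(1) in auto)
  have d2: "(zb has_vector_derivative ham_vec H2 (zb r)) (at r)" if "r \<in> {tb1<..<tf}" for r
    by (rule arc_solution[OF H2.ham_flow_axioms _ _ _ N' _ that]) (use tb1 N(3) dominance(2) in auto)
  show "zb t = \<zeta>1 t (zb 0)" if t: "t \<in> {0..tb1}" for t
    by (rule H1.solution_unique[where v = zb and T = tb1])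
       (use t tb1 zb_in[of 0] d1 continuous_on_subset[OF zb_cont, of "{0..tb1}"] in auto)
  show "zb t = \<zeta>2 (t - tb1) (zb tb1)" if t: "t \<in> {tb1..tf}" for t
  proof -
    have "(\<lambda>s. zb (tb1 + s)) (t - tb1) = \<zeta>2 (t - tb1) (zb tb1)"
    proof (rule H2.solution_unique[where T = "tf - tb1"])
      show "continuous_on {0..tf - tb1} (\<lambda>s. zb (tb1 + s))"
        using tb1 by (intro continuous_on_compose2[OF zb_cont] continuous_intros) auto
      show "((\<lambda>s. zb (tb1 + s)) has_vector_derivative ham_vec H2 (zb (tb1 + s))) (at s)" if "s \<in> {0<..<tf - tb1}" for s
      proof -
        have "((\<lambda>s. tb1 + s) has_vector_derivative 1) (at s)" by (auto intro!: derivative_eq_intros)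
        from vector_diff_chain_at[OF this, of zb "ham_vec H2 (zb (tb1 + s))"] d2[of "tb1 + s"] that
        show ?thesis by (simp add: o_def)
      qed
    qed (use t tb1 zb_in[of tb1] in auto)
    then show ?thesis by simp
  qed
qed

lemma maximal_value_constant:
  "AE t in lebesgue_on {0..tf}. Hc (ub t) (zb t) = H1 (zb 0)"
proof -
  obtain N where N: "negligible N"
    "\<And>t. t \<in> {0..tf} - N \<Longrightarrow> zb t \<in> dominance_set X H1 H2 \<Longrightarrow> Hc (ub t) (zb t) = H1 (zb t) \<and>
       (xb has_vector_derivative grad_p H1 (zb t)) (at t within {0..tf}) \<and>
       (pb has_vector_derivative - grad_x H1 (zb t)) (at t within {0..tf})"
    "\<And>t. t \<in> {0..tf} - N \<Longrightarrow> zb t \<in> dominance_set X H2 H1 \<Longrightarrow> Hc (ub t) (zb t) = H2 (zb t) \<and>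
       (xb has_vector_derivative grad_p H2 (zb t)) (at t within {0..tf}) \<and>
       (pb has_vector_derivative - grad_x H2 (zb t)) (at t within {0..tf})"
    by (rule maximal_value) (rule that)
  have z0: "zb 0 \<in> W" "zb tb1 \<in> W" using zb_in tb1 by auto
  have h1: "H1 (zb t) = H1 (zb 0)" if "t \<in> {0..tb1}" for t
    using H1.H_conserved[OF z0(1)] reference_arcs(1)[OF that] by metis
  have "H1 (zb tb1) = H2 (zb tb1)" using contact[of tb1] tb1 by (simp add: switching_set_def)
  then have h2: "H2 (zb t) = H1 (zb 0)" if "t \<in> {tb1..tf}" for t
    using H2.H_conserved[OF z0(2)] reference_arcs(2)[OF that] h1[of tb1] tb1 by force
  have val: "Hc (ub t) (zb t) = H1 (zb 0)" if t: "t \<in> {0..tf} - insert tb1 N" for t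
  proof (cases "t < tb1")
    case True
    then show ?thesis using N(2)[of t] dominance(1)[of t] h1[of t] t by auto
  next
    case False
    then show ?thesis using N(3)[of t] dominance(2)[of t] h2[of t] t by auto
  qed
  have "insert tb1 N \<in> null_sets lebesgue" using N(1) by (simp add: negligible_iff_null_sets[symmetric])
  then have "AE t in lebesgue. t \<notin> insert tb1 N" by (rule AE_not_in)
  then have "AE t in lebesgue. t \<in> {0..tf} \<longrightarrow> Hc (ub t) (zb t) = H1 (zb 0)"
    by eventually_elim (use val in auto)
  then show ?thesis by (subst AE_restrict_space_iff) auto
qed

text \<open>A maximized Hamiltonian is convex in the covector, where it is smooth: it lies above an affine
  function of the covector that it touches.\<close>

lemma hessian_pp_nonneg:
  assumes z: "z \<in> dominance_set X H1 H2"
  shows "hessian H1 z (0, p) (0, p) \<ge> 0"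
proof (rule ccontr)
  assume "\<not> ?thesis"
  then have "hessian H1 z (0, p) (0, p) < 0" by simp
  have zW: "z \<in> W" using z by (simp add: dominance_set_def)
  define v where "v = (0 :: real ^ 'n, p)"
  have neg: "hessian H1 z v v < 0" unfolding v_def by fact
  have at_0: "z + 0 *\<^sub>R v = z" by (simp only: scaleR_zero_left add_0_right)
  obtain u where u: "u \<in> U" "H1 z = Hc u z"
    using max1[OF z] by (auto simp: is_maximum_over_def)
  define k where "k s = H1 (z + s *\<^sub>R v) - Hc u (z + s *\<^sub>R v)" for s
  define \<beta> where "\<beta> = p \<bullet> f (fst z) u"
  have Hc_affine: "Hc u (z + s *\<^sub>R v) = Hc u z + s * \<beta>" for s
    by (simp add: control_hamiltonian_def \<beta>_def v_def algebra_simps)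
  have "open ((\<lambda>s. z + s *\<^sub>R v) -` dominance_set X H1 H2)"
    by (intro open_vimage open_dominance continuous_intros)
  moreover have "0 \<in> (\<lambda>s. z + s *\<^sub>R v) -` dominance_set X H1 H2"
    using z by (simp only: vimage_eq at_0)
  ultimately obtain d where d: "d > 0" "ball 0 d \<subseteq> (\<lambda>s. z + s *\<^sub>R v) -` dominance_set X H1 H2"
    by (rule openE)
  have dom: "z + s *\<^sub>R v \<in> dominance_set X H1 H2" "z + s *\<^sub>R v \<in> W" if "\<bar>s\<bar> < d" for s
    using d(2) that by (auto simp: dominance_set_def subset_iff)
  have k_nonneg: "k s \<ge> k 0" if "\<bar>s\<bar> < d" for s
  proof -
    have "k 0 = 0" unfolding k_def at_0 using u(2) by simp
    moreover have "Hc u (z + s *\<^sub>R v) \<le> H1 (z + s *\<^sub>R v)"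
      using max1[OF dom(1)[OF that]] u(1) unfolding is_maximum_over_def by blast
    ultimately show ?thesis by (simp add: k_def)
  qed
  define k' where "k' s = frechet_derivative H1 (at (z + s *\<^sub>R v)) v - \<beta>" for s
  have line: "((\<lambda>s. z + s *\<^sub>R v) has_derivative (\<lambda>h. h *\<^sub>R v)) (at s)" for s
    using has_derivative_add[OF has_derivative_const bounded_linear_imp_has_derivative[OF bounded_linear_scaleR_left]]
    by (simp only: add_0_left)
  have k: "(k has_real_derivative k' s) (at s)" if s: "\<bar>s\<bar> < d" for s
  proof -
    have D: "(H1 has_derivative frechet_derivative H1 (at (z + s *\<^sub>R v))) (at (z + s *\<^sub>R v))"
      using H1.H_differentiable[OF dom(2)[OF s]] by (simp add: frechet_derivative_works)
    have "((\<lambda>s. H1 (z + s *\<^sub>R v)) has_derivative (\<lambda>h. h * frechet_derivative H1 (at (z + s *\<^sub>R v)) v)) (at s)"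
      by (rule has_derivative_eq_rhs[OF has_derivative_compose[OF line D]])
         (simp only: linear_scale[OF has_derivative_linear[OF D]] real_scaleR_def)
    then have "((\<lambda>s. H1 (z + s *\<^sub>R v)) has_real_derivative frechet_derivative H1 (at (z + s *\<^sub>R v)) v) (at s)"
      unfolding has_field_derivative_def by (rule has_derivative_eq_rhs) (simp add: fun_eq_iff mult.commute)
    then show ?thesis unfolding k_def Hc_affine k'_def by (auto intro!: derivative_eq_intros)
  qed
  have "k' 0 = 0"
    by (rule DERIV_local_min[OF k d(1)]) (use d(1) k_nonneg in auto)
  have "(k' has_real_derivative hessian H1 z v v) (at 0)"
  proof -
    have D: "((\<lambda>y. frechet_derivative H1 (at y) v) has_derivative hessian H1 (z + 0 *\<^sub>R v) v) (at (z + 0 *\<^sub>R v))"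
      unfolding at_0 by (rule Ck_on_open_hessian(1)[OF H1.Ck_H zW])
    have "((\<lambda>s. frechet_derivative H1 (at (z + s *\<^sub>R v)) v) has_derivative (\<lambda>h. h * hessian H1 (z + 0 *\<^sub>R v) v v)) (at 0)"
      by (rule has_derivative_eq_rhs[OF has_derivative_compose[OF line D]])
         (simp only: linear_scale[OF has_derivative_linear[OF D]] real_scaleR_def)
    then have "((\<lambda>s. frechet_derivative H1 (at (z + s *\<^sub>R v)) v) has_real_derivative hessian H1 z v v) (at 0)"
      unfolding has_field_derivative_def at_0 by (rule has_derivative_eq_rhs) (simp add: fun_eq_iff mult.commute)
    then show ?thesis unfolding k'_def by (auto intro!: derivative_eq_intros)
  qed
  from DERIV_neg_dec_right[OF this neg] obtain d' where d': "d' > 0" "\<And>s. s > 0 \<Longrightarrow> s < d' \<Longrightarrow> k' s < 0"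
    using \<open>k' 0 = 0\<close> by auto
  define s where "s = min d d' / 2"
  have s: "s > 0" "s < d" "s < d'" using d(1) d'(1) by (auto simp: s_def min_def)
  have "k s < k 0"
  proof (rule DERIV_neg_imp_decreasing_open[OF s(1)])
    show "continuous_on {0..s} k"
    proof (intro continuous_at_imp_continuous_on ballI)
      fix r assume "r \<in> {0..s}"
      then have "\<bar>r\<bar> < d" using s by simp
      then show "isCont k r" by (rule DERIV_isCont[OF k])
    qed
    fix r assume r: "0 < r" "r < s"
    have "(k has_real_derivative k' r) (at r)" by (rule k) (use r s in linarith)
    moreover have "k' r < 0" by (rule d'(2)) (use r s in linarith)+
    ultimately show "\<exists>y. (k has_real_derivative y) (at r) \<and> y < 0" by (intro exI conjI)
  qed
  moreover have "k 0 \<le> k s" by (rule k_nonneg) (use s in linarith)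
  ultimately show False by linarith
qed

end

theorem theorem2:
  fixes X :: "(real ^ 'n) set" and U :: "(real ^ 'm) set"
    and f :: "real ^ 'n \<Rightarrow> real ^ 'm \<Rightarrow> real ^ 'n"
    and f0 :: "real ^ 'n \<Rightarrow> real ^ 'm \<Rightarrow> real"
    and tf p0 tb1 :: real and x0 xf :: "real ^ 'n"
    and xb pb :: "real \<Rightarrow> real ^ 'n" and ub :: "real \<Rightarrow> real ^ 'm"
    and H1 H2 :: "(real ^ 'n) \<times> (real ^ 'n) \<Rightarrow> real"
    and \<zeta>1 \<zeta>2 :: "real \<Rightarrow> (real ^ 'n) \<times> (real ^ 'n) \<Rightarrow> (real ^ 'n) \<times> (real ^ 'n)"
    and t1 :: "(real ^ 'n) \<times> (real ^ 'n) \<Rightarrow> real"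
    and zb :: "real \<Rightarrow> (real ^ 'n) \<times> (real ^ 'n)" and \<delta> :: "real \<Rightarrow> real"
  defines "zb \<equiv> \<lambda>t. (xb t, pb t)"
    and "\<delta> \<equiv> fold_det \<zeta>1 \<zeta>2 t1 (zb 0)"
  assumes "open X" and "U \<noteq> {}"
    and "smooth_on (X \<times> U) (\<lambda>(x, u). f x u)" and "smooth_on (X \<times> U) (\<lambda>(x, u). f0 x u)"
    and "0 < tf" and "x0 \<in> X" and "xf \<in> X"
    and extremal: "extremal X U f f0 tf x0 xf p0 xb pb ub"
    and normalization: "p0 \<noteq> 0 \<Longrightarrow> p0 = -1"
    and "smooth_on (cotangent X) H1" and "smooth_on (cotangent X) H2"
    and max1: "\<And>z. z \<in> dominance_set X H1 H2 \<Longrightarrow>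
                 is_maximum_over U (control_hamiltonian f f0 (-1) z) (H1 z)"
    and max2: "\<And>z. z \<in> dominance_set X H2 H1 \<Longrightarrow>
                 is_maximum_over U (control_hamiltonian f f0 (-1) z) (H2 z)"
    and "tb1 \<in> {0<..<tf}"
    and contact: "\<And>t. t \<in> {0..tf} \<Longrightarrow> zb t \<in> switching_set X H1 H2 \<longleftrightarrow> t = tb1"
    and "complete_ham_flow X H1 \<zeta>1" and "complete_ham_flow X H2 \<zeta>2"
    and "switching_time X H1 H2 \<zeta>1 (zb 0) tb1 t1"
    and A0: "p0 \<noteq> 0"
    and A1: "poisson_bracket H1 H2 (zb tb1) > 0"
    and A2: "\<And>t. t \<in> {0<..<tb1} \<union> {tb1<..tf} \<Longrightarrow> \<delta> t \<noteq> 0"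
            "Lim (at_right tb1) \<delta> * Lim (at_left tb1) \<delta> > 0"
  shows "\<exists>\<epsilon>>0. \<forall>x u. admissible X U f tf x0 xf x u \<and> (\<forall>t\<in>{0..tf}. dist (x t) (xb t) < \<epsilon>)
           \<longrightarrow> cost f0 tf x u \<ge> cost f0 tf xb ub"
proof -
  have p0: "p0 = -1" using normalization A0 by simp
  have ext: "extremal X U f f0 tf x0 xf (-1) xb pb ub" using extremal unfolding p0 .
  interpret R: reference_extremal X H1 H2 \<zeta>1 \<zeta>2 U f f0 tf tb1 x0 xf xb pb ub
  proof
    show "z \<in> dominance_set X H1 H2 \<Longrightarrow> is_maximum_over U (control_hamiltonian f f0 (-1) z) (H1 z)" for z
      by (rule max1)
    show "z \<in> dominance_set X H2 H1 \<Longrightarrow> is_maximum_over U (control_hamiltonian f f0 (-1) z) (H2 z)" for z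
      by (rule max2)
    show "t \<in> {0..tf} \<Longrightarrow> (xb t, pb t) \<in> switching_set X H1 H2 \<longleftrightarrow> t = tb1" for t
      using contact[of t] by (simp add: zb_def)
    show "poisson_bracket H1 H2 (xb tb1, pb tb1) > 0" using A1 by (simp add: zb_def)
  qed fact+
  have times: "0 < tb1" "tb1 < tf" using \<open>tb1 \<in> {0<..<tf}\<close> by auto
  have arc1: "\<zeta>1 t (zb 0) = zb t" if "t \<in> {0..tb1}" for t
    using R.reference_arcs(1)[OF that] by (simp add: zb_def)
  have arc2: "\<zeta>2 s (zb tb1) = zb (tb1 + s)" if "s \<in> {0..tf - tb1}" for s
    using R.reference_arcs(2)[of "tb1 + s"] that by (simp add: zb_def)
  have zb1: "\<zeta>1 tb1 (zb 0) = zb tb1" using arc1 times by simp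
  interpret B: broken_extremal X H1 H2 \<zeta>1 \<zeta>2 t1 "zb 0" tb1 tf
  proof
    show "zb 0 \<in> cotangent X" using R.zb_in[of 0] times by (simp add: zb_def)
    show "\<zeta>1 t (zb 0) \<in> dominance_set X H1 H2" if "t \<in> {0..<tb1}" for t
      using R.dominance(1)[OF that] arc1[of t] that by (simp add: zb_def)
    show "\<zeta>2 s (\<zeta>1 tb1 (zb 0)) \<in> dominance_set X H2 H1" if "s \<in> {0<..tf - tb1}" for s
      using R.dominance(2)[of "tb1 + s"] arc2[of s] that by (simp add: zb_def zb1[unfolded zb_def])
    show "poisson_bracket H1 H2 (\<zeta>1 tb1 (zb 0)) > 0" using A1 by (simp add: zb1)
  qed (rule times | fact)+
  obtain \<Phi>1 where \<Phi>1: "R.H1.linearization tf (zb 0) \<Phi>1"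
    by (rule R.H1.linearization_exists[OF less_imp_le[OF B.tf] B.zb0])
  obtain \<Phi>2 where \<Phi>2: "R.H2.linearization tf (\<zeta>1 tb1 (zb 0)) \<Phi>2"
    by (rule R.H2.linearization_exists[OF less_imp_le[OF B.tf] B.zb1])
  obtain dt1 :: "((real ^ 'n) \<times> (real ^ 'n)) \<Rightarrow>\<^sub>L real" where dt1: "\<And>e. e > 0 \<Longrightarrow>
      \<exists>r>0. \<forall>z\<in>ball (zb 0) r. \<forall>z'\<in>ball (zb 0) r. \<bar>t1 z - t1 z' - dt1 (z - z')\<bar> \<le> e * norm (z - z')"
    by (rule B.contact_time_strict_derivative) (rule that)
  interpret L: linearized_broken_extremal X H1 H2 \<zeta>1 \<zeta>2 t1 "zb 0" tb1 tf \<Phi>1 \<Phi>2 dt1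
    by unfold_locales (fact \<Phi>1 \<Phi>2 dt1)+
  have broken: "broken_flow \<zeta>1 \<zeta>2 t1 t (zb 0) = zb t" if "t \<in> {0..tf}" for t
    using arc1[of t] arc2[of "t - tb1"] that times by (simp add: broken_flow_def B.t1_zb0 zb1)
  obtain \<xi> \<pi> S h r c M where field:
    "extremal_field U f f0 tf (fst (zb 0)) (fst (broken_flow \<zeta>1 \<zeta>2 t1 tf (zb 0))) \<xi> \<pi> S h (snd (zb 0)) r c M"
    and central: "\<And>t. \<xi> t (snd (zb 0)) = fst (broken_flow \<zeta>1 \<zeta>2 t1 t (zb 0))"
    "\<And>t. \<pi> t (snd (zb 0)) = snd (broken_flow \<zeta>1 \<zeta>2 t1 t (zb 0))" "h (snd (zb 0)) = H1 (zb 0)"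
  proof (rule L.field_exists[where U = U and f = f and ?f0.0 = f0])
    show "fold_det \<zeta>1 \<zeta>2 t1 (zb 0) t \<noteq> 0" if "t \<in> {0<..<tb1} \<union> {tb1<..tf}" for t
      using A2(1)[OF that] by (simp add: \<delta>_def)
    show "Lim (at_right tb1) (fold_det \<zeta>1 \<zeta>2 t1 (zb 0)) * Lim (at_left tb1) (fold_det \<zeta>1 \<zeta>2 t1 (zb 0)) > 0"
      using A2(2) by (simp add: \<delta>_def)
    show "hessian H1 z (0, p) (0, p) \<ge> 0" if "z \<in> dominance_set X H1 H2" for z p
      by (rule R.hessian_pp_nonneg[OF that])
    show "continuous_on (cotangent X) (\<lambda>z. control_hamiltonian f f0 (-1) z u)" if "u \<in> U" for u
      by (rule R.Hc_cont[OF that])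
    show "control_hamiltonian f f0 (-1) z u \<le> H1 z" if "u \<in> U" "z \<in> dominance_set X H1 H2" for u z
      using max1[OF that(2)] that(1) unfolding is_maximum_over_def by blast
    show "control_hamiltonian f f0 (-1) z u \<le> H2 z" if "u \<in> U" "z \<in> dominance_set X H2 H1" for u z
      using max2[OF that(2)] that(1) unfolding is_maximum_over_def by blast
  qed (rule that)
  have ends: "fst (zb 0) = x0" "fst (broken_flow \<zeta>1 \<zeta>2 t1 tf (zb 0)) = xf"
    using R.adm broken[of tf] times by (auto simp: admissible_def zb_def)
  show ?thesis
  proof (rule extremal_field.field_minimizer[OF field[unfolded ends] R.adm])
    show "\<xi> t (snd (zb 0)) = xb t" if "t \<in> {0..tf}" for t
      using central(1) broken[OF that] by (simp add: zb_def)
    have "AE t in lebesgue_on {0..tf}. t \<in> {0..tf}" by (rule AE_I2) simp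
    with R.maximal_value_constant
    show "AE t in lebesgue_on {0..tf}. control_hamiltonian f f0 (-1) (xb t, \<pi> t (snd (zb 0))) (ub t) = h (snd (zb 0))"
    proof eventually_elim
      case (elim t)
      then show ?case using central(2)[of t] central(3) broken[of t] by (simp add: zb_def)
    qed
  qed
qed

end
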